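(* There is an algorithm that, given any feasible instance of the RAP--NC with separable convex objective and continuous variables (as defined in the context) and any $\epsilon > 0$, finds an $\epsilon$-approximate solution in $\mathcal{O}\left(n \log m \log \frac{nB}{\epsilon}\right)$ time, where $n$ is the number of decision variables, $m$ is the number of nested constraints (including the global resource constraint), and $B$ is the resource bound. The algorithm accesses the objective only through evaluations of the functions $f_i$ and does not require strict convexity or differentiability.
   Context: The resource allocation problem with nested lower and upper constraints (RAP--NC) with continuous variables is $$\min_{\mathbf{x}\in\mathbb{R}^n} \sum_{i=1}^n f_i(x_i) \quad \text{s.t.} \quad a_i \le \sum_{k=1}^{\sigma[i]} x_k \le b_i \ (i \in \{1,\dots,m-1\}), \quad \sum_{k=1}^n x_k = B, \quad c_i \le x_i \le d_i \ (i\in\{1,\dots,n\}),$$ where $(\sigma[1],\dots,\sigma[m])$ is a (strictly increasing) subsequence of $(1,\dots,n)$ with $\sigma[m]=n$. The coefficients $a_i,b_i,c_i,d_i$ and $B$ are integers, $a_i \le b_i$ for all $i$, and each $f_i : [c_i,d_i]\to\mathbb{R}$ is convex and Lipschitz continuous (not necessarily differentiable or strictly convex). An $\epsilon$-approximate solution is a feasible solution $\mathbf{x}$ for which there is an optimal solution $\mathbf{x}^*$ with $\max_i |x_i - x_i^*| \le \epsilon$. Model of computation: time is the number of elementary operations (arithmetic operations and comparisons), and an oracle evaluates each $f_i$ at a given point in $\mathcal{O}(1)$ time. As usual in such bounds, logarithmic factors are understood to be at least $1$.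
   Formalization: The bound with log(nB/ε) is proved when all lower bounds c_i are nonnegative; for arbitrary integer c_i, where that bound is false in general, B is replaced by B plus the sum of max(0, -c_i). *)

theory Defs
  imports "HOL-Analysis.Analysis"
begin

section \<open>The problem RAP--NC\<close>

text \<open>Variables are numbered from 1 to \<open>nvars\<close> and nested constraints from 1 to \<open>ncons\<close>, as in
  the mathematical formulation; the values of the data (and of a vector \<open>x\<close>) at other indices are
  irrelevant. The last constraint, of index \<open>ncons\<close>, is the global resource constraint.\<close>

record rapnc =
  nvars :: nat                       \<comment> \<open>\<open>n\<close>\<close>
  ncons :: nat                       \<comment> \<open>\<open>m\<close>\<close>
  sigma :: "nat \<Rightarrow> nat"
  nest_lo :: "nat \<Rightarrow> int"            \<comment> \<open>\<open>a\<close>\<close>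
  nest_hi :: "nat \<Rightarrow> int"            \<comment> \<open>\<open>b\<close>\<close>
  var_lo :: "nat \<Rightarrow> int"             \<comment> \<open>\<open>c\<close>\<close>
  var_hi :: "nat \<Rightarrow> int"             \<comment> \<open>\<open>d\<close>\<close>
  resource :: int                    \<comment> \<open>\<open>B\<close>\<close>
  cost :: "nat \<Rightarrow> real \<Rightarrow> real"      \<comment> \<open>\<open>f\<close>\<close>

definition is_rapnc :: "rapnc \<Rightarrow> bool" where
  "is_rapnc P \<longleftrightarrow>
     1 \<le> ncons P \<and>
     sigma P ` {1..ncons P} \<subseteq> {1..nvars P} \<and>
     strict_mono_on {1..ncons P} (sigma P) \<and>
     sigma P (ncons P) = nvars P \<and>
     (\<forall>i\<in>{1..<ncons P}. nest_lo P i \<le> nest_hi P i) \<and>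
     (\<forall>i\<in>{1..nvars P}.
        convex_on {real_of_int (var_lo P i)..real_of_int (var_hi P i)} (cost P i) \<and>
        (\<exists>L. L-lipschitz_on {real_of_int (var_lo P i)..real_of_int (var_hi P i)} (cost P i)))"

definition feasible :: "rapnc \<Rightarrow> (nat \<Rightarrow> real) \<Rightarrow> bool" where
  "feasible P x \<longleftrightarrow>
     (\<forall>i\<in>{1..<ncons P}. real_of_int (nest_lo P i) \<le> (\<Sum>k=1..sigma P i. x k) \<and>
                        (\<Sum>k=1..sigma P i. x k) \<le> real_of_int (nest_hi P i)) \<and>
     (\<Sum>k=1..nvars P. x k) = real_of_int (resource P) \<and>
     (\<forall>i\<in>{1..nvars P}. real_of_int (var_lo P i) \<le> x i \<and> x i \<le> real_of_int (var_hi P i))"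

definition objective :: "rapnc \<Rightarrow> (nat \<Rightarrow> real) \<Rightarrow> real" where
  "objective P x = (\<Sum>i=1..nvars P. cost P i (x i))"

definition optimal :: "rapnc \<Rightarrow> (nat \<Rightarrow> real) \<Rightarrow> bool" where
  "optimal P x \<longleftrightarrow> feasible P x \<and> (\<forall>y. feasible P y \<longrightarrow> objective P x \<le> objective P y)"

definition approx_solution :: "rapnc \<Rightarrow> real \<Rightarrow> (nat \<Rightarrow> real) \<Rightarrow> bool" where
  "approx_solution P \<epsilon> x \<longleftrightarrow>
     feasible P x \<and> (\<exists>y. optimal P y \<and> (\<forall>i\<in>{1..nvars P}. \<bar>x i - y i\<bar> \<le> \<epsilon>))"

section \<open>The model of computation\<close>

text \<open>A real RAM with an evaluation oracle, programmed in a structured language. The memory of a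
  program consists of named, unbounded arrays, of natural numbers (for indexing) and of reals.
  Every node of an evaluated expression (arithmetic operation, comparison, memory access, literal,
  oracle call), every assignment and every branching costs one unit.

  Real literals are integers, so that a program is a finite object, and there is no rounding of
  reals. Numbers used as indices can only be added, subtracted (truncated at 0) and halved
  (rounding down). The oracle is the only access to the functions \<open>f\<^sub>i\<close>; it is total, but as they
  are constrained on \<open>[c\<^sub>i, d\<^sub>i]\<close> only, its answers elsewhere are arbitrary.\<close>

type_synonym name = string

record state =
  imem :: "name \<Rightarrow> nat \<Rightarrow> nat"
  rmem :: "name \<Rightarrow> nat \<Rightarrow> real"

type_synonym oracle_fun = "nat \<Rightarrow> real \<Rightarrow> real"

datatype iexp =
    IConst nat
  | IGet name iexp
  | IAdd iexp iexp
  | ISub iexp iexp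
  | IHalf iexp

datatype rexp =
    RConst int
  | ROfIndex iexp
  | RGet name iexp
  | RAdd rexp rexp
  | RSub rexp rexp
  | RMul rexp rexp
  | RDiv rexp rexp
  | REval iexp rexp

datatype bexp =
    ILe iexp iexp
  | RLe rexp rexp
  | BNot bexp
  | BAnd bexp bexp

datatype com =
    Skip
  | ISet name iexp iexp
  | RSet name iexp rexp
  | Seq com com
  | Cond bexp com com
  | While bexp com

primrec ival :: "state \<Rightarrow> iexp \<Rightarrow> nat" where
  "ival s (IConst k) = k"
| "ival s (IGet v e) = imem s v (ival s e)"
| "ival s (IAdd e1 e2) = ival s e1 + ival s e2"
| "ival s (ISub e1 e2) = ival s e1 - ival s e2"
| "ival s (IHalf e) = ival s e div 2"

primrec rval :: "oracle_fun \<Rightarrow> state \<Rightarrow> rexp \<Rightarrow> real" where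
  "rval f s (RConst k) = real_of_int k"
| "rval f s (ROfIndex e) = real (ival s e)"
| "rval f s (RGet v e) = rmem s v (ival s e)"
| "rval f s (RAdd e1 e2) = rval f s e1 + rval f s e2"
| "rval f s (RSub e1 e2) = rval f s e1 - rval f s e2"
| "rval f s (RMul e1 e2) = rval f s e1 * rval f s e2"
| "rval f s (RDiv e1 e2) = rval f s e1 / rval f s e2"
| "rval f s (REval e1 e2) = f (ival s e1) (rval f s e2)"

primrec bval :: "oracle_fun \<Rightarrow> state \<Rightarrow> bexp \<Rightarrow> bool" where
  "bval f s (ILe e1 e2) \<longleftrightarrow> ival s e1 \<le> ival s e2"
| "bval f s (RLe e1 e2) \<longleftrightarrow> rval f s e1 \<le> rval f s e2"
| "bval f s (BNot b) \<longleftrightarrow> \<not> bval f s b"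
| "bval f s (BAnd b1 b2) \<longleftrightarrow> bval f s b1 \<and> bval f s b2"

primrec itime :: "iexp \<Rightarrow> nat" where
  "itime (IConst k) = 1"
| "itime (IGet v e) = 1 + itime e"
| "itime (IAdd e1 e2) = 1 + itime e1 + itime e2"
| "itime (ISub e1 e2) = 1 + itime e1 + itime e2"
| "itime (IHalf e) = 1 + itime e"

primrec rtime :: "rexp \<Rightarrow> nat" where
  "rtime (RConst k) = 1"
| "rtime (ROfIndex e) = 1 + itime e"
| "rtime (RGet v e) = 1 + itime e"
| "rtime (RAdd e1 e2) = 1 + rtime e1 + rtime e2"
| "rtime (RSub e1 e2) = 1 + rtime e1 + rtime e2"
| "rtime (RMul e1 e2) = 1 + rtime e1 + rtime e2"
| "rtime (RDiv e1 e2) = 1 + rtime e1 + rtime e2"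
| "rtime (REval e1 e2) = 1 + itime e1 + rtime e2"

primrec btime :: "bexp \<Rightarrow> nat" where
  "btime (ILe e1 e2) = 1 + itime e1 + itime e2"
| "btime (RLe e1 e2) = 1 + rtime e1 + rtime e2"
| "btime (BNot b) = 1 + btime b"
| "btime (BAnd b1 b2) = 1 + btime b1 + btime b2"

definition iset :: "name \<Rightarrow> nat \<Rightarrow> nat \<Rightarrow> state \<Rightarrow> state" where
  "iset v i k s = s\<lparr>imem := (imem s)(v := (imem s v)(i := k))\<rparr>"

definition rset :: "name \<Rightarrow> nat \<Rightarrow> real \<Rightarrow> state \<Rightarrow> state" where
  "rset v i r s = s\<lparr>rmem := (rmem s)(v := (rmem s v)(i := r))\<rparr>"

text \<open>\<open>exec f p s t s'\<close>: with oracle \<open>f\<close>, the program \<open>p\<close> started in \<open>s\<close> terminates in \<open>s'\<close> after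
  exactly \<open>t\<close> time units.\<close>

inductive exec :: "oracle_fun \<Rightarrow> com \<Rightarrow> state \<Rightarrow> nat \<Rightarrow> state \<Rightarrow> bool" for f :: oracle_fun where
  Skip: "exec f Skip s 1 s"
| ISet: "exec f (ISet v i e) s (1 + itime i + itime e) (iset v (ival s i) (ival s e) s)"
| RSet: "exec f (RSet v i e) s (1 + itime i + rtime e) (rset v (ival s i) (rval f s e) s)"
| Seq: "exec f p s t s' \<Longrightarrow> exec f q s' t' s'' \<Longrightarrow> exec f (Seq p q) s (t + t') s''"
| CondT: "bval f s b \<Longrightarrow> exec f p s t s' \<Longrightarrow> exec f (Cond b p q) s (1 + btime b + t) s'"
| CondF: "\<not> bval f s b \<Longrightarrow> exec f q s t s' \<Longrightarrow> exec f (Cond b p q) s (1 + btime b + t) s'"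
| WhileF: "\<not> bval f s b \<Longrightarrow> exec f (While b p) s (1 + btime b) s"
| WhileT: "bval f s b \<Longrightarrow> exec f p s t s' \<Longrightarrow> exec f (While b p) s' t' s'' \<Longrightarrow>
    exec f (While b p) s (1 + btime b + t + t') s''"

inductive_cases exec_SkipE: "exec f Skip s t s'"
inductive_cases exec_ISetE: "exec f (ISet v i e) s t s'"
inductive_cases exec_RSetE: "exec f (RSet v i e) s t s'"
inductive_cases exec_SeqE: "exec f (Seq p q) s t s'"
inductive_cases exec_CondE: "exec f (Cond b p q) s t s'"
inductive_cases exec_WhileE: "exec f (While b p) s t s'"

text \<open>Runs are unique, so the existence of a run with some property is total correctness.\<close>

lemma exec_deterministic:
  "exec f p s t s' \<Longrightarrow> exec f p s u s'' \<Longrightarrow> t = u \<and> s' = s''"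
proof (induction arbitrary: u s'' rule: exec.induct)
  case (Skip s)
  from Skip.prems show ?case by (rule exec_SkipE) simp
next
  case (ISet v i e s)
  from ISet.prems show ?case by (rule exec_ISetE) simp
next
  case (RSet v i e s)
  from RSet.prems show ?case by (rule exec_RSetE) simp
next
  case (Seq p s t s' q t' s1)
  from Seq.prems obtain w w' r
    where "u = w + w'" "exec f p s w r" "exec f q r w' s''" by (rule exec_SeqE)
  with Seq.IH show ?case by metis
next
  case (CondT s b p t s' q)
  from CondT.prems obtain w
    where "u = 1 + btime b + w" "exec f p s w s''" by (rule exec_CondE) (use CondT.hyps in auto)
  with CondT.IH show ?case by metis
next
  case (CondF s b q t s' p)
  from CondF.prems obtain w
    where "u = 1 + btime b + w" "exec f q s w s''" by (rule exec_CondE) (use CondF.hyps in auto)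
  with CondF.IH show ?case by metis
next
  case (WhileF s b p)
  from WhileF.prems show ?case by (rule exec_WhileE) (use WhileF.hyps in auto)
next
  case (WhileT s b p t s' t' s1)
  from WhileT.prems obtain w w' r
    where "u = 1 + btime b + w + w'" "exec f p s w r" "exec f (While b p) r w' s''"
    by (rule exec_WhileE) (use WhileT.hyps in auto)
  with WhileT.IH show ?case by metis
qed

text \<open>The input: \<open>n\<close>, \<open>m\<close>, \<open>B\<close> and \<open>\<epsilon>\<close> are stored at index 0 of their arrays; all memory not
  holding input is zero. The cost functions are not part of it.\<close>

definition segment :: "nat set \<Rightarrow> (nat \<Rightarrow> 'a::zero) \<Rightarrow> nat \<Rightarrow> 'a" where
  "segment I g = (\<lambda>i. if i \<in> I then g i else 0)"

definition input :: "rapnc \<Rightarrow> real \<Rightarrow> state" where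
  "input P \<epsilon> = \<lparr>
     imem = (\<lambda>_ _. 0)(
       ''n'' := segment {0} (\<lambda>_. nvars P),
       ''m'' := segment {0} (\<lambda>_. ncons P),
       ''sigma'' := segment {1..ncons P} (sigma P)),
     rmem = (\<lambda>_ _. 0)(
       ''a'' := segment {1..<ncons P} (\<lambda>i. real_of_int (nest_lo P i)),
       ''b'' := segment {1..<ncons P} (\<lambda>i. real_of_int (nest_hi P i)),
       ''c'' := segment {1..nvars P} (\<lambda>i. real_of_int (var_lo P i)),
       ''d'' := segment {1..nvars P} (\<lambda>i. real_of_int (var_hi P i)),
       ''B'' := segment {0} (\<lambda>_. real_of_int (resource P)),
       ''eps'' := segment {0} (\<lambda>_. \<epsilon>))\<rparr>"

definition result_vector :: "state \<Rightarrow> nat \<Rightarrow> real" where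
  "result_vector s = rmem s ''x''"

text \<open>Logarithmic factors are understood to be at least 1.\<close>

definition lg :: "real \<Rightarrow> real" where
  "lg y = max 1 (log 2 y)"

text \<open>The bound \<open>O(n log m log (n B / \<epsilon>))\<close> presupposes that the \<open>x\<^sub>i\<close> are nonnegative amounts of a
  resource: for \<open>n = 2\<close>, \<open>m = 1\<close>, \<open>B = 0\<close>, \<open>c\<^sub>i = -M\<close>, \<open>d\<^sub>i = M\<close> the number of evaluations needed
  grows with \<open>M\<close>. The total resource for arbitrary bounds is \<open>B\<close> after the shift that raises negative
  lower bounds to zero; it equals \<open>B\<close> if no \<open>c\<^sub>i\<close> is negative.\<close>

definition total_resource :: "rapnc \<Rightarrow> int" where
  "total_resource P = resource P + (\<Sum>i=1..nvars P. max 0 (- var_lo P i))"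

end

theory Submission
  imports Defs
begin

text \<open>The algorithm shrinks a box that contains an optimal solution. For a grid size \<open>u\<close>, the cells of
  width \<open>u\<close> in the intervals \<open>[c\<^sub>i, d\<^sub>i]\<close> are treated as items whose slopes are secant slopes of \<open>f\<^sub>i\<close>.
  The items of each nested block are sorted approximately, in linear time, by merging them into a few
  heavier items; a greedy algorithm with tournament trees over the blocks then solves the resulting
  problem, in which only block sums are constrained, up to its thresholds. By an exchange argument
  some optimal solution lies below the upper bounds that these thresholds suggest, and the excess of
  the new upper bounds over the lower ones is at most \<open>B - \<Sum>c\<^sub>i\<close> plus a small fraction of the old
  total width plus \<open>O(n u)\<close>. The same step for the negated problem raises the lower bounds, and both
  together reduce the total width from \<open>32 n u\<close> to \<open>16 n u\<close>, in time \<open>O(n log m)\<close>. Halving \<open>u\<close>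
  until \<open>16 n u \<le> \<epsilon>\<close> takes \<open>O(log (n B / \<epsilon>))\<close> rounds, and any feasible point of the last box will do.\<close>

text \<open>The factor \<open>log m\<close> is the obstacle: an exact sort of all slopes costs
  \<open>log n\<close> per item. Merging across blocks is exact, by trees with one leaf per block;
  inside a block every threshold count may be off by 1/32 of the cells. Without derivatives or
  strict convexity there are neither multipliers to compute nor a unique optimum to locate. Each
  block therefore carries two thresholds around a multiplier that is never determined, and the
  optimal solution is chosen to exceed the new bounds as little as possible, so that an exchange at
  no cost is already a contradiction. A cut need not shrink the box: it only brings the sum of the
  upper bounds close to \<open>B\<close>. The mirrored cut then leaves a width of about that sum
  minus \<open>B\<close>, which is why cuts come in pairs. A cut errs by \<open>2 u\<close> per
  variable, \<open>u\<close> per block and 1/32 of the width, so a pair turns width \<open>W\<close>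
  into at most \<open>W / 16 + 8 n u\<close>, which is \<open>10 n u\<close> for
  \<open>W = 32 n u\<close>. Each block gets spare capacity as one very expensive item, so that
  rounding never makes the relaxed problem infeasible.\<close>

declare One_nat_def [simp del] plus_1_eq_Suc [simp del]

section \<open>Total correctness with running time\<close>

primrec imods :: "com \<Rightarrow> name set" where
  "imods Skip = {}"
| "imods (ISet v i e) = {v}"
| "imods (RSet v i e) = {}"
| "imods (Seq p q) = imods p \<union> imods q"
| "imods (Cond b p q) = imods p \<union> imods q"
| "imods (While b p) = imods p"

primrec rmods :: "com \<Rightarrow> name set" where
  "rmods Skip = {}"
| "rmods (ISet v i e) = {}"
| "rmods (RSet v i e) = {v}"
| "rmods (Seq p q) = rmods p \<union> rmods q"
| "rmods (Cond b p q) = rmods p \<union> rmods q"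
| "rmods (While b p) = rmods p"

text \<open>Programs write to named arrays, so preservation can be decided by name from the syntax
  alone. The statements about programs then mostly mention only what changes.\<close>

definition frame :: "com \<Rightarrow> state \<Rightarrow> state \<Rightarrow> bool" where
  "frame p s s' \<longleftrightarrow> (\<forall>v. v \<notin> imods p \<longrightarrow> imem s' v = imem s v) \<and>
                  (\<forall>v. v \<notin> rmods p \<longrightarrow> rmem s' v = rmem s v)"

lemma imem_iset [simp]: "imem (iset v i k s) = (imem s)(v := (imem s v)(i := k))"
  and rmem_iset [simp]: "rmem (iset v i k s) = rmem s"
  and imem_rset [simp]: "imem (rset v i r s) = imem s"
  and rmem_rset [simp]: "rmem (rset v i r s) = (rmem s)(v := (rmem s v)(i := r))"
  by (simp_all add: iset_def rset_def)

lemma frameI: "frame p s s' \<Longrightarrow> v \<notin> imods p \<Longrightarrow> imem s' v = imem s v"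
  and frameR: "frame p s s' \<Longrightarrow> v \<notin> rmods p \<Longrightarrow> rmem s' v = rmem s v"
  by (auto simp: frame_def)

lemma exec_frame: "exec f p s t s' \<Longrightarrow> frame p s s'"
  by (induction rule: exec.induct) (auto simp: frame_def)

text \<open>The running time is an argument of the postcondition, so a time bound and the effect on
  the memory are proved in one pass. Uniqueness of runs turns the rules for basic commands into
  equivalences fit for rewriting.\<close>

definition wp :: "oracle_fun \<Rightarrow> com \<Rightarrow> state \<Rightarrow> (nat \<Rightarrow> state \<Rightarrow> bool) \<Rightarrow> bool" where
  "wp f p s Q \<longleftrightarrow> (\<exists>t s'. exec f p s t s' \<and> Q t s')"

lemma wp_Skip [simp]: "wp f Skip s Q \<longleftrightarrow> Q 1 s"
  unfolding wp_def using exec.Skip exec_deterministic by metis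

lemma wp_ISet [simp]:
  "wp f (ISet v i e) s Q \<longleftrightarrow> Q (1 + itime i + itime e) (iset v (ival s i) (ival s e) s)"
  unfolding wp_def using exec.ISet exec_deterministic by metis

lemma wp_RSet [simp]:
  "wp f (RSet v i e) s Q \<longleftrightarrow> Q (1 + itime i + rtime e) (rset v (ival s i) (rval f s e) s)"
  unfolding wp_def using exec.RSet exec_deterministic by metis

lemma wp_Seq [simp]:
  "wp f (Seq p q) s Q \<longleftrightarrow> wp f p s (\<lambda>t s'. wp f q s' (\<lambda>t' s''. Q (t + t') s''))"
  unfolding wp_def by (blast intro: exec.Seq elim: exec_SeqE)

lemma wp_Cond [simp]:
  "wp f (Cond b p q) s Q \<longleftrightarrow>
     (if bval f s b then wp f p s (\<lambda>t. Q (1 + btime b + t)) else wp f q s (\<lambda>t. Q (1 + btime b + t)))"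
proof -
  have "exec f (Cond b p q) s t s' \<longleftrightarrow>
    (\<exists>u. t = 1 + btime b + u \<and> exec f (if bval f s b then p else q) s u s')" for t s'
    by (auto intro: exec.CondT exec.CondF elim!: exec_CondE simp: plus_1_eq_Suc)
       (metis exec.CondT exec.CondF plus_1_eq_Suc add_Suc)+
  then show ?thesis unfolding wp_def by auto
qed

lemma wp_use:
  assumes "wp f p s Q" "\<And>t s'. Q t s' \<Longrightarrow> frame p s s' \<Longrightarrow> Q' t s'"
  shows "wp f p s Q'"
  using assms exec_frame unfolding wp_def by blast

text \<open>The potential \<open>V\<close> pays for the running time, and so also proves termination.\<close>

lemma wp_while:
  assumes I: "I s0"
    and step: "\<And>s. I s \<Longrightarrow> bval f s b \<Longrightarrow> frame p s0 s \<Longrightarrow>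
      wp f p s (\<lambda>t s'. I s' \<and> 1 + btime b + t + V s' \<le> V s)"
    and Q: "\<And>t s. I s \<Longrightarrow> \<not> bval f s b \<Longrightarrow> frame p s0 s \<Longrightarrow>
      t + V s \<le> V s0 + 1 + btime b \<Longrightarrow> Q t s"
  shows "wp f (While b p) s0 Q"
proof -
  have *: "\<exists>t s'. exec f (While b p) s t s' \<and> I s' \<and> \<not> bval f s' b \<and> frame p s0 s' \<and>
      t + V s' \<le> V s + 1 + btime b" if "I s" "frame p s0 s" for s
    using that
  proof (induction "V s" arbitrary: s rule: less_induct)
    case less
    show ?case
    proof (cases "bval f s b")
      case False
      then show ?thesis using less exec.WhileF[OF False] by fastforce
    next
      case True
      from step[OF less.prems(1) True less.prems(2)] obtain t s' where
        s': "exec f p s t s'" "I s'" "1 + btime b + t + V s' \<le> V s"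
        unfolding wp_def by blast
      have "frame p s0 s'"
        using less.prems(2) exec_frame[OF s'(1)] by (auto simp: frame_def)
      moreover have "V s' < V s" using s'(3) by simp
      ultimately obtain t' s'' where
        "exec f (While b p) s' t' s''" "I s''" "\<not> bval f s'' b" "frame p s0 s''"
        "t' + V s'' \<le> V s' + 1 + btime b"
        using less.hyps s'(2) by blast
      then show ?thesis
        using exec.WhileT[OF True s'(1)] s'(3) by fastforce
    qed
  qed
  have "frame p s0 s0" by (simp add: frame_def)
  from *[OF I this] show ?thesis unfolding wp_def using Q by blast
qed

section \<open>Scalars, stored at index 0 of their arrays\<close>

abbreviation IV :: "name \<Rightarrow> iexp" where "IV v \<equiv> IGet v (IConst 0)"
abbreviation RV :: "name \<Rightarrow> rexp" where "RV v \<equiv> RGet v (IConst 0)"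
abbreviation IS :: "name \<Rightarrow> iexp \<Rightarrow> com" where "IS v e \<equiv> ISet v (IConst 0) e"
abbreviation RS :: "name \<Rightarrow> rexp \<Rightarrow> com" where "RS v e \<equiv> RSet v (IConst 0) e"
abbreviation ILt :: "iexp \<Rightarrow> iexp \<Rightarrow> bexp" where "ILt e e' \<equiv> BNot (ILe e' e)"
abbreviation RLt :: "rexp \<Rightarrow> rexp \<Rightarrow> bexp" where "RLt e e' \<equiv> BNot (RLe e' e)"
abbreviation inc :: "name \<Rightarrow> com" where "inc v \<equiv> IS v (IAdd (IV v) (IConst 1))"
abbreviation iv :: "state \<Rightarrow> name \<Rightarrow> nat" where "iv s v \<equiv> imem s v 0"
abbreviation rv :: "state \<Rightarrow> name \<Rightarrow> real" where "rv s v \<equiv> rmem s v 0"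
notation Seq (infixr ";;" 60)

section \<open>Approximate sorting in linear time\<close>

text \<open>Equal counts for all predicates mean equal multisets, so this function replaces
  permutations: merging preserves every count, and thinning is judged by its effect on the counts of
  down-sets.\<close>

definition cnt :: "(nat \<Rightarrow> real) \<Rightarrow> nat \<Rightarrow> nat \<Rightarrow> (real \<Rightarrow> bool) \<Rightarrow> nat" where
  "cnt A a b P = (\<Sum>k\<in>{a..<b}. of_bool (P (A k)))"

lemma cnt_empty [simp]: "b \<le> a \<Longrightarrow> cnt A a b P = 0"
  by (simp add: cnt_def)

lemma cnt_Suc: "a \<le> b \<Longrightarrow> cnt A a (b + 1) P = cnt A a b P + of_bool (P (A b))"
  unfolding cnt_def Suc_eq_plus1[symmetric] by (rule sum.atLeastLessThan_Suc)

lemma cnt_append: "a \<le> b \<Longrightarrow> b \<le> c \<Longrightarrow> cnt A a c P = cnt A a b P + cnt A b c P"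
  unfolding cnt_def by (rule sum.atLeastLessThan_concat[symmetric])

lemma cnt_cong: "(\<And>k. a \<le> k \<Longrightarrow> k < b \<Longrightarrow> A k = A' k) \<Longrightarrow> cnt A a b P = cnt A' a b P"
  by (simp add: cnt_def)

text \<open>Runs are aligned to multiples of \<open>L\<close> and the last one may be incomplete;
  alignment lets the run of an index be read off as a quotient.\<close>

definition runs :: "(nat \<Rightarrow> real) \<Rightarrow> nat \<Rightarrow> nat \<Rightarrow> bool" where
  "runs A n L \<longleftrightarrow> (\<forall>x y. x \<le> y \<and> y < n \<and> x div L = y div L \<longrightarrow> A x \<le> A y)"

text \<open>The thresholds of the greedy algorithm are felt only through the sets
  \<open>x \<le> t\<close> and \<open>x < t\<close>. Approximate counts on down-sets are therefore
  all that sorting has to deliver.\<close>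

definition down :: "(real \<Rightarrow> bool) \<Rightarrow> bool" where
  "down P \<longleftrightarrow> (\<forall>x y. x \<le> y \<and> P y \<longrightarrow> P x)"

text \<open>The equation \<open>k + e1 = i + j\<close> says that as many items have been written
  from \<open>lo\<close> on as have been read from the two runs together. \<open>T0\<close> pins the
  output of earlier merges, to the left of \<open>lo\<close>.\<close>

definition merge_inv where
  "merge_inv lo e1 e2 S T0 i j k T \<longleftrightarrow>
    lo \<le> i \<and> i \<le> e1 \<and> e1 \<le> j \<and> j \<le> e2 \<and> k + e1 = i + j \<and>
    (\<forall>x y. lo \<le> x \<and> x \<le> y \<and> y < k \<longrightarrow> T x \<le> T y) \<and>
    (\<forall>x. lo \<le> x \<and> x < k \<longrightarrow> (i < e1 \<longrightarrow> T x \<le> S i) \<and> (j < e2 \<longrightarrow> T x \<le> S j)) \<and>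
    (\<forall>P. cnt T lo k P = cnt S lo i P + cnt S e1 j P) \<and>
    (\<forall>x<lo. T x = (T0 x :: real))"

lemma merge_inv_left:
  assumes I: "merge_inv lo e1 e2 S T0 i j k T" and i: "i < e1" "j < e2 \<Longrightarrow> S i \<le> S j"
    and s1: "\<And>x y. lo \<le> x \<Longrightarrow> x \<le> y \<Longrightarrow> y < e1 \<Longrightarrow> S x \<le> S y"
  shows "merge_inv lo e1 e2 S T0 (i + 1) j (k + 1) (T(k := S i))"
proof -
  have I': "lo \<le> i" "i \<le> e1" "e1 \<le> j" "j \<le> e2" "k + e1 = i + j" "lo \<le> k"
    "\<And>x y. lo \<le> x \<Longrightarrow> x \<le> y \<Longrightarrow> y < k \<Longrightarrow> T x \<le> T y"
    "\<And>x. lo \<le> x \<Longrightarrow> x < k \<Longrightarrow> T x \<le> S i"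
    "\<And>P. cnt T lo k P = cnt S lo i P + cnt S e1 j P"
    "\<And>x. x < lo \<Longrightarrow> T x = T0 x"
    using I i by (auto simp: merge_inv_def)
  have "(T(k := S i)) x \<le> (T(k := S i)) y" if "lo \<le> x" "x \<le> y" "y < k + 1" for x y
    using that I'(7,8) by (cases "y = k"; cases "x = k") auto
  moreover have "(i + 1 < e1 \<longrightarrow> (T(k := S i)) x \<le> S (i+1)) \<and> (j < e2 \<longrightarrow> (T(k := S i)) x \<le> S j)"
    if "lo \<le> x" "x < k + 1" for x
  proof -
    have "(T(k := S i)) x \<le> S i" using I'(8)[of x] that by auto
    moreover have "i + 1 < e1 \<longrightarrow> S i \<le> S (i + 1)" using s1[of i "i+1"] I' by auto
    ultimately show ?thesis using i(2) by force
  qed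
  moreover have "cnt (T(k := S i)) lo (k + 1) P = cnt S lo (i + 1) P + cnt S e1 j P" for P
    using I'(1,6,9) cnt_cong[of lo k "T(k := S i)" T P] by (simp add: cnt_Suc)
  ultimately show ?thesis unfolding merge_inv_def using I'(1-6,10) i by auto
qed

lemma merge_inv_right:
  assumes I: "merge_inv lo e1 e2 S T0 i j k T" and j: "j < e2" "i < e1 \<Longrightarrow> S j \<le> S i"
    and s2: "\<And>x y. e1 \<le> x \<Longrightarrow> x \<le> y \<Longrightarrow> y < e2 \<Longrightarrow> S x \<le> S y"
  shows "merge_inv lo e1 e2 S T0 i (j + 1) (k + 1) (T(k := S j))"
proof -
  have I': "lo \<le> i" "i \<le> e1" "e1 \<le> j" "j \<le> e2" "k + e1 = i + j" "lo \<le> k"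
    "\<And>x y. lo \<le> x \<Longrightarrow> x \<le> y \<Longrightarrow> y < k \<Longrightarrow> T x \<le> T y"
    "\<And>x. lo \<le> x \<Longrightarrow> x < k \<Longrightarrow> T x \<le> S j"
    "\<And>P. cnt T lo k P = cnt S lo i P + cnt S e1 j P"
    "\<And>x. x < lo \<Longrightarrow> T x = T0 x"
    using I j by (auto simp: merge_inv_def)
  have "(T(k := S j)) x \<le> (T(k := S j)) y" if "lo \<le> x" "x \<le> y" "y < k + 1" for x y
    using that I'(7,8) by (cases "y = k"; cases "x = k") auto
  moreover have "(i < e1 \<longrightarrow> (T(k := S j)) x \<le> S i) \<and> (j + 1 < e2 \<longrightarrow> (T(k := S j)) x \<le> S (j + 1))"
    if "lo \<le> x" "x < k + 1" for x
  proof -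
    have "(T(k := S j)) x \<le> S j" using I'(8)[of x] that by auto
    moreover have "j + 1 < e2 \<longrightarrow> S j \<le> S (j + 1)" using s2[of j "j+1"] I' by auto
    ultimately show ?thesis using j(2) by force
  qed
  moreover have "cnt (T(k := S j)) lo (k + 1) P = cnt S lo i P + cnt S e1 (j + 1) P" for P
    using I'(3,6,9) cnt_cong[of lo k "T(k := S j)" T P] by (simp add: cnt_Suc)
  ultimately show ?thesis unfolding merge_inv_def using I'(1-6,10) j by auto
qed

section \<open>Merging neighbouring runs\<close>

definition merge_two :: com where
  "merge_two = While (ILt (IV ''k'') (IV ''e2''))
    (Cond (BAnd (ILt (IV ''i'') (IV ''e1''))
                (BNot (BAnd (ILt (IV ''j'') (IV ''e2''))
                            (RLt (RGet ''S'' (IV ''j'')) (RGet ''S'' (IV ''i''))))))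
       (RSet ''T'' (IV ''k'') (RGet ''S'' (IV ''i'')) ;; inc ''i'')
       (RSet ''T'' (IV ''k'') (RGet ''S'' (IV ''j'')) ;; inc ''j'') ;;
     inc ''k'')"

lemma mods_merge_two [simp]: "imods merge_two = {''i'', ''j'', ''k''}" "rmods merge_two = {''T''}"
  by (auto simp: merge_two_def)

lemma merge_two:
  assumes lo: "iv s ''k'' = lo" "iv s ''i'' = lo" "iv s ''e1'' = e1" "iv s ''j'' = e1"
      "iv s ''e2'' = e2" "lo \<le> e1" "e1 \<le> e2"
    and S: "rmem s ''S'' = S"
    and s1: "\<And>x y. lo \<le> x \<Longrightarrow> x \<le> y \<Longrightarrow> y < e1 \<Longrightarrow> S x \<le> S y"
    and s2: "\<And>x y. e1 \<le> x \<Longrightarrow> x \<le> y \<Longrightarrow> y < e2 \<Longrightarrow> S x \<le> S y"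
  shows "wp f merge_two s (\<lambda>t s'. t \<le> 50 * (e2 - lo) + 8 \<and> iv s' ''k'' = e2 \<and>
    (\<forall>x y. lo \<le> x \<and> x \<le> y \<and> y < e2 \<longrightarrow> rmem s' ''T'' x \<le> rmem s' ''T'' y) \<and>
    (\<forall>P. cnt (rmem s' ''T'') lo e2 P = cnt S lo e2 P) \<and>
    (\<forall>x<lo. rmem s' ''T'' x = rmem s ''T'' x))"
  unfolding merge_two_def
proof (rule wp_while[where V = "\<lambda>s'. 50 * (e2 - iv s' ''k'')" and
      I = "\<lambda>s'. merge_inv lo e1 e2 S (rmem s ''T'') (iv s' ''i'') (iv s' ''j'') (iv s' ''k'') (rmem s' ''T'')"],
    goal_cases)
  case 1
  show ?case using lo by (simp add: merge_inv_def)
next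
  case (2 s')
  have fr: "iv s' ''e1'' = e1" "iv s' ''e2'' = e2" "rmem s' ''S'' = S"
    using 2(3) lo S by (simp_all add: frame_def)
  have b: "iv s' ''k'' + e1 = iv s' ''i'' + iv s' ''j''" "iv s' ''i'' \<le> e1" "iv s' ''j'' \<le> e2"
    using 2(1) by (simp_all add: merge_inv_def)
  show ?case
  proof (cases "iv s' ''i'' < e1 \<and> \<not> (iv s' ''j'' < e2 \<and> S (iv s' ''j'') < S (iv s' ''i''))")
    case True
    then have "merge_inv lo e1 e2 S (rmem s ''T'') (iv s' ''i'' + 1) (iv s' ''j'') (iv s' ''k'' + 1)
        ((rmem s' ''T'')(iv s' ''k'' := S (iv s' ''i'')))"
      by (intro merge_inv_left[OF 2(1) _ _ s1]) auto
    then show ?thesis using True fr 2(2) by (simp add: not_le not_less)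
  next
    case False
    then have *: "iv s' ''j'' < e2" "iv s' ''i'' < e1 \<Longrightarrow> S (iv s' ''j'') < S (iv s' ''i'')"
      using b 2(2) fr by auto
    then have "merge_inv lo e1 e2 S (rmem s ''T'') (iv s' ''i'') (iv s' ''j'' + 1) (iv s' ''k'' + 1)
        ((rmem s' ''T'')(iv s' ''k'' := S (iv s' ''j'')))"
      by (intro merge_inv_right[OF 2(1) _ _ s2]) auto
    moreover have "(iv s' ''i'' < e1 \<and> \<not> S (iv s' ''j'') < S (iv s' ''i'')) = False"
      using *(2) by auto
    ultimately show ?thesis using *(1) fr 2(2) by (simp add: not_le del: de_Morgan_conj not_less)
  qed
next
  case (3 t s')
  have "iv s' ''k'' = e2 \<and> iv s' ''i'' = e1 \<and> iv s' ''j'' = e2"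
    using 3(1-3) lo by (auto simp: frame_def merge_inv_def)
  then show ?case using 3(1,4) lo cnt_append[of lo e1 e2 S] by (simp add: merge_inv_def)
qed

text \<open>Truncated subtraction makes this the minimum.\<close>

abbreviation IMin :: "iexp \<Rightarrow> iexp \<Rightarrow> iexp" where "IMin e e' \<equiv> ISub e (ISub e e')"

definition merge_pass :: com where
  "merge_pass = IS ''lo'' (IConst 0) ;;
   While (ILt (IV ''lo'') (IV ''Len''))
    (IS ''k'' (IV ''lo'') ;; IS ''i'' (IV ''lo'') ;;
     IS ''e1'' (IMin (IV ''Len'') (IAdd (IV ''lo'') (IV ''L''))) ;;
     IS ''j'' (IV ''e1'') ;;
     IS ''e2'' (IMin (IV ''Len'') (IAdd (IV ''e1'') (IV ''L''))) ;;
     merge_two ;; IS ''lo'' (IV ''e2''))"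

lemma mods_merge_pass [simp]:
  "imods merge_pass = {''i'', ''j'', ''k'', ''lo'', ''e1'', ''e2''}" "rmods merge_pass = {''T''}"
  by (auto simp: merge_pass_def)

text \<open>The old output ends at a multiple of \<open>M\<close>, so no index below
  \<open>lo\<close> has the quotient \<open>q\<close>; a sorted stretch of length at most
  \<open>M\<close> after it is a run of its own.\<close>

lemma runs_extend:
  assumes "runs T lo M" "lo = q * M" "e \<le> lo + M"
    "\<And>x y. lo \<le> x \<Longrightarrow> x \<le> y \<Longrightarrow> y < e \<Longrightarrow> T' x \<le> T' y" "\<And>x. x < lo \<Longrightarrow> T' x = T x"
  shows "runs T' e M"
  unfolding runs_def
proof (intro allI impI)
  fix x y assume xy: "x \<le> y \<and> y < e \<and> x div M = y div M"
  show "T' x \<le> T' y"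
  proof (cases "y < lo")
    case True
    then show ?thesis using xy assms(1,5) by (simp add: runs_def)
  next
    case False
    then have "y div M = q" using xy assms(2,3) by (intro div_nat_eqI) (auto simp: algebra_simps)
    then have "lo \<le> x" using xy assms(2) by (metis div_times_less_eq_dividend)
    then show ?thesis using xy assms(4) by blast
  qed
qed

lemma merge_pass:
  assumes R: "runs S n L" and L: "1 \<le> L" and s: "iv s ''Len'' = n" "iv s ''L'' = L" "rmem s ''S'' = S"
  shows "wp f merge_pass s (\<lambda>t s'. t \<le> 120 * n + 10 \<and> runs (rmem s' ''T'') n (2 * L) \<and>
    (\<forall>P. cnt (rmem s' ''T'') 0 n P = cnt S 0 n P))"
proof -
  let ?I = "\<lambda>s'. let lo = iv s' ''lo''; T = rmem s' ''T'' in
    lo \<le> n \<and> (lo = n \<or> (\<exists>q. lo = q * (2 * L))) \<and> runs T lo (2 * L) \<and>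
    (\<forall>P. cnt T 0 lo P = cnt S 0 lo P)"
  show ?thesis
    unfolding merge_pass_def wp_Seq wp_ISet
  proof (rule wp_while[where I = ?I and V = "\<lambda>s'. 120 * (n - iv s' ''lo'')"], goal_cases)
    case 1
    show ?case by (auto simp: Let_def runs_def)
  next
    case (2 s1)
    have fr: "iv s1 ''Len'' = n" "iv s1 ''L'' = L" "rmem s1 ''S'' = S"
      using 2(3) s by (simp_all add: frame_def)
    define lo where "lo = iv s1 ''lo''"
    define e1 where "e1 = n - (n - (lo + L))"
    define e2 where "e2 = n - (n - (e1 + L))"
    have lo: "lo < n" using 2(2) fr by (simp add: lo_def)
    obtain q where q: "lo = q * (2 * L)" using 2(1) lo by (auto simp: Let_def lo_def)
    have le: "lo < e1" "e1 \<le> e2" "e2 \<le> n" "e2 \<le> lo + 2 * L" "e2 = n \<or> e2 = lo + 2 * L"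
      using lo L by (auto simp: e1_def e2_def)
    have r1: "S x \<le> S y" if "lo \<le> x" "x \<le> y" "y < e1" for x y
    proof -
      have "x div L = 2 * q" "y div L = 2 * q"
        by (rule div_nat_eqI; use that q in \<open>simp add: e1_def algebra_simps\<close>)+
      then show ?thesis using R that le unfolding runs_def by auto
    qed
    have r2: "S x \<le> S y" if "e1 \<le> x" "x \<le> y" "y < e2" for x y
    proof -
      have "e1 = lo + L" using that by (auto simp: e1_def e2_def)
      moreover have "e2 \<le> e1 + L" by (simp add: e2_def)
      ultimately have "L * (2 * q + 1) \<le> z \<and> z < L * Suc (2 * q + 1)" if "z = x \<or> z = y" for z
        using that \<open>e1 \<le> x\<close> \<open>x \<le> y\<close> \<open>y < e2\<close> unfolding q by (elim disjE) (simp_all add: algebra_simps)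
      then have "x div L = 2 * q + 1" "y div L = 2 * q + 1"
        by (blast intro: div_nat_eqI)+
      then show ?thesis using R that le unfolding runs_def by auto
    qed
    have fin: "?I s3"
      if "iv s3 ''lo'' = e2" "\<forall>x y. lo \<le> x \<and> x \<le> y \<and> y < e2 \<longrightarrow> rmem s3 ''T'' x \<le> rmem s3 ''T'' y"
        "\<forall>P. cnt (rmem s3 ''T'') lo e2 P = cnt S lo e2 P"
        "\<forall>x<lo. rmem s3 ''T'' x = rmem s1 ''T'' x" for s3
    proof -
      have "runs (rmem s3 ''T'') e2 (2 * L)"
        by (rule runs_extend[of "rmem s1 ''T''" lo _ q]) (use 2(1) that q le in \<open>auto simp: Let_def lo_def\<close>)
      moreover have "cnt (rmem s3 ''T'') 0 e2 P = cnt S 0 e2 P" for P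
      proof -
        have "cnt (rmem s3 ''T'') 0 lo P = cnt (rmem s1 ''T'') 0 lo P"
          by (rule cnt_cong) (use that in auto)
        then show ?thesis
          using that 2(1) le by (simp add: cnt_append[of 0 lo e2] Let_def lo_def)
      qed
      moreover have "e2 = n \<or> e2 = (q + 1) * (2 * L)" using le q by (auto simp: algebra_simps)
      ultimately show ?thesis using that le by (auto simp: Let_def)
    qed
    have M: "wp f merge_two s' (\<lambda>t s3. t \<le> 50 * (e2 - lo) + 8 \<and> iv s3 ''e2'' = e2 \<and>
        (\<forall>x y. lo \<le> x \<and> x \<le> y \<and> y < e2 \<longrightarrow> rmem s3 ''T'' x \<le> rmem s3 ''T'' y) \<and>
        (\<forall>P. cnt (rmem s3 ''T'') lo e2 P = cnt S lo e2 P) \<and>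
        (\<forall>x<lo. rmem s3 ''T'' x = rmem s1 ''T'' x))"
      if "iv s' ''k'' = lo" "iv s' ''i'' = lo" "iv s' ''e1'' = e1" "iv s' ''j'' = e1" "iv s' ''e2'' = e2"
        "rmem s' = rmem s1" for s'
      by (rule wp_use[OF merge_two[of s' lo e1 e2 S]])
         (use that le fr r1 r2 in \<open>auto simp: frame_def\<close>)
    \<comment> \<open>Merging costs 50 per item, while the potential releases 120. The surplus
      covers the fixed cost of treating a pair of runs, because every pair contains at least one
      item.\<close>
    have len: "49 + t + 120 * (n - e2) \<le> 120 * (n - lo)" if "t \<le> 50 * (e2 - lo) + 8" for t
    proof -
      obtain p r where "e2 = lo + p" "1 \<le> p" "n = e2 + r" using le
        by (metis le_add_diff_inverse less_le_trans less_imp_le less_iff_succ_less_eq add_le_cancel_left)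
      then show ?thesis using that by simp
    qed
    show ?case
      unfolding wp_Seq wp_ISet
      apply (rule wp_use[OF M])
            apply (simp_all add: fr lo_def[symmetric] e1_def[symmetric] e2_def[symmetric])
      subgoal for t s3
        using fin[of "iset ''lo'' 0 e2 s3"] len[of t] by simp
      done
  next
    case (3 t s')
    have "iv s' ''lo'' = n" using 3(1-3) s by (simp add: Let_def frame_def)
    then show ?case using 3(1,4) by (simp add: Let_def)
  qed
qed

section \<open>Thinning a list to half its length\<close>

lemma cnt_card: "cnt A 0 n P = card {x. x < n \<and> P (A x)}"
proof -
  have "{0..<n} \<inter> {k. P (A k)} = {x. x < n \<and> P (A x)}" by auto
  then show ?thesis by (simp add: cnt_def)
qed

text \<open>Of two neighbours in a sorted run only the larger is kept: each run loses at most one.\<close>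

lemma decimate:
  assumes R: "runs T n (2 * L)" and P: "down P" and L: "1 \<le> L"
  defines "c \<equiv> cnt (\<lambda>k. T (2 * k + 1)) 0 (n div 2) P"
  shows "2 * c \<le> cnt T 0 n P" "cnt T 0 n P \<le> 2 * c + (n - 1) div (2 * L) + 1"
proof -
  define E where "E = {k. 2 * k < n \<and> P (T (2 * k))}"
  define Od where "Od = {k. 2 * k + 1 < n \<and> P (T (2 * k + 1))}"
  have fin: "finite E" "finite Od"
    by (rule finite_subset[of _ "{..n}"]; auto simp: E_def Od_def)+
  have "{x. x < n \<and> P (T x)} = (\<lambda>k. 2 * k) ` E \<union> (\<lambda>k. 2 * k + 1) ` Od"
  proof (rule set_eqI)
    fix x
    show "x \<in> {x. x < n \<and> P (T x)} \<longleftrightarrow> x \<in> (\<lambda>k. 2 * k) ` E \<union> (\<lambda>k. 2 * k + 1) ` Od"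
      by (cases "even x") (auto simp: E_def Od_def image_iff elim!: evenE oddE)
  qed
  moreover have "card ((\<lambda>k. 2 * k) ` E \<union> (\<lambda>k. 2 * k + 1) ` Od) = card E + card Od"
    using fin by (subst card_Un_disjoint) (auto simp: card_image inj_on_def, presburger)
  ultimately have c: "cnt T 0 n P = card E + card Od" by (simp add: cnt_card)
  have c': "c = card Od"
  proof -
    have "{x. x < n div 2 \<and> P (T (2 * x + 1))} = Od" unfolding Od_def by auto
    then show ?thesis by (simp add: c_def cnt_card)
  qed
  \<comment> \<open>Runs of \<open>T\<close> have the even length \<open>2 * L\<close>, so a pair of
    neighbours never straddles two runs.\<close>
  have run: "T (2 * k) \<le> T (2 * k + 1)" if "2 * k + 1 < n" for k
  proof -
    have "(2 * k + 1) div (2 * L) = k div L" "(2 * k) div (2 * L) = k div L"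
      by (simp_all add: div_mult2_eq)
    then show ?thesis using R that by (simp add: runs_def)
  qed
  have "Od \<subseteq> E" using run P unfolding Od_def E_def down_def by auto
  then show "2 * c \<le> cnt T 0 n P"
    using c c' card_mono[OF fin(1)] by force
  \<comment> \<open>The pairs split by the down-set: smaller element inside, larger one outside. Two
    such pairs in one run would contradict its order, hence the injection into the numbers of the
    runs.\<close>
  define B where "B = E - Od"
  have "inj_on (\<lambda>k. (2 * k) div (2 * L)) B"
  proof (rule inj_onI, rule ccontr)
    fix k k' assume k: "k \<in> B" "k' \<in> B" "(2 * k) div (2 * L) = (2 * k') div (2 * L)" "k \<noteq> k'"
    have *: False if k: "k \<in> B" "k' \<in> B" "(2 * k) div (2 * L) = (2 * k') div (2 * L)" "k < k'" for k k'
    proof -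
      have "(2 * k + 1) div (2 * L) = (2 * k) div (2 * L)" by (simp add: div_mult2_eq)
      then have "(2 * k + 1) div (2 * L) = (2 * k') div (2 * L)" using k(3) by simp
      moreover have "2 * k + 1 \<le> 2 * k'" "2 * k' < n" "P (T (2 * k'))" using k by (auto simp: B_def E_def)
      ultimately have "T (2 * k + 1) \<le> T (2 * k')" using R unfolding runs_def by blast
      then have "P (T (2 * k + 1))" using P \<open>P (T (2 * k'))\<close> unfolding down_def by blast
      then show False using k \<open>2 * k + 1 \<le> 2 * k'\<close> \<open>2 * k' < n\<close> by (auto simp: B_def Od_def)
    qed
    show False using *[of k k'] *[of k' k] k by (metis linorder_neqE_nat)
  qed
  moreover have "(\<lambda>k. (2 * k) div (2 * L)) ` B \<subseteq> {..(n - 1) div (2 * L)}"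
  proof (rule image_subsetI)
    fix k assume "k \<in> B"
    then have "2 * k \<le> n - 1" by (auto simp: B_def E_def)
    then show "(2 * k) div (2 * L) \<in> {..(n - 1) div (2 * L)}" unfolding atMost_iff by (rule div_le_mono)
  qed
  ultimately have "card B \<le> (n - 1) div (2 * L) + 1"
    by (metis card_atMost card_inj_on_le finite_atMost Suc_eq_plus1)
  moreover have "card E \<le> card Od + card B"
    using card_Un_le[of Od B] card_mono[of "Od \<union> B" E] fin by (fastforce simp: B_def)
  ultimately show "cnt T 0 n P \<le> 2 * c + (n - 1) div (2 * L) + 1"
    using c c' by simp
qed

definition copy_loop :: "iexp \<Rightarrow> com" where
  "copy_loop e = IS ''k'' (IConst 0) ;;
    While (ILt (IV ''k'') (IV ''Len'')) (RSet ''S'' (IV ''k'') (RGet ''T'' e) ;; inc ''k'')"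

lemma mods_copy_loop [simp]: "imods (copy_loop e) = {''k''}" "rmods (copy_loop e) = {''S''}"
  by (auto simp: copy_loop_def)

lemma copy_loop:
  assumes g: "\<And>s. ival s e = g (iv s ''k'')" and n: "iv s ''Len'' = n"
  shows "wp f (copy_loop e) s (\<lambda>t s'. t \<le> (20 + itime e) * n + 10 \<and>
    (\<forall>k<n. rmem s' ''S'' k = rmem s ''T'' (g k)))"
  unfolding copy_loop_def wp_Seq wp_ISet
proof (rule wp_while[where V = "\<lambda>s'. (20 + itime e) * (n - iv s' ''k'')" and
      I = "\<lambda>s'. iv s' ''k'' \<le> n \<and> (\<forall>k < iv s' ''k''. rmem s' ''S'' k = rmem s ''T'' (g k))"],
    goal_cases)
  case 1
  show ?case by simp
next
  case (2 s')
  have fr: "iv s' ''Len'' = n" "rmem s' ''T'' = rmem s ''T''"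
    using 2(3) n by (simp_all add: frame_def)
  have "n - iv s' ''k'' = Suc (n - (iv s' ''k'' + 1))" using 2(2) fr by simp
  then show ?case using 2 fr by (simp add: g less_Suc_eq)
next
  case (3 t s')
  then show ?case using n by (simp add: frame_def)
qed

section \<open>Merging and thinning in alternation\<close>

definition compress :: com where
  "compress = IS ''L'' (IConst 1) ;; RS ''w'' (RConst 1) ;; IS ''lim'' (IConst 128) ;;
   While (ILt (IV ''L'') (IV ''Len''))
     (merge_pass ;; IS ''L'' (IAdd (IV ''L'') (IV ''L'')) ;;
      Cond (ILe (IV ''lim'') (IV ''L''))
        (IS ''Len'' (IHalf (IV ''Len'')) ;; IS ''L'' (IHalf (IV ''L'')) ;;
         IS ''lim'' (IAdd (IV ''lim'') (IV ''lim'')) ;; RS ''w'' (RAdd (RV ''w'') (RV ''w'')) ;;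
         copy_loop (IAdd (IAdd (IV ''k'') (IV ''k'')) (IConst 1)))
        (copy_loop (IV ''k'')))"

lemma mods_compress [simp]:
  "imods compress = {''i'', ''j'', ''k'', ''lo'', ''e1'', ''e2'', ''L'', ''lim'', ''Len''}"
  "rmods compress = {''S'', ''T'', ''w''}"
  by (auto simp: compress_def)

text \<open>The permitted error \<open>N / 32 - N / (32 * w)\<close> is 0 at the initial weight 1,
  and doubling \<open>w\<close> releases \<open>N / (64 * w)\<close>, which is what one thinning
  costs. Thinning happens when runs reach the length \<open>lm = 128 * w\<close>. The first clause
  passes bounds on the original slopes on to the surviving ones.\<close>

definition compress_inv ::
  "nat \<Rightarrow> (nat \<Rightarrow> real) \<Rightarrow> (nat \<Rightarrow> real) \<Rightarrow> nat \<Rightarrow> nat \<Rightarrow> nat \<Rightarrow> real \<Rightarrow> bool" where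
  "compress_inv N S0 S n L lm (w :: real) \<longleftrightarrow>
    (\<forall>P. (\<forall>k<N. P (S0 k)) \<longrightarrow> (\<forall>k<n. P (S k))) \<and>
    1 \<le> L \<and> (\<exists>q\<ge>1. lm = L * 2 ^ q) \<and> real lm = 128 * w \<and> (1::real) \<le> w \<and> runs S n L \<and> n \<le> N \<and>
    (\<forall>P. down P \<longrightarrow> w * real (cnt S 0 n P) \<le> real (cnt S0 0 N P) \<and>
        real (cnt S0 0 N P) \<le> w * real (cnt S 0 n P) + N / 32 - N / (32 * w))"

lemma cnt_full: "cnt A 0 n P = n \<longleftrightarrow> (\<forall>k<n. P (A k))"
proof
  assume "cnt A 0 n P = n"
  then have c: "card {x. x < n \<and> P (A x)} = card {..<n}" by (simp add: cnt_card)
  have "{x. x < n \<and> P (A x)} \<subseteq> {..<n}" by blast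
  from card_subset_eq[OF finite_lessThan this c] show "\<forall>k<n. P (A k)" by blast
next
  assume "\<forall>k<n. P (A k)"
  then have "{x. x < n \<and> P (A x)} = {..<n}" by blast
  then show "cnt A 0 n P = n" by (simp add: cnt_card)
qed

lemma compress_inv_merge:
  assumes "compress_inv N S0 S n L lm w" "\<not> lm \<le> 2 * L" "runs S' n (2 * L)"
    "\<And>P. cnt S' 0 n P = cnt S 0 n P"
  shows "compress_inv N S0 S' n (2 * L) lm w"
proof -
  obtain q where q: "1 \<le> q" "lm = L * 2 ^ q" using assms(1) by (auto simp: compress_inv_def)
  with assms(2) have "q \<noteq> 1" by auto
  with q have "lm = 2 * L * 2 ^ (q - 1)" "1 \<le> q - 1" by (auto simp: power_eq_if)
  moreover have "\<forall>k<n. P (S' k)" if "\<forall>k<N. P (S0 k)" for P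
  proof -
    have "\<forall>k<n. P (S k)" using assms(1) that unfolding compress_inv_def by blast
    then show ?thesis using assms(4)[of P] cnt_full by metis
  qed
  moreover have "n \<le> N" "1 \<le> 2 * L" "real lm = 128 * w" "1 \<le> w"
    using assms(1) unfolding compress_inv_def by auto
  moreover have "\<forall>P. down P \<longrightarrow> w * cnt S' 0 n P \<le> cnt S0 0 N P \<and>
      cnt S0 0 N P \<le> w * cnt S' 0 n P + N / 32 - N / (32 * w)"
    using assms(1) unfolding assms(4) compress_inv_def by blast
  ultimately show ?thesis using assms(3) unfolding compress_inv_def by blast
qed

text \<open>One thinning miscounts by at most one item of weight \<open>w\<close> per run. At most
  \<open>n / L\<close> runs are charged, \<open>w * n\<close> never exceeds \<open>N\<close>, and
  \<open>L = 64 * w\<close> at this moment, so the new error is at most \<open>N / (64 * w)\<close>: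
  a geometric series over the doublings.\<close>

lemma compress_inv_decimate:
  assumes I: "compress_inv N S0 S n L lm w" and lm: "lm \<le> 2 * L" and T: "runs T n (2 * L)"
    "\<And>P. cnt T 0 n P = cnt S 0 n P" and L: "L < n"
    and S': "\<And>k. k < n div 2 \<Longrightarrow> S' k = T (2 * k + 1)"
  shows "compress_inv N S0 S' (n div 2) L (2 * lm) (2 * w)"
proof -
  obtain q where q: "1 \<le> q" "lm = L * 2 ^ q" using I by (auto simp: compress_inv_def)
  have I': "1 \<le> L" "real lm = 128 * w" "1 \<le> w" "n \<le> N" using I by (auto simp: compress_inv_def)
  have "(2::nat) ^ q \<le> 2" using lm q I'(1) by auto
  moreover have "(2::nat) ^ 1 \<le> 2 ^ q" using q(1) by (intro power_increasing) auto
  ultimately have lm2: "lm = 2 * L" using q(2) by auto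
  have Lw: "real L = 64 * w" using lm2 I'(2) by simp
  have "2 * lm = L * 2 ^ 2" using lm2 by simp
  then have q': "\<exists>q\<ge>1. 2 * lm = L * 2 ^ q" by (intro exI[of _ 2]) simp
  have runs': "runs S' (n div 2) L"
    unfolding runs_def
  proof (intro allI impI)
    fix x y assume xy: "x \<le> y \<and> y < n div 2 \<and> x div L = y div L"
    have "(2 * x + 1) div (2 * L) = (2 * y + 1) div (2 * L)" using xy by (simp add: div_mult2_eq)
    then have "T (2 * x + 1) \<le> T (2 * y + 1)" using T(1) xy unfolding runs_def by auto
    then show "S' x \<le> S' y" using xy S' by auto
  qed
  have "2 * w * cnt S' 0 (n div 2) P \<le> cnt S0 0 N P \<and>
      cnt S0 0 N P \<le> 2 * w * cnt S' 0 (n div 2) P + N / 32 - N / (32 * (2 * w))" if P: "down P" for P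
  proof -
    define c where "c = cnt S' 0 (n div 2) P"
    have c: "c = cnt (\<lambda>k. T (2 * k + 1)) 0 (n div 2) P" unfolding c_def using S' by (intro cnt_cong) auto
    note d = decimate[OF T(1) P I'(1), folded c]
    have old: "w * cnt S 0 n P \<le> cnt S0 0 N P" "cnt S0 0 N P \<le> w * cnt S 0 n P + N / 32 - N / (32 * w)"
      using I P by (auto simp: compress_inv_def)
    have "w * (2 * c) \<le> w * cnt S 0 n P" using d(1) T(2) I'(3) by (intro mult_left_mono) auto
    \<comment> \<open>The bound \<open>n / L\<close> is twice the number of full runs of length
      \<open>2 * L\<close>; the factor 2 also covers a single incomplete run, since
      \<open>L < n\<close>.\<close>
    moreover have "real ((n - 1) div (2 * L)) + 1 \<le> n / L"
    proof (cases "n \<le> 2 * L")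
      case True
      then have "(n - 1) div (2 * L) = 0" using L by (intro div_less) auto
      then show ?thesis using L I'(1) by simp
    next
      case False
      have "real ((n - 1) div (2 * L)) \<le> real (n - 1) / real (2 * L)"
        by (rule of_nat_div_le_of_nat)
      also have "\<dots> + 1 = (real (n - 1) + 2 * L) / (2 * L)" using I'(1) by (simp add: field_simps)
      also have "\<dots> \<le> (2 * n) / (2 * L)" using False I'(1) by (intro divide_right_mono) auto
      finally show ?thesis by simp
    qed
    then have "w * cnt S 0 n P \<le> w * (2 * c + n / L)"
      using d(2) T(2)[of P] I'(3) by (intro mult_left_mono) auto
    moreover have "w * (n / L) \<le> N / (64 * w)"
    proof -
      \<comment> \<open>The trivial down-set, which contains everything, turns the lower count
        estimate into a bound on the length.\<close>
      have "w * n \<le> N"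
      proof -
        have "down (\<lambda>_. True)" by (simp add: down_def)
        moreover have "\<forall>P. down P \<longrightarrow> w * cnt S 0 n P \<le> cnt S0 0 N P"
          using I by (simp add: compress_inv_def)
        ultimately have "w * cnt S 0 n (\<lambda>_. True) \<le> cnt S0 0 N (\<lambda>_. True)" by blast
        then show ?thesis by (simp add: cnt_def)
      qed
      then have "w * (n / L) \<le> N / L" using I'(1) by (simp add: divide_simps)
      then show ?thesis by (simp add: Lw)
    qed
    moreover have "N / (32 * w) = N / (64 * w) + N / (32 * (2 * w))" using I'(3) by (simp add: field_simps)
    ultimately show ?thesis using old unfolding c_def[symmetric] by (simp add: distrib_left)
  qed
  moreover have "\<forall>k<n div 2. P (S' k)" if "\<forall>k<N. P (S0 k)" for P
  proof -
    have "\<forall>k<n. P (S k)" using I that unfolding compress_inv_def by blast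
    then have "\<forall>k<n. P (T k)" using T(2)[of P] cnt_full by metis
    then show ?thesis using S' by simp
  qed
  moreover have "n div 2 \<le> N" "real (2 * lm) = 128 * (2 * w)" "1 \<le> 2 * w" using I' by auto
  ultimately show ?thesis unfolding compress_inv_def using I'(1) q' runs' by blast
qed

text \<open>Linear time comes from the potential \<open>300 * n * (2 + lim div L)\<close>, where
  \<open>lim div L\<close> is a power of two. A pass without thinning halves this power and releases
  at least \<open>600 * n\<close>. Thinning raises it from 2 to 4 but halves \<open>n\<close>, so
  the potential falls from \<open>1200 * n\<close> to at most \<open>900 * n\<close>. The initial
  value is \<open>39000 * N\<close>, as \<open>lim\<close> starts at 128.\<close>

lemma compress:
  assumes n: "iv s ''Len'' = N" and S: "rmem s ''S'' = S0"
  shows "wp f compress s (\<lambda>t s'. t \<le> 40000 * N + 100 \<and> iv s' ''Len'' \<le> N \<and> 1 \<le> rv s' ''w'' \<and>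
    (\<forall>x y. x \<le> y \<and> y < iv s' ''Len'' \<longrightarrow> rmem s' ''S'' x \<le> rmem s' ''S'' y) \<and>
    (\<forall>P. down P \<longrightarrow> rv s' ''w'' * cnt (rmem s' ''S'') 0 (iv s' ''Len'') P \<le> cnt S0 0 N P \<and>
        cnt S0 0 N P \<le> rv s' ''w'' * cnt (rmem s' ''S'') 0 (iv s' ''Len'') P + N / 32) \<and>
    (\<forall>P. (\<forall>k<N. P (S0 k)) \<longrightarrow> (\<forall>k<iv s' ''Len''. P (rmem s' ''S'' k))))"
proof -
  let ?I = "\<lambda>s'. compress_inv N S0 (rmem s' ''S'') (iv s' ''Len'') (iv s' ''L'') (iv s' ''lim'') (rv s' ''w'')"
  let ?V = "\<lambda>s'. 300 * (iv s' ''Len'' * (2 + iv s' ''lim'' div iv s' ''L''))"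
  show ?thesis
    unfolding compress_def wp_Seq wp_ISet wp_RSet
  proof (rule wp_while[where I = ?I and V = ?V], goal_cases)
    case 1
    have "\<exists>q\<ge>1. 128 = (2::nat) ^ q" by (intro exI[of _ 7]) simp
    then show ?case by (simp add: compress_inv_def n S runs_def)
  next
    case (2 s1)
    define n1 L lm w where d: "n1 = iv s1 ''Len''" "L = iv s1 ''L''" "lm = iv s1 ''lim''" "w = rv s1 ''w''"
    have I: "compress_inv N S0 (rmem s1 ''S'') n1 L lm w" using 2(1) d by simp
    then obtain q where q: "1 \<le> q" "lm = L * 2 ^ q" "1 \<le> L" by (auto simp: compress_inv_def)
    have Ln: "L < n1" using 2(2) d by simp
    have R: "runs (rmem s1 ''S'') n1 L" using I by (simp add: compress_inv_def)
    have pot: "lm div L = 2 ^ q" using q by simp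
    show ?case
    proof (cases "lm \<le> 2 * L")
      case True
      then have "q = 1" using q power_increasing[of 2 q "2::nat"] by (cases "q = 1") auto
      then have lm: "lm = 2 * L" using q by simp
      show ?thesis
        apply simp
        apply (rule wp_use[OF merge_pass[OF R q(3) d(1)[symmetric] d(2)[symmetric] refl]])
        subgoal premises p for t s2
        proof -
          have e: "iv s2 ''Len'' = n1" "iv s2 ''L'' = L" "iv s2 ''lim'' = lm" "rv s2 ''w'' = w"
            by (simp_all add: frameI[OF p(2)] frameR[OF p(2)] d)
          show ?thesis
            apply (simp add: e lm)
            apply (rule wp_use[OF copy_loop[where g = "\<lambda>k. k + k + 1" and n = "n1 div 2"]])
              apply simp
             apply simp
            subgoal premises r for t' s3
            proof -
              have e3: "iv s3 ''Len'' = n1 div 2" "iv s3 ''L'' = L" "iv s3 ''lim'' = 2 * lm" "rv s3 ''w'' = 2 * w"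
                by (simp_all add: frameI[OF r(2)] frameR[OF r(2)] lm e)
              have "compress_inv N S0 (rmem s3 ''S'') (n1 div 2) L (2 * lm) (2 * w)"
              proof (rule compress_inv_decimate[OF I True _ _ Ln])
                show "runs (rmem s2 ''T'') n1 (2 * L)" using p(1) by blast
                show "cnt (rmem s2 ''T'') 0 n1 P = cnt (rmem s1 ''S'') 0 n1 P" for P using p(1) by blast
                show "rmem s3 ''S'' k = rmem s2 ''T'' (2 * k + 1)" if "k < n1 div 2" for k
                  using r(1) that by (simp add: mult_2[of k])
              qed
              moreover have "t \<le> 120 * n1 + 10" "t' \<le> 27 * (n1 div 2) + 10"
                using conjunct1[OF p(1)] conjunct1[OF r(1)] by simp_all
              moreover have "300 * (n1 div 2 * 6) \<le> 900 * n1" "27 * (n1 div 2) \<le> 14 * n1" by simp_all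
              moreover have "2 * lm div L = 4" "lm div L = 2" using q(3) by (simp_all add: lm)
              ultimately show ?thesis using Ln q(3) by (simp add: e3 d(1-3)[symmetric])
            qed
            done
        qed
        done
    next
      case False
      then have "q \<noteq> 1" using q by auto
      then have q2: "(2::nat) ^ q = 2 * 2 ^ (q - 1)" "(2::nat) \<le> 2 ^ (q - 1)"
        using q(1) power_increasing[of 1 "q - 1" "2::nat"] by (cases q; simp)+
      then have pot2: "lm div (2 * L) = 2 ^ (q - 1)" using q(2,3) q2(1) by simp
      have pot3: "n1 * 2 \<le> n1 * 2 ^ (q - 1)" using q2(2) by (rule mult_le_mono2)
      show ?thesis
        apply simp
        apply (rule wp_use[OF merge_pass[OF R q(3) d(1)[symmetric] d(2)[symmetric] refl]])
        subgoal premises p for t s2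
        proof -
          have e: "iv s2 ''Len'' = n1" "iv s2 ''L'' = L" "iv s2 ''lim'' = lm" "rv s2 ''w'' = w"
            by (simp_all add: frameI[OF p(2)] frameR[OF p(2)] d)
          have F: "(lm \<le> L + L) = False" using False by simp
          show ?thesis
            apply (simp add: e F)
            apply (rule wp_use[OF copy_loop[where g = "\<lambda>k. k" and n = n1]])
              apply simp
             apply (simp add: e)
            subgoal premises r for t' s3
            proof -
              have e3: "iv s3 ''Len'' = n1" "iv s3 ''L'' = 2 * L" "iv s3 ''lim'' = lm" "rv s3 ''w'' = w"
                by (simp_all add: frameI[OF r(2)] frameR[OF r(2)] e)
              have c: "cnt (rmem s3 ''S'') 0 n1 P = cnt (rmem s2 ''T'') 0 n1 P" for P
                using r(1) by (intro cnt_cong) simp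
              have "runs (rmem s3 ''S'') n1 (2 * L)"
                using p(1) r(1) unfolding runs_def by simp
              then have "compress_inv N S0 (rmem s3 ''S'') n1 (2 * L) lm w"
                using p(1) c by (intro compress_inv_merge[OF I False]) auto
              moreover have "t \<le> 120 * n1 + 10" "t' \<le> 27 * n1 + 10"
                using conjunct1[OF p(1)] conjunct1[OF r(1)] by simp_all
              then have "20 + (t + t') \<le> 300 * (n1 * 2 ^ (q - 1))" using Ln pot3 by linarith
              ultimately show ?thesis
                by (simp add: e3 d(1-3)[symmetric] pot2 pot q2(1) distrib_left)
            qed
            done
        qed
        done
    qed
  next
    case (3 t s')
    then have I: "?I s'" and L: "iv s' ''Len'' \<le> iv s' ''L''" by (simp_all add: not_less)
    have "N / (32 * rv s' ''w'') \<ge> 0" using I by (simp add: compress_inv_def)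
    moreover have "runs (rmem s' ''S'') (iv s' ''Len'') (iv s' ''L'')" using I by (simp add: compress_inv_def)
    \<comment> \<open>On exit the list is no longer than one run, so runs being sorted means that
      all of it is.\<close>
    then have "\<forall>x y. x \<le> y \<and> y < iv s' ''Len'' \<longrightarrow> rmem s' ''S'' x \<le> rmem s' ''S'' y"
      using L unfolding runs_def by auto
    moreover have "rv s' ''w'' * cnt (rmem s' ''S'') 0 (iv s' ''Len'') P \<le> cnt S0 0 N P \<and>
        cnt S0 0 N P \<le> rv s' ''w'' * cnt (rmem s' ''S'') 0 (iv s' ''Len'') P + N / 32" if "down P" for P
    proof -
      have "rv s' ''w'' * cnt (rmem s' ''S'') 0 (iv s' ''Len'') P \<le> cnt S0 0 N P \<and>
        cnt S0 0 N P \<le> rv s' ''w'' * cnt (rmem s' ''S'') 0 (iv s' ''Len'') P + N / 32 - N / (32 * rv s' ''w'')"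
        using I that unfolding compress_inv_def by presburger
      then show ?thesis using calculation(1) by linarith
    qed
    moreover have "\<forall>P. (\<forall>k<N. P (S0 k)) \<longrightarrow> (\<forall>k<iv s' ''Len''. P (rmem s' ''S'' k))"
      using I unfolding compress_inv_def by blast
    moreover have "1 \<le> rv s' ''w''" "iv s' ''Len'' \<le> N" using I by (simp_all add: compress_inv_def)
    ultimately show ?case using 3(4) n by simp
  qed
qed

section \<open>Tournament trees\<close>

text \<open>The number of binary digits, which is the number of nodes on the path from node
  \<open>n\<close> up to the root, node 1, in heap numbering.\<close>

fun depth :: "nat \<Rightarrow> nat" where
  "depth n = (if n = 0 then 0 else depth (n div 2) + 1)"

declare depth.simps [simp del]

lemma depth_0 [simp]: "depth 0 = 0"
  by (simp add: depth.simps)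

lemma depth_pos: "0 < n \<Longrightarrow> depth n = depth (n div 2) + 1"
  by (subst depth.simps) simp

lemma depth_mono: "k \<le> n \<Longrightarrow> depth k \<le> depth n"
proof (induction n arbitrary: k rule: less_induct)
  case (less n)
  show ?case
  proof (cases "k = 0")
    case False
    then have "depth (k div 2) \<le> depth (n div 2)" using less by (intro less.IH div_le_mono) auto
    then show ?thesis using False less.prems by (simp add: depth_pos)
  qed simp
qed

lemma depth_double: "0 < n \<Longrightarrow> depth (2 * n) = depth n + 1"
  by (simp add: depth_pos[of "2 * n"])

lemma depth_le: "0 < n \<Longrightarrow> 2 ^ depth n \<le> 2 * n"
proof (induction n rule: less_induct)
  case (less n)
  show ?case
  proof (cases "n = 1")
    case True then show ?thesis by (simp add: depth_pos)
  next
    case False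
    then have "2 ^ depth (n div 2) \<le> 2 * (n div 2)" using less by (intro less.IH) auto
    moreover have "2 ^ depth n = 2 * (2::nat) ^ depth (n div 2)" using less.prems by (simp add: depth_pos power_add)
    ultimately show ?thesis by linarith
  qed
qed

lemma depth_log: "0 < n \<Longrightarrow> real (depth n) \<le> 1 + log 2 n"
proof -
  assume n: "0 < n"
  have "(2::real) ^ depth n \<le> 2 * n" using depth_le[OF n] by (metis of_nat_le_iff of_nat_mult of_nat_numeral of_nat_power)
  then have "log 2 (2 ^ depth n) \<le> log 2 (2 * n)" using n by (intro log_mono) auto
  moreover have "log 2 (2 ^ depth n) = depth n" by (rule log_pow_cancel) auto
  ultimately show ?thesis using n by (simp add: log_mult)
qed

text \<open>Heap numbering: the children of \<open>k\<close> are \<open>2 * k\<close> and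
  \<open>2 * k + 1\<close>, and the leaves are the nodes from \<open>m\<close> to
  \<open>2 * m - 1\<close>. The number of leaves may be arbitrary; leaves may then differ in depth
  by one.\<close>

definition tree_ok :: "(nat \<Rightarrow> real) \<Rightarrow> nat \<Rightarrow> bool" where
  "tree_ok V m \<longleftrightarrow> (\<forall>k. 1 \<le> k \<and> k < m \<longrightarrow> V k = max (V (2 * k)) (V (2 * k + 1)))"

lemma tree_ok_le: "tree_ok V m \<Longrightarrow> 1 \<le> k \<Longrightarrow> k < 2 * m \<Longrightarrow> V k \<le> V 1"
proof (induction k rule: less_induct)
  case (less k)
  show ?case
  proof (cases "k = 1")
    case False
    define h where "h = k div 2"
    have h: "1 \<le> h" "h < m" "h < k" "k = 2 * h \<or> k = 2 * h + 1" using less.prems False by (auto simp: h_def)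
    then have "V h = max (V (2 * h)) (V (2 * h + 1))" using less.prems(1) unfolding tree_ok_def by blast
    then have "V k \<le> V h" using h(4) by (elim disjE) simp_all
    also have "\<dots> \<le> V 1" using less h by auto
    finally show ?thesis .
  qed simp
qed

section \<open>Updating a leaf and finding a largest one\<close>

definition tree_set :: "name \<Rightarrow> com" where
  "tree_set v = RSet v (IV ''pos'') (RV ''val'') ;; IS ''pos'' (IHalf (IV ''pos'')) ;;
    While (ILe (IConst 1) (IV ''pos''))
      (Cond (RLe (RGet v (IAdd (IV ''pos'') (IV ''pos''))) (RGet v (IAdd (IAdd (IV ''pos'') (IV ''pos'')) (IConst 1))))
         (RSet v (IV ''pos'') (RGet v (IAdd (IAdd (IV ''pos'') (IV ''pos'')) (IConst 1))))
         (RSet v (IV ''pos'') (RGet v (IAdd (IV ''pos'') (IV ''pos'')))) ;;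
       IS ''pos'' (IHalf (IV ''pos'')))"

lemma mods_tree_set [simp]: "imods (tree_set v) = {''pos''}" "rmods (tree_set v) = {v}"
  by (auto simp: tree_set_def)

text \<open>Only node \<open>p\<close> may violate the maximum equation. Repairing it moves the
  possible violation to the parent, and \<open>p = 0\<close>, which is no node, means that the tree
  is correct again.\<close>

definition tree_inv :: "(nat \<Rightarrow> real) \<Rightarrow> nat \<Rightarrow> nat \<Rightarrow> (nat \<Rightarrow> real) \<Rightarrow> bool" where
  "tree_inv V0 m p V \<longleftrightarrow> p < m \<and> (\<forall>k. 1 \<le> k \<and> k < m \<and> k \<noteq> p \<longrightarrow> V k = max (V (2 * k)) (V (2 * k + 1))) \<and>
     (\<forall>k\<ge>m. V k = V0 k)"

lemma tree_inv_step:
  assumes "tree_inv V0 m p V" "1 \<le> p" "w = max (V (2 * p)) (V (2 * p + 1))"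
  shows "tree_inv V0 m (p div 2) (V(p := w))"
proof -
  have "(V(p := w)) k = max ((V(p := w)) (2 * k)) ((V(p := w)) (2 * k + 1))"
    if k: "1 \<le> k" "k < m" "k \<noteq> p div 2" for k
  proof -
    have "2 * k \<noteq> p" "2 * k + 1 \<noteq> p" using k by auto
    then show ?thesis using assms k by (cases "k = p") (simp_all add: tree_inv_def)
  qed
  moreover have "p < m" "\<forall>k\<ge>m. V k = V0 k" using assms(1) by (simp_all add: tree_inv_def)
  ultimately show ?thesis unfolding tree_inv_def by simp
qed

lemma tree_set:
  assumes ok: "tree_ok (rmem s v) m" and pos: "iv s ''pos'' = p" "m \<le> p" "p < 2 * m" and v: "v \<noteq> ''val''"
  shows "wp f (tree_set v) s (\<lambda>t s'. t \<le> 40 * depth (2 * m) + 20 \<and> tree_ok (rmem s' v) m \<and>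
    (\<forall>k\<ge>m. rmem s' v k = (if k = p then rv s ''val'' else rmem s v k)))"
proof -
  let ?V0 = "(rmem s v)(p := rv s ''val'')"
  show ?thesis
    unfolding tree_set_def wp_Seq wp_ISet wp_RSet
  proof (rule wp_while[where I = "\<lambda>s'. tree_inv ?V0 m (iv s' ''pos'') (rmem s' v)"
        and V = "\<lambda>s'. 40 * depth (iv s' ''pos'')"], goal_cases)
    case 1
    have "tree_inv ?V0 m (p div 2) ?V0"
      unfolding tree_inv_def
    proof (intro conjI allI impI)
      fix k assume k: "1 \<le> k \<and> k < m \<and> k \<noteq> p div 2"
      then have "k \<noteq> p" "2 * k \<noteq> p" "2 * k + 1 \<noteq> p" using pos by auto
      then show "?V0 k = max (?V0 (2 * k)) (?V0 (2 * k + 1))" using ok k by (simp add: tree_ok_def)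
    qed (use pos in auto)
    then show ?case using pos v by simp
  next
    case (2 s1)
    define q where "q = iv s1 ''pos''"
    have q: "1 \<le> q" using 2(2) by (simp add: q_def)
    have st: "tree_inv ?V0 m (q div 2) ((rmem s1 v)(q := w))"
      if "w = max (rmem s1 v (2 * q)) (rmem s1 v (2 * q + 1))" for w
      using tree_inv_step[OF 2(1)[folded q_def] q that] .
    have "depth q = depth (q div 2) + 1" using q by (simp add: depth_pos)
    moreover have "tree_inv ?V0 m (q div 2) ((rmem s1 v)(q := rmem s1 v (2 * q + 1)))"
      if "rmem s1 v (2 * q) \<le> rmem s1 v (2 * q + 1)" using that by (intro st) simp
    moreover have "tree_inv ?V0 m (q div 2) ((rmem s1 v)(q := rmem s1 v (2 * q)))"
      if "\<not> rmem s1 v (2 * q) \<le> rmem s1 v (2 * q + 1)" using that by (intro st) simp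
    ultimately show ?case by (simp add: q_def[symmetric] mult_2[symmetric])
  next
    case (3 t s1)
    have "iv s1 ''pos'' = 0" using 3(2) by simp
    then have "tree_ok (rmem s1 v) m" "\<forall>k\<ge>m. rmem s1 v k = ?V0 k"
      using 3(1) by (simp_all add: tree_inv_def tree_ok_def)
    moreover have "depth (p div 2) \<le> depth (2 * m)" using pos by (intro depth_mono) auto
    ultimately show ?case using 3(4) pos by simp
  qed
qed

definition tree_find :: "name \<Rightarrow> com" where
  "tree_find v = IS ''pos'' (IConst 1) ;;
    While (ILt (IV ''pos'') (IV ''M''))
      (Cond (RLe (RGet v (IV ''pos'')) (RGet v (IAdd (IV ''pos'') (IV ''pos''))))
         (IS ''pos'' (IAdd (IV ''pos'') (IV ''pos'')))
         (IS ''pos'' (IAdd (IAdd (IV ''pos'') (IV ''pos'')) (IConst 1))))"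

lemma mods_tree_find [simp]: "imods (tree_find v) = {''pos''}" "rmods (tree_find v) = {}"
  by (auto simp: tree_find_def)

text \<open>The descent visits only nodes that carry the value of the root, and by
  \<open>tree_ok_le\<close> that value is the maximum. The potential is the number of levels still
  to go.\<close>

lemma tree_find:
  assumes ok: "tree_ok (rmem s v) m" and m: "iv s ''M'' = m" "1 \<le> m"
  shows "wp f (tree_find v) s (\<lambda>t s'. t \<le> 40 * depth (2 * m) + 20 \<and> m \<le> iv s' ''pos'' \<and> iv s' ''pos'' < 2 * m \<and>
    (\<forall>k. 1 \<le> k \<and> k < 2 * m \<longrightarrow> rmem s v k \<le> rmem s v (iv s' ''pos'')))"
  unfolding tree_find_def wp_Seq wp_ISet
proof (rule wp_while[where I = "\<lambda>s'. 1 \<le> iv s' ''pos'' \<and> iv s' ''pos'' < 2 * m \<and> rmem s v (iv s' ''pos'') = rmem s v 1"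
      and V = "\<lambda>s'. 40 * (depth (2 * m) - depth (iv s' ''pos''))"], goal_cases)
  case 1
  show ?case using m by simp
next
  case (2 s1)
  define q where "q = iv s1 ''pos''"
  have fr: "iv s1 ''M'' = m" "rmem s1 v = rmem s v" using frameI[OF 2(3)] frameR[OF 2(3)] m by simp_all
  have q: "1 \<le> q" "q < m" "rmem s v q = rmem s v 1" using 2(1,2) fr by (simp_all add: q_def)
  have mx: "rmem s v q = max (rmem s v (2 * q)) (rmem s v (2 * q + 1))"
    using ok q unfolding tree_ok_def by blast
  have "depth (2 * q) = depth q + 1" "depth (2 * q + 1) = depth q + 1"
    using q by (simp_all add: depth_pos[of "2 * q"] depth_pos[of "2 * q + 1"])
  moreover have "depth q + 1 \<le> depth (2 * m)"
    using depth_mono[of q m] depth_double[of m] q m by simp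
  then have "27 + 40 * (depth (2 * m) - (depth q + 1)) \<le> 40 * (depth (2 * m) - depth q)"
    by (simp add: diff_mult_distrib2)
  ultimately show ?case using q mx fr
    by (simp add: q_def[symmetric] mult_2[symmetric] max_def split: if_splits)
next
  case (3 t s1)
  have "iv s1 ''M'' = m" using frameI[OF 3(3)] m by simp
  then have "m \<le> iv s1 ''pos''" using 3(2) by simp
  moreover have "rmem s v k \<le> rmem s v (iv s1 ''pos'')" if "1 \<le> k" "k < 2 * m" for k
    using tree_ok_le[OF ok that] 3(1) by simp
  ultimately show ?case using 3(1,4) by (simp add: depth_double)
qed

section \<open>The greedy algorithm\<close>

text \<open>\<open>th k\<close> and \<open>la k\<close> are the least slope removed from and the largest slope taken from block \<open>k\<close>,
  \<open>Po k\<close> holds the remaining slopes, and \<open>M j\<close> is the largest sum that the blocks up to \<open>j\<close> can still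
  reach. The dual half is the same statement for negated slopes and sums.\<close>

definition half_opt :: "real \<Rightarrow> nat \<Rightarrow> (nat \<Rightarrow> real) \<Rightarrow> (nat \<Rightarrow> real) \<Rightarrow> (nat \<Rightarrow> real set) \<Rightarrow>
    (nat \<Rightarrow> real) \<Rightarrow> (nat \<Rightarrow> real) \<Rightarrow> bool" where
  "half_opt BIG K th la Po M b \<longleftrightarrow>
     (\<forall>i k x. 1 \<le> i \<and> i < k \<and> k \<le> K \<and> (x \<in> Po k \<or> x = la k) \<and> th i < x \<longrightarrow>
        (\<exists>j. i \<le> j \<and> j < k \<and> M j = b j \<and> (\<forall>l. 1 \<le> l \<and> l \<le> j \<longrightarrow> (\<forall>z\<in>Po l. z < x)))) \<and>
     (\<forall>i s. 1 \<le> i \<and> i \<le> K \<and> th i < s \<and> s \<le> BIG \<longrightarrow>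
        (\<exists>j. i \<le> j \<and> j \<le> K \<and> (M j = b j \<or> j = K \<and> b K \<le> M K) \<and>
          (\<forall>l. 1 \<le> l \<and> l \<le> j \<longrightarrow> (\<forall>z\<in>Po l. z < s))))"

text \<open>When block \<open>k\<close> is inserted, the remaining slopes of all blocks up to
  \<open>k\<close> are in play. Every later removal hits a largest and every later taking a smallest
  slope, so what survives lies between the last slope taken from \<open>k\<close> and the last one
  removed from it.\<close>

definition pool_le :: "nat \<Rightarrow> (nat \<Rightarrow> real) \<Rightarrow> (nat \<Rightarrow> real) \<Rightarrow> (nat \<Rightarrow> real set) \<Rightarrow> bool" where
  "pool_le K la th Po \<longleftrightarrow> (\<forall>i k. 1 \<le> i \<and> i \<le> k \<and> k \<le> K \<longrightarrow> (\<forall>z\<in>Po i. la k \<le> z \<and> z \<le> th k))"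

lemma half_optD1:
  "half_opt BIG K th la Po M b \<Longrightarrow> 1 \<le> i \<Longrightarrow> i < k \<Longrightarrow> k \<le> K \<Longrightarrow> x \<in> Po k \<or> x = la k \<Longrightarrow> th i < x \<Longrightarrow>
    \<exists>j. i \<le> j \<and> j < k \<and> M j = b j \<and> (\<forall>l. 1 \<le> l \<and> l \<le> j \<longrightarrow> (\<forall>z\<in>Po l. z < x))"
  unfolding half_opt_def by blast

lemma half_optD2:
  "half_opt BIG K th la Po M b \<Longrightarrow> 1 \<le> i \<Longrightarrow> i \<le> K \<Longrightarrow> th i < s \<Longrightarrow> s \<le> BIG \<Longrightarrow>
    \<exists>j. i \<le> j \<and> j \<le> K \<and> (M j = b j \<or> j = K \<and> b K \<le> M K) \<and> (\<forall>l. 1 \<le> l \<and> l \<le> j \<longrightarrow> (\<forall>z\<in>Po l. z < s))"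
  unfolding half_opt_def by blast

text \<open>The second clause of \<open>half_opt\<close> is a promise to blocks not yet inserted,
  and insertion redeems it: the way out \<open>b K \<le> M K\<close> becomes a tight constraint
  because of \<open>M K \<le> b K\<close>. The initial value \<open>l0\<close> of \<open>la\<close>
  is below every \<open>th\<close>, so it raises no new obligation.\<close>

lemma half_opt_insert:
  assumes H: "half_opt BIG K th la Po M b" and MK: "M K \<le> b K"
    and A: "\<And>z. z \<in> A \<Longrightarrow> z \<le> BIG" and th: "\<And>i. 1 \<le> i \<Longrightarrow> i \<le> K \<Longrightarrow> l0 \<le> th i"
    and M': "\<And>j. j \<le> K \<Longrightarrow> M' j = M j"
  shows "half_opt BIG (K + 1) (th(K + 1 := BIG)) (la(K + 1 := l0)) (Po(K + 1 := A)) M' b"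
  unfolding half_opt_def
proof (intro conjI allI impI, goal_cases)
  case (1 i k x)
  show ?case
  proof (cases "k = K + 1")
    case True
    then have x: "x \<in> A" "th i < x" "1 \<le> i" "i \<le> K" using 1 th[of i] by auto
    then obtain j where "i \<le> j" "j \<le> K" "M j = b j \<or> j = K \<and> b K \<le> M K"
        "\<forall>l. 1 \<le> l \<and> l \<le> j \<longrightarrow> (\<forall>z\<in>Po l. z < x)"
      using half_optD2[OF H, of i x] A[of x] by blast
    then show ?thesis using MK M'[of j] True by (intro exI[of _ j]) auto
  next
    case False
    then have "1 \<le> i \<and> i < k \<and> k \<le> K \<and> (x \<in> Po k \<or> x = la k) \<and> th i < x" using 1 by auto
    then obtain j where "i \<le> j" "j < k" "M j = b j" "\<forall>l. 1 \<le> l \<and> l \<le> j \<longrightarrow> (\<forall>z\<in>Po l. z < x)"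
      using half_optD1[OF H, of i k x] by blast
    then show ?thesis using M'[of j] False 1 by (intro exI[of _ j]) auto
  qed
next
  case (2 i s)
  then have "1 \<le> i \<and> i \<le> K \<and> th i < s \<and> s \<le> BIG" by (cases "i = K + 1") auto
  then obtain j where "i \<le> j" "j \<le> K" "M j = b j \<or> j = K \<and> b K \<le> M K"
      "\<forall>l. 1 \<le> l \<and> l \<le> j \<longrightarrow> (\<forall>z\<in>Po l. z < s)"
    using half_optD2[OF H, of i s] by blast
  then show ?case using MK M'[of j] by (intro exI[of _ j]) auto
qed

text \<open>A witness \<open>j\<close> comes with the information that all slopes remaining up to
  \<open>j\<close> are smaller than the slope in question. Since \<open>s0\<close> is a largest
  slope, its block must lie beyond \<open>j\<close>, and so \<open>M j\<close> is not affected and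
  \<open>j\<close> stays tight. For slopes above \<open>s0\<close> the new witness is
  \<open>K\<close> itself, where removal does not go below the bound.\<close>

lemma half_opt_remove:
  assumes H: "half_opt BIG K th la Po M b" and P: "pool_le K la th' Po"
    and o: "1 \<le> o'" "o' \<le> K" "s0 \<in> Po o'"
    and mx: "\<And>l z. 1 \<le> l \<Longrightarrow> l \<le> K \<Longrightarrow> z \<in> Po l \<Longrightarrow> z \<le> s0"
    and M': "\<And>j. j < o' \<Longrightarrow> M' j = M j" "b K \<le> M' K"
    and Po': "\<And>l. 1 \<le> l \<Longrightarrow> l \<le> K \<Longrightarrow> Po' l \<subseteq> Po l"
  shows "half_opt BIG K (th(o' := s0)) la Po' M' b"
  unfolding half_opt_def
proof (intro conjI allI impI, goal_cases)
  case (1 i k x)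
  \<comment> \<open>A slope already taken from a block \<open>k \<ge> o'\<close> is covered by
    \<open>pool_le\<close>: it is at most every slope remaining in \<open>o'\<close>, in particular
    \<open>s0\<close>.\<close>
  have xs: "x \<le> s0" if "o' \<le> k"
  proof (cases "x \<in> Po' k")
    case True then show ?thesis using mx[of k x] Po'[of k] 1 by auto
  next
    case False
    then have "x = la k" using 1 by blast
    then show ?thesis using P o 1 that unfolding pool_le_def by auto
  qed
  show ?case
  proof (cases "i = o'")
    case True
    then show ?thesis using xs 1 by auto
  next
    case False
    then have "1 \<le> i \<and> i < k \<and> k \<le> K \<and> (x \<in> Po k \<or> x = la k) \<and> th i < x" using 1 Po'[of k] by auto
    then obtain j where j: "i \<le> j" "j < k" "M j = b j" "\<forall>l. 1 \<le> l \<and> l \<le> j \<longrightarrow> (\<forall>z\<in>Po l. z < x)"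
      using half_optD1[OF H, of i k x] by blast
    have "j < o'"
    proof (rule ccontr)
      assume "\<not> j < o'"
      then have "o' \<le> j" by simp
      then have "s0 < x" using j(4) o by blast
      moreover have "x \<le> s0" using xs \<open>o' \<le> j\<close> j(2) by simp
      ultimately show False by simp
    qed
    then have "M' j = b j" using M'(1)[of j] j(3) by simp
    moreover have "\<forall>z\<in>Po' l. z < x" if "1 \<le> l" "l \<le> j" for l
    proof -
      have "l \<le> K" using that j(2) 1 by linarith
      then show ?thesis using Po'[of l] that j(4) by blast
    qed
    ultimately show ?thesis using j(1,2) by blast
  qed
next
  case (2 i s)
  show ?case
  proof (cases "s0 < s")
    case True
    have "z < s" if "1 \<le> l" "l \<le> K" "z \<in> Po' l" for l z using mx[of l z] Po'[of l] that True by auto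
    then show ?thesis using 2 M' by (intro exI[of _ K]) auto
  next
    case False
    then have "1 \<le> i \<and> i \<le> K \<and> th i < s \<and> s \<le> BIG" using 2 by (auto split: if_splits)
    then obtain j where j: "i \<le> j" "j \<le> K" "M j = b j \<or> j = K \<and> b K \<le> M K"
        "\<forall>l. 1 \<le> l \<and> l \<le> j \<longrightarrow> (\<forall>z\<in>Po l. z < s)"
      using half_optD2[OF H, of i s] by blast
    have "j < o'"
    proof (rule ccontr)
      assume "\<not> j < o'"
      then have "s0 < s" using j(4) o by (meson leI)
      then show False using False by simp
    qed
    then have "M' j = b j" "j \<noteq> K" using M'(1)[of j] j(2,3) o by auto
    moreover have "\<forall>z\<in>Po' l. z < s" if "1 \<le> l" "l \<le> j" for l
      using Po'[of l] that j(2,4) by (meson le_trans subsetD)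
    ultimately show ?thesis using j(1,2) by blast
  qed
qed

text \<open>Taking an item turns a possible contribution into a certain one, so the reachable maxima
  stay, and the new \<open>la\<close> was a remaining slope before and had its witnesses then. Read
  with signs reversed, the lemma treats a removal.\<close>

lemma half_opt_take:
  assumes H: "half_opt BIG K th la Po M b" and o: "1 \<le> o'" "o' \<le> K" "s1 \<in> Po o'"
    and Po': "\<And>l. 1 \<le> l \<Longrightarrow> l \<le> K \<Longrightarrow> Po' l \<subseteq> Po l" and M': "\<And>j. j \<le> K \<Longrightarrow> M' j = M j"
  shows "half_opt BIG K th (la(o' := s1)) Po' M' b"
  unfolding half_opt_def
proof (intro conjI allI impI, goal_cases)
  case (1 i k x)
  then have "1 \<le> i \<and> i < k \<and> k \<le> K \<and> (x \<in> Po k \<or> x = la k) \<and> th i < x"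
    using o Po'[of k] by (auto split: if_splits)
  then obtain j where j: "i \<le> j" "j < k" "M j = b j" "\<forall>l. 1 \<le> l \<and> l \<le> j \<longrightarrow> (\<forall>z\<in>Po l. z < x)"
    using half_optD1[OF H, of i k x] by blast
  moreover have "\<forall>z\<in>Po' l. z < x" if "1 \<le> l" "l \<le> j" for l
  proof -
    have "l \<le> K" using that j(2) 1 by linarith
    then show ?thesis using Po'[of l] that j(4) by blast
  qed
  moreover have "M' j = M j" using M'[of j] j(2) 1 by simp
  ultimately show ?case by metis
next
  case (2 i s)
  then obtain j where j: "i \<le> j" "j \<le> K" "M j = b j \<or> j = K \<and> b K \<le> M K"
      "\<forall>l. 1 \<le> l \<and> l \<le> j \<longrightarrow> (\<forall>z\<in>Po l. z < s)"
    using half_optD2[OF H, of i s] by blast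
  moreover have "\<forall>z\<in>Po' l. z < s" if "1 \<le> l" "l \<le> j" for l
    using Po'[of l] that j(2,4) by (meson le_trans subsetD)
  moreover have "M' j = M j" "M' K = M K" using M'[of j] M'[of K] j(2) by simp_all
  ultimately show ?case by metis
qed

section \<open>Cutting the upper bounds\<close>

definition pre :: "(nat \<Rightarrow> real) \<Rightarrow> nat \<Rightarrow> real" where
  "pre x k = (\<Sum>i=1..k. x i)"

lemma pre_0 [simp]: "pre x 0 = 0"
  by (simp add: pre_def)

lemma pre_Suc: "pre x (Suc k) = pre x k + x (Suc k)"
  by (simp add: pre_def)

lemma pre_upd: "pre (x(i := v)) k = pre x k + (if 1 \<le> i \<and> i \<le> k then v - x i else 0)"
  by (induction k) (auto simp: pre_Suc)

lemma pre_cong: "(\<And>i. 1 \<le> i \<Longrightarrow> i \<le> k \<Longrightarrow> x i = y i) \<Longrightarrow> pre x k = pre y k"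
  unfolding pre_def by (rule sum.cong) auto

lemma pre_diff: "j \<le> k \<Longrightarrow> pre x k - pre x j = (\<Sum>i\<in>{j<..k}. x i)"
  by (induction k rule: dec_induct) (simp_all add: pre_Suc greaterThanAtMost_upt flip: atLeastSucAtMost_greaterThanAtMost)

text \<open>The resource equation has no clause of its own: it is the nested constraint of index
  \<open>m\<close>, for which \<open>a m = b m\<close> is assumed where it matters. This makes the
  set of problems closed under negation.\<close>

definition feas :: "nat \<Rightarrow> nat \<Rightarrow> (nat \<Rightarrow> nat) \<Rightarrow> (nat \<Rightarrow> real) \<Rightarrow> (nat \<Rightarrow> real) \<Rightarrow>
    (nat \<Rightarrow> real) \<Rightarrow> (nat \<Rightarrow> real) \<Rightarrow> (nat \<Rightarrow> real) \<Rightarrow> bool" where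
  "feas n m sg a b c d x \<longleftrightarrow> (\<forall>j\<in>{1..m}. a j \<le> pre x (sg j) \<and> pre x (sg j) \<le> b j) \<and>
     (\<forall>i\<in>{1..n}. c i \<le> x i \<and> x i \<le> d i)"

abbreviation obj :: "nat \<Rightarrow> (nat \<Rightarrow> real \<Rightarrow> real) \<Rightarrow> (nat \<Rightarrow> real) \<Rightarrow> real" where
  "obj n F x \<equiv> (\<Sum>i=1..n. F i (x i))"

text \<open>Coordinates outside \<open>{1..n}\<close> are pinned to 0, so that the set is a closed
  part of a product of compact sets, and Tychonoff's theorem applies in the function space.\<close>

lemma feas_compact:
  assumes sg: "\<forall>j\<in>{1..m}. sg j \<le> n"
  shows "compact {x. feas n m sg a b c d x \<and> (\<forall>i. i \<notin> {1..n} \<longrightarrow> x i = 0)}"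
proof -
  let ?K = "PiE UNIV (\<lambda>i. if i \<in> {1..n} then {c i..d i} else {0::real})"
  have "compactin (product_topology (\<lambda>_. euclidean) UNIV) ?K"
    by (subst compactin_PiE) auto
  then have K: "compact ?K" by (simp add: euclidean_product_topology)
  have cont: "continuous_on UNIV (\<lambda>x. pre x k)" for k
    unfolding pre_def by (intro continuous_on_sum) simp
  have "closed {x. pre x (sg j) \<in> {a j..b j}}" for j
    using continuous_closed_vimage[of "{a j..b j}" "\<lambda>x. pre x (sg j)"] cont
    by (simp add: vimage_def continuous_on_eq_continuous_at)
  then have "closed (\<Inter>j\<in>{1..m}. {x. pre x (sg j) \<in> {a j..b j}})" by blast
  then have "compact (?K \<inter> (\<Inter>j\<in>{1..m}. {x. pre x (sg j) \<in> {a j..b j}}))"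
    using K by (rule compact_Int_closed[rotated])
  also have "?K \<inter> (\<Inter>j\<in>{1..m}. {x. pre x (sg j) \<in> {a j..b j}}) =
      {x. feas n m sg a b c d x \<and> (\<forall>i. i \<notin> {1..n} \<longrightarrow> x i = 0)}"
    unfolding feas_def PiE_UNIV_domain Pi_def by (auto split: if_splits)
  finally show ?thesis .
qed

text \<open>Without strict convexity there may be many minimizers, and most of them may violate the
  new bounds \<open>h\<close>. Two successive minimizations over compact sets, of the objective and
  then of the total excess over \<open>h\<close>, select one on which an exchange argument can
  work.\<close>

lemma minimizer_least_excess:
  assumes sg: "\<forall>j\<in>{1..m}. sg j \<le> n" and F: "\<forall>i\<in>{1..n}. continuous_on {c i..d i} (F i)"
    and x0: "feas n m sg a b c d x0"
  shows "\<exists>x. feas n m sg a b c d x \<and> (\<forall>z. feas n m sg a b c d z \<longrightarrow> obj n F x \<le> obj n F z) \<and>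
    (\<forall>z. feas n m sg a b c d z \<and> obj n F z \<le> obj n F x \<longrightarrow>
       (\<Sum>i=1..n. max 0 (x i - h i)) \<le> (\<Sum>i=1..n. max 0 (z i - h i)))"
proof -
  define K where "K = {x. feas n m sg a b c d x \<and> (\<forall>i. i \<notin> {1..n} \<longrightarrow> x i = 0)}"
  define R where "R z = (\<lambda>i. if i \<in> {1..n} then z i else 0 :: real)" for z
  have preR: "pre (R z) (sg j) = pre z (sg j)" if "j \<in> {1..m}" for z j
    using sg that by (intro pre_cong) (auto simp: R_def intro: order_trans)
  have RK: "R z \<in> K" if "feas n m sg a b c d z" for z
    using that preR unfolding K_def feas_def by (simp add: R_def)
  have objR: "obj n F (R z) = obj n F z" for z
    by (rule sum.cong) (auto simp: R_def)
  have PhiR: "(\<Sum>i=1..n. max 0 (R z i - h i)) = (\<Sum>i=1..n. max 0 (z i - h i))" for z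
    by (rule sum.cong) (auto simp: R_def)
  have cK: "compact K" unfolding K_def by (rule feas_compact[OF sg])
  have contF: "continuous_on K (obj n F)"
  proof (intro continuous_on_sum)
    fix i assume i: "i \<in> {1..n}"
    show "continuous_on K (\<lambda>x. F i (x i))"
    proof (rule continuous_on_compose2[of "{c i..d i}" "F i" _ "\<lambda>x. x i"])
      show "continuous_on {c i..d i} (F i)" using F i by blast
      show "continuous_on K (\<lambda>x. x i)" by (rule continuous_on_subset[OF continuous_on_product_coordinates]) simp
      show "(\<lambda>x. x i) ` K \<subseteq> {c i..d i}" using i unfolding K_def feas_def by auto
    qed
  qed
  have "K \<noteq> {}" using RK x0 by blast
  then obtain x1 where x1: "x1 \<in> K" "\<forall>z\<in>K. obj n F x1 \<le> obj n F z"
    using continuous_attains_inf[OF cK _ contF] by blast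
  \<comment> \<open>The minimizers of the objective form a compact set again, on which the
    continuous excess attains its minimum.\<close>
  define K' where "K' = K \<inter> obj n F -` {..obj n F x1}"
  have "closed K'" unfolding K'_def
    by (rule continuous_closed_preimage[OF contF]) (use cK compact_imp_closed in auto)
  then have cK': "compact K'"
    using compact_Int_closed[OF cK] unfolding K'_def by (metis Int_assoc inf.idem)
  have "continuous_on K' (\<lambda>x. \<Sum>i=1..n. max 0 (x i - h i))"
    by (intro continuous_intros continuous_on_subset[OF continuous_on_product_coordinates]) simp
  moreover have "K' \<noteq> {}" using x1 by (auto simp: K'_def)
  ultimately obtain x where x: "x \<in> K'"
      "\<forall>z\<in>K'. (\<Sum>i=1..n. max 0 (x i - h i)) \<le> (\<Sum>i=1..n. max 0 (z i - h i))"
    using continuous_attains_inf[OF cK'] by blast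
  have le: "obj n F x \<le> obj n F z" if "feas n m sg a b c d z" for z
    using x(1) x1(2) RK[OF that] objR[of z] unfolding K'_def by fastforce
  moreover have "(\<Sum>i=1..n. max 0 (x i - h i)) \<le> (\<Sum>i=1..n. max 0 (z i - h i))"
    if "feas n m sg a b c d z" "obj n F z \<le> obj n F x" for z
  proof -
    have "R z \<in> K'" using RK[OF that(1)] that(2) objR[of z] x(1) unfolding K'_def by auto
    then show ?thesis using x(2) PhiR[of z] by fastforce
  qed
  moreover have "feas n m sg a b c d x" using x(1) by (simp add: K'_def K_def)
  ultimately show ?thesis by blast
qed

section \<open>The exchange argument\<close>

lemma block_exists:
  fixes sg :: "nat \<Rightarrow> nat"
  assumes "sg 0 = 0" "1 \<le> i" "i \<le> sg m"
  shows "\<exists>p. 1 \<le> p \<and> p \<le> m \<and> sg (p - 1) < i \<and> i \<le> sg p"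
proof -
  define p where "p = (LEAST p. i \<le> sg p)"
  have p: "i \<le> sg p" unfolding p_def using assms(3) by (rule LeastI)
  have "p \<noteq> 0" using p assms by (metis not_one_le_zero le_trans)
  moreover have "\<not> i \<le> sg (p - 1)"
    using not_less_Least[of "p - 1" "\<lambda>p. i \<le> sg p"] \<open>p \<noteq> 0\<close> by (simp add: p_def)
  moreover have "p \<le> m" unfolding p_def using assms(3) by (rule Least_le)
  ultimately show ?thesis using p by (intro exI[of _ p]) auto
qed

text \<open>\<open>th\<close> and \<open>la\<close> bound the multipliers of the blocks from above and from below, and \<open>S\<close> is a
  relaxed solution with which they are complementary. If \<open>x\<close> exceeds \<open>h\<close> at \<open>i\<close>, then between the
  nearest prefixes on which \<open>x\<close> or \<open>S\<close> is tight there is a \<open>k\<close> with \<open>x k < y k\<close>, and moving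
  resource from \<open>i\<close> to \<open>k\<close> costs nothing.\<close>

lemma cut_exists:
  fixes F :: "nat \<Rightarrow> real \<Rightarrow> real" and S :: "nat \<Rightarrow> real"
  assumes sg: "sg 0 = 0" "sg m = n" "\<And>i j. i < j \<Longrightarrow> j \<le> m \<Longrightarrow> sg i < sg j" and m: "1 \<le> m" "a m = b m"
    and F: "\<forall>i\<in>{1..n}. continuous_on {c i..d i} (F i)"
    and x0: "feas n m sg a b c d x0"
    and S: "S 0 = 0" "\<And>j. 1 \<le> j \<Longrightarrow> j \<le> m \<Longrightarrow> a j \<le> S j \<and> S j \<le> b j"
    and opt1: "\<And>p q. 1 \<le> p \<Longrightarrow> p < q \<Longrightarrow> q \<le> m \<Longrightarrow> th p < la q \<Longrightarrow> \<exists>j. p \<le> j \<and> j < q \<and> S j = b j"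
    and opt2: "\<And>p q. 1 \<le> q \<Longrightarrow> q < p \<Longrightarrow> p \<le> m \<Longrightarrow> th p < la q \<Longrightarrow> \<exists>j. q \<le> j \<and> j < p \<and> S j = a j"
    and lath: "\<And>j. 1 \<le> j \<Longrightarrow> j \<le> m \<Longrightarrow> la j \<le> th j"
    and y: "\<And>j. 1 \<le> j \<Longrightarrow> j \<le> m \<Longrightarrow> la j < BIG \<Longrightarrow> S j - S (j - 1) \<le> pre y (sg j) - pre y (sg (j - 1))"
    and yh: "\<And>i. 1 \<le> i \<Longrightarrow> i \<le> n \<Longrightarrow> y i \<le> h i \<and> y i \<le> d i \<and> c i \<le> h i \<and> h i \<le> d i"
    and up: "\<And>j i u v. 1 \<le> j \<Longrightarrow> j \<le> m \<Longrightarrow> la j < BIG \<Longrightarrow> sg (j - 1) < i \<Longrightarrow> i \<le> sg j \<Longrightarrow>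
        c i \<le> u \<Longrightarrow> u < v \<Longrightarrow> v \<le> y i \<Longrightarrow> F i v - F i u \<le> la j * (v - u)"
    and dn: "\<And>j i u v. 1 \<le> j \<Longrightarrow> j \<le> m \<Longrightarrow> sg (j - 1) < i \<Longrightarrow> i \<le> sg j \<Longrightarrow>
        h i \<le> u \<Longrightarrow> u < v \<Longrightarrow> v \<le> d i \<Longrightarrow> th j * (v - u) \<le> F i v - F i u"
    and big: "\<And>j i. 1 \<le> j \<Longrightarrow> j \<le> m \<Longrightarrow> sg (j - 1) < i \<Longrightarrow> i \<le> sg j \<Longrightarrow> h i < d i \<Longrightarrow> th j < BIG"
  shows "\<exists>x. feas n m sg a b c h x \<and> (\<forall>z. feas n m sg a b c d z \<longrightarrow> obj n F x \<le> obj n F z)"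
proof -
  have sgn: "\<forall>j\<in>{1..m}. sg j \<le> n" using sg by (metis atLeastAtMost_iff le_eq_less_or_eq)
  obtain x where x: "feas n m sg a b c d x" "\<And>z. feas n m sg a b c d z \<Longrightarrow> obj n F x \<le> obj n F z"
    "\<And>z. feas n m sg a b c d z \<Longrightarrow> obj n F z \<le> obj n F x \<Longrightarrow>
       (\<Sum>i=1..n. max 0 (x i - h i)) \<le> (\<Sum>i=1..n. max 0 (z i - h i))"
    using minimizer_least_excess[OF sgn F x0, of h] by blast
  have xb: "a j \<le> pre x (sg j)" "pre x (sg j) \<le> b j" if "1 \<le> j" "j \<le> m" for j
    using x(1) that by (auto simp: feas_def)
  have xc: "c i \<le> x i" "x i \<le> d i" if "1 \<le> i" "i \<le> n" for i
    using x(1) that by (auto simp: feas_def)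
  have "x i \<le> h i" if i: "1 \<le> i" "i \<le> n" for i
  proof (rule ccontr)
    assume "\<not> x i \<le> h i"
    then have xi: "h i < x i" by simp
    obtain p where p: "1 \<le> p" "p \<le> m" "sg (p - 1) < i" "i \<le> sg p"
      using block_exists[of sg i m] sg i by auto
    have thp: "th p < BIG" using big[OF p] xi xc(2)[OF i] by simp
    \<comment> \<open>On the right either \<open>x\<close> is tight from below or \<open>S\<close>
      from above, and both give \<open>pre x \<le> S\<close>. On the left the roles are swapped and
      give \<open>S \<le> pre x\<close>. So between the two ends \<open>x\<close> has no larger sum
      than \<open>S\<close>. The indices \<open>m\<close> and 0 ensure that such ends exist.\<close>
    define Rs where "Rs = {r \<in> {p..m}. pre x (sg r) = a r \<or> S r = b r}"
    define Ls where "Ls = {l \<in> {0..<p}. l = 0 \<or> pre x (sg l) = b l \<or> S l = a l}"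
    have "pre x (sg m) = a m" using xb[of m] m by simp
    then have Rs: "finite Rs" "Rs \<noteq> {}" using p by (auto simp: Rs_def)
    have "0 \<in> Ls" using p by (simp add: Ls_def)
    then have Ls: "finite Ls" "Ls \<noteq> {}" by (auto simp: Ls_def)
    define r where "r = Min Rs"
    define l where "l = Max Ls"
    have r: "p \<le> r" "r \<le> m" "pre x (sg r) = a r \<or> S r = b r"
      using Min_in[OF Rs] unfolding r_def[symmetric] by (auto simp: Rs_def)
    have rmin: "pre x (sg j) \<noteq> a j" "S j \<noteq> b j" if "p \<le> j" "j < r" for j
      using Min_le[OF Rs(1), of j] that r unfolding r_def[symmetric] by (auto simp: Rs_def)
    have l: "l < p" "l = 0 \<or> pre x (sg l) = b l \<or> S l = a l"
      using Max_in[OF Ls] unfolding l_def[symmetric] by (auto simp: Ls_def)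
    have lmax: "pre x (sg j) \<noteq> b j" "S j \<noteq> a j" if "l < j" "j < p" for j
      using Max_ge[OF Ls(1), of j] that unfolding l_def[symmetric] by (auto simp: Ls_def)
    \<comment> \<open>Otherwise \<open>opt1\<close> or \<open>opt2\<close> would supply a tight
      prefix of \<open>S\<close> strictly inside, against the choice of the nearest ends
      \<open>l\<close> and \<open>r\<close>.\<close>
    have laq: "la q \<le> th p" if q: "l < q" "q \<le> r" for q
    proof (rule ccontr)
      assume *: "\<not> la q \<le> th p"
      consider "q < p" | "q = p" | "p < q" by linarith
      then show False
      proof cases
        case 1
        then obtain j where "q \<le> j" "j < p" "S j = a j" using opt2[of q p] * q p by auto
        then show False using lmax q by auto
      next
        case 2 then show False using * lath p by auto
      next
        case 3
        then obtain j where "p \<le> j" "j < q" "S j = b j" using opt1[of p q] * q p r by auto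
        then show False using rmin q by auto
      qed
    qed
    have "pre x (sg r) \<le> S r" using r S(2)[of r] xb[of r] p by auto
    moreover have "S l \<le> pre x (sg l)"
      using l S(2)[of l] xb[of l] p S(1) sg(1) by (cases "l = 0") auto
    moreover have "S r - S l \<le> pre y (sg r) - pre y (sg l)"
    proof -
      have "S t - S l \<le> pre y (sg t) - pre y (sg l)" if "l \<le> t" "t \<le> r" for t
        using that
      proof (induction t rule: dec_induct)
        case base show ?case by simp
      next
        case (step t)
        have "la (Suc t) < BIG" using laq[of "Suc t"] step thp by simp
        then show ?case using y[of "Suc t"] step r by simp
      qed
      then show ?thesis using l r by auto
    qed
    ultimately have sum: "pre x (sg r) - pre x (sg l) \<le> pre y (sg r) - pre y (sg l)" by linarith
    have lr: "sg l \<le> sg r" using sg(3)[of l r] l r p by (simp add: le_less)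
    have irange: "sg l < i" "i \<le> sg r"
    proof -
      have "l = p - 1 \<or> l < p - 1 \<and> p - 1 \<le> m" using l(1) p(2) by linarith
      then have "sg l \<le> sg (p - 1)" using sg(3)[of l "p - 1"] by auto
      then show "sg l < i" using p by simp
      have "sg p \<le> sg r" using r sg(3)[of p r] by (cases "p = r") simp_all
      then show "i \<le> sg r" using p by simp
    qed
    have "\<exists>k. sg l < k \<and> k \<le> sg r \<and> x k < y k"
    proof (rule ccontr)
      assume "\<not> ?thesis"
      then have "\<And>k. k \<in> {sg l<..sg r} \<Longrightarrow> y k \<le> x k" by auto
      moreover have "y i < x i" using xi yh[OF i] by simp
      ultimately have "(\<Sum>k\<in>{sg l<..sg r}. y k) < (\<Sum>k\<in>{sg l<..sg r}. x k)"
        using irange by (intro sum_strict_mono_ex1) auto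
      then show False using sum lr by (simp add: pre_diff)
    qed
    then obtain k where k: "sg l < k" "k \<le> sg r" "x k < y k" by blast
    have kn: "1 \<le> k" "k \<le> n" using k(1,2) bspec[OF sgn, of r] r(1,2) p(1) by simp_all
    obtain q where q: "1 \<le> q" "q \<le> r" "sg (q - 1) < k" "k \<le> sg q"
      using block_exists[of sg k r] sg(1) kn k by auto
    have lq: "l < q"
    proof (rule ccontr)
      assume "\<not> l < q"
      then have "q = l \<or> q < l \<and> l \<le> m" using l(1) p(2) by linarith
      then have "sg q \<le> sg l" using sg(3)[of q l] by auto
      then show False using q k by simp
    qed
    have qm: "q \<le> m" using q r by simp
    have isg: "i \<le> sg j \<longleftrightarrow> p \<le> j" if "j \<le> m" for j
    proof
      assume "p \<le> j" then show "i \<le> sg j" using p(4) sg(3)[of p j] that by (cases "p = j") auto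
    next
      assume A: "i \<le> sg j" show "p \<le> j"
      proof (rule ccontr)
        assume "\<not> p \<le> j"
        then have "j = p - 1 \<or> j < p - 1 \<and> p - 1 \<le> m" using p(2) by linarith
        then have "sg j \<le> sg (p - 1)" using sg(3)[of j "p - 1"] by auto
        then show False using A p by simp
      qed
    qed
    have ksg: "k \<le> sg j \<longleftrightarrow> q \<le> j" if "j \<le> m" for j
    proof
      assume "q \<le> j" then show "k \<le> sg j" using q(4) sg(3)[of q j] that by (cases "q = j") auto
    next
      assume A: "k \<le> sg j" show "q \<le> j"
      proof (rule ccontr)
        assume "\<not> q \<le> j"
        then have "j = q - 1 \<or> j < q - 1 \<and> q - 1 \<le> m" using qm by linarith
        then have "sg j \<le> sg (q - 1)" using sg(3)[of j "q - 1"] by auto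
        then show False using A q by simp
      qed
    qed
    have ki: "k \<noteq> i" using k(3) xi yh[OF i] by auto
    \<comment> \<open>The quantities that limit the shift: the excess at \<open>i\<close>, the gap
      below \<open>y\<close> at \<open>k\<close>, and the slack of the prefixes that lie between the
      two blocks. At most one of the two index ranges is nonempty, depending on which block comes
      first.\<close>
    define D where "D = {x i - h i, y k - x k} \<union> (\<lambda>j. pre x (sg j) - a j) ` {p..<q} \<union>
      (\<lambda>j. b j - pre x (sg j)) ` {q..<p}"
    have D: "finite D" "D \<noteq> {}" by (auto simp: D_def)
    have "0 < t" if "t \<in> D" for t
    proof -
      have "0 < pre x (sg j) - a j" if "j \<in> {p..<q}" for j
        using that rmin(1)[of j] xb(1)[of j] q r p by force
      moreover have "0 < b j - pre x (sg j)" if "j \<in> {q..<p}" for j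
        using that lmax(1)[of j] xb(2)[of j] q lq p by force
      ultimately show ?thesis using that xi k(3) by (auto simp: D_def)
    qed
    define \<delta> where "\<delta> = Min D"
    have d0: "0 < \<delta>" using Min_in[OF D] \<open>\<And>t. t \<in> D \<Longrightarrow> 0 < t\<close> unfolding \<delta>_def by blast
    have dle: "\<delta> \<le> t" if "t \<in> D" for t using that D by (simp add: \<delta>_def)
    have di: "\<delta> \<le> x i - h i" "\<delta> \<le> y k - x k" by (rule dle; simp add: D_def)+
    have da: "\<delta> \<le> pre x (sg j) - a j" if "p \<le> j" "j < q" for j
      by (rule dle) (use that in \<open>auto simp: D_def\<close>)
    have db: "\<delta> \<le> b j - pre x (sg j)" if "q \<le> j" "j < p" for j
      by (rule dle) (use that in \<open>auto simp: D_def\<close>)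
    define z where "z = x(i := x i - \<delta>, k := x k + \<delta>)"
    have zpre: "pre z (sg j) = pre x (sg j) + (if q \<le> j then \<delta> else 0) - (if p \<le> j then \<delta> else 0)"
      if "j \<le> m" for j
      unfolding z_def using ki i kn isg[OF that] ksg[OF that] by (simp add: pre_upd)
    have zk: "z k = x k + \<delta>" "z i = x i - \<delta>" "\<And>t. t \<noteq> i \<Longrightarrow> t \<noteq> k \<Longrightarrow> z t = x t"
      using ki by (auto simp: z_def)
    have feasz: "feas n m sg a b c d z"
      unfolding feas_def
    proof (intro conjI ballI)
      fix j assume j: "j \<in> {1..m}"
      show "a j \<le> pre z (sg j)"
        using zpre[of j] j xb(1)[of j] da[of j] d0 by (simp split: if_splits)
      show "pre z (sg j) \<le> b j"
        using zpre[of j] j xb(2)[of j] db[of j] d0 by (simp split: if_splits)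
    next
      fix t assume t: "t \<in> {1..n}"
      show "c t \<le> z t"
        using zk xc(1)[of t] t d0 di yh[OF i] by (cases "t = i"; cases "t = k") auto
      show "z t \<le> d t"
        using zk xc(2)[of t] t d0 di yh[OF kn] by (cases "t = i"; cases "t = k") auto
    qed
    have split2: "(\<Sum>t=1..n. g t (z t)) - (\<Sum>t=1..n. g t (x t)) = g i (z i) - g i (x i) + (g k (z k) - g k (x k))"
      for g :: "nat \<Rightarrow> real \<Rightarrow> real"
    proof -
      have "(\<Sum>t=1..n. g t (z t)) - (\<Sum>t=1..n. g t (x t)) = (\<Sum>t=1..n. g t (z t) - g t (x t))"
        by (simp add: sum_subtractf)
      also have "\<dots> = (\<Sum>t\<in>{i, k}. g t (z t) - g t (x t))"
        by (rule sum.mono_neutral_right) (use i kn zk in auto)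
      finally show ?thesis using ki by simp
    qed
    have "F k (x k + \<delta>) - F k (x k) \<le> la q * \<delta>"
      using up[of q k "x k" "x k + \<delta>"] q qm laq[OF lq q(2)] thp xc(1)[OF kn] d0 di by simp
    moreover have "th p * \<delta> \<le> F i (x i) - F i (x i - \<delta>)"
      using dn[of p i "x i - \<delta>" "x i"] p xc(2)[OF i] d0 di by simp
    moreover have "la q * \<delta> \<le> th p * \<delta>" using laq[OF lq q(2)] d0 by (intro mult_right_mono) auto
    ultimately have "obj n F z \<le> obj n F x" using split2[of F] zk by simp
    \<comment> \<open>The contradiction: coordinate \<open>k\<close> stays below
      \<open>y k \<le> h k\<close> and has no excess, while the excess at \<open>i\<close> drops by
      \<open>\<delta>\<close>.\<close>
    then have "(\<Sum>i=1..n. max 0 (x i - h i)) \<le> (\<Sum>i=1..n. max 0 (z i - h i))" using x(3) feasz by blast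
    then show False
      using split2[of "\<lambda>t v. max 0 (v - h t)"] zk xi d0 di yh[OF kn] by simp
  qed
  then have "feas n m sg a b c h x" using x(1) unfolding feas_def by simp
  then show ?thesis using x(2) by blast
qed

section \<open>The state of the greedy algorithm\<close>

text \<open>The items \<open>hp..<tp\<close> remain, with weights \<open>Wt\<close>, and the amount
  \<open>Y\<close> has been taken. The third and fourth lines are inequalities because head and tail
  can be the same item, shortened from both ends. The last two lines are what counts at the end:
  when nothing remains, \<open>Y\<close> lies between the weight below \<open>th\<close> and the
  weight up to \<open>la\<close>.\<close>

definition blk :: "(nat \<Rightarrow> real) \<Rightarrow> (nat \<Rightarrow> real) \<Rightarrow> nat \<Rightarrow> nat \<Rightarrow> nat \<Rightarrow> nat \<Rightarrow> (nat \<Rightarrow> real) \<Rightarrow>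
    real \<Rightarrow> real \<Rightarrow> real \<Rightarrow> bool" where
  "blk P W0 ps pe hp tp Wt th la Y \<longleftrightarrow>
     ps \<le> hp \<and> hp \<le> tp \<and> tp \<le> pe \<and> (\<forall>p. hp \<le> p \<and> p < tp \<longrightarrow> 0 < Wt p \<and> Wt p \<le> W0 p) \<and>
     (hp < tp \<longrightarrow> Y + Wt hp \<le> sum W0 {ps..<hp + 1}) \<and>
     (hp < tp \<longrightarrow> sum W0 {ps..<tp - 1} \<le> Y + sum Wt {hp..<tp - 1}) \<and>
     Y \<le> sum W0 {p \<in> {ps..<pe}. P p \<le> la} \<and>
     sum W0 {p \<in> {ps..<pe}. P p < th} \<le> Y + sum Wt {hp..<tp}"

lemma blk_cong:
  assumes "\<And>p. ps \<le> p \<Longrightarrow> p < pe \<Longrightarrow> Wt' p = Wt p" "blk P W0 ps pe hp tp Wt th la Y"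
  shows "blk P W0 ps pe hp tp Wt' th la Y"
proof -
  have b: "ps \<le> hp" "hp \<le> tp" "tp \<le> pe" using assms(2) by (simp_all add: blk_def)
  have "sum Wt' {hp..<t} = sum Wt {hp..<t}" if "t \<le> tp" for t
    using b that assms(1) by (intro sum.cong) auto
  moreover have "hp < tp \<Longrightarrow> Wt' hp = Wt hp" using b assms(1) by simp
  moreover have "Wt' p = Wt p" if "hp \<le> p" "p < tp" for p using b assms(1) that by simp
  moreover have "sum Wt' {hp..<tp - 1} = sum Wt {hp..<tp - 1}" "sum Wt' {hp..<tp} = sum Wt {hp..<tp}"
    using calculation(1) by simp_all
  ultimately show ?thesis using assms(2) unfolding blk_def by simp
qed

lemma blk_init:
  assumes "ps \<le> pe" "\<And>p. ps \<le> p \<Longrightarrow> p < pe \<Longrightarrow> 0 < W0 p" "\<And>p. ps \<le> p \<Longrightarrow> p < pe \<Longrightarrow> Wt p = W0 p"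
  shows "blk P W0 ps pe ps pe Wt th la 0"
proof -
  have e: "sum Wt {ps..<t} = sum W0 {ps..<t}" if "t \<le> pe" for t
    using assms(3) that by (intro sum.cong) auto
  have "sum W0 {p \<in> {ps..<pe}. P p < th} \<le> sum W0 {ps..<pe}"
    using assms(2) by (intro sum_mono2) (auto intro: less_imp_le)
  moreover have "0 \<le> sum W0 {p \<in> {ps..<pe}. P p \<le> la}"
    using assms(2) by (intro sum_nonneg) (auto intro: less_imp_le)
  moreover have "{ps..<ps + 1} = {ps}" by auto
  moreover have "sum Wt {ps..<pe - 1} = sum W0 {ps..<pe - 1}" "sum Wt {ps..<pe} = sum W0 {ps..<pe}"
    using e by simp_all
  ultimately show ?thesis unfolding blk_def using assms by simp
qed

lemma blk_take:
  assumes B: "blk P W0 ps pe hp tp Wt th la Y" and ne: "hp < tp" and \<delta>: "0 < \<delta>" "\<delta> \<le> Wt hp"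
    and W: "\<And>p. ps \<le> p \<Longrightarrow> p < pe \<Longrightarrow> 0 < W0 p"
    and srt: "\<And>p q. ps \<le> p \<Longrightarrow> p \<le> q \<Longrightarrow> q < pe \<Longrightarrow> P p \<le> P q"
  shows "\<delta> = Wt hp \<Longrightarrow> blk P W0 ps pe (hp + 1) tp Wt th (P hp) (Y + \<delta>)"
    and "\<delta> < Wt hp \<Longrightarrow> blk P W0 ps pe hp tp (Wt(hp := Wt hp - \<delta>)) th (P hp) (Y + \<delta>)"
proof -
  have b: "ps \<le> hp" "hp \<le> tp" "tp \<le> pe" "\<And>p. hp \<le> p \<Longrightarrow> p < tp \<Longrightarrow> 0 < Wt p \<and> Wt p \<le> W0 p"
      "Y + Wt hp \<le> sum W0 {ps..<hp + 1}" "sum W0 {ps..<tp - 1} \<le> Y + sum Wt {hp..<tp - 1}"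
      "sum W0 {p \<in> {ps..<pe}. P p < th} \<le> Y + sum Wt {hp..<tp}"
    using B ne by (simp_all add: blk_def)
  \<comment> \<open>By sortedness no item up to the head is more expensive than the head, so the
    weight taken so far is covered by slopes up to the new \<open>la\<close>.\<close>
  have "sum W0 {ps..<hp + 1} \<le> sum W0 {p \<in> {ps..<pe}. P p \<le> P hp}"
    using b ne srt W by (intro sum_mono2) (auto intro: less_imp_le)
  then have la: "Y + \<delta> \<le> sum W0 {p \<in> {ps..<pe}. P p \<le> P hp}" using b(5) \<delta> by linarith
  have s: "sum Wt {hp..<t} = Wt hp + sum Wt {hp + 1..<t}" if "hp < t" for t
    using that by (simp add: sum.atLeast_Suc_lessThan Suc_eq_plus1)
  {
    assume e: "\<delta> = Wt hp"
    have "Y + \<delta> + Wt (hp + 1) \<le> sum W0 {ps..<hp + 1 + 1}" if "hp + 1 < tp"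
    proof -
      have "hp + 1 + 1 = Suc (hp + 1)" by simp
      then have "sum W0 {ps..<hp + 1 + 1} = sum W0 {ps..<hp + 1} + W0 (hp + 1)"
        using sum.atLeastLessThan_Suc[of ps "hp + 1" W0] b(1) by (metis le_add1 le_trans)
      then show ?thesis using b(5) b(4)[of "hp + 1"] that e by linarith
    qed
    moreover have "sum W0 {ps..<tp - 1} \<le> Y + \<delta> + sum Wt {hp + 1..<tp - 1}" if "hp + 1 < tp"
      using b(6) s[of "tp - 1"] that e by simp
    moreover have "sum W0 {p \<in> {ps..<pe}. P p < th} \<le> Y + \<delta> + sum Wt {hp + 1..<tp}"
      using b(7) s[of tp] ne e by simp
    ultimately show "blk P W0 ps pe (hp + 1) tp Wt th (P hp) (Y + \<delta>)"
      unfolding blk_def using b(1-4) ne la by simp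
  }
  {
    assume l: "\<delta> < Wt hp"
    let ?W = "Wt(hp := Wt hp - \<delta>)"
    have s': "sum ?W {hp..<t} = sum Wt {hp..<t} - \<delta>" if "hp < t" for t
    proof -
      have "sum ?W {hp + 1..<t} = sum Wt {hp + 1..<t}" by (intro sum.cong) auto
      moreover have "sum ?W {hp..<t} = ?W hp + sum ?W {hp + 1..<t}"
        using that by (simp add: sum.atLeast_Suc_lessThan Suc_eq_plus1 del: fun_upd_apply)
      ultimately show ?thesis using s[OF that] by simp
    qed
    have "sum W0 {ps..<tp - 1} \<le> Y + \<delta> + sum ?W {hp..<tp - 1}"
      using b(6) s'[of "tp - 1"] \<delta> by (cases "hp < tp - 1") simp_all
    moreover have "sum W0 {p \<in> {ps..<pe}. P p < th} \<le> Y + \<delta> + sum ?W {hp..<tp}"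
      using b(7) s'[of tp] ne by linarith
    moreover have "Y + \<delta> + ?W hp \<le> sum W0 {ps..<hp + 1}" using b(5) by simp
    moreover have "0 < ?W p \<and> ?W p \<le> W0 p" if "hp \<le> p" "p < tp" for p
      using b(4)[OF that] \<delta> l by (cases "p = hp") auto
    ultimately show "blk P W0 ps pe hp tp ?W th (P hp) (Y + \<delta>)"
      unfolding blk_def using b(1-3) ne la by blast
  }
qed

lemma blk_remove:
  assumes B: "blk P W0 ps pe hp tp Wt th la Y" and ne: "hp < tp" and \<delta>: "0 < \<delta>" "\<delta> \<le> Wt (tp - 1)"
    and W: "\<And>p. ps \<le> p \<Longrightarrow> p < pe \<Longrightarrow> 0 < W0 p"
    and srt: "\<And>p q. ps \<le> p \<Longrightarrow> p \<le> q \<Longrightarrow> q < pe \<Longrightarrow> P p \<le> P q"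
  shows "\<delta> = Wt (tp - 1) \<Longrightarrow> blk P W0 ps pe hp (tp - 1) Wt (P (tp - 1)) la Y"
    and "\<delta> < Wt (tp - 1) \<Longrightarrow> blk P W0 ps pe hp tp (Wt(tp - 1 := Wt (tp - 1) - \<delta>)) (P (tp - 1)) la Y"
proof -
  obtain t where t: "tp = t + 1" "tp - 1 = t" using ne by (cases tp) auto
  have b: "ps \<le> hp" "hp \<le> t" "t < pe" "\<And>p. hp \<le> p \<Longrightarrow> p \<le> t \<Longrightarrow> 0 < Wt p \<and> Wt p \<le> W0 p"
      "Y + Wt hp \<le> sum W0 {ps..<hp + 1}" "sum W0 {ps..<t} \<le> Y + sum Wt {hp..<t}"
      "Y \<le> sum W0 {p \<in> {ps..<pe}. P p \<le> la}"
    using B ne t by (simp_all add: blk_def)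
  \<comment> \<open>Items cheaper than the tail item come before it, and the weight of everything
    before it is covered by what has been taken and what remains there.\<close>
  have "sum W0 {p \<in> {ps..<pe}. P p < P t} \<le> sum W0 {ps..<t}"
  proof (rule sum_mono2)
    show "{p \<in> {ps..<pe}. P p < P t} \<subseteq> {ps..<t}"
    proof
      fix p assume "p \<in> {p \<in> {ps..<pe}. P p < P t}"
      then show "p \<in> {ps..<t}" using srt[of t p] b by (cases "p < t") auto
    qed
  qed (use W b in \<open>auto intro: less_imp_le\<close>)
  then have th: "sum W0 {p \<in> {ps..<pe}. P p < P t} \<le> Y + sum Wt {hp..<t}" using b(6) by linarith
  {
    assume e: "\<delta> = Wt (tp - 1)"
    have "sum W0 {ps..<t - 1} \<le> Y + sum Wt {hp..<t - 1}" if "hp < t"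
    proof -
      obtain r where r: "t = Suc r" "hp \<le> r" using less_imp_Suc_add[OF \<open>hp < t\<close>] le_add1 by blast
      then have "sum W0 {ps..<t} = sum W0 {ps..<r} + W0 r" "sum Wt {hp..<t} = sum Wt {hp..<r} + Wt r"
        using b(1) by simp_all
      then show ?thesis using b(6) b(4)[of r] r by simp
    qed
    then show "blk P W0 ps pe hp (tp - 1) Wt (P (tp - 1)) la Y"
      unfolding blk_def t using b th by simp
  }
  {
    assume l: "\<delta> < Wt (tp - 1)"
    let ?W = "Wt(t := Wt t - \<delta>)"
    have s: "sum ?W {hp..<t} = sum Wt {hp..<t}" by (intro sum.cong) auto
    have "sum ?W {hp..<t + 1} = sum Wt {hp..<t} + (Wt t - \<delta>)"
      using sum.atLeastLessThan_Suc[of hp t ?W] s b(2) by (simp only: Suc_eq_plus1 fun_upd_same)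
    then have "sum W0 {p \<in> {ps..<pe}. P p < P t} \<le> Y + sum ?W {hp..<t + 1}" using th l t by simp
    moreover have "?W hp \<le> Wt hp" using \<delta>(1) by simp
    then have "Y + ?W hp \<le> sum W0 {ps..<hp + 1}" using b(5) by linarith
    moreover have "0 < ?W p \<and> ?W p \<le> W0 p" if "hp \<le> p" "p < t + 1" for p
    proof -
      have "0 < Wt p \<and> Wt p \<le> W0 p" using b(4)[of p] that by simp
      then show ?thesis using \<delta>(1) l t(2) by (cases "p = t") simp_all
    qed
    moreover have "sum W0 {ps..<t} \<le> Y + sum ?W {hp..<t}" using b(6) s by simp
    moreover have "hp \<le> t + 1" "t + 1 \<le> pe" using b by auto
    moreover have "t + 1 - 1 = t" by simp
    ultimately have "blk P W0 ps pe hp (t + 1) ?W (P t) la Y"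
      unfolding blk_def using b(1,7) by metis
    then show "blk P W0 ps pe hp tp (Wt(tp - 1 := Wt (tp - 1) - \<delta>)) (P (tp - 1)) la Y" by (simp add: t)
  }
qed

section \<open>The invariant of the greedy algorithm\<close>

abbreviation pool :: "(nat \<Rightarrow> nat) \<Rightarrow> (nat \<Rightarrow> nat) \<Rightarrow> (nat \<Rightarrow> real) \<Rightarrow> nat \<Rightarrow> real" where
  "pool hp tp Wt j \<equiv> sum Wt {hp j..<tp j}"

text \<open>\<open>X\<close> stands for the prefix sums of a feasible point at the ends of the
  blocks. It exists only in the proof and witnesses that the relaxed problem is solvable:
  \<open>X K\<close> always stays between \<open>base\<close> and \<open>tot\<close>, so whenever a
  bound is violated there is still an item to remove or to take.\<close>

locale greedy_data =
  fixes m :: nat and a b C X :: "nat \<Rightarrow> real" and P W0 :: "nat \<Rightarrow> real" and ps pe :: "nat \<Rightarrow> nat"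
    and BIG :: real
  assumes m1: "1 \<le> m"
    and reg: "\<And>j. 1 \<le> j \<Longrightarrow> j \<le> m \<Longrightarrow> ps j \<le> pe j"
    and disj: "\<And>i j. 1 \<le> i \<Longrightarrow> i < j \<Longrightarrow> j \<le> m \<Longrightarrow> pe i \<le> ps j"
    and srt: "\<And>j p q. 1 \<le> j \<Longrightarrow> j \<le> m \<Longrightarrow> ps j \<le> p \<Longrightarrow> p \<le> q \<Longrightarrow> q < pe j \<Longrightarrow> P p \<le> P q"
    and W0: "\<And>j p. 1 \<le> j \<Longrightarrow> j \<le> m \<Longrightarrow> ps j \<le> p \<Longrightarrow> p < pe j \<Longrightarrow> 0 < W0 p"
    and PB: "\<And>j p. 1 \<le> j \<Longrightarrow> j \<le> m \<Longrightarrow> ps j \<le> p \<Longrightarrow> p < pe j \<Longrightarrow> - BIG \<le> P p \<and> P p \<le> BIG"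
    and B0: "0 < BIG"
    and abm: "a m = b m"
    and X: "X 0 = 0" "\<And>j. 1 \<le> j \<Longrightarrow> j \<le> m \<Longrightarrow> a j \<le> X j \<and> X j \<le> b j"
      "\<And>j. 1 \<le> j \<Longrightarrow> j \<le> m \<Longrightarrow> C j \<le> X j - X (j - 1) \<and> X j - X (j - 1) \<le> C j + sum W0 {ps j..<pe j}"
begin

abbreviation "Lo Y \<equiv> pre (\<lambda>i. C i + Y i)"
abbreviation "Hi Y w \<equiv> pre (\<lambda>i. C i + Y i + w i)"

text \<open>\<open>base\<close> and \<open>tot\<close> store the values of \<open>Lo\<close> and
  \<open>Hi\<close> at \<open>K\<close>, the only prefix that the loops inspect. Constraints of
  earlier prefixes need no second look, since \<open>Lo\<close> only grows and \<open>Hi\<close>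
  only falls while the set of blocks is fixed, and insertion leaves earlier prefixes alone.\<close>

definition ginv :: "nat \<Rightarrow> (nat \<Rightarrow> nat) \<Rightarrow> (nat \<Rightarrow> nat) \<Rightarrow> (nat \<Rightarrow> real) \<Rightarrow> (nat \<Rightarrow> real) \<Rightarrow> (nat \<Rightarrow> real) \<Rightarrow>
    (nat \<Rightarrow> real) \<Rightarrow> real \<Rightarrow> real \<Rightarrow> bool" where
  "ginv K hp tp Wt th la Y base tot \<longleftrightarrow>
     K \<le> m \<and>
     (\<forall>j. 1 \<le> j \<and> j \<le> K \<longrightarrow> blk P W0 (ps j) (pe j) (hp j) (tp j) Wt (th j) (la j) (Y j)) \<and>
     (\<forall>j p. K < j \<and> j \<le> m \<and> ps j \<le> p \<and> p < pe j \<longrightarrow> Wt p = W0 p) \<and>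
     half_opt BIG K th la (\<lambda>j. P ` {hp j..<tp j}) (Hi Y (pool hp tp Wt)) b \<and>
     half_opt BIG K (\<lambda>j. - la j) (\<lambda>j. - th j) (\<lambda>j. uminus ` P ` {hp j..<tp j}) (\<lambda>j. - Lo Y j) (\<lambda>j. - a j) \<and>
     pool_le K la th (\<lambda>j. P ` {hp j..<tp j}) \<and>
     (\<forall>j. 1 \<le> j \<and> j \<le> K \<longrightarrow> - BIG \<le> la j \<and> la j \<le> th j \<and> th j \<le> BIG) \<and>
     base = Lo Y K \<and> tot = Hi Y (pool hp tp Wt) K \<and> base \<le> X K \<and> X K \<le> tot \<and>
     (\<forall>j. 1 \<le> j \<and> j < K \<longrightarrow> a j \<le> Lo Y j \<and> Hi Y (pool hp tp Wt) j \<le> b j)"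

lemma ginv_0:
  assumes "\<And>j p. 1 \<le> j \<Longrightarrow> j \<le> m \<Longrightarrow> ps j \<le> p \<Longrightarrow> p < pe j \<Longrightarrow> Wt p = W0 p"
  shows "ginv 0 hp tp Wt th la Y 0 0"
proof -
  have "Wt p = W0 p" if "0 < j" "j \<le> m" "ps j \<le> p" "p < pe j" for j p
    using assms[of j p] that by simp
  then have "\<forall>j p. 0 < j \<and> j \<le> m \<and> ps j \<le> p \<and> p < pe j \<longrightarrow> Wt p = W0 p" by blast
  then show ?thesis unfolding ginv_def half_opt_def pool_le_def using X(1) by simp
qed

lemma ginvD:
  assumes "ginv K hp tp Wt th la Y base tot"
  shows "K \<le> m" "\<And>j. 1 \<le> j \<Longrightarrow> j \<le> K \<Longrightarrow> blk P W0 (ps j) (pe j) (hp j) (tp j) Wt (th j) (la j) (Y j)"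
    "\<And>j p. K < j \<Longrightarrow> j \<le> m \<Longrightarrow> ps j \<le> p \<Longrightarrow> p < pe j \<Longrightarrow> Wt p = W0 p"
    "half_opt BIG K th la (\<lambda>j. P ` {hp j..<tp j}) (Hi Y (pool hp tp Wt)) b"
    "half_opt BIG K (\<lambda>j. - la j) (\<lambda>j. - th j) (\<lambda>j. uminus ` P ` {hp j..<tp j}) (\<lambda>j. - Lo Y j) (\<lambda>j. - a j)"
    "pool_le K la th (\<lambda>j. P ` {hp j..<tp j})"
    "\<And>j. 1 \<le> j \<Longrightarrow> j \<le> K \<Longrightarrow> - BIG \<le> la j \<and> la j \<le> th j \<and> th j \<le> BIG"
    "base = Lo Y K" "tot = Hi Y (pool hp tp Wt) K" "base \<le> X K" "X K \<le> tot"
    "\<And>j. 1 \<le> j \<Longrightarrow> j < K \<Longrightarrow> a j \<le> Lo Y j \<and> Hi Y (pool hp tp Wt) j \<le> b j"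
  using assms unfolding ginv_def by blast+

lemma ginv_range:
  assumes "ginv K hp tp Wt th la Y base tot" "1 \<le> j" "j \<le> K"
  shows "ps j \<le> hp j" "hp j \<le> tp j" "tp j \<le> pe j" "\<And>p. hp j \<le> p \<Longrightarrow> p < tp j \<Longrightarrow> 0 < Wt p"
    "\<And>p. hp j \<le> p \<Longrightarrow> p < tp j \<Longrightarrow> - BIG \<le> P p \<and> P p \<le> BIG"
    "\<And>p q. hp j \<le> p \<Longrightarrow> p \<le> q \<Longrightarrow> q < tp j \<Longrightarrow> P p \<le> P q"
proof -
  have B: "blk P W0 (ps j) (pe j) (hp j) (tp j) Wt (th j) (la j) (Y j)" and j: "j \<le> m"
    using ginvD[OF assms(1)] assms by auto
  then show r: "ps j \<le> hp j" "hp j \<le> tp j" "tp j \<le> pe j" "\<And>p. hp j \<le> p \<Longrightarrow> p < tp j \<Longrightarrow> 0 < Wt p"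
    by (simp_all add: blk_def)
  show "- BIG \<le> P p \<and> P p \<le> BIG" if "hp j \<le> p" "p < tp j" for p
    using PB[of j p] assms(2) j r(1-3) that by simp
  show "P p \<le> P q" if "hp j \<le> p" "p \<le> q" "q < tp j" for p q
    using srt[of j p q] assms(2) j r(1-3) that by simp
qed

lemma ginv_nonempty:
  assumes G: "ginv K hp tp Wt th la Y base tot" and lt: "base < tot"
  shows "\<exists>j. 1 \<le> j \<and> j \<le> K \<and> hp j < tp j"
proof (rule ccontr)
  assume A: "\<not> ?thesis"
  have "Hi Y (pool hp tp Wt) K = Lo Y K"
  proof (rule pre_cong)
    fix i assume i: "1 \<le> i" "i \<le> K"
    then have "\<not> hp i < tp i" using A by blast
    then show "C i + Y i + pool hp tp Wt i = C i + Y i" by simp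
  qed
  then show False using ginvD(8,9)[OF G] lt by simp
qed

lemma ginv_insert:
  assumes G: "ginv K hp tp Wt th la Y base tot" and K: "K < m" and fin: "1 \<le> K \<Longrightarrow> a K \<le> base \<and> tot \<le> b K"
  shows "ginv (K + 1) (hp(K + 1 := ps (K + 1))) (tp(K + 1 := pe (K + 1))) Wt (th(K + 1 := BIG))
    (la(K + 1 := - BIG)) (Y(K + 1 := 0)) (base + C (K + 1)) (tot + C (K + 1) + sum W0 {ps (K + 1)..<pe (K + 1)})"
proof -
  note d = ginvD[OF G]
  let ?k = "K + 1"
  let ?hp = "hp(?k := ps ?k)" and ?tp = "tp(?k := pe ?k)" and ?th = "th(?k := BIG)" and ?la = "la(?k := - BIG)"
    and ?Y = "Y(?k := 0)"
  let ?A = "P ` {ps ?k..<pe ?k}"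
  have k: "1 \<le> ?k" "?k \<le> m" using K by auto
  have Wk: "sum Wt {ps ?k..<pe ?k} = sum W0 {ps ?k..<pe ?k}"
    using d(3)[of ?k] k by (intro sum.cong refl) simp
  have LoE: "Lo ?Y j = Lo Y j" if "j \<le> K" for j using that by (intro pre_cong) auto
  have HiE: "Hi ?Y (pool ?hp ?tp Wt) j = Hi Y (pool hp tp Wt) j" if "j \<le> K" for j
    using that by (intro pre_cong) auto
  have PoE: "(\<lambda>j. P ` {?hp j..<?tp j}) = (\<lambda>j. P ` {hp j..<tp j})(?k := ?A)"
  proof (rule ext)
    show "P ` {?hp j..<?tp j} = ((\<lambda>j. P ` {hp j..<tp j})(?k := ?A)) j" for j by (cases "j = ?k") simp_all
  qed
  have A: "- BIG \<le> z \<and> z \<le> BIG" if "z \<in> ?A" for z using PB[OF k] that by auto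
  have M: "Hi Y (pool hp tp Wt) K \<le> b K" "a K \<le> Lo Y K" if "1 \<le> K" using fin[OF that] d(8,9) by auto
  have h1: "half_opt BIG ?k ?th ?la (\<lambda>j. P ` {?hp j..<?tp j}) (Hi ?Y (pool ?hp ?tp Wt)) b"
  proof (cases "K = 0")
    case True
    then show ?thesis unfolding half_opt_def by simp
  next
    case False
    show ?thesis unfolding PoE
      by (rule half_opt_insert[OF d(4)]) (use M d(7) HiE A False in fastforce)+
  qed
  have e: "(\<lambda>j. - ?la j) = (\<lambda>j. - la j)(?k := BIG)" "(\<lambda>j. - ?th j) = (\<lambda>j. - th j)(?k := - BIG)"
    "(\<lambda>j. uminus ` P ` {?hp j..<?tp j}) = (\<lambda>j. uminus ` P ` {hp j..<tp j})(?k := uminus ` ?A)"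
  proof (rule_tac [!] ext)
    fix j
    show "- ?la j = ((\<lambda>j. - la j)(?k := BIG)) j" "- ?th j = ((\<lambda>j. - th j)(?k := - BIG)) j"
      "uminus ` P ` {?hp j..<?tp j} = ((\<lambda>j. uminus ` P ` {hp j..<tp j})(?k := uminus ` ?A)) j"
      by (cases "j = ?k"; simp)+
  qed
  have h2: "half_opt BIG ?k (\<lambda>j. - ?la j) (\<lambda>j. - ?th j) (\<lambda>j. uminus ` P ` {?hp j..<?tp j})
      (\<lambda>j. - Lo ?Y j) (\<lambda>j. - a j)"
  proof (cases "K = 0")
    case True
    then show ?thesis unfolding half_opt_def by simp
  next
    case False
    have "z \<le> BIG" if "z \<in> uminus ` ?A" for z using A that by fastforce
    moreover have "- BIG \<le> - la i" if "1 \<le> i" "i \<le> K" for i using d(7)[OF that] by linarith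
    moreover have "- Lo Y K \<le> - a K" using M(2) False by simp
    ultimately show ?thesis unfolding e
      by (intro half_opt_insert[OF d(5)]) (use LoE in simp_all)
  qed
  have pl: "pool_le ?k ?la ?th (\<lambda>j. P ` {?hp j..<?tp j})"
    unfolding pool_le_def
  proof (intro allI impI ballI)
    fix i k z assume ik: "1 \<le> i \<and> i \<le> k \<and> k \<le> ?k" and z: "z \<in> P ` {?hp i..<?tp i}"
    show "?la k \<le> z \<and> z \<le> ?th k"
    proof (cases "k = ?k")
      case True
      have "- BIG \<le> z \<and> z \<le> BIG"
        using A z ginv_range(5)[OF G, of i] ik by (cases "i = ?k") auto
      then show ?thesis using True by simp
    next
      case False
      then show ?thesis using d(6) ik z unfolding pool_le_def by auto
    qed
  qed
  have bl: "blk P W0 (ps j) (pe j) (?hp j) (?tp j) Wt (?th j) (?la j) (?Y j)" if "1 \<le> j" "j \<le> ?k" for j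
  proof (cases "j = ?k")
    case True
    have "blk P W0 (ps ?k) (pe ?k) (ps ?k) (pe ?k) Wt BIG (- BIG) 0"
      by (rule blk_init[OF reg[OF k] W0[OF k] d(3)]) (use k in simp_all)
    then show ?thesis using True by simp
  next
    case False
    then show ?thesis using d(2) that by simp
  qed
  have Lk: "Lo ?Y ?k = base + C ?k"
    using pre_Suc[of "\<lambda>i. C i + ?Y i" K, unfolded Suc_eq_plus1] LoE[of K] d(8) by simp
  have Hk: "Hi ?Y (pool ?hp ?tp Wt) ?k = tot + C ?k + sum W0 {ps ?k..<pe ?k}"
    using pre_Suc[of "\<lambda>i. C i + ?Y i + pool ?hp ?tp Wt i" K, unfolded Suc_eq_plus1] HiE[of K] d(9) Wk by simp
  have Xk: "base + C ?k \<le> X ?k" "X ?k \<le> tot + C ?k + sum W0 {ps ?k..<pe ?k}"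
    using X(3)[OF k] d(10,11) by auto
  have ab: "a j \<le> Lo ?Y j \<and> Hi ?Y (pool ?hp ?tp Wt) j \<le> b j" if "1 \<le> j" "j < ?k" for j
  proof (cases "j = K")
    case True then show ?thesis using M that LoE[of K] HiE[of K] by simp
  next
    case False
    then have "j < K" using that by simp
    then show ?thesis using d(12)[of j] that LoE[of j] HiE[of j] by simp
  qed
  have bnd: "- BIG \<le> ?la j \<and> ?la j \<le> ?th j \<and> ?th j \<le> BIG" if "1 \<le> j" "j \<le> ?k" for j
    using d(7)[of j] that B0 by (cases "j = ?k") auto
  have Wr: "Wt p = W0 p" if "?k < j" "j \<le> m" "ps j \<le> p" "p < pe j" for j p using d(3)[of j p] that by simp
  show ?thesis
    unfolding ginv_def
    by (intro conjI allI impI; (elim conjE)?) (use k bl h1 h2 pl Lk Hk Xk ab bnd Wr in \<open>simp_all del: fun_upd_apply\<close>)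
qed

lemma ginv_remove:
  assumes G: "ginv K hp tp Wt th la Y base tot" and o: "1 \<le> o'" "o' \<le> K" "hp o' < tp o'"
    and mx: "\<And>l. 1 \<le> l \<Longrightarrow> l \<le> K \<Longrightarrow> hp l < tp l \<Longrightarrow> P (tp l - 1) \<le> P (tp o' - 1)"
    and \<delta>: "0 < \<delta>" "b K \<le> tot - \<delta>"
  shows "\<delta> = Wt (tp o' - 1) \<Longrightarrow>
      ginv K hp (tp(o' := tp o' - 1)) Wt (th(o' := P (tp o' - 1))) la Y base (tot - \<delta>)"
    and "\<delta> < Wt (tp o' - 1) \<Longrightarrow>
      ginv K hp tp (Wt(tp o' - 1 := Wt (tp o' - 1) - \<delta>)) (th(o' := P (tp o' - 1))) la Y base (tot - \<delta>)"
proof -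
  note d = ginvD[OF G]
  note r = ginv_range[OF G]
  let ?s = "P (tp o' - 1)"
  have om: "o' \<le> m" using o d(1) by simp
  have K1: "1 \<le> K" using o by simp
  \<comment> \<open>Using up the tail item changes \<open>tp\<close>, shortening it changes
    \<open>Wt\<close>. All that the invariant needs from either is that the block loses the weight
    \<open>\<delta>\<close> and that \<open>blk\<close> holds with the new
    \<open>th\<close>.\<close>
  have main: "ginv K hp tp' Wt' (th(o' := ?s)) la Y base (tot - \<delta>)"
    if bl: "blk P W0 (ps o') (pe o') (hp o') (tp' o') Wt' ?s (la o') (Y o')"
      and tp': "\<And>j. j \<noteq> o' \<Longrightarrow> tp' j = tp j" "tp' o' \<le> tp o'"
      and Wt': "\<And>p. \<not> (ps o' \<le> p \<and> p < pe o') \<Longrightarrow> Wt' p = Wt p"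
      and pw: "sum Wt' {hp o'..<tp' o'} = sum Wt {hp o'..<tp o'} - \<delta>" for tp' Wt'
  proof -
    have Wd: "Wt' p = Wt p" if "1 \<le> j" "j \<le> m" "j \<noteq> o'" "ps j \<le> p" "p < pe j" for j p
    proof (rule Wt')
      show "\<not> (ps o' \<le> p \<and> p < pe o')"
        using disj[of j o'] disj[of o' j] that o om by (cases "j < o'") auto
    qed
    have pw': "pool hp tp' Wt' j = pool hp tp Wt j" if "1 \<le> j" "j \<le> K" "j \<noteq> o'" for j
      using Wd[of j] r(1-3)[of j] that d(1) tp'(1)[of j] by (intro sum.cong) auto
    have Hi': "Hi Y (pool hp tp' Wt') j = Hi Y (pool hp tp Wt) j - (if o' \<le> j then \<delta> else 0)" if "j \<le> K" for j
    proof -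
      have "Hi Y (pool hp tp' Wt') j =
          pre ((\<lambda>i. C i + Y i + pool hp tp Wt i)(o' := C o' + Y o' + pool hp tp Wt o' - \<delta>)) j"
        using that pw pw' by (intro pre_cong) auto
      then show ?thesis using o by (simp add: pre_upd)
    qed
    have sub: "P ` {hp l..<tp' l} \<subseteq> P ` {hp l..<tp l}" for l
      using tp' by (cases "l = o'") (auto intro!: image_mono)
    have mx': "z \<le> ?s" if "1 \<le> l" "l \<le> K" "z \<in> P ` {hp l..<tp l}" for l z
    proof -
      obtain p where p: "z = P p" "hp l \<le> p" "p < tp l" using \<open>z \<in> P ` {hp l..<tp l}\<close> by auto
      have "P p \<le> P (tp l - 1)" using r(6)[of l p "tp l - 1"] p that by simp
      then show ?thesis using mx[of l] that p by simp
    qed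
    have so: "?s \<in> P ` {hp o'..<tp o'}" using o by simp
    have h1: "half_opt BIG K (th(o' := ?s)) la (\<lambda>j. P ` {hp j..<tp' j}) (Hi Y (pool hp tp' Wt')) b"
      by (rule half_opt_remove[OF d(4) d(6) o(1,2) so])
         (use mx' Hi' sub \<delta> d(9) o in \<open>simp_all\<close>)
    have e: "(\<lambda>j. - (th(o' := ?s)) j) = (\<lambda>j. - th j)(o' := - ?s)" by auto
    \<comment> \<open>Seen with reversed signs, removing a largest slope is taking a smallest one,
      and the lower sums do not move.\<close>
    have h2: "half_opt BIG K (\<lambda>j. - la j) (\<lambda>j. - (th(o' := ?s)) j) (\<lambda>j. uminus ` P ` {hp j..<tp' j})
        (\<lambda>j. - Lo Y j) (\<lambda>j. - a j)"
      unfolding e by (rule half_opt_take[OF d(5) o(1,2) imageI[OF so] image_mono[OF sub] refl])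
    have pl0: "la k \<le> z \<and> z \<le> th k" if "1 \<le> i" "i \<le> k" "k \<le> K" "z \<in> P ` {hp i..<tp i}" for i k z
      using d(6) that unfolding pool_le_def by blast
    have pl: "pool_le K la (th(o' := ?s)) (\<lambda>j. P ` {hp j..<tp' j})"
      unfolding pool_le_def
    proof (intro allI impI ballI)
      fix i k z assume ik: "1 \<le> i \<and> i \<le> k \<and> k \<le> K" and z: "z \<in> P ` {hp i..<tp' i}"
      have z': "z \<in> P ` {hp i..<tp i}" using sub z by blast
      have "i \<le> K" using ik by simp
      then show "la k \<le> z \<and> z \<le> (th(o' := ?s)) k" using pl0[of i k z] mx'[of i z] ik z' by simp
    qed
    have bnd: "- BIG \<le> la j \<and> la j \<le> (th(o' := ?s)) j \<and> (th(o' := ?s)) j \<le> BIG" if "1 \<le> j" "j \<le> K" for j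
    proof (cases "j = o'")
      case True
      have "la o' \<le> ?s" using pl0[OF o(1) order_refl o(2) so] by blast
      moreover have "- BIG \<le> ?s \<and> ?s \<le> BIG" using r(5)[OF o(1,2), of "tp o' - 1"] o(3) by simp
      ultimately show ?thesis using True d(7)[OF that] by simp
    next
      case False then show ?thesis using d(7)[OF that] by simp
    qed
    have bl': "blk P W0 (ps j) (pe j) (hp j) (tp' j) Wt' ((th(o' := ?s)) j) (la j) (Y j)" if "1 \<le> j" "j \<le> K" for j
    proof (cases "j = o'")
      case True then show ?thesis using bl by simp
    next
      case False
      have "blk P W0 (ps j) (pe j) (hp j) (tp j) Wt' (th j) (la j) (Y j)"
        by (rule blk_cong[OF _ d(2)[OF that]]) (use Wd[of j] that d(1) False in simp)
      then show ?thesis using False tp'(1) by simp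
    qed
    have Wr: "Wt' p = W0 p" if "K < j" "j \<le> m" "ps j \<le> p" "p < pe j" for j p
      using Wd[of j p] d(3)[of j p] that o by simp
    have ab: "a j \<le> Lo Y j \<and> Hi Y (pool hp tp' Wt') j \<le> b j" if "1 \<le> j" "j < K" for j
      using d(12)[OF that] Hi'[of j] that \<delta>(1) by simp
    have "tot - \<delta> = Hi Y (pool hp tp' Wt') K" using Hi'[of K] o d(9) by simp
    moreover have "X K \<le> tot - \<delta>" using X(2)[OF K1 d(1)] \<delta>(2) by linarith
    ultimately show ?thesis
      unfolding ginv_def using d(1,8,10) bl' h1 h2 pl Wr ab bnd by blast
  qed
  note B = d(2)[OF o(1,2)]
  have s: "sum Wt {hp o'..<tp o'} = sum Wt {hp o'..<tp o' - 1} + Wt (tp o' - 1)"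
  proof -
    obtain t where "tp o' = Suc t" "hp o' \<le> t" using o(3) by (cases "tp o'") auto
    then show ?thesis by simp
  qed
  note Wo = W0[OF o(1) om] and So = srt[OF o(1) om]
  {
    assume e: "\<delta> = Wt (tp o' - 1)"
    show "ginv K hp (tp(o' := tp o' - 1)) Wt (th(o' := ?s)) la Y base (tot - \<delta>)"
      by (rule main) (use blk_remove(1)[OF B o(3) \<delta>(1) _ Wo So] e s in simp_all)
  }
  {
    assume l: "\<delta> < Wt (tp o' - 1)"
    have "sum (Wt(tp o' - 1 := Wt (tp o' - 1) - \<delta>)) {hp o'..<tp o' - 1} = sum Wt {hp o'..<tp o' - 1}"
      by (intro sum.cong) auto
    moreover have "sum (Wt(tp o' - 1 := v)) {hp o'..<tp o'} = sum (Wt(tp o' - 1 := v)) {hp o'..<tp o' - 1} + v" for v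
    proof -
      obtain t where "tp o' = Suc t" "hp o' \<le> t" using o(3) by (cases "tp o'") auto
      then show ?thesis by simp
    qed
    moreover have "ps o' \<le> tp o' - 1 \<and> tp o' - 1 < pe o'" using r(1-3)[OF o(1,2)] o(3) by auto
    ultimately show "ginv K hp tp (Wt(tp o' - 1 := Wt (tp o' - 1) - \<delta>)) (th(o' := ?s)) la Y base (tot - \<delta>)"
      by (intro main) (use blk_remove(2)[OF B o(3) \<delta>(1) _ Wo So] l s in auto)
  }
qed

end

context greedy_data
begin

lemma ginv_take:
  assumes G: "ginv K hp tp Wt th la Y base tot" and o: "1 \<le> o'" "o' \<le> K" "hp o' < tp o'"
    and mn: "\<And>l. 1 \<le> l \<Longrightarrow> l \<le> K \<Longrightarrow> hp l < tp l \<Longrightarrow> P (hp o') \<le> P (hp l)"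
    and \<delta>: "0 < \<delta>" "base + \<delta> \<le> a K"
  shows "\<delta> = Wt (hp o') \<Longrightarrow>
      ginv K (hp(o' := hp o' + 1)) tp Wt th (la(o' := P (hp o'))) (Y(o' := Y o' + \<delta>)) (base + \<delta>) tot"
    and "\<delta> < Wt (hp o') \<Longrightarrow>
      ginv K hp tp (Wt(hp o' := Wt (hp o') - \<delta>)) th (la(o' := P (hp o'))) (Y(o' := Y o' + \<delta>)) (base + \<delta>) tot"
proof -
  note d = ginvD[OF G]
  note r = ginv_range[OF G]
  let ?s = "P (hp o')" and ?Y = "Y(o' := Y o' + \<delta>)"
  have om: "o' \<le> m" using o d(1) by simp
  have K1: "1 \<le> K" using o by simp
  have main: "ginv K hp' tp Wt' th (la(o' := ?s)) ?Y (base + \<delta>) tot"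
    if bl: "blk P W0 (ps o') (pe o') (hp' o') (tp o') Wt' (th o') ?s (Y o' + \<delta>)"
      and hp': "\<And>j. j \<noteq> o' \<Longrightarrow> hp' j = hp j" "hp o' \<le> hp' o'"
      and Wt': "\<And>p. \<not> (ps o' \<le> p \<and> p < pe o') \<Longrightarrow> Wt' p = Wt p"
      and pw: "sum Wt' {hp' o'..<tp o'} = sum Wt {hp o'..<tp o'} - \<delta>" for hp' Wt'
  proof -
    have Wd: "Wt' p = Wt p" if "1 \<le> j" "j \<le> m" "j \<noteq> o'" "ps j \<le> p" "p < pe j" for j p
    proof (rule Wt')
      show "\<not> (ps o' \<le> p \<and> p < pe o')"
        using disj[of j o'] disj[of o' j] that o om by (cases "j < o'") auto
    qed
    have pw': "pool hp' tp Wt' j = pool hp tp Wt j" if "1 \<le> j" "j \<le> K" "j \<noteq> o'" for j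
      using Wd[of j] r(1-3)[of j] that d(1) hp'(1)[of j] by (intro sum.cong) auto
    have Hi': "Hi ?Y (pool hp' tp Wt') j = Hi Y (pool hp tp Wt) j" if "j \<le> K" for j
      using that pw pw' by (intro pre_cong) auto
    have Lo': "Lo ?Y j = Lo Y j + (if o' \<le> j then \<delta> else 0)" for j
    proof -
      have "Lo ?Y j = pre ((\<lambda>i. C i + Y i)(o' := C o' + Y o' + \<delta>)) j"
        by (intro pre_cong) auto
      then show ?thesis using o by (simp add: pre_upd)
    qed
    have sub: "P ` {hp' l..<tp l} \<subseteq> P ` {hp l..<tp l}" for l
      using hp' by (cases "l = o'") (auto intro!: image_mono)
    have mn': "?s \<le> z" if "1 \<le> l" "l \<le> K" "z \<in> P ` {hp l..<tp l}" for l z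
    proof -
      obtain p where p: "z = P p" "hp l \<le> p" "p < tp l" using \<open>z \<in> P ` {hp l..<tp l}\<close> by auto
      have "P (hp l) \<le> P p" using r(6)[of l "hp l" p] p that by simp
      then show ?thesis using mn[of l] that p by simp
    qed
    have so: "?s \<in> P ` {hp o'..<tp o'}" using o by simp
    have h1: "half_opt BIG K th (la(o' := ?s)) (\<lambda>j. P ` {hp' j..<tp j}) (Hi ?Y (pool hp' tp Wt')) b"
      by (rule half_opt_take[OF d(4) o(1,2) so sub Hi'])
    have e: "(\<lambda>j. - (la(o' := ?s)) j) = (\<lambda>j. - la j)(o' := - ?s)" by auto
    have pl0: "la k \<le> z \<and> z \<le> th k" if "1 \<le> i" "i \<le> k" "k \<le> K" "z \<in> P ` {hp i..<tp i}" for i k z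
      using d(6) that unfolding pool_le_def by blast
    have pln: "pool_le K (\<lambda>j. - th j) (\<lambda>j. - la j) (\<lambda>j. uminus ` P ` {hp j..<tp j})"
      unfolding pool_le_def
    proof (intro allI impI ballI)
      fix i k z assume ik: "1 \<le> i \<and> i \<le> k \<and> k \<le> K" and z: "z \<in> uminus ` P ` {hp i..<tp i}"
      then obtain y where y: "z = - y" "y \<in> P ` {hp i..<tp i}" by blast
      show "- th k \<le> z \<and> z \<le> - la k" using pl0[of i k y] y ik by simp
    qed
    have mxn: "z \<le> - ?s" if "1 \<le> l" "l \<le> K" "z \<in> uminus ` P ` {hp l..<tp l}" for l z
    proof -
      obtain y where y: "z = - y" "y \<in> P ` {hp l..<tp l}" using \<open>z \<in> uminus ` P ` {hp l..<tp l}\<close> by blast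
      then show ?thesis using mn'[of l y] that by simp
    qed
    \<comment> \<open>Seen with reversed signs, taking a smallest slope is removing a largest one;
      this is why \<open>pool_le\<close> was restated for negated slopes.\<close>
    have h2: "half_opt BIG K (\<lambda>j. - (la(o' := ?s)) j) (\<lambda>j. - th j) (\<lambda>j. uminus ` P ` {hp' j..<tp j})
        (\<lambda>j. - Lo ?Y j) (\<lambda>j. - a j)"
      unfolding e
    proof (rule half_opt_remove[OF d(5) pln o(1,2) imageI[OF so] mxn])
      show "- Lo ?Y j = - Lo Y j" if "j < o'" for j using Lo'[of j] that by simp
      show "- a K \<le> - Lo ?Y K" using Lo'[of K] o \<delta>(2) d(8) by simp
      show "uminus ` P ` {hp' l..<tp l} \<subseteq> uminus ` P ` {hp l..<tp l}" for l by (rule image_mono[OF sub])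
    qed
    have pl: "pool_le K (la(o' := ?s)) th (\<lambda>j. P ` {hp' j..<tp j})"
      unfolding pool_le_def
    proof (intro allI impI ballI)
      fix i k z assume ik: "1 \<le> i \<and> i \<le> k \<and> k \<le> K" and z: "z \<in> P ` {hp' i..<tp i}"
      have z': "z \<in> P ` {hp i..<tp i}" using sub z by blast
      have "i \<le> K" using ik by simp
      then show "(la(o' := ?s)) k \<le> z \<and> z \<le> th k" using pl0[of i k z] mn'[of i z] ik z' by simp
    qed
    have bnd: "- BIG \<le> (la(o' := ?s)) j \<and> (la(o' := ?s)) j \<le> th j \<and> th j \<le> BIG" if "1 \<le> j" "j \<le> K" for j
    proof (cases "j = o'")
      case True
      have "?s \<le> th o'" using pl0[OF o(1) order_refl o(2) so] by blast
      moreover have "- BIG \<le> ?s \<and> ?s \<le> BIG" using r(5)[OF o(1,2), of "hp o'"] o(3) by simp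
      ultimately show ?thesis using True d(7)[OF that] by simp
    next
      case False then show ?thesis using d(7)[OF that] by simp
    qed
    have bl': "blk P W0 (ps j) (pe j) (hp' j) (tp j) Wt' (th j) ((la(o' := ?s)) j) (?Y j)" if "1 \<le> j" "j \<le> K" for j
    proof (cases "j = o'")
      case True then show ?thesis using bl by simp
    next
      case False
      have "blk P W0 (ps j) (pe j) (hp j) (tp j) Wt' (th j) (la j) (Y j)"
        by (rule blk_cong[OF _ d(2)[OF that]]) (use Wd[of j] that d(1) False in simp)
      then show ?thesis using False hp'(1) by simp
    qed
    have Wr: "Wt' p = W0 p" if "K < j" "j \<le> m" "ps j \<le> p" "p < pe j" for j p
      using Wd[of j p] d(3)[of j p] that o by simp
    have ab: "a j \<le> Lo ?Y j \<and> Hi ?Y (pool hp' tp Wt') j \<le> b j" if "1 \<le> j" "j < K" for j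
      using d(12)[OF that] Hi'[of j] Lo'[of j] that \<delta>(1) by simp
    have "tot = Hi ?Y (pool hp' tp Wt') K" using Hi'[of K] d(9) by simp
    moreover have "base + \<delta> = Lo ?Y K" using Lo'[of K] o d(8) by simp
    moreover have "base + \<delta> \<le> X K" using X(2)[OF K1 d(1)] \<delta>(2) by linarith
    ultimately show ?thesis
      unfolding ginv_def using d(1,11) bl' h1 h2 pl Wr ab bnd by blast
  qed
  note B = d(2)[OF o(1,2)]
  have s: "sum V {hp o'..<tp o'} = V (hp o') + sum V {hp o' + 1..<tp o'}" for V :: "nat \<Rightarrow> real"
    using o(3) by (simp add: sum.atLeast_Suc_lessThan Suc_eq_plus1)
  note Wo = W0[OF o(1) om] and So = srt[OF o(1) om]
  {
    assume e: "\<delta> = Wt (hp o')"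
    show "ginv K (hp(o' := hp o' + 1)) tp Wt th (la(o' := ?s)) ?Y (base + \<delta>) tot"
      by (rule main) (use blk_take(1)[OF B o(3) \<delta>(1) _ Wo So] e s[of Wt] in simp_all)
  }
  {
    assume l: "\<delta> < Wt (hp o')"
    let ?W = "Wt(hp o' := Wt (hp o') - \<delta>)"
    have "sum ?W {hp o' + 1..<tp o'} = sum Wt {hp o' + 1..<tp o'}"
      by (intro sum.cong) auto
    then have pw: "sum ?W {hp o'..<tp o'} = sum Wt {hp o'..<tp o'} - \<delta>"
      using s[of Wt] s[of ?W] by simp
    have rg: "ps o' \<le> hp o' \<and> hp o' < pe o'" using r(1-3)[OF o(1,2)] o(3) by auto
    show "ginv K hp tp ?W th (la(o' := ?s)) ?Y (base + \<delta>) tot"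
    proof (rule main[where hp' = hp and Wt' = ?W])
      show "sum ?W {hp o'..<tp o'} = sum Wt {hp o'..<tp o'} - \<delta>" by (rule pw)
      show "blk P W0 (ps o') (pe o') (hp o') (tp o') ?W (th o') ?s (Y o' + \<delta>)"
        using blk_take(2)[OF B o(3) \<delta>(1) _ Wo So] l by simp
      show "?W p = Wt p" if "\<not> (ps o' \<le> p \<and> p < pe o')" for p using that rg by auto
    qed simp_all
  }
qed

text \<open>Equality \<open>a m = b m\<close> squeezes \<open>base\<close> and \<open>tot\<close>
  together. The remaining weights are nonnegative with sum 0, so nothing remains in any block;
  \<open>Lo\<close> and \<open>Hi\<close> then agree on all prefixes and give the relaxed solution
  \<open>S\<close> of the exchange argument.\<close>

lemma ginv_final:
  assumes G: "ginv m hp tp Wt th la Y base tot" and fin: "a m \<le> base" "tot \<le> b m"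
  shows "\<And>j. 1 \<le> j \<Longrightarrow> j \<le> m \<Longrightarrow> a j \<le> Lo Y j \<and> Lo Y j \<le> b j"
    "\<And>p q. 1 \<le> p \<Longrightarrow> p < q \<Longrightarrow> q \<le> m \<Longrightarrow> th p < la q \<Longrightarrow> \<exists>j. p \<le> j \<and> j < q \<and> Lo Y j = b j"
    "\<And>p q. 1 \<le> q \<Longrightarrow> q < p \<Longrightarrow> p \<le> m \<Longrightarrow> th p < la q \<Longrightarrow> \<exists>j. q \<le> j \<and> j < p \<and> Lo Y j = a j"
    "\<And>j. 1 \<le> j \<Longrightarrow> j \<le> m \<Longrightarrow> - BIG \<le> la j \<and> la j \<le> th j \<and> th j \<le> BIG"
    "\<And>j. 1 \<le> j \<Longrightarrow> j \<le> m \<Longrightarrow> sum W0 {p \<in> {ps j..<pe j}. P p < th j} \<le> Y j \<and>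
       Y j \<le> sum W0 {p \<in> {ps j..<pe j}. P p \<le> la j}"
proof -
  note d = ginvD[OF G]
  note r = ginv_range[OF G]
  \<comment> \<open>Both sums enclose \<open>X m\<close>, which is equal to both bounds.\<close>
  have bt: "base = tot" "base = a m" using d(10,11) fin abm X(2)[of m] m1 by simp_all
  define D where "D = pre (pool hp tp Wt)"
  have HL: "Hi Y (pool hp tp Wt) j = Lo Y j + D j" for j
    unfolding D_def by (induction j) (simp_all add: pre_Suc)
  have nn: "0 \<le> pool hp tp Wt j" if "1 \<le> j" "j \<le> m" for j
    using r(4)[OF that] by (intro sum_nonneg) (simp add: less_imp_le)
  have mono: "D i \<le> D j" if "i \<le> j" "j \<le> m" for i j
    using that
  proof (induction j rule: dec_induct)
    case (step j)
    then show ?case using nn[of "Suc j"] unfolding D_def by (simp add: pre_Suc)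
  qed simp
  have D0: "D j = 0" if "j \<le> m" for j
  proof -
    have "D m = 0" using HL[of m] d(8,9) bt by simp
    moreover have "D 0 = 0" by (simp add: D_def)
    ultimately show ?thesis using mono[of 0 j] mono[of j m] that by simp
  qed
  have HiLo: "Hi Y (pool hp tp Wt) j = Lo Y j" if "j \<le> m" for j using HL D0 that by simp
  have pool0: "pool hp tp Wt j = 0" if "1 \<le> j" "j \<le> m" for j
  proof -
    obtain i where "j = Suc i" using \<open>1 \<le> j\<close> by (cases j) simp_all
    then show ?thesis using D0[of i] D0[of j] that pre_Suc[of "pool hp tp Wt" i] by (simp add: D_def)
  qed
  show "a j \<le> Lo Y j \<and> Lo Y j \<le> b j" if j: "1 \<le> j" "j \<le> m" for j
  proof (cases "j = m")
    case True then show ?thesis using d(8) bt abm by simp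
  next
    case False then show ?thesis using d(12)[of j] HiLo[of j] j by simp
  qed
  show "\<exists>j. p \<le> j \<and> j < q \<and> Lo Y j = b j" if q: "1 \<le> p" "p < q" "q \<le> m" "th p < la q" for p q
  proof -
    obtain j where j: "p \<le> j" "j < q" "Hi Y (pool hp tp Wt) j = b j"
      using half_optD1[OF d(4) q(1-3) _ q(4)] by blast
    then show ?thesis using HiLo[of j] q(3) by auto
  qed
  show "\<exists>j. q \<le> j \<and> j < p \<and> Lo Y j = a j" if q: "1 \<le> q" "q < p" "p \<le> m" "th p < la q" for p q
  proof -
    have "- la q < - th p" using q by simp
    then obtain j where j: "q \<le> j" "j < p" "- Lo Y j = - a j"
      using half_optD1[OF d(5) q(1-3), of "- th p"] by blast
    then show ?thesis by auto
  qed
  show "- BIG \<le> la j \<and> la j \<le> th j \<and> th j \<le> BIG" if "1 \<le> j" "j \<le> m" for j using d(7)[OF that] .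
  show "sum W0 {p \<in> {ps j..<pe j}. P p < th j} \<le> Y j \<and> Y j \<le> sum W0 {p \<in> {ps j..<pe j}. P p \<le> la j}"
    if "1 \<le> j" "j \<le> m" for j
    using d(2)[OF that] pool0[OF that] by (simp add: blk_def)
qed

end

text \<open>The key \<open>- 1 - BIG\<close> is below every slope and every negated slope, so a
  block without remaining items never wins the tournament against one that has some.\<close>

definition key_max :: com where
  "key_max = Cond (ILt (IGet ''hd'' (IV ''j'')) (IGet ''tl'' (IV ''j'')))
     (RS ''val'' (RGet ''P'' (ISub (IGet ''tl'' (IV ''j'')) (IConst 1))))
     (RS ''val'' (RSub (RConst (-1)) (RV ''BIG'')))"

definition key_min :: com where
  "key_min = Cond (ILt (IGet ''hd'' (IV ''j'')) (IGet ''tl'' (IV ''j'')))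
     (RS ''val'' (RSub (RConst 0) (RGet ''P'' (IGet ''hd'' (IV ''j'')))))
     (RS ''val'' (RSub (RConst (-1)) (RV ''BIG'')))"

section \<open>Removing and taking as programs\<close>

definition refresh :: com where
  "refresh = key_max ;; IS ''pos'' (IAdd (IV ''M'') (IV ''j'')) ;; tree_set ''tmax'' ;;
     key_min ;; IS ''pos'' (IAdd (IV ''M'') (IV ''j'')) ;; tree_set ''tmin''"

text \<open>A shortened item keeps its slope and its place, so the trees stay correct; only an item
  that is used up changes the key of its block and calls for \<open>refresh\<close>.\<close>

definition remove_max :: com where
  "remove_max = tree_find ''tmax'' ;; IS ''j'' (ISub (IV ''pos'') (IV ''M'')) ;;
     IS ''p'' (ISub (IGet ''tl'' (IV ''j'')) (IConst 1)) ;;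
     RSet ''th'' (IV ''j'') (RGet ''P'' (IV ''p'')) ;;
     RS ''need'' (RSub (RV ''tot'') (RGet ''b'' (IV ''K''))) ;;
     Cond (RLe (RGet ''Wt'' (IV ''p'')) (RV ''need''))
       (RS ''tot'' (RSub (RV ''tot'') (RGet ''Wt'' (IV ''p''))) ;; ISet ''tl'' (IV ''j'') (IV ''p'') ;; refresh)
       (RSet ''Wt'' (IV ''p'') (RSub (RGet ''Wt'' (IV ''p'')) (RV ''need'')) ;;
        RS ''tot'' (RSub (RV ''tot'') (RV ''need'')))"

definition take_min :: com where
  "take_min = tree_find ''tmin'' ;; IS ''j'' (ISub (IV ''pos'') (IV ''M'')) ;;
     IS ''p'' (IGet ''hd'' (IV ''j'')) ;;
     RSet ''la'' (IV ''j'') (RGet ''P'' (IV ''p'')) ;;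
     RS ''need'' (RSub (RGet ''a'' (IV ''K'')) (RV ''base'')) ;;
     Cond (RLe (RGet ''Wt'' (IV ''p'')) (RV ''need''))
       (RSet ''Y'' (IV ''j'') (RAdd (RGet ''Y'' (IV ''j'')) (RGet ''Wt'' (IV ''p''))) ;;
        RS ''base'' (RAdd (RV ''base'') (RGet ''Wt'' (IV ''p''))) ;;
        ISet ''hd'' (IV ''j'') (IAdd (IV ''p'') (IConst 1)) ;; refresh)
       (RSet ''Y'' (IV ''j'') (RAdd (RGet ''Y'' (IV ''j'')) (RV ''need'')) ;;
        RSet ''Wt'' (IV ''p'') (RSub (RGet ''Wt'' (IV ''p'')) (RV ''need'')) ;;
        RS ''base'' (RAdd (RV ''base'') (RV ''need'')))"

lemma mods_refresh [simp]: "imods refresh = {''pos''}" "rmods refresh = {''val'', ''tmax'', ''tmin''}"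
  by (auto simp: refresh_def key_max_def key_min_def)

lemma mods_remove_max [simp]: "imods remove_max = {''pos'', ''j'', ''p'', ''tl''}"
  "rmods remove_max = {''val'', ''tmax'', ''tmin'', ''th'', ''need'', ''tot'', ''Wt''}"
  by (auto simp: remove_max_def)

lemma mods_take_min [simp]: "imods take_min = {''pos'', ''j'', ''p'', ''hd''}"
  "rmods take_min = {''val'', ''tmax'', ''tmin'', ''la'', ''need'', ''base'', ''Wt'', ''Y''}"
  by (auto simp: take_min_def)

context greedy_data
begin

definition kmax :: "nat \<Rightarrow> (nat \<Rightarrow> nat) \<Rightarrow> (nat \<Rightarrow> nat) \<Rightarrow> nat \<Rightarrow> real" where
  "kmax K hp tp j = (if 1 \<le> j \<and> j \<le> K \<and> hp j < tp j then P (tp j - 1) else - 1 - BIG)"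

definition kmin :: "nat \<Rightarrow> (nat \<Rightarrow> nat) \<Rightarrow> (nat \<Rightarrow> nat) \<Rightarrow> nat \<Rightarrow> real" where
  "kmin K hp tp j = (if 1 \<le> j \<and> j \<le> K \<and> hp j < tp j then - P (hp j) else - 1 - BIG)"

text \<open>\<open>D\<close> holds the blocks whose leaves may be out of date, between a change of
  head or tail and the next \<open>refresh\<close>. Block \<open>j\<close> has the leaf
  \<open>m + 1 + j\<close>, and leaf \<open>m + 1\<close> belongs to no block.\<close>

definition trees :: "nat set \<Rightarrow> nat \<Rightarrow> (nat \<Rightarrow> nat) \<Rightarrow> (nat \<Rightarrow> nat) \<Rightarrow> (nat \<Rightarrow> real) \<Rightarrow> (nat \<Rightarrow> real) \<Rightarrow> bool" where
  "trees D K hp tp Vx Vn \<longleftrightarrow> tree_ok Vx (m + 1) \<and> tree_ok Vn (m + 1) \<and>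
     (\<forall>j. j \<le> m \<and> j \<notin> D \<longrightarrow> Vx (m + 1 + j) = kmax K hp tp j \<and> Vn (m + 1 + j) = kmin K hp tp j)"

definition genv :: "state \<Rightarrow> bool" where
  "genv s \<longleftrightarrow> iv s ''m'' = m \<and> iv s ''M'' = m + 1 \<and> rmem s ''P'' = P \<and> rmem s ''a'' = a \<and> rmem s ''b'' = b \<and>
     rmem s ''cs'' = C \<and> rv s ''BIG'' = BIG \<and> imem s ''ps'' = ps \<and> (\<forall>j. pe j = ps (j + 1)) \<and>
     (\<forall>j. 1 \<le> j \<and> j \<le> m \<longrightarrow> rmem s ''cap'' j = sum W0 {ps j..<pe j})"

definition Dm :: nat where
  "Dm = depth (2 * (m + 1))"

lemmas tree_set_m = tree_set[where m = "m + 1", folded Dm_def]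
lemmas tree_find_m = tree_find[where m = "m + 1", folded Dm_def]

lemma trees_cong:
  assumes "trees {j} K hp tp Vx Vn" "\<And>i. i \<noteq> j \<Longrightarrow> hp' i = hp i \<and> tp' i = tp i"
  shows "trees {j} K hp' tp' Vx Vn"
  using assms unfolding trees_def kmax_def kmin_def by simp

lemma trees_mono: "trees {} K hp tp Vx Vn \<Longrightarrow> trees {j} K hp tp Vx Vn"
  by (simp add: trees_def)

lemma key_max:
  assumes "genv s" "iv s ''j'' = j" "1 \<le> j" "j \<le> K" and Q: "\<And>t. t \<le> 20 \<Longrightarrow>
    Q t (rset ''val'' 0 (kmax K (imem s ''hd'') (imem s ''tl'') j) s)"
  shows "wp f key_max s Q"
proof -
  have e: "rmem s ''P'' = P" "rv s ''BIG'' = BIG" using assms(1) by (simp_all add: genv_def)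
  show ?thesis
    using assms(2-4) Q[of 17] Q[of 15] unfolding key_max_def
    by (cases "imem s ''hd'' j < imem s ''tl'' j") (simp_all add: kmax_def e)
qed

lemma key_min:
  assumes "genv s" "iv s ''j'' = j" "1 \<le> j" "j \<le> K" and Q: "\<And>t. t \<le> 20 \<Longrightarrow>
    Q t (rset ''val'' 0 (kmin K (imem s ''hd'') (imem s ''tl'') j) s)"
  shows "wp f key_min s Q"
proof -
  have e: "rmem s ''P'' = P" "rv s ''BIG'' = BIG" using assms(1) by (simp_all add: genv_def)
  show ?thesis
    using assms(2-4) Q[of 17] Q[of 15] unfolding key_min_def
    by (cases "imem s ''hd'' j < imem s ''tl'' j") (simp_all add: kmin_def e)
qed

lemma refresh:
  assumes e: "genv s" "iv s ''j'' = j" "1 \<le> j" "j \<le> K" "j \<le> m"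
    and tr: "trees {j} K (imem s ''hd'') (imem s ''tl'') (rmem s ''tmax'') (rmem s ''tmin'')"
  shows "wp f refresh s (\<lambda>t s'. t \<le> 80 * Dm + 100 \<and>
    trees {} K (imem s ''hd'') (imem s ''tl'') (rmem s' ''tmax'') (rmem s' ''tmin''))"
proof -
  have M: "iv s ''M'' = m + 1" using e(1) by (simp add: genv_def)
  have ok: "tree_ok (rmem s ''tmax'') (m + 1)" "tree_ok (rmem s ''tmin'') (m + 1)" using tr by (simp_all add: trees_def)
  show ?thesis
    unfolding refresh_def wp_Seq
    apply (rule key_max[OF e(1-4)])
    apply (simp add: M e(2))
    apply (rule wp_use[OF tree_set_m[where p = "m + 1 + j"]])
         apply (simp add: ok)
        apply simp
       apply simp
      apply (use e(5) in simp)
     apply simp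
    subgoal premises p for t t1 s1
    proof -
      note fI = frameI[OF p(3)] and fR = frameR[OF p(3)]
      have e1: "genv s1" "iv s1 ''j'' = j" using e(1,2) unfolding genv_def by (simp_all add: fI fR)
      have h1: "imem s1 ''hd'' = imem s ''hd''" "imem s1 ''tl'' = imem s ''tl''" "iv s1 ''M'' = m + 1"
        "rmem s1 ''tmin'' = rmem s ''tmin''"
        using M by (simp_all add: fI fR)
      have L1: "rmem s1 ''tmax'' (m + 1 + i) =
          (if i = j then kmax K (imem s ''hd'') (imem s ''tl'') j else rmem s ''tmax'' (m + 1 + i))" for i
        using p(2) by simp
      have ok1: "tree_ok (rmem s1 ''tmax'') (m + 1)" "t1 \<le> 40 * Dm + 20" using p(2) by simp_all
      show ?thesis
        apply (rule key_min[OF e1 e(3,4)])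
        apply (simp add: h1 e1(2))
        apply (rule wp_use[OF tree_set_m[where p = "m + 1 + j"]])
             apply (simp add: ok h1)
            apply simp
           apply simp
          apply (use e(5) in simp)
         apply simp
        subgoal premises r for t2 t3 s2
        proof -
          note gI = frameI[OF r(3)] and gR = frameR[OF r(3)]
          have x: "rmem s2 ''tmax'' = rmem s1 ''tmax''" by (simp add: gR)
          have L2: "rmem s2 ''tmin'' (m + 1 + i) =
              (if i = j then kmin K (imem s ''hd'') (imem s ''tl'') j else rmem s ''tmin'' (m + 1 + i))" for i
            using r(2) by (simp add: h1)
          have "tree_ok (rmem s2 ''tmin'') (m + 1)" "t3 \<le> 40 * Dm + 20" using r(2) by simp_all
          then have "trees {} K (imem s ''hd'') (imem s ''tl'') (rmem s2 ''tmax'') (rmem s2 ''tmin'')"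
            using tr ok1(1) L1 L2 unfolding trees_def x by simp
          then show ?thesis using \<open>t3 \<le> 40 * Dm + 20\<close> ok1(2) p(1) r(1) by simp
        qed
        done
    qed
    done
qed

text \<open>Since some block still has an item, of slope at least \<open>- BIG\<close>, the largest
  key exceeds the dummy key \<open>- 1 - BIG\<close>; the leaf that was found therefore belongs to
  an inserted block with remaining items.\<close>

lemma find_max:
  assumes T: "trees {} K hp tp Vx Vn" and K: "K \<le> m" and G: "ginv K hp tp Wt th la Y base tot"
    and ne: "1 \<le> i" "i \<le> K" "hp i < tp i" and p: "m + 1 \<le> p" "p < 2 * (m + 1)"
      "\<forall>k. 1 \<le> k \<and> k < 2 * (m + 1) \<longrightarrow> Vx k \<le> Vx p"
  shows "1 \<le> p - (m + 1)" "p - (m + 1) \<le> K" "hp (p - (m + 1)) < tp (p - (m + 1))"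
    "\<And>l. 1 \<le> l \<Longrightarrow> l \<le> K \<Longrightarrow> hp l < tp l \<Longrightarrow> P (tp l - 1) \<le> P (tp (p - (m + 1)) - 1)"
proof -
  define j where "j = p - (m + 1)"
  have j: "j \<le> m" "p = m + 1 + j" using p by (auto simp: j_def)
  have le: "kmax K hp tp l \<le> kmax K hp tp j" if "l \<le> m" for l
    using spec[OF p(3), of "m + 1 + l"] that T j unfolding trees_def by simp
  have v: "kmax K hp tp i = P (tp i - 1)" "- BIG \<le> P (tp i - 1)"
    using ne ginv_range(5)[OF G, of i "tp i - 1"] by (simp_all add: kmax_def)
  have "kmax K hp tp j \<noteq> - 1 - BIG" using le[of i] v ne K by simp
  then have *: "1 \<le> j \<and> j \<le> K \<and> hp j < tp j" unfolding kmax_def by presburger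
  then show "1 \<le> p - (m + 1)" "p - (m + 1) \<le> K" "hp (p - (m + 1)) < tp (p - (m + 1))"
    unfolding j_def by blast+
  fix l assume l: "1 \<le> l" "l \<le> K" "hp l < tp l"
  have "kmax K hp tp l = P (tp l - 1)" "kmax K hp tp j = P (tp j - 1)" using l * by (simp_all add: kmax_def)
  then show "P (tp l - 1) \<le> P (tp (p - (m + 1)) - 1)"
    using le[of l] l K unfolding j_def[symmetric] by simp
qed

lemma find_min:
  assumes T: "trees {} K hp tp Vx Vn" and K: "K \<le> m" and G: "ginv K hp tp Wt th la Y base tot"
    and ne: "1 \<le> i" "i \<le> K" "hp i < tp i" and p: "m + 1 \<le> p" "p < 2 * (m + 1)"
      "\<forall>k. 1 \<le> k \<and> k < 2 * (m + 1) \<longrightarrow> Vn k \<le> Vn p"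
  shows "1 \<le> p - (m + 1)" "p - (m + 1) \<le> K" "hp (p - (m + 1)) < tp (p - (m + 1))"
    "\<And>l. 1 \<le> l \<Longrightarrow> l \<le> K \<Longrightarrow> hp l < tp l \<Longrightarrow> P (hp (p - (m + 1))) \<le> P (hp l)"
proof -
  define j where "j = p - (m + 1)"
  have j: "j \<le> m" "p = m + 1 + j" using p by (auto simp: j_def)
  have le: "kmin K hp tp l \<le> kmin K hp tp j" if "l \<le> m" for l
    using spec[OF p(3), of "m + 1 + l"] that T j unfolding trees_def by simp
  have v: "kmin K hp tp i = - P (hp i)" "P (hp i) \<le> BIG"
    using ne ginv_range(5)[OF G, of i "hp i"] by (simp_all add: kmin_def)
  have "kmin K hp tp j \<noteq> - 1 - BIG" using le[of i] v ne K by simp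
  then have *: "1 \<le> j \<and> j \<le> K \<and> hp j < tp j" unfolding kmin_def by presburger
  then show "1 \<le> p - (m + 1)" "p - (m + 1) \<le> K" "hp (p - (m + 1)) < tp (p - (m + 1))"
    unfolding j_def by blast+
  fix l assume l: "1 \<le> l" "l \<le> K" "hp l < tp l"
  have "kmin K hp tp l = - P (hp l)" "kmin K hp tp j = - P (hp j)" using l * by (simp_all add: kmin_def)
  then show "P (hp (p - (m + 1))) \<le> P (hp l)"
    using le[of l] l K unfolding j_def[symmetric] by simp
qed

definition gst :: "nat \<Rightarrow> state \<Rightarrow> bool" where
  "gst K s \<longleftrightarrow> genv s \<and> iv s ''K'' = K \<and>
     ginv K (imem s ''hd'') (imem s ''tl'') (rmem s ''Wt'') (rmem s ''th'') (rmem s ''la'') (rmem s ''Y'')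
       (rv s ''base'') (rv s ''tot'') \<and>
     trees {} K (imem s ''hd'') (imem s ''tl'') (rmem s ''tmax'') (rmem s ''tmin'')"

definition items :: "nat \<Rightarrow> state \<Rightarrow> nat" where
  "items K s = (\<Sum>j=1..K. imem s ''tl'' j - imem s ''hd'' j)"

lemma items_dec:
  fixes hp tp hp' tp' :: "nat \<Rightarrow> nat"
  assumes "1 \<le> o'" "o' \<le> K" "\<And>j. j \<noteq> o' \<Longrightarrow> hp' j = hp j \<and> tp' j = tp j"
    "tp' o' - hp' o' + 1 = tp o' - hp o'"
  shows "(\<Sum>j=1..K. tp' j - hp' j) + 1 = (\<Sum>j=1..K. tp j - hp j)"
proof -
  have "(\<Sum>j=1..K. tp' j - hp' j) = (tp' o' - hp' o') + (\<Sum>j\<in>{1..K} - {o'}. tp' j - hp' j)"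
    "(\<Sum>j=1..K. tp j - hp j) = (tp o' - hp o') + (\<Sum>j\<in>{1..K} - {o'}. tp j - hp j)"
    using assms(1,2) by (simp_all add: sum.remove)
  moreover have "(\<Sum>j\<in>{1..K} - {o'}. tp' j - hp' j) = (\<Sum>j\<in>{1..K} - {o'}. tp j - hp j)"
    using assms(3) by (intro sum.cong) auto
  ultimately show ?thesis using assms(4) by simp
qed

text \<open>Either an item disappears for good, or a shortened item absorbs the whole surplus and
  the bound is met exactly, which ends the loop. Amortization over the items rests on this
  alternative.\<close>

lemma remove_max:
  assumes S: "gst K s" and K: "1 \<le> K" "K \<le> m" and gt: "b K < rv s ''tot''"
  shows "wp f remove_max s (\<lambda>t s'. gst K s' \<and> t \<le> 120 * Dm + 250 \<and>
    (items K s' + 1 = items K s \<or> items K s' = items K s \<and> rv s' ''tot'' = b K))"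
proof -
  have ge: "genv s" and sK: "iv s ''K'' = K"
    and G: "ginv K (imem s ''hd'') (imem s ''tl'') (rmem s ''Wt'') (rmem s ''th'') (rmem s ''la'') (rmem s ''Y'')
       (rv s ''base'') (rv s ''tot'')"
    and T: "trees {} K (imem s ''hd'') (imem s ''tl'') (rmem s ''tmax'') (rmem s ''tmin'')"
    using S by (simp_all add: gst_def)
  have fx: "iv s ''M'' = m + 1" "rmem s ''P'' = P" "rmem s ''b'' = b" using ge by (simp_all add: genv_def)
  have "rv s ''base'' < rv s ''tot''" using gt ginvD(10)[OF G] X(2)[OF K] by linarith
  then obtain i where i: "1 \<le> i" "i \<le> K" "imem s ''hd'' i < imem s ''tl'' i" using ginv_nonempty[OF G] by blast
  have okx: "tree_ok (rmem s ''tmax'') (m + 1)" using T by (simp add: trees_def)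
  show ?thesis
    unfolding remove_max_def wp_Seq
    apply (rule wp_use[OF tree_find_m[OF okx fx(1)]])
     apply simp
    subgoal premises p for t s1
    proof -
      define j where "j = iv s1 ''pos'' - (m + 1)"
      note fI = frameI[OF p(2)] and fR = frameR[OF p(2)]
      have e: "imem s1 v = imem s v" "rmem s1 w = rmem s w" if "v \<noteq> ''pos''" for v w
        using that by (simp_all add: fI fR)
      have pp: "m + 1 \<le> iv s1 ''pos''" "iv s1 ''pos'' < 2 * (m + 1)"
        "\<forall>k. 1 \<le> k \<and> k < 2 * (m + 1) \<longrightarrow> rmem s ''tmax'' k \<le> rmem s ''tmax'' (iv s1 ''pos'')" "t \<le> 40 * Dm + 20"
        using p(1) by blast+
      note j = find_max[OF T K(2) G i pp(1-3), folded j_def]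
      have er: "rmem s1 = rmem s" by (intro ext) (simp add: fR)
      define q where "q = imem s ''tl'' j - 1"
      define W where "W = rmem s ''Wt'' q"
      have r: "imem s ''hd'' j \<le> q" "q < imem s ''tl'' j" using j(3) by (auto simp: q_def)
      have Wp: "0 < W" using ginv_range(4)[OF G j(1,2) r] by (simp add: W_def)
      have jm: "j \<le> m" using j(2) K by simp
      define s2 where "s2 = rset ''need'' 0 (rv s ''tot'' - b K) (rset ''th'' j (P q) (iset ''p'' 0 q (iset ''j'' 0 j s1)))"
      have f2: "iv s2 ''j'' = j" "iv s2 ''p'' = q" "rv s2 ''tot'' = rv s ''tot''" "rmem s2 ''Wt'' = rmem s ''Wt''"
        "rv s2 ''need'' = rv s ''tot'' - b K"
        by (simp_all add: s2_def er)
      show ?thesis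
      proof (cases "W \<le> rv s ''tot'' - b K")
        case True
        define s3 where "s3 = iset ''tl'' j q (rset ''tot'' 0 (rv s ''tot'' - W) s2)"
        have g3: "genv s3" using ge unfolding genv_def s3_def s2_def by (simp add: er e)
        have G3: "ginv K (imem s ''hd'') ((imem s ''tl'')(j := q)) (rmem s ''Wt'') ((rmem s ''th'')(j := P q))
            (rmem s ''la'') (rmem s ''Y'') (rv s ''base'') (rv s ''tot'' - W)"
          unfolding q_def W_def
          by (rule ginv_remove(1)[OF G j(1-4)]) (use Wp True in \<open>simp_all add: W_def q_def\<close>)
        have T3: "trees {j} K (imem s ''hd'') ((imem s ''tl'')(j := q)) (rmem s ''tmax'') (rmem s ''tmin'')"
          by (rule trees_cong[OF trees_mono[OF T]]) simp
        have it: "(\<Sum>i=1..K. ((imem s ''tl'')(j := q)) i - imem s ''hd'' i) + 1 = items K s"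
          unfolding items_def by (rule items_dec[OF j(1,2)]) (use r in \<open>auto simp: q_def\<close>)
        have R: "wp f refresh s3 (\<lambda>t s'. t \<le> 80 * Dm + 100 \<and>
            trees {} K (imem s3 ''hd'') (imem s3 ''tl'') (rmem s' ''tmax'') (rmem s' ''tmin''))"
          by (rule refresh[OF g3 _ j(1,2) jm]) (use T3 in \<open>simp_all add: s3_def s2_def er e\<close>)
        have R': "wp f refresh s3 (\<lambda>t' s'. gst K s' \<and> t' \<le> 80 * Dm + 100 \<and> items K s' + 1 = items K s)"
        proof (rule wp_use[OF R])
          fix t' s' assume q: "t' \<le> 80 * Dm + 100 \<and>
            trees {} K (imem s3 ''hd'') (imem s3 ''tl'') (rmem s' ''tmax'') (rmem s' ''tmin'')" "frame refresh s3 s'"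
          note gI = frameI[OF q(2)] and gR = frameR[OF q(2)]
          have "genv s'" using g3 unfolding genv_def by (simp add: gI gR)
          moreover have a: "imem s' ''hd'' = imem s ''hd''" "imem s' ''tl'' = (imem s ''tl'')(j := q)"
            by (simp_all add: gI s3_def s2_def e)
          ultimately have "gst K s'" using q(1) G3 sK unfolding gst_def by (simp add: gI gR s3_def s2_def e er)
          then show "gst K s' \<and> t' \<le> 80 * Dm + 100 \<and> items K s' + 1 = items K s"
            using q(1) it unfolding items_def a by simp
        qed
        show ?thesis
          using True apply (simp add: e er fx sK j_def[symmetric] q_def[symmetric] W_def[symmetric] s2_def[symmetric] f2 s3_def[symmetric])
          apply (rule wp_use[OF R'])
          using pp(4) by simp
      next
        case False
        define n where "n = rv s ''tot'' - b K"
        have G3: "ginv K (imem s ''hd'') (imem s ''tl'') ((rmem s ''Wt'')(q := W - n)) ((rmem s ''th'')(j := P q))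
            (rmem s ''la'') (rmem s ''Y'') (rv s ''base'') (rv s ''tot'' - n)"
          unfolding q_def W_def
          by (rule ginv_remove(2)[OF G j(1-4)]) (use gt False in \<open>simp_all add: W_def q_def n_def\<close>)
        have g3: "genv (rset ''tot'' 0 (rv s ''tot'' - n) (rset ''Wt'' q (W - n) s2))"
          using ge unfolding genv_def s2_def by (simp add: er e)
        have "gst K (rset ''tot'' 0 (rv s ''tot'' - n) (rset ''Wt'' q (W - n) s2))"
          unfolding gst_def using g3 G3 T sK by (simp add: s2_def er e)
        moreover have "items K (rset ''tot'' 0 (rv s ''tot'' - n) (rset ''Wt'' q (W - n) s2)) = items K s"
          by (simp add: items_def s2_def e)
        ultimately show ?thesis
          using False pp(4) unfolding n_def
          by (simp add: e er fx sK j_def[symmetric] q_def[symmetric] W_def[symmetric] s2_def[symmetric] f2)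
      qed
    qed
    done
qed

end

context greedy_data
begin

lemma take_min:
  assumes S: "gst K s" and K: "1 \<le> K" "K \<le> m" and gt: "rv s ''base'' < a K"
  shows "wp f take_min s (\<lambda>t s'. gst K s' \<and> t \<le> 120 * Dm + 250 \<and>
    (items K s' + 1 = items K s \<or> items K s' = items K s \<and> rv s' ''base'' = a K))"
proof -
  have ge: "genv s" and sK: "iv s ''K'' = K"
    and G: "ginv K (imem s ''hd'') (imem s ''tl'') (rmem s ''Wt'') (rmem s ''th'') (rmem s ''la'') (rmem s ''Y'')
       (rv s ''base'') (rv s ''tot'')"
    and T: "trees {} K (imem s ''hd'') (imem s ''tl'') (rmem s ''tmax'') (rmem s ''tmin'')"
    using S by (simp_all add: gst_def)
  have fx: "iv s ''M'' = m + 1" "rmem s ''P'' = P" "rmem s ''a'' = a" using ge by (simp_all add: genv_def)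
  have "rv s ''base'' < rv s ''tot''" using gt ginvD(11)[OF G] X(2)[OF K] by linarith
  then obtain i where i: "1 \<le> i" "i \<le> K" "imem s ''hd'' i < imem s ''tl'' i" using ginv_nonempty[OF G] by blast
  have okx: "tree_ok (rmem s ''tmin'') (m + 1)" using T by (simp add: trees_def)
  show ?thesis
    unfolding take_min_def wp_Seq
    apply (rule wp_use[OF tree_find_m[OF okx fx(1)]])
     apply simp
    subgoal premises p for t s1
    proof -
      define j where "j = iv s1 ''pos'' - (m + 1)"
      note fI = frameI[OF p(2)] and fR = frameR[OF p(2)]
      have e: "imem s1 v = imem s v" "rmem s1 w = rmem s w" if "v \<noteq> ''pos''" for v w
        using that by (simp_all add: fI fR)
      have pp: "m + 1 \<le> iv s1 ''pos''" "iv s1 ''pos'' < 2 * (m + 1)"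
        "\<forall>k. 1 \<le> k \<and> k < 2 * (m + 1) \<longrightarrow> rmem s ''tmin'' k \<le> rmem s ''tmin'' (iv s1 ''pos'')" "t \<le> 40 * Dm + 20"
        using p(1) by blast+
      note j = find_min[OF T K(2) G i pp(1-3), folded j_def]
      have er: "rmem s1 = rmem s" by (intro ext) (simp add: fR)
      define q where "q = imem s ''hd'' j"
      define W where "W = rmem s ''Wt'' q"
      have r: "imem s ''hd'' j \<le> q" "q < imem s ''tl'' j" using j(3) by (auto simp: q_def)
      have Wp: "0 < W" using ginv_range(4)[OF G j(1,2) r] by (simp add: W_def)
      have jm: "j \<le> m" using j(2) K by simp
      define s2 where "s2 = rset ''need'' 0 (a K - rv s ''base'') (rset ''la'' j (P q) (iset ''p'' 0 q (iset ''j'' 0 j s1)))"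
      have f2: "iv s2 ''j'' = j" "iv s2 ''p'' = q" "rv s2 ''base'' = rv s ''base''" "rmem s2 ''Wt'' = rmem s ''Wt''"
        "rv s2 ''need'' = a K - rv s ''base''" "rmem s2 ''Y'' = rmem s ''Y''"
        by (simp_all add: s2_def er)
      show ?thesis
      proof (cases "W \<le> a K - rv s ''base''")
        case True
        define s3 where "s3 = iset ''hd'' j (q + 1) (rset ''base'' 0 (rv s ''base'' + W) (rset ''Y'' j (rmem s ''Y'' j + W) s2))"
        have g3: "genv s3" using ge unfolding genv_def s3_def s2_def by (simp add: er e)
        have G3: "ginv K ((imem s ''hd'')(j := q + 1)) (imem s ''tl'') (rmem s ''Wt'') (rmem s ''th'')
            ((rmem s ''la'')(j := P q)) ((rmem s ''Y'')(j := rmem s ''Y'' j + W)) (rv s ''base'' + W) (rv s ''tot'')"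
          unfolding q_def W_def
          by (rule ginv_take(1)[OF G j(1-4)]) (use Wp True in \<open>simp_all add: W_def q_def\<close>)
        have T3: "trees {j} K ((imem s ''hd'')(j := q + 1)) (imem s ''tl'') (rmem s ''tmax'') (rmem s ''tmin'')"
          by (rule trees_cong[OF trees_mono[OF T]]) simp
        have it: "(\<Sum>i=1..K. imem s ''tl'' i - ((imem s ''hd'')(j := q + 1)) i) + 1 = items K s"
          unfolding items_def by (rule items_dec[OF j(1,2)]) (use r in \<open>auto simp: q_def\<close>)
        have R: "wp f refresh s3 (\<lambda>t s'. t \<le> 80 * Dm + 100 \<and>
            trees {} K (imem s3 ''hd'') (imem s3 ''tl'') (rmem s' ''tmax'') (rmem s' ''tmin''))"
          by (rule refresh[OF g3 _ j(1,2) jm]) (use T3 in \<open>simp_all add: s3_def s2_def er e\<close>)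
        have R': "wp f refresh s3 (\<lambda>t' s'. gst K s' \<and> t' \<le> 80 * Dm + 100 \<and> items K s' + 1 = items K s)"
        proof (rule wp_use[OF R])
          fix t' s' assume q: "t' \<le> 80 * Dm + 100 \<and>
            trees {} K (imem s3 ''hd'') (imem s3 ''tl'') (rmem s' ''tmax'') (rmem s' ''tmin'')" "frame refresh s3 s'"
          note gI = frameI[OF q(2)] and gR = frameR[OF q(2)]
          have "genv s'" using g3 unfolding genv_def by (simp add: gI gR)
          moreover have a: "imem s' ''hd'' = (imem s ''hd'')(j := q + 1)" "imem s' ''tl'' = imem s ''tl''"
            by (simp_all add: gI s3_def s2_def e)
          ultimately have "gst K s'" using q(1) G3 sK unfolding gst_def by (simp add: gI gR s3_def s2_def e er)
          then show "gst K s' \<and> t' \<le> 80 * Dm + 100 \<and> items K s' + 1 = items K s"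
            using q(1) it unfolding items_def a by simp
        qed
        show ?thesis
          using True apply (simp add: e er fx sK j_def[symmetric] q_def[symmetric] W_def[symmetric] s2_def[symmetric] f2 s3_def[symmetric])
          apply (rule wp_use[OF R'])
          using pp(4) by simp
      next
        case False
        define n where "n = a K - rv s ''base''"
        have G3: "ginv K (imem s ''hd'') (imem s ''tl'') ((rmem s ''Wt'')(q := W - n)) (rmem s ''th'')
            ((rmem s ''la'')(j := P q)) ((rmem s ''Y'')(j := rmem s ''Y'' j + n)) (rv s ''base'' + n) (rv s ''tot'')"
          unfolding q_def W_def
          by (rule ginv_take(2)[OF G j(1-4)]) (use gt False in \<open>simp_all add: W_def q_def n_def\<close>)
        have g3: "genv (rset ''base'' 0 (rv s ''base'' + n) (rset ''Wt'' q (W - n) (rset ''Y'' j (rmem s ''Y'' j + n) s2)))"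
          using ge unfolding genv_def s2_def by (simp add: er e)
        have "gst K (rset ''base'' 0 (rv s ''base'' + n) (rset ''Wt'' q (W - n) (rset ''Y'' j (rmem s ''Y'' j + n) s2)))"
          unfolding gst_def using g3 G3 T sK by (simp add: s2_def er e)
        moreover have "items K (rset ''base'' 0 (rv s ''base'' + n) (rset ''Wt'' q (W - n) (rset ''Y'' j (rmem s ''Y'' j + n) s2))) = items K s"
          by (simp add: items_def s2_def e)
        ultimately show ?thesis
          using False pp(4) unfolding n_def
          by (simp add: e er fx sK j_def[symmetric] q_def[symmetric] W_def[symmetric] s2_def[symmetric] f2)
      qed
    qed
    done
qed


lemma trees_insert:
  assumes "trees {} K hp tp Vx Vn"
  shows "trees {K + 1} (K + 1) (hp(K + 1 := u)) (tp(K + 1 := v)) Vx Vn"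
proof -
  have "kmax (K + 1) (hp(K + 1 := u)) (tp(K + 1 := v)) i = kmax K hp tp i"
    "kmin (K + 1) (hp(K + 1 := u)) (tp(K + 1 := v)) i = kmin K hp tp i" if "i \<noteq> K + 1" for i
    using that by (auto simp: kmax_def kmin_def)
  then show ?thesis using assms unfolding trees_def by simp
qed

end

section \<open>Inserting the blocks one after the other\<close>

definition insert_block :: com where
  "insert_block = inc ''K'' ;; IS ''j'' (IV ''K'') ;;
     RS ''base'' (RAdd (RV ''base'') (RGet ''cs'' (IV ''K''))) ;;
     RS ''tot'' (RAdd (RAdd (RV ''tot'') (RGet ''cs'' (IV ''K''))) (RGet ''cap'' (IV ''K''))) ;;
     ISet ''hd'' (IV ''K'') (IGet ''ps'' (IV ''K'')) ;;
     ISet ''tl'' (IV ''K'') (IGet ''ps'' (IAdd (IV ''K'') (IConst 1))) ;;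
     RSet ''th'' (IV ''K'') (RV ''BIG'') ;;
     RSet ''la'' (IV ''K'') (RSub (RConst 0) (RV ''BIG'')) ;;
     RSet ''Y'' (IV ''K'') (RConst 0) ;; refresh"

lemma mods_insert_block [simp]: "imods insert_block = {''K'', ''j'', ''hd'', ''tl'', ''pos''}"
  "rmods insert_block = {''base'', ''tot'', ''th'', ''la'', ''Y'', ''val'', ''tmax'', ''tmin''}"
  by (auto simp: insert_block_def)

context greedy_data
begin

lemma insert_block:
  assumes S: "gst K s" and K: "K < m" and fin: "1 \<le> K \<Longrightarrow> a K \<le> rv s ''base'' \<and> rv s ''tot'' \<le> b K"
  shows "wp f insert_block s (\<lambda>t s'. gst (K + 1) s' \<and> t \<le> 80 * Dm + 250 \<and>
    items (K + 1) s' = items K s + (pe (K + 1) - ps (K + 1)))"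
proof -
  let ?k = "K + 1"
  have ge: "genv s" and sK: "iv s ''K'' = K"
    and G: "ginv K (imem s ''hd'') (imem s ''tl'') (rmem s ''Wt'') (rmem s ''th'') (rmem s ''la'') (rmem s ''Y'')
       (rv s ''base'') (rv s ''tot'')"
    and T: "trees {} K (imem s ''hd'') (imem s ''tl'') (rmem s ''tmax'') (rmem s ''tmin'')"
    using S by (simp_all add: gst_def)
  have k: "1 \<le> ?k" "?k \<le> m" using K by simp_all
  have fx: "rmem s ''cs'' = C" "rv s ''BIG'' = BIG" "imem s ''ps'' = ps" "ps (?k + 1) = pe ?k"
    "rmem s ''cap'' ?k = sum W0 {ps ?k..<pe ?k}"
    using ge k unfolding genv_def by simp_all
  note G1 = ginv_insert[OF G K fin]
  note T1 = trees_insert[OF T, of "ps ?k" "pe ?k"]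
  define s3 where "s3 = rset ''Y'' ?k 0 (rset ''la'' ?k (- BIG) (rset ''th'' ?k BIG (iset ''tl'' ?k (pe ?k)
    (iset ''hd'' ?k (ps ?k) (rset ''tot'' 0 (rv s ''tot'' + C ?k + sum W0 {ps ?k..<pe ?k})
    (rset ''base'' 0 (rv s ''base'' + C ?k) (iset ''j'' 0 ?k (iset ''K'' 0 ?k s))))))))"
  have g3: "genv s3" using ge unfolding genv_def s3_def by simp
  have h3: "imem s3 ''hd'' = (imem s ''hd'')(?k := ps ?k)" "imem s3 ''tl'' = (imem s ''tl'')(?k := pe ?k)"
    "rmem s3 ''Wt'' = rmem s ''Wt''" "rmem s3 ''th'' = (rmem s ''th'')(?k := BIG)"
    "rmem s3 ''la'' = (rmem s ''la'')(?k := - BIG)" "rmem s3 ''Y'' = (rmem s ''Y'')(?k := 0)"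
    "rv s3 ''base'' = rv s ''base'' + C ?k" "rv s3 ''tot'' = rv s ''tot'' + C ?k + sum W0 {ps ?k..<pe ?k}"
    "iv s3 ''K'' = ?k" "iv s3 ''j'' = ?k" "rmem s3 ''tmax'' = rmem s ''tmax''" "rmem s3 ''tmin'' = rmem s ''tmin''"
    by (simp_all add: s3_def)
  have R: "wp f refresh s3 (\<lambda>t s'. t \<le> 80 * Dm + 100 \<and>
      trees {} ?k (imem s3 ''hd'') (imem s3 ''tl'') (rmem s' ''tmax'') (rmem s' ''tmin''))"
    by (rule refresh[OF g3 h3(10) k(1) order_refl k(2)]) (unfold h3, rule T1)
  have R': "wp f refresh s3 (\<lambda>t' s'. gst ?k s' \<and> t' \<le> 80 * Dm + 100 \<and>
      items ?k s' = items K s + (pe ?k - ps ?k))"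
  proof (rule wp_use[OF R])
    fix t' s' assume q: "t' \<le> 80 * Dm + 100 \<and>
      trees {} ?k (imem s3 ''hd'') (imem s3 ''tl'') (rmem s' ''tmax'') (rmem s' ''tmin'')" "frame refresh s3 s'"
    note gI = frameI[OF q(2)] and gR = frameR[OF q(2)]
    have "genv s'" using g3 unfolding genv_def by (simp add: gI gR)
    moreover have "imem s' ''hd'' = imem s3 ''hd''" "imem s' ''tl'' = imem s3 ''tl''" "iv s' ''K'' = ?k"
      "rmem s' ''Wt'' = rmem s3 ''Wt''" "rmem s' ''th'' = rmem s3 ''th''" "rmem s' ''la'' = rmem s3 ''la''"
      "rmem s' ''Y'' = rmem s3 ''Y''" "rv s' ''base'' = rv s3 ''base''" "rv s' ''tot'' = rv s3 ''tot''"
      by (simp_all add: gI gR h3(9))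
    note e = this
    ultimately have "gst ?k s'" using conjunct2[OF q(1)] G1 unfolding gst_def e h3 by blast
    moreover have "items ?k s' = items K s + (pe ?k - ps ?k)"
    proof -
      have "(\<Sum>j=1..K. imem s' ''tl'' j - imem s' ''hd'' j) = items K s"
        unfolding items_def e h3 by (intro sum.cong) auto
      moreover have "{1..?k} = insert ?k {1..K}" using k by auto
      ultimately show ?thesis unfolding items_def e h3 by simp
    qed
    ultimately show "gst ?k s' \<and> t' \<le> 80 * Dm + 100 \<and> items ?k s' = items K s + (pe ?k - ps ?k)"
      using q(1) by blast
  qed
  show ?thesis
    unfolding insert_block_def wp_Seq wp_ISet wp_RSet
    apply (simp add: sK fx s3_def[symmetric] del: fun_upd_apply)
    apply (simp add: sK fx s3_def[symmetric])
    apply (rule wp_use[OF R'])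
    by simp
qed

end

definition greedy_step :: com where
  "greedy_step = insert_block ;; While (RLt (RGet ''b'' (IV ''K'')) (RV ''tot'')) remove_max ;;
     While (RLt (RV ''base'') (RGet ''a'' (IV ''K''))) take_min"

lemma mods_greedy_step [simp]: "imods greedy_step = {''K'', ''j'', ''hd'', ''tl'', ''pos'', ''p''}"
  "rmods greedy_step = {''base'', ''tot'', ''th'', ''la'', ''Y'', ''val'', ''tmax'', ''tmin'', ''need'', ''Wt''}"
  by (auto simp: greedy_step_def)

context greedy_data
begin

abbreviation "Tm \<equiv> 120 * Dm + 300"

text \<open>The \<open>of_bool\<close> term of the potential pays for the one iteration that
  shortens an item without using it up; all other iterations are paid for by the item that they
  delete.\<close>

lemma remove_loop:
  assumes S: "gst K s" and K: "1 \<le> K" "K \<le> m"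
  shows "wp f (While (RLt (RGet ''b'' (IV ''K'')) (RV ''tot'')) remove_max) s
    (\<lambda>t s'. gst K s' \<and> rv s' ''tot'' \<le> b K \<and> t + Tm * items K s' \<le> Tm * (items K s + 1) + 20)"
proof (rule wp_while[where I = "gst K" and V = "\<lambda>s. Tm * (items K s + of_bool (b K < rv s ''tot''))"], goal_cases)
  case 1 show ?case by (rule S)
next
  case (2 s1)
  have e: "rmem s1 ''b'' = b" "iv s1 ''K'' = K" using 2(1) by (simp_all add: gst_def genv_def)
  have gt: "b K < rv s1 ''tot''" using 2(2) e by simp
  show ?case
  proof (rule wp_use[OF remove_max[OF 2(1) K gt]], elim conjE)
    fix t s' assume q: "gst K s'" "t \<le> 120 * Dm + 250"
      "items K s' + 1 = items K s1 \<or> items K s' = items K s1 \<and> rv s' ''tot'' = b K"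
    have "items K s' + of_bool (b K < rv s' ''tot'') + 1 \<le> items K s1 + 1" using q(3) by auto
    from mult_le_mono2[OF this, of Tm] have "Tm * (items K s' + of_bool (b K < rv s' ''tot'')) + Tm \<le> Tm * (items K s1 + 1)"
      by (simp only: add_mult_distrib2 mult_1_right)
    then show "gst K s' \<and> 1 + btime (RLt (RGet ''b'' (IV ''K'')) (RV ''tot'')) + t +
        Tm * (items K s' + of_bool (b K < rv s' ''tot'')) \<le> Tm * (items K s1 + of_bool (b K < rv s1 ''tot''))"
      using q(1,2) gt by simp
  qed
next
  case (3 t s1)
  have e: "rmem s1 ''b'' = b" "iv s1 ''K'' = K" using 3(1) by (simp_all add: gst_def genv_def)
  have le: "rv s1 ''tot'' \<le> b K" using 3(2) e by simp
  have z: "(of_bool (b K < rv s1 ''tot'') :: nat) = 0" using le by simp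
  have bt: "btime (RLt (RGet ''b'' (IV ''K'')) (RV ''tot'')) \<le> 19" by simp
  have "Tm * (items K s + of_bool (b K < rv s ''tot'')) \<le> Tm * (items K s + 1)" by (intro mult_le_mono2) simp
  then have "t + Tm * items K s1 \<le> Tm * (items K s + 1) + 20"
    using 3(4) bt unfolding z add_0_right by linarith
  then show ?case using 3(1) le by blast
qed

lemma take_loop:
  assumes S: "gst K s" and K: "1 \<le> K" "K \<le> m"
  shows "wp f (While (RLt (RV ''base'') (RGet ''a'' (IV ''K''))) take_min) s
    (\<lambda>t s'. gst K s' \<and> a K \<le> rv s' ''base'' \<and> t + Tm * items K s' \<le> Tm * (items K s + 1) + 20)"
proof (rule wp_while[where I = "gst K" and V = "\<lambda>s. Tm * (items K s + of_bool (rv s ''base'' < a K))"], goal_cases)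
  case 1 show ?case by (rule S)
next
  case (2 s1)
  have e: "rmem s1 ''a'' = a" "iv s1 ''K'' = K" using 2(1) by (simp_all add: gst_def genv_def)
  have gt: "rv s1 ''base'' < a K" using 2(2) e by simp
  show ?case
  proof (rule wp_use[OF take_min[OF 2(1) K gt]], elim conjE)
    fix t s' assume q: "gst K s'" "t \<le> 120 * Dm + 250"
      "items K s' + 1 = items K s1 \<or> items K s' = items K s1 \<and> rv s' ''base'' = a K"
    have "items K s' + of_bool (rv s' ''base'' < a K) + 1 \<le> items K s1 + 1" using q(3) by auto
    from mult_le_mono2[OF this, of Tm] have "Tm * (items K s' + of_bool (rv s' ''base'' < a K)) + Tm \<le> Tm * (items K s1 + 1)"
      by (simp only: add_mult_distrib2 mult_1_right)
    then show "gst K s' \<and> 1 + btime (RLt (RV ''base'') (RGet ''a'' (IV ''K''))) + t +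
        Tm * (items K s' + of_bool (rv s' ''base'' < a K)) \<le> Tm * (items K s1 + of_bool (rv s1 ''base'' < a K))"
      using q(1,2) gt by simp
  qed
next
  case (3 t s1)
  have e: "rmem s1 ''a'' = a" "iv s1 ''K'' = K" using 3(1) by (simp_all add: gst_def genv_def)
  have le: "a K \<le> rv s1 ''base''" using 3(2) e by simp
  have z: "(of_bool (rv s1 ''base'' < a K) :: nat) = 0" using le by simp
  have bt: "btime (RLt (RV ''base'') (RGet ''a'' (IV ''K''))) \<le> 19" by simp
  have "Tm * (items K s + of_bool (rv s ''base'' < a K)) \<le> Tm * (items K s + 1)" by (intro mult_le_mono2) simp
  then have "t + Tm * items K s1 \<le> Tm * (items K s + 1) + 20"
    using 3(4) bt unfolding z add_0_right by linarith
  then show ?case using 3(1) le by blast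
qed

text \<open>Of the three extra units \<open>Tm\<close>, one pays for the insertion and the exits of
  the loops, and each loop needs one for an iteration that only shortens an item.\<close>

lemma greedy_step:
  assumes S: "gst K s" and K: "K < m" and fin: "1 \<le> K \<Longrightarrow> a K \<le> rv s ''base'' \<and> rv s ''tot'' \<le> b K"
  shows "wp f greedy_step s (\<lambda>t s'. gst (K + 1) s' \<and> a (K + 1) \<le> rv s' ''base'' \<and> rv s' ''tot'' \<le> b (K + 1) \<and>
    t + Tm * items (K + 1) s' \<le> Tm * (items K s + (pe (K + 1) - ps (K + 1)) + 3))"
proof -
  have k: "1 \<le> K + 1" "K + 1 \<le> m" using K by simp_all
  show ?thesis
    unfolding greedy_step_def wp_Seq
  proof (rule wp_use[OF insert_block[OF S K fin]], assumption, elim conjE)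
    fix t1 s1 assume 1: "gst (K + 1) s1" "t1 \<le> 80 * Dm + 250" "items (K + 1) s1 = items K s + (pe (K + 1) - ps (K + 1))"
    show "wp f (While (RLt (RGet ''b'' (IV ''K'')) (RV ''tot'')) remove_max) s1 (\<lambda>t s'.
      wp f (While (RLt (RV ''base'') (RGet ''a'' (IV ''K''))) take_min) s' (\<lambda>t' s'.
       gst (K + 1) s' \<and> a (K + 1) \<le> rv s' ''base'' \<and> rv s' ''tot'' \<le> b (K + 1) \<and>
       t1 + (t + t') + Tm * items (K + 1) s' \<le> Tm * (items K s + (pe (K + 1) - ps (K + 1)) + 3)))"
    proof (rule wp_use[OF remove_loop[OF 1(1) k]], elim conjE)
      fix t2 s2 assume 2: "gst (K + 1) s2" "rv s2 ''tot'' \<le> b (K + 1)"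
        "t2 + Tm * items (K + 1) s2 \<le> Tm * (items (K + 1) s1 + 1) + 20"
      show "wp f (While (RLt (RV ''base'') (RGet ''a'' (IV ''K''))) take_min) s2 (\<lambda>t' s'.
       gst (K + 1) s' \<and> a (K + 1) \<le> rv s' ''base'' \<and> rv s' ''tot'' \<le> b (K + 1) \<and>
       t1 + (t2 + t') + Tm * items (K + 1) s' \<le> Tm * (items K s + (pe (K + 1) - ps (K + 1)) + 3))"
      proof (rule wp_use[OF take_loop[OF 2(1) k]], elim conjE)
        fix t3 s3 assume 3: "gst (K + 1) s3" "a (K + 1) \<le> rv s3 ''base''"
          "t3 + Tm * items (K + 1) s3 \<le> Tm * (items (K + 1) s2 + 1) + 20"
          and fr: "frame (While (RLt (RV ''base'') (RGet ''a'' (IV ''K''))) take_min) s2 s3"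
        have "rv s3 ''tot'' = rv s2 ''tot''" using frameR[OF fr] by simp
        moreover have "t1 + (t2 + t3) + Tm * items (K + 1) s3 \<le> Tm * (items (K + 1) s1 + 3)"
        proof -
          define T where "T = Tm"
          have "t1 + 40 \<le> T" using 1(2) by (simp add: T_def)
          moreover have "t2 + T * items (K + 1) s2 \<le> T * items (K + 1) s1 + T + 20"
            using 2(3) unfolding T_def[symmetric] add_mult_distrib2 mult_1_right .
          moreover have "t3 + T * items (K + 1) s3 \<le> T * items (K + 1) s2 + T + 20"
            using 3(3) unfolding T_def[symmetric] add_mult_distrib2 mult_1_right .
          moreover have "T * (items (K + 1) s1 + 3) = T * items (K + 1) s1 + 3 * T"
            by (simp only: add_mult_distrib2 mult.commute[of T 3])
          ultimately have "t1 + (t2 + t3) + T * items (K + 1) s3 \<le> T * (items (K + 1) s1 + 3)" by linarith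
          then show ?thesis by (simp only: T_def)
        qed
        ultimately show "gst (K + 1) s3 \<and> a (K + 1) \<le> rv s3 ''base'' \<and> rv s3 ''tot'' \<le> b (K + 1) \<and>
          t1 + (t2 + t3) + Tm * items (K + 1) s3 \<le> Tm * (items K s + (pe (K + 1) - ps (K + 1)) + 3)"
          using 2(2) 3(1,2) 1(3) by simp
      qed
    qed
  qed
qed

end

definition init_trees :: com where
  "init_trees = IS ''k'' (IConst 1) ;; While (ILt (IV ''k'') (IAdd (IV ''M'') (IV ''M'')))
     (RSet ''tmax'' (IV ''k'') (RSub (RConst (-1)) (RV ''BIG'')) ;;
      RSet ''tmin'' (IV ''k'') (RSub (RConst (-1)) (RV ''BIG'')) ;; inc ''k'')"

definition greedy :: com where
  "greedy = IS ''M'' (IAdd (IV ''m'') (IConst 1)) ;; IS ''K'' (IConst 0) ;; RS ''base'' (RConst 0) ;;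
     RS ''tot'' (RConst 0) ;; init_trees ;; While (ILt (IV ''K'') (IV ''m'')) greedy_step"

lemma mods_init_trees [simp]: "imods init_trees = {''k''}" "rmods init_trees = {''tmax'', ''tmin''}"
  by (auto simp: init_trees_def)

lemma mods_greedy [simp]: "imods greedy = {''M'', ''k'', ''K'', ''j'', ''hd'', ''tl'', ''pos'', ''p''}"
  "rmods greedy = {''base'', ''tot'', ''th'', ''la'', ''Y'', ''val'', ''tmax'', ''tmin'', ''need'', ''Wt''}"
  by (auto simp: greedy_def)

lemma init_trees:
  assumes "iv s ''M'' = M" "1 \<le> M"
  shows "wp f init_trees s (\<lambda>t s'. t \<le> 80 * M + 10 \<and> (\<forall>k. 1 \<le> k \<and> k < 2 * M \<longrightarrow>
    rmem s' ''tmax'' k = - 1 - rv s ''BIG'' \<and> rmem s' ''tmin'' k = - 1 - rv s ''BIG''))"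
  unfolding init_trees_def wp_Seq wp_ISet
proof (rule wp_while[where V = "\<lambda>s'. 40 * (2 * M - iv s' ''k'')" and I = "\<lambda>s'. 1 \<le> iv s' ''k'' \<and> iv s' ''k'' \<le> 2 * M \<and>
      (\<forall>k. 1 \<le> k \<and> k < iv s' ''k'' \<longrightarrow>
      rmem s' ''tmax'' k = - 1 - rv s ''BIG'' \<and> rmem s' ''tmin'' k = - 1 - rv s ''BIG'')"], goal_cases)
  case 1 show ?case using assms by simp
next
  case (2 s1)
  have e: "iv s1 ''M'' = M" "rv s1 ''BIG'' = rv s ''BIG''" using frameI[OF 2(3)] frameR[OF 2(3)] assms by simp_all
  have lt: "iv s1 ''k'' < 2 * M" using 2(2) e by simp
  then have p: "40 + 40 * (2 * M - (iv s1 ''k'' + 1)) \<le> 40 * (2 * M - iv s1 ''k'')" by simp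
  have st: "k = iv s1 ''k'' \<or> k < iv s1 ''k''" if "k < iv s1 ''k'' + 1" for k using that by auto
  show ?case using 2(1) lt p st by (simp add: e)
next
  case (3 t s1)
  have e: "iv s1 ''M'' = M" using frameI[OF 3(3)] assms by simp
  have "iv s1 ''k'' = 2 * M" using 3(1,2) e by simp
  moreover have "40 * (2 * M - 1) + 40 \<le> 80 * M" using assms(2) by simp
  ultimately show ?case using 3(1,4) by simp
qed

context greedy_data
begin

text \<open>An item enters once and is used up at most once, so the number of tree operations is
  bounded by items plus a constant per block. The potential counts the items present, those still to
  come, and four units per remaining block: three for \<open>greedy_step\<close> and one for the
  test of the outer loop.\<close>

lemma greedy:
  assumes e: "genv (iset ''M'' 0 (m + 1) s)"
    and W: "\<And>j p. 1 \<le> j \<Longrightarrow> j \<le> m \<Longrightarrow> ps j \<le> p \<Longrightarrow> p < pe j \<Longrightarrow> rmem s ''Wt'' p = W0 p"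
  shows "wp f greedy s (\<lambda>t s'. (\<exists>hp tp Wt base tot. ginv m hp tp Wt (rmem s' ''th'') (rmem s' ''la'') (rmem s' ''Y'') base tot \<and>
       a m \<le> base \<and> tot \<le> b m) \<and>
     t \<le> Tm * ((\<Sum>j=1..m. pe j - ps j) + 4 * m) + 200 * (m + 1))"
proof -
  define rest where "rest K = (\<Sum>j\<in>{K<..m}. pe j - ps j)" for K
  have rest_Suc: "rest K = (pe (K + 1) - ps (K + 1)) + rest (K + 1)" if "K < m" for K
  proof -
    have "{K<..m} = insert (K + 1) {K + 1<..m}" using that by auto
    then show ?thesis unfolding rest_def by simp
  qed
  have rest0: "rest 0 = (\<Sum>j=1..m. pe j - ps j)"
    unfolding rest_def by (intro sum.cong) (auto simp: Suc_le_eq)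
  have restm: "rest m = 0" by (simp add: rest_def)
  define T where "T = Tm"
  have M1: "1 \<le> m + 1" by simp
  have m: "iv s ''m'' = m" "rv s ''BIG'' = BIG" using e by (simp_all add: genv_def)
  show ?thesis
    unfolding greedy_def wp_Seq wp_ISet wp_RSet
  proof (rule wp_use[OF init_trees[where M = "m + 1"]], goal_cases)
    case 1 show ?case by (simp add: m)
  next
    case 2 show ?case by simp
  next
    case (3 t0 s0)
    note fI = frameI[OF 3(2)] and fR = frameR[OF 3(2)]
    have ge: "genv s0" using e unfolding genv_def by (simp add: fI fR m)
    have Wt0: "rmem s0 ''Wt'' = rmem s ''Wt''" "iv s0 ''K'' = 0" "rv s0 ''base'' = 0" "rv s0 ''tot'' = 0"
      by (simp_all add: fI fR)
    have tv: "rmem s0 ''tmax'' k = - 1 - BIG \<and> rmem s0 ''tmin'' k = - 1 - BIG" if "1 \<le> k" "k < 2 * (m + 1)" for k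
      using conjunct2[OF 3(1)] that m by simp
    have "trees {} 0 (imem s0 ''hd'') (imem s0 ''tl'') (rmem s0 ''tmax'') (rmem s0 ''tmin'')"
      unfolding trees_def tree_ok_def kmax_def kmin_def
    proof (intro conjI allI impI)
      fix k assume "1 \<le> k \<and> k < m + 1"
      then have "1 \<le> k" "k < 2 * (m + 1)" "1 \<le> 2 * k" "2 * k < 2 * (m + 1)" "1 \<le> 2 * k + 1" "2 * k + 1 < 2 * (m + 1)"
        by simp_all
      then show "rmem s0 ''tmax'' k = max (rmem s0 ''tmax'' (2 * k)) (rmem s0 ''tmax'' (2 * k + 1))"
        "rmem s0 ''tmin'' k = max (rmem s0 ''tmin'' (2 * k)) (rmem s0 ''tmin'' (2 * k + 1))"
        using tv[of k] tv[of "2 * k"] tv[of "2 * k + 1"] by simp_all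
    next
      fix j assume j: "j \<le> m \<and> j \<notin> {}"
      show "rmem s0 ''tmax'' (m + 1 + j) =
         (if 1 \<le> j \<and> j \<le> 0 \<and> imem s0 ''hd'' j < imem s0 ''tl'' j then P (imem s0 ''tl'' j - 1) else - 1 - BIG)"
        "rmem s0 ''tmin'' (m + 1 + j) =
         (if 1 \<le> j \<and> j \<le> 0 \<and> imem s0 ''hd'' j < imem s0 ''tl'' j then - P (imem s0 ''hd'' j) else - 1 - BIG)"
        using tv[of "m + 1 + j"] j by simp_all
    qed
    moreover have "ginv 0 (imem s0 ''hd'') (imem s0 ''tl'') (rmem s0 ''Wt'') (rmem s0 ''th'') (rmem s0 ''la'') (rmem s0 ''Y'') 0 0"
      by (rule ginv_0) (simp add: Wt0 W)
    ultimately have S0: "gst 0 s0" using ge Wt0 unfolding gst_def by simp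
    have t0: "t0 \<le> 80 * (m + 1) + 10" using 3(1) by blast
    show ?case
    proof (rule wp_while[where I = "\<lambda>s. iv s ''K'' \<le> m \<and> gst (iv s ''K'') s \<and>
          (1 \<le> iv s ''K'' \<longrightarrow> a (iv s ''K'') \<le> rv s ''base'' \<and> rv s ''tot'' \<le> b (iv s ''K''))"
        and V = "\<lambda>s. T * (items (iv s ''K'') s + rest (iv s ''K'') + 4 * (m - iv s ''K''))"], goal_cases)
      case 1 show ?case using S0 Wt0 by simp
    next
      case (2 s1)
      define K where "K = iv s1 ''K''"
      have "iv s1 ''m'' = m" using 2(1) by (simp add: gst_def genv_def)
      then have K: "K < m" using 2(2) by (simp add: K_def)
      have S: "gst K s1" and fin: "1 \<le> K \<Longrightarrow> a K \<le> rv s1 ''base'' \<and> rv s1 ''tot'' \<le> b K"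
        using 2(1) by (simp_all add: K_def)
      show ?case unfolding K_def[symmetric]
      proof (rule wp_use[OF greedy_step[OF S K fin]], assumption, elim conjE)
        fix t s2 assume q: "gst (K + 1) s2" "a (K + 1) \<le> rv s2 ''base''" "rv s2 ''tot'' \<le> b (K + 1)"
          "t + Tm * items (K + 1) s2 \<le> Tm * (items K s1 + (pe (K + 1) - ps (K + 1)) + 3)"
        have K2: "iv s2 ''K'' = K + 1" using q(1) by (simp add: gst_def)
        define p where "p = m - (K + 1)"
        have mK: "m - K = p + 1" using K by (simp add: p_def)
        have r: "T * (items K s1 + rest K + 4 * (m - K)) =
            T * (items K s1 + (pe (K + 1) - ps (K + 1)) + 3) + T * (rest (K + 1) + 4 * p) + T"
          unfolding rest_Suc[OF K] mK by (simp add: algebra_simps)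
        have l: "T * (items (K + 1) s2 + rest (K + 1) + 4 * p) =
            T * items (K + 1) s2 + T * (rest (K + 1) + 4 * p)"
          by (simp add: algebra_simps)
        have bt: "1 + btime (ILt (IV ''K'') (IV ''m'')) \<le> T" by (simp add: T_def)
        have "1 + btime (ILt (IV ''K'') (IV ''m'')) + t + T * (items (K + 1) s2 + rest (K + 1) + 4 * p)
            \<le> T * (items K s1 + rest K + 4 * (m - K))"
          using q(4)[folded T_def] bt unfolding r l by linarith
        then show "(iv s2 ''K'' \<le> m \<and> gst (iv s2 ''K'') s2 \<and>
            (1 \<le> iv s2 ''K'' \<longrightarrow> a (iv s2 ''K'') \<le> rv s2 ''base'' \<and> rv s2 ''tot'' \<le> b (iv s2 ''K''))) \<and>
          1 + btime (ILt (IV ''K'') (IV ''m'')) + t + T * (items (iv s2 ''K'') s2 + rest (iv s2 ''K'') + 4 * (m - iv s2 ''K''))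
            \<le> T * (items K s1 + rest K + 4 * (m - K))"
          using K q(1-3) unfolding K2 p_def by simp
      qed
    next
      case (3 t s1)
      have "iv s1 ''m'' = m" using 3(1) by (simp add: gst_def genv_def)
      then have K: "iv s1 ''K'' = m" using 3(1,2) by simp
      have "items 0 s0 = 0" by (simp add: items_def)
      then have V0: "T * (items (iv s0 ''K'') s0 + rest (iv s0 ''K'') + 4 * (m - iv s0 ''K'')) =
          T * ((\<Sum>j=1..m. pe j - ps j) + 4 * m)"
        by (simp add: Wt0 rest0)
      have "t \<le> T * ((\<Sum>j=1..m. pe j - ps j) + 4 * m) + 10" using 3(4) unfolding V0 by simp
      moreover have "\<exists>hp tp Wt base tot. ginv m hp tp Wt (rmem s1 ''th'') (rmem s1 ''la'') (rmem s1 ''Y'') base tot \<and>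
          a m \<le> base \<and> tot \<le> b m"
        using 3(1) m1 unfolding K gst_def by blast
      moreover have "80 * (m + 1) + 100 \<le> 200 * (m + 1)" using m1 by simp
      ultimately show ?case using t0 unfolding T_def[symmetric] by (simp del: distrib_left_numeral)
    qed
  qed
qed

end

section \<open>Cells and their slopes\<close>

text \<open>Item \<open>k\<close> stands for the cell from \<open>c + k u\<close> to
  \<open>c + (k + 1) u\<close>, but its slope is measured on the next cell. By convexity this number
  is an upper bound for the slopes of \<open>F\<close> on the item's own cell and a lower bound for
  those from \<open>c + (k + 2) u\<close> on, which replaces one-sided derivatives. All evaluations
  stay inside the interval.\<close>

definition slope :: "(nat \<Rightarrow> real \<Rightarrow> real) \<Rightarrow> (nat \<Rightarrow> real) \<Rightarrow> real \<Rightarrow> nat \<Rightarrow> nat \<Rightarrow> real" where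
  "slope F c u i k = (F i (c i + real (k + 2) * u) - F i (c i + real (k + 1) * u)) / u"

text \<open>The sign \<open>g\<close> lets one program serve both a problem and its mirror image,
  whose cost at \<open>x\<close> is the given cost at \<open>- x\<close>. Evaluating once per grid
  point suffices, as \<open>f1\<close> carries the last value over.\<close>

definition build_var :: com where
  "build_var = RS ''x1'' (RAdd (RGet ''c'' (IV ''v'')) (RV ''u'')) ;; RS ''x2'' (RAdd (RV ''x1'') (RV ''u'')) ;;
     RS ''f1'' (REval (IV ''v'') (RMul (RV ''g'') (RV ''x1''))) ;;
     While (RLe (RV ''x2'') (RGet ''d'' (IV ''v'')))
       (RS ''f2'' (REval (IV ''v'') (RMul (RV ''g'') (RV ''x2''))) ;;
        RS ''sl'' (RDiv (RSub (RV ''f2'') (RV ''f1'')) (RV ''u'')) ;;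
        RSet ''Q'' (IV ''q'') (RV ''sl'') ;;
        Cond (RLe (RV ''BIG'') (RV ''sl'')) (RS ''BIG'' (RV ''sl'')) Skip ;;
        Cond (RLe (RV ''BIG'') (RSub (RConst 0) (RV ''sl''))) (RS ''BIG'' (RSub (RConst 0) (RV ''sl''))) Skip ;;
        inc ''q'' ;; RS ''f1'' (RV ''f2'') ;; RS ''x2'' (RAdd (RV ''x2'') (RV ''u'')))"

lemma mods_build_var [simp]: "imods build_var = {''q''}"
  "rmods build_var = {''x1'', ''x2'', ''f1'', ''f2'', ''sl'', ''Q'', ''BIG''}"
  by (auto simp: build_var_def)

definition build_inv where
  "build_inv F c d u i q0 Q0 B0 q (Q :: nat \<Rightarrow> real) B x2 f1 \<longleftrightarrow>
     q0 \<le> q \<and> x2 = c i + real (q - q0 + 2) * u \<and> f1 = F i (c i + real (q - q0 + 1) * u) \<and>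
     (\<forall>k<q - q0. Q (q0 + k) = slope F c u i k \<and> c i + real (k + 2) * u \<le> d i \<and> \<bar>Q (q0 + k)\<bar> \<le> B) \<and>
     (\<forall>k<q0. Q k = Q0 k) \<and> (B0 :: real) \<le> B"

lemma build_inv_step:
  assumes I: "build_inv F c d u i q0 Q0 B0 q Q B x2 f1" and x2: "x2 \<le> d i"
    and sl: "sl = (F i x2 - f1) / u" and B': "B \<le> B'" "\<bar>sl\<bar> \<le> B'"
  shows "build_inv F c d u i q0 Q0 B0 (q + 1) (Q(q := sl)) B' (x2 + u) (F i x2)"
proof -
  have q: "q0 \<le> q" "x2 = c i + real (q - q0 + 2) * u" "f1 = F i (c i + real (q - q0 + 1) * u)"
    using I unfolding build_inv_def by blast+
  have d: "q + 1 - q0 = (q - q0) + 1" using q(1) by simp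
  have "(Q(q := sl)) (q0 + k) = slope F c u i k \<and> c i + real (k + 2) * u \<le> d i \<and> \<bar>(Q(q := sl)) (q0 + k)\<bar> \<le> B'"
    if k: "k < q + 1 - q0" for k
  proof (cases "k = q - q0")
    case True
    then have "q0 + k = q" using q(1) by simp
    then show ?thesis using True x2 q sl B'(2) by (simp add: slope_def)
  next
    case False
    then have "k < q - q0" "q0 + k \<noteq> q" using k q(1) by arith+
    moreover have "\<forall>k<q - q0. Q (q0 + k) = slope F c u i k \<and> c i + real (k + 2) * u \<le> d i \<and> \<bar>Q (q0 + k)\<bar> \<le> B"
      using I unfolding build_inv_def by blast
    ultimately have "Q (q0 + k) = slope F c u i k \<and> c i + real (k + 2) * u \<le> d i \<and> \<bar>Q (q0 + k)\<bar> \<le> B"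
      by blast
    moreover have "(Q(q := sl)) (q0 + k) = Q (q0 + k)" using \<open>q0 + k \<noteq> q\<close> by simp
    ultimately show ?thesis using B'(1) by linarith
  qed
  moreover have "x2 + u = c i + real (q + 1 - q0 + 2) * u" using q(2) unfolding d by (simp add: algebra_simps)
  moreover have "F i x2 = F i (c i + real (q + 1 - q0 + 1) * u)" using q(2) unfolding d by simp
  moreover have "\<forall>k<q0. (Q(q := sl)) k = Q0 k" using I q(1) by (simp add: build_inv_def)
  moreover have "B0 \<le> B'" using I B'(1) by (simp add: build_inv_def)
  moreover have "q0 \<le> q + 1" using q(1) by simp
  ultimately show ?thesis unfolding build_inv_def by blast
qed

text \<open>The number of grid points \<open>x2\<close>, \<open>x2 + u\<close>, ... up to
  \<open>d\<close>; truncation by \<open>nat\<close> yields 0 if there is none.\<close>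

definition steps :: "real \<Rightarrow> real \<Rightarrow> real \<Rightarrow> nat" where
  "steps d u x2 = nat \<lfloor>(d - x2) / u + 1\<rfloor>"

lemma steps_step:
  assumes "0 < u" "x2 \<le> d"
  shows "steps d u x2 = steps d u (x2 + u) + 1"
proof -
  have "(d - x2) / u + 1 = ((d - (x2 + u)) / u + 1) + 1" using assms by (simp add: field_simps)
  moreover have "0 \<le> (d - (x2 + u)) / u + 1" using assms by (simp add: field_simps)
  then have "0 \<le> \<lfloor>(d - (x2 + u)) / u + 1\<rfloor>" by (simp only: zero_le_floor)
  ultimately show ?thesis unfolding steps_def by linarith
qed

lemma steps_0: "0 < u \<Longrightarrow> d < x2 \<Longrightarrow> steps d u x2 = 0"
proof -
  assume "0 < u" "d < x2"
  then have "(d - x2) / u + 1 < 1" by (simp add: divide_neg_pos)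
  then have "\<lfloor>(d - x2) / u + 1\<rfloor> \<le> 0" by linarith
  then show ?thesis by (simp add: steps_def)
qed

lemma build_var:
  fixes f :: oracle_fun
  assumes u: "0 < u" and s: "iv s ''v'' = i" "rmem s ''c'' = c" "rmem s ''d'' = d" "rv s ''u'' = u" "rv s ''g'' = g"
    and F: "\<And>i x. F i x = f i (g * x)"
  shows "wp f build_var s (\<lambda>t s'. let q0 = iv s ''q''; q = iv s' ''q''; Q = rmem s' ''Q'' in
    t \<le> 80 * (q - q0) + 60 \<and> q = q0 + steps (d i) u (c i + 2 * u) \<and> d i < c i + real (q - q0 + 2) * u \<and> rv s ''BIG'' \<le> rv s' ''BIG'' \<and>
    (\<forall>k<q - q0. Q (q0 + k) = slope F c u i k \<and> c i + real (k + 2) * u \<le> d i \<and> \<bar>Q (q0 + k)\<bar> \<le> rv s' ''BIG'') \<and>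
    (\<forall>k<q0. Q k = rmem s ''Q'' k))"
proof -
  define q0 where "q0 = iv s ''q''"
  define N where "N = steps (d i) u (c i + 2 * u)"
  let ?I = "\<lambda>s'. build_inv F c d u i q0 (rmem s ''Q'') (rv s ''BIG'') (iv s' ''q'') (rmem s' ''Q'') (rv s' ''BIG'')
    (rv s' ''x2'') (rv s' ''f1'') \<and> iv s' ''q'' - q0 + steps (d i) u (rv s' ''x2'') = N"
  show ?thesis
    unfolding build_var_def wp_Seq wp_RSet
  proof (rule wp_while[where I = ?I and V = "\<lambda>s'. 80 * steps (d i) u (rv s' ''x2'')"], goal_cases)
    case 1
    show ?case by (simp add: s build_inv_def F N_def q0_def add.assoc)
  next
    case (2 s1)
    have e: "iv s1 ''v'' = i" "rmem s1 ''d'' = d" "rv s1 ''u'' = u" "rv s1 ''g'' = g"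
      using frameI[OF 2(3)] frameR[OF 2(3)] s by simp_all
    define q x2 f1 B where v: "q = iv s1 ''q''" "x2 = rv s1 ''x2''" "f1 = rv s1 ''f1''" "B = rv s1 ''BIG''"
    have x2: "x2 \<le> d i" using 2(2) e by (simp add: v)
    define sl where "sl = (F i x2 - f1) / u"
    have I: "build_inv F c d u i q0 (rmem s ''Q'') (rv s ''BIG'') q (rmem s1 ''Q'') B x2 f1" "q - q0 + steps (d i) u x2 = N"
      using 2(1) by (simp_all add: v)
    have qq: "q0 \<le> q" using I(1) by (simp add: build_inv_def)
    note st = build_inv_step[OF I(1) x2 sl_def]
    note sp = steps_step[OF u x2]
    have ct: "q + 1 - q0 + steps (d i) u (x2 + u) = N" using I(2) sp qq by simp
    \<comment> \<open>The two tests of the program replace \<open>BIG\<close> by the largest of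
      \<open>BIG\<close>, \<open>sl\<close> and \<open>- sl\<close>; the facts \<open>s1\<close> to
      \<open>s4\<close> correspond to their four outcomes.\<close>
    have s1: "build_inv F c d u i q0 (rmem s ''Q'') (rv s ''BIG'') (q + 1) ((rmem s1 ''Q'')(q := sl)) sl (x2 + u) (F i x2)"
      if "B \<le> sl" "\<not> sl \<le> - sl" using that by (intro st) auto
    have s2: "build_inv F c d u i q0 (rmem s ''Q'') (rv s ''BIG'') (q + 1) ((rmem s1 ''Q'')(q := sl)) (- sl) (x2 + u) (F i x2)"
      if "B \<le> sl" "sl \<le> - sl" using that by (intro st) auto
    have s3: "build_inv F c d u i q0 (rmem s ''Q'') (rv s ''BIG'') (q + 1) ((rmem s1 ''Q'')(q := sl)) (- sl) (x2 + u) (F i x2)"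
      if "\<not> B \<le> sl" "B \<le> - sl" using that by (intro st) auto
    have s4: "build_inv F c d u i q0 (rmem s ''Q'') (rv s ''BIG'') (q + 1) ((rmem s1 ''Q'')(q := sl)) B (x2 + u) (F i x2)"
      if "\<not> B \<le> sl" "\<not> B \<le> - sl" using that by (intro st) auto
    have lo: "f i (g * x2) = F i x2" by (simp add: F)
    have sl': "(F i x2 - f1) / u = sl" by (simp add: sl_def)
    consider "B \<le> sl" "\<not> sl \<le> - sl" | "B \<le> sl" "sl \<le> - sl" | "\<not> B \<le> sl" "B \<le> - sl" | "\<not> B \<le> sl" "\<not> B \<le> - sl"
      by blast
    then show ?case
    proof cases
      case 1 show ?thesis
        using s1[OF 1] ct sp 1 by (simp add: e v[symmetric] lo sl')
    next
      case 2 show ?thesis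
        using s2[OF 2] ct sp 2 by (simp add: e v[symmetric] lo sl')
    next
      case 3 show ?thesis
        using s3[OF 3] ct sp 3 by (simp add: e v[symmetric] lo sl')
    next
      case 4 show ?thesis
        using s4[OF 4] ct sp 4 by (simp add: e v[symmetric] lo sl')
    qed
  next
    case (3 t s1)
    have e: "iv s1 ''v'' = i" "rmem s1 ''d'' = d" using frameI[OF 3(3)] frameR[OF 3(3)] s by simp_all
    have gt: "d i < rv s1 ''x2''" using 3(2) e by simp
    have I: "build_inv F c d u i q0 (rmem s ''Q'') (rv s ''BIG'') (iv s1 ''q'') (rmem s1 ''Q'') (rv s1 ''BIG'')
      (rv s1 ''x2'') (rv s1 ''f1'')" "iv s1 ''q'' - q0 = N"
      using 3(1) steps_0[OF u gt] by simp_all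
    have "t \<le> 80 * N + 20" using 3(4) by (simp add: s N_def add.assoc)
    moreover have b: "\<forall>k<iv s1 ''q'' - q0. rmem s1 ''Q'' (q0 + k) = slope F c u i k \<and> c i + real (k + 2) * u \<le> d i \<and>
        \<bar>rmem s1 ''Q'' (q0 + k)\<bar> \<le> rv s1 ''BIG''" "\<forall>k<q0. rmem s1 ''Q'' k = rmem s ''Q'' k"
      "rv s ''BIG'' \<le> rv s1 ''BIG''" "q0 \<le> iv s1 ''q''"
      "rv s1 ''x2'' = c i + real (iv s1 ''q'' - q0 + 2) * u"
      using I(1) unfolding build_inv_def by blast+
    ultimately show ?case
      unfolding Let_def q0_def[symmetric] by (intro conjI b) (use gt I(2) b(4) in \<open>simp_all add: N_def\<close>)
  qed
qed

text \<open>The cells are stored variable by variable, those of \<open>i\<close> from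
  \<open>vstart cc i\<close> on. A block of consecutive variables thus owns a contiguous
  segment.\<close>

definition vstart :: "(nat \<Rightarrow> nat) \<Rightarrow> nat \<Rightarrow> nat" where
  "vstart cc i = sum cc {1..<i}"

lemma vstart_1 [simp]: "vstart cc 1 = 0"
  by (simp add: vstart_def)

lemma vstart_Suc: "1 \<le> i \<Longrightarrow> vstart cc (i + 1) = vstart cc i + cc i"
  by (simp add: vstart_def flip: Suc_eq_plus1)

lemma vstart_mono: "i \<le> j \<Longrightarrow> vstart cc i \<le> vstart cc j"
  unfolding vstart_def by (rule sum_mono2) auto

definition cells :: "(nat \<Rightarrow> real \<Rightarrow> real) \<Rightarrow> (nat \<Rightarrow> real) \<Rightarrow> real \<Rightarrow> (nat \<Rightarrow> nat) \<Rightarrow> nat \<Rightarrow> (nat \<Rightarrow> nat) \<Rightarrow>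
    (nat \<Rightarrow> real) \<Rightarrow> real \<Rightarrow> bool" where
  "cells F c u cc n vs Q B \<longleftrightarrow> (\<forall>i. 1 \<le> i \<and> i \<le> n + 1 \<longrightarrow> vs i = vstart cc i) \<and>
     (\<forall>i k. 1 \<le> i \<and> i \<le> n \<and> k < cc i \<longrightarrow> Q (vstart cc i + k) = slope F c u i k \<and> \<bar>slope F c u i k\<bar> \<le> B)"

section \<open>Listing the cells of all variables\<close>

lemma cells_0: "vs 1 = 0 \<Longrightarrow> cells F c u cc 0 vs Q B"
proof -
  assume vs: "vs 1 = 0"
  have "vs i = vstart cc i" if "1 \<le> i" "i \<le> 0 + 1" for i
  proof -
    have "i = 1" using that by simp
    then show ?thesis using vs by simp
  qed
  then have "\<forall>i. 1 \<le> i \<and> i \<le> 0 + 1 \<longrightarrow> vs i = vstart cc i" by blast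
  moreover have "\<forall>i k. 1 \<le> i \<and> i \<le> 0 \<and> k < cc i \<longrightarrow> Q (vstart cc i + k) = slope F c u i k \<and> \<bar>slope F c u i k\<bar> \<le> B"
    by simp
  ultimately show ?thesis unfolding cells_def by blast
qed

lemma cells_step:
  assumes C: "cells F c u cc V vs Q B" and B: "B \<le> B'"
    and Q: "\<forall>k<cc (V + 1). Q' (vstart cc (V + 1) + k) = slope F c u (V + 1) k \<and> \<bar>Q' (vstart cc (V + 1) + k)\<bar> \<le> B'"
      "\<forall>k<vstart cc (V + 1). Q' k = Q k"
  shows "cells F c u cc (V + 1) (vs(V + 2 := vstart cc (V + 1) + cc (V + 1))) Q' B'"
  unfolding cells_def
proof (intro conjI allI impI; elim conjE)
  fix i assume i: "1 \<le> i" "i \<le> V + 1 + 1"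
  show "(vs(V + 2 := vstart cc (V + 1) + cc (V + 1))) i = vstart cc i"
  proof (cases "i = V + 2")
    case True
    then have "i = V + 1 + 1" by simp
    then have "vstart cc i = vstart cc (V + 1) + cc (V + 1)"
      using vstart_Suc[of "V + 1" cc] by (simp only: le_add2)
    then show ?thesis using True by simp
  next
    case False
    then have "i \<le> V + 1" using i by simp
    then show ?thesis using C i(1) False unfolding cells_def by simp
  qed
next
  fix i k assume i: "1 \<le> i" "i \<le> V + 1" "k < cc i"
  show "Q' (vstart cc i + k) = slope F c u i k" "\<bar>slope F c u i k\<bar> \<le> B'"
  proof -
    have "Q' (vstart cc i + k) = slope F c u i k \<and> \<bar>slope F c u i k\<bar> \<le> B'"
    proof (cases "i = V + 1")
      case True
      have "Q' (vstart cc (V + 1) + k) = slope F c u (V + 1) k \<and> \<bar>Q' (vstart cc (V + 1) + k)\<bar> \<le> B'"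
        using Q(1) i(3) unfolding True by blast
      then show ?thesis unfolding True by metis
    next
      case False
      then have iV: "i \<le> V" using i by simp
      have "vstart cc i + k < vstart cc (i + 1)" using vstart_Suc[OF i(1)] i(3) by simp
      also have "\<dots> \<le> vstart cc (V + 1)" using iV by (intro vstart_mono) simp
      finally have "Q' (vstart cc i + k) = Q (vstart cc i + k)" using Q(2) by blast
      moreover have "Q (vstart cc i + k) = slope F c u i k \<and> \<bar>slope F c u i k\<bar> \<le> B"
        using C i(1,3) iV unfolding cells_def by blast
      ultimately show ?thesis using B by linarith
    qed
    then show "Q' (vstart cc i + k) = slope F c u i k" "\<bar>slope F c u i k\<bar> \<le> B'" by blast+
  qed
qed

text \<open>The final increment puts \<open>BIG\<close> strictly above every slope. It can then
  serve as the price of the spare capacity of a block, and a threshold below \<open>BIG\<close>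
  separates that capacity from all cells.\<close>

definition build :: com where
  "build = IS ''q'' (IConst 0) ;; IS ''v'' (IConst 0) ;; RS ''BIG'' (RConst 1) ;; ISet ''vs'' (IConst 1) (IConst 0) ;;
     While (ILt (IV ''v'') (IV ''n'')) (inc ''v'' ;; build_var ;; ISet ''vs'' (IAdd (IV ''v'') (IConst 1)) (IV ''q'')) ;;
     RS ''BIG'' (RAdd (RV ''BIG'') (RConst 1))"

lemma mods_build [simp]: "imods build = {''q'', ''v'', ''vs''}"
  "rmods build = {''x1'', ''x2'', ''f1'', ''f2'', ''sl'', ''Q'', ''BIG''}"
  by (auto simp: build_def)

lemma build:
  fixes f :: oracle_fun
  assumes u: "0 < u" and s: "iv s ''n'' = n" "rmem s ''c'' = c" "rmem s ''d'' = d" "rv s ''u'' = u" "rv s ''g'' = g"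
    and F: "\<And>i x. F i x = f i (g * x)"
  defines "cc \<equiv> \<lambda>i. steps (d i) u (c i + 2 * u)"
  shows "wp f build s (\<lambda>t s'. t \<le> 80 * vstart cc (n + 1) + 100 * n + 50 \<and> 2 \<le> rv s' ''BIG'' \<and>
    cells F c u cc n (imem s' ''vs'') (rmem s' ''Q'') (rv s' ''BIG'' - 1))"
proof -
  let ?I = "\<lambda>s'. iv s' ''v'' \<le> n \<and> iv s' ''q'' = vstart cc (iv s' ''v'' + 1) \<and> 1 \<le> rv s' ''BIG'' \<and>
    cells F c u cc (iv s' ''v'') (imem s' ''vs'') (rmem s' ''Q'') (rv s' ''BIG'')"
  show ?thesis
    unfolding build_def wp_Seq wp_RSet wp_ISet
  proof (rule wp_while[where I = ?I and V = "\<lambda>s'. 80 * (vstart cc (n + 1) - iv s' ''q'') + 100 * (n - iv s' ''v'')"], goal_cases)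
    case 1
    show ?case by (simp add: cells_0)
  next
    case (2 s1)
    define V where "V = iv s1 ''v''"
    have e: "iv s1 ''n'' = n" "rmem s1 ''c'' = c" "rmem s1 ''d'' = d" "rv s1 ''u'' = u" "rv s1 ''g'' = g"
      using frameI[OF 2(3)] frameR[OF 2(3)] s by simp_all
    have V: "V < n" using 2(2) e by (simp add: V_def)
    have I: "iv s1 ''q'' = vstart cc (V + 1)" "1 \<le> rv s1 ''BIG''"
      "cells F c u cc V (imem s1 ''vs'') (rmem s1 ''Q'') (rv s1 ''BIG'')"
      using 2(1) by (simp_all add: V_def)
    show ?case
      apply (simp add: V_def[symmetric])
      apply (rule wp_use[OF build_var[where u = u and i = "V + 1" and c = c and d = d and g = g and F = F]])
             apply (rule u)
            apply (simp_all add: e F)[6]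
      subgoal premises p for t s2
      proof -
        note fI = frameI[OF p(2)] and fR = frameR[OF p(2)]
        have q0: "iv (iset ''v'' 0 (V + 1) s1) ''q'' = vstart cc (V + 1)" by (simp add: I(1))
        note h = p(1)[unfolded Let_def q0 rmem_iset]
        have p2: "iv s2 ''q'' = vstart cc (V + 1) + cc (V + 1)" using h unfolding cc_def by blast
        then have e3: "iv s2 ''q'' - vstart cc (V + 1) = cc (V + 1)" by simp
        note h' = h[unfolded e3]
        have p1: "t \<le> 80 * cc (V + 1) + 60" "rv s1 ''BIG'' \<le> rv s2 ''BIG''"
          "\<forall>k<cc (V + 1). rmem s2 ''Q'' (vstart cc (V + 1) + k) = slope F c u (V + 1) k \<and>
             \<bar>rmem s2 ''Q'' (vstart cc (V + 1) + k)\<bar> \<le> rv s2 ''BIG''"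
          "\<forall>k<vstart cc (V + 1). rmem s2 ''Q'' k = rmem s1 ''Q'' k"
          using h' by blast+
        have v2: "iv s2 ''v'' = V + 1" "imem s2 ''vs'' = imem s1 ''vs''" by (simp_all add: fI)
        have C: "cells F c u cc (V + 1) ((imem s1 ''vs'')(V + 2 := vstart cc (V + 1) + cc (V + 1))) (rmem s2 ''Q'') (rv s2 ''BIG'')"
          by (rule cells_step[OF I(3) p1(2,3,4)])
        have vS: "vstart cc (V + 1 + 1) = vstart cc (V + 1) + cc (V + 1)" by (rule vstart_Suc) simp
        have le: "vstart cc (V + 1 + 1) \<le> vstart cc (n + 1)" using V by (intro vstart_mono) simp
        have V2: "V + 1 + 1 = V + 2" by simp
        note p1(1)
        moreover have "80 * (vstart cc (n + 1) - vstart cc (V + 1)) =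
            80 * (vstart cc (n + 1) - (vstart cc (V + 1) + cc (V + 1))) + 80 * cc (V + 1)"
          using le vS by simp
        moreover have "100 * (n - V) = 100 * (n - (V + 1)) + 100" using V by simp
        ultimately have tm: "33 + t + (80 * (vstart cc (n + 1) - (vstart cc (V + 1) + cc (V + 1))) + 100 * (n - (V + 1)))
            \<le> 80 * (vstart cc (n + 1) - vstart cc (V + 1)) + 100 * (n - V)"
          by linarith
        show ?thesis
          using V C I(2) p1(2) vS tm by (simp add: v2 p2 I(1) V2)
      qed
      done
  next
    case (3 t s1)
    have e: "iv s1 ''n'' = n" using frameI[OF 3(3)] s by simp
    have v: "iv s1 ''v'' = n" using 3(1,2) e by simp
    show ?case using 3(1,4) by (simp add: v)
  qed
qed

section \<open>Packing the blocks\<close>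

definition load :: com where
  "load = IS ''k'' (IConst 0) ;; While (ILt (IV ''k'') (IV ''Len''))
     (RSet ''S'' (IV ''k'') (RGet ''Q'' (IAdd (IV ''q'') (IV ''k''))) ;; inc ''k'')"

lemma mods_load [simp]: "imods load = {''k''}" "rmods load = {''S''}"
  by (auto simp: load_def)

lemma load:
  assumes n: "iv s ''Len'' = n"
  shows "wp f load s (\<lambda>t s'. t \<le> 40 * n + 10 \<and> (\<forall>k<n. rmem s' ''S'' k = rmem s ''Q'' (iv s ''q'' + k)))"
  unfolding load_def wp_Seq wp_ISet
proof (rule wp_while[where V = "\<lambda>s'. 40 * (n - iv s' ''k'')" and
      I = "\<lambda>s'. iv s' ''k'' \<le> n \<and> (\<forall>k < iv s' ''k''. rmem s' ''S'' k = rmem s ''Q'' (iv s ''q'' + k))"], goal_cases)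
  case 1
  show ?case by simp
next
  case (2 s')
  have fr: "iv s' ''Len'' = n" "rmem s' ''Q'' = rmem s ''Q''" "iv s' ''q'' = iv s ''q''"
    using frameI[OF 2(3)] frameR[OF 2(3)] n by simp_all
  have "n - iv s' ''k'' = Suc (n - (iv s' ''k'' + 1))" using 2(2) fr by simp
  then show ?case using 2(1,2) fr by (simp add: less_Suc_eq)
next
  case (3 t s')
  have fr: "iv s' ''Len'' = n" using frameI[OF 3(3)] n by simp
  have "iv s' ''k'' = n" using 3(1,2) fr by simp
  then show ?case using 3(1,4) by simp
qed

definition unload :: com where
  "unload = RS ''wu'' (RMul (RV ''w'') (RV ''u'')) ;; IS ''k'' (IConst 0) ;; While (ILt (IV ''k'') (IV ''Len''))
     (RSet ''P'' (IAdd (IV ''pp'') (IV ''k'')) (RGet ''S'' (IV ''k'')) ;;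
      RSet ''Wt'' (IAdd (IV ''pp'') (IV ''k'')) (RV ''wu'') ;; inc ''k'')"

lemma mods_unload [simp]: "imods unload = {''k''}" "rmods unload = {''P'', ''Wt'', ''wu''}"
  by (auto simp: unload_def)

lemma unload:
  assumes n: "iv s ''Len'' = n" and pp: "iv s ''pp'' = pp"
  shows "wp f unload s (\<lambda>t s'. t \<le> 60 * n + 20 \<and> rv s' ''wu'' = rv s ''w'' * rv s ''u'' \<and>
    (\<forall>k<n. rmem s' ''P'' (pp + k) = rmem s ''S'' k \<and> rmem s' ''Wt'' (pp + k) = rv s ''w'' * rv s ''u'') \<and>
    (\<forall>k<pp. rmem s' ''P'' k = rmem s ''P'' k \<and> rmem s' ''Wt'' k = rmem s ''Wt'' k))"
  unfolding unload_def wp_Seq wp_ISet wp_RSet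
proof (rule wp_while[where V = "\<lambda>s'. 60 * (n - iv s' ''k'')" and
      I = "\<lambda>s'. iv s' ''k'' \<le> n \<and> (\<forall>k < iv s' ''k''. rmem s' ''P'' (pp + k) = rmem s ''S'' k \<and>
         rmem s' ''Wt'' (pp + k) = rv s ''w'' * rv s ''u'') \<and>
        (\<forall>k<pp. rmem s' ''P'' k = rmem s ''P'' k \<and> rmem s' ''Wt'' k = rmem s ''Wt'' k)"], goal_cases)
  case 1
  show ?case by simp
next
  case (2 s')
  have fr: "iv s' ''Len'' = n" "rmem s' ''S'' = rmem s ''S''" "iv s' ''pp'' = pp" "rv s' ''wu'' = rv s ''w'' * rv s ''u''"
    using frameI[OF 2(3)] frameR[OF 2(3)] n pp by simp_all
  have "n - iv s' ''k'' = Suc (n - (iv s' ''k'' + 1))" using 2(2) fr by simp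
  then show ?case using 2(1,2) fr by (simp add: less_Suc_eq)
next
  case (3 t s')
  have fr: "iv s' ''Len'' = n" "rv s' ''wu'' = rv s ''w'' * rv s ''u''"
    using frameI[OF 3(3)] frameR[OF 3(3)] n by simp_all
  have "iv s' ''k'' = n" using 3(1,2) fr by simp
  then show ?case using 3(1,4) fr by simp
qed

text \<open>The sum starts at \<open>u\<close> instead of 0, so that the spare item of a block has
  positive weight even if all its intervals are single points.\<close>

definition widths :: com where
  "widths = RS ''wid'' (RV ''u'') ;; RSet ''cs'' (IV ''blk'') (RConst 0) ;;
     IS ''v'' (IGet ''sigma'' (ISub (IV ''blk'') (IConst 1))) ;;
     While (ILt (IV ''v'') (IGet ''sigma'' (IV ''blk'')))
       (inc ''v'' ;; RSet ''cs'' (IV ''blk'') (RAdd (RGet ''cs'' (IV ''blk'')) (RGet ''c'' (IV ''v''))) ;;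
        RS ''wid'' (RAdd (RV ''wid'') (RSub (RGet ''d'' (IV ''v'')) (RGet ''c'' (IV ''v'')))))"

lemma mods_widths [simp]: "imods widths = {''v''}" "rmods widths = {''wid'', ''cs''}"
  by (auto simp: widths_def)

lemma widths:
  assumes s: "imem s ''sigma'' = sg" "iv s ''blk'' = j" "rmem s ''c'' = c" "rmem s ''d'' = d" "rv s ''u'' = u"
    and j: "sg (j - 1) \<le> sg j"
  shows "wp f widths s (\<lambda>t s'. t \<le> 60 * (sg j - sg (j - 1)) + 40 \<and>
    rv s' ''wid'' = u + (\<Sum>i\<in>{sg (j - 1)<..sg j}. d i - c i) \<and>
    rmem s' ''cs'' = (rmem s ''cs'')(j := \<Sum>i\<in>{sg (j - 1)<..sg j}. c i))"
proof -
  have ins: "{a<..v + 1} = insert (v + 1) {a<..v}" if "a \<le> v" for a v :: nat using that by auto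
  show ?thesis
    unfolding widths_def wp_Seq wp_ISet wp_RSet
  proof (rule wp_while[where V = "\<lambda>s'. 60 * (sg j - iv s' ''v'')" and
        I = "\<lambda>s'. sg (j - 1) \<le> iv s' ''v'' \<and> iv s' ''v'' \<le> sg j \<and>
          rv s' ''wid'' = u + (\<Sum>i\<in>{sg (j - 1)<..iv s' ''v''}. d i - c i) \<and>
          rmem s' ''cs'' = (rmem s ''cs'')(j := \<Sum>i\<in>{sg (j - 1)<..iv s' ''v''}. c i)"], goal_cases)
    case 1
    show ?case using j by (simp add: s)
  next
    case (2 s')
    have fr: "imem s' ''sigma'' = sg" "iv s' ''blk'' = j" "rmem s' ''c'' = c" "rmem s' ''d'' = d"
      using frameI[OF 2(3)] frameR[OF 2(3)] s by simp_all
    have lt: "iv s' ''v'' < sg j" using 2(2) fr by simp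
    then have "sg j - iv s' ''v'' = Suc (sg j - (iv s' ''v'' + 1))" by simp
    moreover have "sg (j - 1) \<le> iv s' ''v''" using 2(1) by simp
    ultimately show ?case using 2(1) lt
      by (simp add: fr ins add.commute[of "sum c {sg (j - 1)<..iv s' ''v''}"])
  next
    case (3 t s')
    have fr: "imem s' ''sigma'' = sg" "iv s' ''blk'' = j"
      using frameI[OF 3(3)] s by simp_all
    have "iv s' ''v'' = sg j" using 3(1,2) fr by simp
    then show ?case using 3(1,4) by (simp add: s)
  qed
qed

text \<open>The item at \<open>p + len\<close> is a sentinel of price \<open>B\<close>, above all
  cells. In use its weight exceeds the total width of the block, so the relaxed problem admits every
  feasible block sum no matter how much capacity rounding and thinning have lost. The last clause is
  the guarantee of \<open>compress\<close> for the surviving items.\<close>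

definition packed :: "real \<Rightarrow> real \<Rightarrow> nat \<Rightarrow> (nat \<Rightarrow> real) \<Rightarrow> real \<Rightarrow> real \<Rightarrow> nat \<Rightarrow> nat \<Rightarrow>
    (nat \<Rightarrow> real) \<Rightarrow> (nat \<Rightarrow> real) \<Rightarrow> real \<Rightarrow> real \<Rightarrow> bool" where
  "packed u B N A wid csum p p' P Wt cs cap \<longleftrightarrow> (\<exists>len. \<exists>w :: real. 1 \<le> w \<and> p' = p + len + 1 \<and> len \<le> N \<and>
     (\<forall>k<len. Wt (p + k) = w * u) \<and> (\<forall>x y. x \<le> y \<and> y < len \<longrightarrow> P (p + x) \<le> P (p + y)) \<and>
     P (p + len) = B \<and> Wt (p + len) = wid \<and> cs = csum \<and> cap = wid + w * u * len \<and>
     (\<forall>k<len. \<bar>P (p + k)\<bar> \<le> B - 1) \<and>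
     (\<forall>D. down D \<longrightarrow> w * cnt (\<lambda>k. P (p + k)) 0 len D \<le> cnt A 0 N D \<and>
        cnt A 0 N D \<le> w * cnt (\<lambda>k. P (p + k)) 0 len D + N / 32))"

lemma packed_cong:
  assumes pk: "packed u B N A wid csum p p' P Wt cs cap"
    and e: "\<And>k. k < p' \<Longrightarrow> P' k = P k \<and> Wt' k = Wt k"
  shows "packed u B N A wid csum p p' P' Wt' cs cap"
proof -
  obtain len and w :: real where h: "1 \<le> w" "p' = p + len + 1" "len \<le> N"
     "\<forall>k<len. Wt (p + k) = w * u" "\<forall>x y. x \<le> y \<and> y < len \<longrightarrow> P (p + x) \<le> P (p + y)"
     "P (p + len) = B" "Wt (p + len) = wid" "cs = csum" "cap = wid + w * u * len"
     "\<forall>k<len. \<bar>P (p + k)\<bar> \<le> B - 1"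
     "\<forall>D. down D \<longrightarrow> w * cnt (\<lambda>k. P (p + k)) 0 len D \<le> cnt A 0 N D \<and>
        cnt A 0 N D \<le> w * cnt (\<lambda>k. P (p + k)) 0 len D + N / 32"
    using pk unfolding packed_def by blast
  have P': "P' (p + k) = P (p + k)" "Wt' (p + k) = Wt (p + k)" if "k \<le> len" for k
    using e[of "p + k"] that h(2) by simp_all
  have c: "cnt (\<lambda>k. P' (p + k)) 0 len D = cnt (\<lambda>k. P (p + k)) 0 len D" for D
    by (rule cnt_cong) (simp add: P')
  show ?thesis
    unfolding packed_def
    by (rule exI[of _ len], rule exI[of _ w]) (use h in \<open>simp add: P' c\<close>)
qed

definition pack_block :: com where
  "pack_block = ISet ''ps'' (IV ''blk'') (IV ''pp'') ;;
     IS ''q'' (IGet ''vs'' (IAdd (IGet ''sigma'' (ISub (IV ''blk'') (IConst 1))) (IConst 1))) ;;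
     IS ''Len'' (ISub (IGet ''vs'' (IAdd (IGet ''sigma'' (IV ''blk'')) (IConst 1))) (IV ''q'')) ;;
     load ;; compress ;; unload ;; widths ;;
     RSet ''P'' (IAdd (IV ''pp'') (IV ''Len'')) (RV ''BIG'') ;;
     RSet ''Wt'' (IAdd (IV ''pp'') (IV ''Len'')) (RV ''wid'') ;;
     RSet ''cap'' (IV ''blk'') (RAdd (RV ''wid'') (RMul (RV ''wu'') (ROfIndex (IV ''Len'')))) ;;
     IS ''pp'' (IAdd (IAdd (IV ''pp'') (IV ''Len'')) (IConst 1))"

lemma mods_pack_block [simp]:
  "imods pack_block = {''ps'', ''q'', ''Len'', ''k'', ''i'', ''j'', ''lo'', ''e1'', ''e2'', ''L'', ''lim'', ''v'', ''pp''}"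
  "rmods pack_block = {''S'', ''T'', ''w'', ''P'', ''Wt'', ''wu'', ''wid'', ''cs'', ''cap''}"
  by (auto simp: pack_block_def)

lemma pack_block:
  assumes s: "imem s ''sigma'' = sg" "iv s ''blk'' = J" "rmem s ''c'' = c" "rmem s ''d'' = d" "rv s ''u'' = u"
      "rmem s ''Q'' = Q" "rv s ''BIG'' = B" "iv s ''pp'' = pp"
      "imem s ''vs'' (sg (J - 1) + 1) = v0" "imem s ''vs'' (sg J + 1) = v0 + N"
    and J: "sg (J - 1) \<le> sg J"
    and QB: "\<forall>k<N. \<bar>Q (v0 + k)\<bar> \<le> B - 1"
  shows "wp f pack_block s (\<lambda>t s'. t \<le> 41000 * N + 60 * (sg J - sg (J - 1)) + 500 \<and>
    imem s' ''ps'' = (imem s ''ps'')(J := pp) \<and> pp \<le> iv s' ''pp'' \<and> iv s' ''pp'' \<le> pp + N + 1 \<and>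
    packed u B N (\<lambda>k. Q (v0 + k)) (u + (\<Sum>i\<in>{sg (J - 1)<..sg J}. d i - c i)) (\<Sum>i\<in>{sg (J - 1)<..sg J}. c i)
      pp (iv s' ''pp'') (rmem s' ''P'') (rmem s' ''Wt'') (rmem s' ''cs'' J) (rmem s' ''cap'' J) \<and>
    (\<forall>k<pp. rmem s' ''P'' k = rmem s ''P'' k \<and> rmem s' ''Wt'' k = rmem s ''Wt'' k) \<and>
    (\<forall>j. j \<noteq> J \<longrightarrow> rmem s' ''cs'' j = rmem s ''cs'' j \<and> rmem s' ''cap'' j = rmem s ''cap'' j))"
proof -
  define wid csum where "wid = u + (\<Sum>i\<in>{sg (J - 1)<..sg J}. d i - c i)" "csum = (\<Sum>i\<in>{sg (J - 1)<..sg J}. c i)"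
  note sm = s(1-8)
  show ?thesis
    unfolding pack_block_def wp_Seq wp_ISet
  proof (rule wp_use[OF load[where n = N]], goal_cases)
    case 1
    show ?case by (simp add: s)
  next
    case (2 t1 s1)
    note fI1 = frameI[OF 2(2)] and fR1 = frameR[OF 2(2)]
    have e1: "imem s1 ''sigma'' = sg" "iv s1 ''blk'' = J" "rmem s1 ''c'' = c" "rmem s1 ''d'' = d" "rv s1 ''u'' = u"
      "rv s1 ''BIG'' = B" "iv s1 ''pp'' = pp" "imem s1 ''ps'' = (imem s ''ps'')(J := pp)"
      "rmem s1 ''P'' = rmem s ''P''" "rmem s1 ''Wt'' = rmem s ''Wt''" "rmem s1 ''cs'' = rmem s ''cs''"
      "rmem s1 ''cap'' = rmem s ''cap''" "iv s1 ''Len'' = N"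
      by (simp_all add: fI1 fR1 s)
    have S1: "rmem s1 ''S'' k = Q (v0 + k)" if "k < N" for k
      using conjunct2[OF 2(1)] that by (simp add: s)
    have t1: "t1 \<le> 40 * N + 10" using 2(1) by blast
    show ?case
    proof (rule wp_use[OF compress[OF e1(13) refl]], goal_cases)
      case (1 t2 s2)
      note fI2 = frameI[OF 1(2)] and fR2 = frameR[OF 1(2)]
      define len w where "len = iv s2 ''Len''" "w = rv s2 ''w''"
      have e2: "imem s2 ''sigma'' = sg" "iv s2 ''blk'' = J" "rmem s2 ''c'' = c" "rmem s2 ''d'' = d" "rv s2 ''u'' = u"
        "rv s2 ''BIG'' = B" "iv s2 ''pp'' = pp" "imem s2 ''ps'' = (imem s ''ps'')(J := pp)"
        "rmem s2 ''P'' = rmem s ''P''" "rmem s2 ''Wt'' = rmem s ''Wt''" "rmem s2 ''cs'' = rmem s ''cs''"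
        "rmem s2 ''cap'' = rmem s ''cap''" "iv s2 ''Len'' = len" "rv s2 ''w'' = w"
        by (simp_all add: fI2 fR2 e1 len_w_def)
      have c2: "t2 \<le> 40000 * N + 100" "len \<le> N" "1 \<le> w"
        "\<forall>x y. x \<le> y \<and> y < len \<longrightarrow> rmem s2 ''S'' x \<le> rmem s2 ''S'' y"
        "\<forall>D. down D \<longrightarrow> w * cnt (rmem s2 ''S'') 0 len D \<le> cnt (rmem s1 ''S'') 0 N D \<and>
          cnt (rmem s1 ''S'') 0 N D \<le> w * cnt (rmem s2 ''S'') 0 len D + N / 32"
        "\<forall>D. (\<forall>k<N. D (rmem s1 ''S'' k)) \<longrightarrow> (\<forall>k<len. D (rmem s2 ''S'' k))"
        using 1(1) unfolding len_w_def by blast+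
      have SB: "\<bar>rmem s2 ''S'' k\<bar> \<le> B - 1" if "k < len" for k
        using c2(6)[rule_format, of "\<lambda>x. \<bar>x\<bar> \<le> B - 1"] QB S1 that by simp
      have cS: "cnt (rmem s1 ''S'') 0 N D = cnt (\<lambda>k. Q (v0 + k)) 0 N D" for D
        by (rule cnt_cong) (simp add: S1)
      show ?case
      proof (rule wp_use[OF unload[OF e2(13,7)]], goal_cases)
        case (1 t3 s3)
        note fI3 = frameI[OF 1(2)] and fR3 = frameR[OF 1(2)]
        have e3: "imem s3 ''sigma'' = sg" "iv s3 ''blk'' = J" "rmem s3 ''c'' = c" "rmem s3 ''d'' = d" "rv s3 ''u'' = u"
          "rv s3 ''BIG'' = B" "iv s3 ''pp'' = pp" "imem s3 ''ps'' = (imem s ''ps'')(J := pp)"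
          "rmem s3 ''cs'' = rmem s ''cs''" "rmem s3 ''cap'' = rmem s ''cap''" "iv s3 ''Len'' = len"
          by (simp_all add: fI3 fR3 e2)
        have u3: "t3 \<le> 60 * len + 20" "rv s3 ''wu'' = w * u"
          "\<And>k. k < len \<Longrightarrow> rmem s3 ''P'' (pp + k) = rmem s2 ''S'' k \<and> rmem s3 ''Wt'' (pp + k) = w * u"
          "\<And>k. k < pp \<Longrightarrow> rmem s3 ''P'' k = rmem s ''P'' k \<and> rmem s3 ''Wt'' k = rmem s ''Wt'' k"
          using 1(1) by (simp_all add: e2)
        show ?case
        proof (rule wp_use[OF widths[OF e3(1-5) J, folded wid_csum_def]], goal_cases)
          case (1 t4 s4)
          note fI4 = frameI[OF 1(2)] and fR4 = frameR[OF 1(2)]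
          have e4: "iv s4 ''blk'' = J" "rv s4 ''BIG'' = B" "iv s4 ''pp'' = pp" "imem s4 ''ps'' = (imem s ''ps'')(J := pp)"
            "rmem s4 ''cap'' = rmem s ''cap''" "iv s4 ''Len'' = len" "rv s4 ''wu'' = w * u" "rv s4 ''wid'' = wid"
            "rmem s4 ''P'' = rmem s3 ''P''" "rmem s4 ''Wt'' = rmem s3 ''Wt''" "rmem s4 ''cs'' = (rmem s ''cs'')(J := csum)"
            using 1(1) by (simp_all add: fI4 fR4 e3 u3(2))
          have t4: "t4 \<le> 60 * (sg J - sg (J - 1)) + 40" using 1(1) by blast
          define P' Wt' where "P' = (rmem s3 ''P'')(pp + len := B)" "Wt' = (rmem s3 ''Wt'')(pp + len := wid)"
          have PW: "P' (pp + k) = rmem s2 ''S'' k" "Wt' (pp + k) = w * u" if "k < len" for k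
            using u3(3)[OF that] that by (simp_all add: P'_Wt'_def)
          have c: "cnt (\<lambda>k. P' (pp + k)) 0 len D = cnt (rmem s2 ''S'') 0 len D" for D
            by (rule cnt_cong) (simp add: PW)
          have pk: "packed u B N (\<lambda>k. Q (v0 + k)) wid csum pp (pp + len + 1) P' Wt' csum (wid + w * u * len)"
            unfolding packed_def
          proof (rule exI[of _ len], rule exI[of _ w], intro conjI)
            show "\<forall>D. down D \<longrightarrow> w * cnt (\<lambda>k. P' (pp + k)) 0 len D \<le> cnt (\<lambda>k. Q (v0 + k)) 0 N D \<and>
              cnt (\<lambda>k. Q (v0 + k)) 0 N D \<le> w * cnt (\<lambda>k. P' (pp + k)) 0 len D + N / 32"
              using c2(5) unfolding c cS .
            show "\<forall>x y. x \<le> y \<and> y < len \<longrightarrow> P' (pp + x) \<le> P' (pp + y)" using c2(4) by (simp add: PW)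
            show "\<forall>k<len. \<bar>P' (pp + k)\<bar> \<le> B - 1" using SB by (simp add: PW)
          qed (use c2(2,3) PW in \<open>simp_all add: P'_Wt'_def\<close>)
          have st: "P' k = rmem s ''P'' k \<and> Wt' k = rmem s ''Wt'' k" if "k < pp" for k
            using u3(4)[OF that] that by (simp add: P'_Wt'_def)
          have tm: "t1 + (t2 + (t3 + t4)) \<le> 41000 * N + 60 * (sg J - sg (J - 1)) + 170"
            using t1 c2(1,2) u3(1) t4 by linarith
          show ?case
            using pk st u3(4) tm c2(2) by (simp add: e4 P'_Wt'_def[symmetric] wid_csum_def[symmetric])
        qed
      qed
    qed
  qed
qed

section \<open>All blocks in one list\<close>

definition pack :: com where
  "pack = IS ''blk'' (IConst 0) ;; IS ''pp'' (IConst 0) ;;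
     While (ILt (IV ''blk'') (IV ''m'')) (inc ''blk'' ;; pack_block) ;;
     ISet ''ps'' (IAdd (IV ''m'') (IConst 1)) (IV ''pp'')"

lemma mods_pack [simp]:
  "imods pack = {''blk'', ''ps'', ''q'', ''Len'', ''k'', ''i'', ''j'', ''lo'', ''e1'', ''e2'', ''L'', ''lim'', ''v'', ''pp''}"
  "rmods pack = {''S'', ''T'', ''w'', ''P'', ''Wt'', ''wu'', ''wid'', ''cs'', ''cap''}"
  by (auto simp: pack_def)

lemma pack:
  fixes sg :: "nat \<Rightarrow> nat"
  assumes s: "imem s ''sigma'' = sg" "iv s ''m'' = m" "rmem s ''c'' = c" "rmem s ''d'' = d" "rv s ''u'' = u"
      "rmem s ''Q'' = Q" "rv s ''BIG'' = B"
    and sg: "sg 0 = 0" "\<And>i j. i < j \<Longrightarrow> j \<le> m \<Longrightarrow> sg i < sg j" "sg m = n"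
    and vs: "\<And>i. 1 \<le> i \<Longrightarrow> i \<le> n + 1 \<Longrightarrow> imem s ''vs'' i = vstart cc i"
    and QB: "\<And>k. k < vstart cc (n + 1) \<Longrightarrow> \<bar>Q k\<bar> \<le> B - 1"
  defines "bs \<equiv> \<lambda>j. vstart cc (sg j + 1)"
  shows "wp f pack s (\<lambda>t s'. t \<le> 41000 * vstart cc (n + 1) + 100 * n + 600 * m + 100 \<and>
    imem s' ''ps'' 1 = 0 \<and> imem s' ''ps'' (m + 1) \<le> vstart cc (n + 1) + m \<and>
    (\<forall>j. 1 \<le> j \<and> j \<le> m \<longrightarrow> packed u B (bs j - bs (j - 1)) (\<lambda>k. Q (bs (j - 1) + k))
      (u + (\<Sum>i\<in>{sg (j - 1)<..sg j}. d i - c i)) (\<Sum>i\<in>{sg (j - 1)<..sg j}. c i)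
      (imem s' ''ps'' j) (imem s' ''ps'' (j + 1)) (rmem s' ''P'') (rmem s' ''Wt'') (rmem s' ''cs'' j) (rmem s' ''cap'' j)))"
proof -
  define pk where "pk j p p' P Wt cs cap \<longleftrightarrow> packed u B (bs j - bs (j - 1)) (\<lambda>k. Q (bs (j - 1) + k))
      (u + (\<Sum>i\<in>{sg (j - 1)<..sg j}. d i - c i)) (\<Sum>i\<in>{sg (j - 1)<..sg j}. c i) p p' P Wt cs cap"
    for j p p' P Wt cs cap
  \<comment> \<open>The start of the next block, which is also the end of the current one, is
    written only when that block is treated or after the loop. The invariant speaks about the array
    as if it were already there.\<close>
  let ?ps = "\<lambda>s'. (imem s' ''ps'')(iv s' ''blk'' + 1 := iv s' ''pp'')"
  let ?I = "\<lambda>s'. iv s' ''blk'' \<le> m \<and> ?ps s' 1 = 0 \<and> iv s' ''pp'' \<le> bs (iv s' ''blk'') + iv s' ''blk'' \<and>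
    (\<forall>j. 1 \<le> j \<and> j \<le> iv s' ''blk'' \<longrightarrow> ?ps s' (j + 1) \<le> iv s' ''pp'' \<and>
       pk j (?ps s' j) (?ps s' (j + 1)) (rmem s' ''P'') (rmem s' ''Wt'') (rmem s' ''cs'' j) (rmem s' ''cap'' j))"
  have sgn: "sg j \<le> n" if "j \<le> m" for j
    using sg(2)[of j m] sg(3) that by (cases "j = m") auto
  have bsn: "bs j \<le> vstart cc (n + 1)" if "j \<le> m" for j
    unfolding bs_def using sgn[OF that] by (intro vstart_mono) simp
  have bs0: "bs 0 = 0" using vstart_1[of cc] by (simp add: bs_def sg(1))
  have bsm: "bs m = vstart cc (n + 1)" by (simp add: bs_def sg(3))
  show ?thesis
    unfolding pack_def wp_Seq wp_ISet
  proof (rule wp_while[where I = ?I and V = "\<lambda>s'. 41000 * (bs m - bs (iv s' ''blk'')) + 60 * (n - sg (iv s' ''blk'')) + 600 * (m - iv s' ''blk'')"], goal_cases)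
    case 1
    show ?case by simp
  next
    case (2 s1)
    define j where "j = iv s1 ''blk'' + 1"
    have e: "imem s1 ''sigma'' = sg" "iv s1 ''m'' = m" "rmem s1 ''c'' = c" "rmem s1 ''d'' = d" "rv s1 ''u'' = u"
      "rmem s1 ''Q'' = Q" "rv s1 ''BIG'' = B" "imem s1 ''vs'' = imem s ''vs''"
      using frameI[OF 2(3)] frameR[OF 2(3)] s by simp_all
    have b: "iv s1 ''blk'' = j - 1" "j - 1 + 1 = j" by (simp_all add: j_def)
    have j: "1 \<le> j" "j \<le> m" "j - 1 \<le> m" "j - 1 < j" using 2(2) e by (simp_all add: j_def)
    have lt: "sg (j - 1) < sg j" using sg(2)[OF j(4,2)] .
    have bsj: "bs (j - 1) \<le> bs j" unfolding bs_def using lt by (intro vstart_mono) simp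
    define N where "N = bs j - bs (j - 1)"
    define pp where "pp = iv s1 ''pp''"
    have I1: "pp \<le> bs (j - 1) + (j - 1)" "((imem s1 ''ps'')(j := pp)) 1 = 0"
      "\<And>i. 1 \<le> i \<Longrightarrow> i \<le> j - 1 \<Longrightarrow> ((imem s1 ''ps'')(j := pp)) (i + 1) \<le> pp \<and>
        pk i (((imem s1 ''ps'')(j := pp)) i) (((imem s1 ''ps'')(j := pp)) (i + 1)) (rmem s1 ''P'') (rmem s1 ''Wt'')
          (rmem s1 ''cs'' i) (rmem s1 ''cap'' i)"
      using 2(1) unfolding b(1) b(2) pp_def by blast+
    define s2 where "s2 = iset ''blk'' 0 j s1"
    have vsj: "imem s2 ''vs'' (sg (j - 1) + 1) = bs (j - 1)" "imem s2 ''vs'' (sg j + 1) = bs (j - 1) + N"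
      using vs[of "sg (j - 1) + 1"] vs[of "sg j + 1"] sgn[OF j(2)] sgn[OF j(3)] bsj
      by (simp_all add: bs_def e N_def s2_def)
    have QBj: "\<forall>k<N. \<bar>Q (bs (j - 1) + k)\<bar> \<le> B - 1" using QB bsn[OF j(2)] by (simp add: N_def)
    have PB: "wp f pack_block s2 (\<lambda>t s'. t \<le> 41000 * N + 60 * (sg j - sg (j - 1)) + 500 \<and>
      imem s' ''ps'' = (imem s2 ''ps'')(j := pp) \<and> pp \<le> iv s' ''pp'' \<and> iv s' ''pp'' \<le> pp + N + 1 \<and>
      packed u B N (\<lambda>k. Q (bs (j - 1) + k)) (u + (\<Sum>i\<in>{sg (j - 1)<..sg j}. d i - c i)) (\<Sum>i\<in>{sg (j - 1)<..sg j}. c i)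
      pp (iv s' ''pp'') (rmem s' ''P'') (rmem s' ''Wt'') (rmem s' ''cs'' j) (rmem s' ''cap'' j) \<and>
      (\<forall>k<pp. rmem s' ''P'' k = rmem s2 ''P'' k \<and> rmem s' ''Wt'' k = rmem s2 ''Wt'' k) \<and>
      (\<forall>i. i \<noteq> j \<longrightarrow> rmem s' ''cs'' i = rmem s2 ''cs'' i \<and> rmem s' ''cap'' i = rmem s2 ''cap'' i))"
      by (rule pack_block[OF _ _ _ _ _ _ _ _ vsj _ QBj]) (use e lt in \<open>simp_all add: s2_def pp_def\<close>)
    have PB': "wp f pack_block s2 (\<lambda>t s'. ?I s' \<and> t \<le> 41000 * N + 60 * (sg j - sg (j - 1)) + 500 \<and> iv s' ''blk'' = j)"
    proof (rule wp_use[OF PB], elim conjE)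
      fix t s'
      assume q: "t \<le> 41000 * N + 60 * (sg j - sg (j - 1)) + 500"
        "imem s' ''ps'' = (imem s2 ''ps'')(j := pp)" "pp \<le> iv s' ''pp''" "iv s' ''pp'' \<le> pp + N + 1"
        "packed u B N (\<lambda>k. Q (bs (j - 1) + k)) (u + (\<Sum>i\<in>{sg (j - 1)<..sg j}. d i - c i)) (\<Sum>i\<in>{sg (j - 1)<..sg j}. c i)
          pp (iv s' ''pp'') (rmem s' ''P'') (rmem s' ''Wt'') (rmem s' ''cs'' j) (rmem s' ''cap'' j)"
        "\<forall>k<pp. rmem s' ''P'' k = rmem s2 ''P'' k \<and> rmem s' ''Wt'' k = rmem s2 ''Wt'' k"
        "\<forall>i. i \<noteq> j \<longrightarrow> rmem s' ''cs'' i = rmem s2 ''cs'' i \<and> rmem s' ''cap'' i = rmem s2 ''cap'' i"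
        and fr: "frame pack_block s2 s'"
      have bk: "iv s' ''blk'' = j" using frameI[OF fr] by (simp add: s2_def)
      define pp' where "pp' = iv s' ''pp''"
      let ?p0 = "(imem s1 ''ps'')(j := pp)" and ?p1 = "(imem s' ''ps'')(j + 1 := pp')"
      have p1: "?p1 i = ?p0 i" if "i \<le> j" for i using that by (simp add: q(2) s2_def)
      have a: "?p1 1 = 0" using I1(2) p1[of 1] j(1) by metis
      have ppb: "pp' \<le> bs j + j"
        using q(4) I1(1) bsj j(1) unfolding pp'_def N_def by linarith
      have blks: "?p1 (i + 1) \<le> pp' \<and> pk i (?p1 i) (?p1 (i + 1)) (rmem s' ''P'') (rmem s' ''Wt'') (rmem s' ''cs'' i) (rmem s' ''cap'' i)"
        if i: "1 \<le> i" "i \<le> j" for i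
      proof (cases "i = j")
        case True
        have "?p1 j = pp" "?p1 (j + 1) = pp'" using p1[of j] by simp_all
        then show ?thesis using q(5) unfolding True pk_def N_def[symmetric] pp'_def by simp
      next
        case False
        then have ij: "i \<le> j - 1" "i + 1 \<le> j" "i \<le> j" using i by simp_all
        note old = I1(3)[OF i(1) ij(1)]
        have "pk i (?p0 i) (?p0 (i + 1)) (rmem s' ''P'') (rmem s' ''Wt'') (rmem s1 ''cs'' i) (rmem s1 ''cap'' i)"
          unfolding pk_def
          by (rule packed_cong[OF conjunct2[OF old, unfolded pk_def]]) (use q(6) old in \<open>auto simp: s2_def\<close>)
        moreover have "rmem s' ''cs'' i = rmem s1 ''cs'' i" "rmem s' ''cap'' i = rmem s1 ''cap'' i"
          using q(7) False by (simp_all add: s2_def)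
        moreover have "?p0 (i + 1) \<le> pp'" using conjunct1[OF old] q(3) unfolding pp'_def by linarith
        ultimately show ?thesis unfolding p1[OF ij(3)] p1[OF ij(2)] by simp
      qed
      show "?I s' \<and> t \<le> 41000 * N + 60 * (sg j - sg (j - 1)) + 500 \<and> iv s' ''blk'' = j"
        using a ppb blks j(2) q(1) unfolding bk pp'_def by blast
    qed
    have V1: "41000 * (bs m - bs (j - 1)) = 41000 * (bs m - bs j) + 41000 * N"
      using bsj bsn[OF j(2)] bsm by (simp add: N_def)
    have V2: "60 * (n - sg (j - 1)) = 60 * (n - sg j) + 60 * (sg j - sg (j - 1))" using lt sgn[OF j(2)] by simp
    have V3: "600 * (m - (j - 1)) = 600 * (m - j) + 600" using j by simp
    show ?case
      unfolding wp_Seq wp_ISet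
      apply (simp only: ival.simps b(1) b(2))
      apply (rule wp_use[OF PB'[unfolded s2_def]])
      apply (unfold V1 V2 V3)
      subgoal premises p for t s'
      proof -
        have "t \<le> 41000 * N + 60 * (sg j - sg (j - 1)) + 500" "iv s' ''blk'' = j" using p(1) by blast+
        then show ?thesis
          apply (intro conjI[OF conjunct1[OF p(1)]])
          by simp
      qed
      done
  next
    case (3 t s1)
    have e: "iv s1 ''m'' = m" using frameI[OF 3(3)] s by simp
    have b: "iv s1 ''blk'' = m" using 3(1,2) e by simp
    have "t \<le> 41000 * vstart cc (n + 1) + 60 * n + 600 * m + 20" using 3(4) by (simp add: b bs0 bsm sg(1))
    then show ?case using 3(1) unfolding b by (simp add: e pk_def bsm)
  qed
qed

section \<open>Cutting the variables of a block\<close>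

lemma cnt_shift: "cnt (\<lambda>k. A (p + k)) 0 N D = cnt A p (p + N) D"
proof -
  have "(\<Sum>k\<in>{0..<N}. of_bool (D (A (p + k)))) = (\<Sum>k\<in>{0 + p..<N + p}. of_bool (D (A k)) :: nat)"
    by (subst sum.shift_bounds_nat_ivl) (simp add: add.commute)
  then show ?thesis unfolding cnt_def by (simp add: add.commute)
qed

abbreviation vcnt :: "(nat \<Rightarrow> real) \<Rightarrow> (nat \<Rightarrow> nat) \<Rightarrow> nat \<Rightarrow> (real \<Rightarrow> bool) \<Rightarrow> nat" where
  "vcnt Q cc i D \<equiv> cnt Q (vstart cc i) (vstart cc (i + 1)) D"

lemma cnt_vars:
  assumes "lo \<le> hi"
  shows "cnt Q (vstart cc (lo + 1)) (vstart cc (hi + 1)) D = (\<Sum>i\<in>{lo<..hi}. vcnt Q cc i D)"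
  using assms
proof (induction hi rule: dec_induct)
  case base show ?case by simp
next
  case (step h)
  have "{lo<..Suc h} = insert (Suc h) {lo<..h}" using step by auto
  moreover have "cnt Q (vstart cc (lo + 1)) (vstart cc (Suc h + 1)) D =
      cnt Q (vstart cc (lo + 1)) (vstart cc (h + 1)) D + cnt Q (vstart cc (h + 1)) (vstart cc (Suc h + 1)) D"
    using step by (intro cnt_append vstart_mono) simp_all
  ultimately show ?case using step by (simp add: Suc_eq_plus1[symmetric])
qed

text \<open>All cells cheaper than the threshold of the block are granted, tied cells only while the
  remainder \<open>rem\<close> is positive. The two cells granted in advance pay for measuring
  slopes one cell further on: beyond \<open>h\<close> the first slope not granted must be a lower
  bound.\<close>

definition cut_var :: com where
  "cut_var = RS ''h'' (RAdd (RGet ''c'' (IV ''v'')) (RAdd (RV ''u'') (RV ''u''))) ;;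
     IS ''q'' (IGet ''vs'' (IV ''v'')) ;;
     While (ILt (IV ''q'') (IGet ''vs'' (IAdd (IV ''v'') (IConst 1))))
       (Cond (RLt (RGet ''Q'' (IV ''q'')) (RGet ''th'' (IV ''blk'')))
          (RS ''h'' (RAdd (RV ''h'') (RV ''u'')))
          (Cond (BAnd (RLe (RGet ''Q'' (IV ''q'')) (RGet ''th'' (IV ''blk''))) (RLt (RConst 0) (RV ''rem'')))
             (RS ''h'' (RAdd (RV ''h'') (RV ''u'')) ;; RS ''rem'' (RSub (RV ''rem'') (RV ''u'')))
             Skip) ;;
        inc ''q'') ;;
     Cond (RLe (RV ''h'') (RGet ''d'' (IV ''v''))) (RSet ''d'' (IV ''v'') (RV ''h'')) Skip"

lemma mods_cut_var [simp]: "imods cut_var = {''q''}" "rmods cut_var = {''h'', ''rem'', ''d''}"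
  by (auto simp: cut_var_def)

text \<open>The number \<open>t\<close> counts the tied cells granted so far. Either all ties were
  granted or the remainder is used up, and granting overshoots the remainder by less than one
  cell.\<close>

definition cutv :: "(nat \<Rightarrow> real) \<Rightarrow> nat \<Rightarrow> real \<Rightarrow> real \<Rightarrow> real \<Rightarrow> real \<Rightarrow> nat \<Rightarrow> real \<Rightarrow> real \<Rightarrow> bool" where
  "cutv Q v0 th u c0 r0 q h r \<longleftrightarrow> v0 \<le> q \<and> (\<exists>t. t \<le> cnt Q v0 q (\<lambda>x. x = th) \<and>
     h = c0 + real (2 + cnt Q v0 q (\<lambda>x. x < th) + t) * u \<and> r = r0 - real t * u \<and>
     (t = cnt Q v0 q (\<lambda>x. x = th) \<or> r \<le> 0) \<and> (t = 0 \<or> - u < r))"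

lemma cutv_lt:
  assumes C: "cutv Q v0 th u c0 r0 q h r" and Q: "Q q < th"
  shows "cutv Q v0 th u c0 r0 (q + 1) (h + u) r"
proof -
  obtain t where t: "v0 \<le> q" "t \<le> cnt Q v0 q (\<lambda>x. x = th)" "h = c0 + real (2 + cnt Q v0 q (\<lambda>x. x < th) + t) * u"
    "r = r0 - real t * u" "t = cnt Q v0 q (\<lambda>x. x = th) \<or> r \<le> 0" "t = 0 \<or> - u < r"
    using C unfolding cutv_def by blast
  have cs: "cnt Q v0 (q + 1) (\<lambda>x. x < th) = cnt Q v0 q (\<lambda>x. x < th) + 1"
    "cnt Q v0 (q + 1) (\<lambda>x. x = th) = cnt Q v0 q (\<lambda>x. x = th)"
    using cnt_Suc[OF t(1)] Q by simp_all
  have "h + u = c0 + real (2 + cnt Q v0 (q + 1) (\<lambda>x. x < th) + t) * u"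
    unfolding cs t(3) by (simp add: algebra_simps)
  then show ?thesis unfolding cutv_def cs(2) using t(1,2,4-6) by (metis le_SucI Suc_eq_plus1)
qed

lemma cutv_skip:
  assumes C: "cutv Q v0 th u c0 r0 q h r" and Q: "\<not> Q q < th" "\<not> (Q q \<le> th \<and> 0 < r)"
  shows "cutv Q v0 th u c0 r0 (q + 1) h r"
proof -
  obtain t where t: "v0 \<le> q" "t \<le> cnt Q v0 q (\<lambda>x. x = th)" "h = c0 + real (2 + cnt Q v0 q (\<lambda>x. x < th) + t) * u"
    "r = r0 - real t * u" "t = cnt Q v0 q (\<lambda>x. x = th) \<or> r \<le> 0" "t = 0 \<or> - u < r"
    using C unfolding cutv_def by blast
  have cs: "cnt Q v0 (q + 1) (\<lambda>x. x < th) = cnt Q v0 q (\<lambda>x. x < th)"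
    "cnt Q v0 (q + 1) (\<lambda>x. x = th) = cnt Q v0 q (\<lambda>x. x = th) + of_bool (Q q = th)"
    using cnt_Suc[OF t(1)] Q by simp_all
  have "t \<le> cnt Q v0 (q + 1) (\<lambda>x. x = th)" using t(2) cs(2) by simp
  moreover have "t = cnt Q v0 (q + 1) (\<lambda>x. x = th) \<or> r \<le> 0"
    using t(5) cs(2) Q by (cases "Q q = th") auto
  ultimately show ?thesis unfolding cutv_def cs(1) using t(1,3,4,6) by (metis le_SucI Suc_eq_plus1)
qed

lemma cutv_tie:
  assumes u: "0 < u" and C: "cutv Q v0 th u c0 r0 q h r" and Q: "Q q = th" "0 < r"
  shows "cutv Q v0 th u c0 r0 (q + 1) (h + u) (r - u)"
proof -
  obtain t where t: "v0 \<le> q" "h = c0 + real (2 + cnt Q v0 q (\<lambda>x. x < th) + t) * u"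
    "r = r0 - real t * u" "t = cnt Q v0 q (\<lambda>x. x = th)"
    using C Q(2) unfolding cutv_def by auto
  have cs: "cnt Q v0 (q + 1) (\<lambda>x. x < th) = cnt Q v0 q (\<lambda>x. x < th)"
    "cnt Q v0 (q + 1) (\<lambda>x. x = th) = cnt Q v0 q (\<lambda>x. x = th) + 1"
    using cnt_Suc[OF t(1)] Q by simp_all
  have "h + u = c0 + real (2 + cnt Q v0 (q + 1) (\<lambda>x. x < th) + (t + 1)) * u"
    unfolding cs t(2) by (simp add: algebra_simps)
  moreover have "r - u = r0 - real (t + 1) * u" using t(3) by (simp add: algebra_simps)
  moreover have "t + 1 = cnt Q v0 (q + 1) (\<lambda>x. x = th)" "- u < r - u" using t(4) cs(2) Q(2) by simp_all
  moreover have "v0 \<le> q + 1" using t(1) by simp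
  ultimately show ?thesis unfolding cutv_def by (metis order_refl)
qed

lemma cut_var:
  assumes u: "0 < u" and s: "iv s ''v'' = i" "rmem s ''c'' = c" "rmem s ''d'' = d" "rv s ''u'' = u" "rmem s ''Q'' = Q"
    "iv s ''blk'' = j" "rmem s ''th'' j = th" "imem s ''vs'' i = v0" "imem s ''vs'' (i + 1) = v1" "v0 \<le> v1" "rv s ''rem'' = r0"
  shows "wp f cut_var s (\<lambda>t s'. t \<le> 80 * (v1 - v0) + 60 \<and> (\<exists>h. cutv Q v0 th u (c i) r0 v1 h (rv s' ''rem'') \<and>
    rmem s' ''d'' = d(i := min (d i) h)))"
proof -
  show ?thesis
    unfolding cut_var_def wp_Seq wp_ISet wp_RSet
  proof (rule wp_while[where V = "\<lambda>s'. 80 * (v1 - iv s' ''q'')" and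
        I = "\<lambda>s'. iv s' ''q'' \<le> v1 \<and> cutv Q v0 th u (c i) r0 (iv s' ''q'') (rv s' ''h'') (rv s' ''rem'')"], goal_cases)
    case 1
    show ?case using s by (simp add: cutv_def)
  next
    case (2 s1)
    define q h r where v: "q = iv s1 ''q''" "h = rv s1 ''h''" "r = rv s1 ''rem''"
    have e: "iv s1 ''v'' = i" "rv s1 ''u'' = u" "rmem s1 ''Q'' = Q" "iv s1 ''blk'' = j" "rmem s1 ''th'' j = th"
      "imem s1 ''vs'' (i + 1) = v1"
      using frameI[OF 2(3)] frameR[OF 2(3)] s by simp_all
    have lt: "q < v1" using 2(2) e by (simp add: v)
    have I: "cutv Q v0 th u (c i) r0 q h r" using 2(1) by (simp add: v)
    have pt: "60 + 80 * (v1 - (q + 1)) \<le> 80 * (v1 - q)" using lt by simp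
    consider "Q q < th" | "\<not> Q q < th" "Q q \<le> th \<and> 0 < r" | "\<not> Q q < th" "\<not> (Q q \<le> th \<and> 0 < r)" by blast
    then show ?case
    proof cases
      case 1
      show ?thesis using cutv_lt[OF I 1] lt pt 1 by (simp add: e v[symmetric])
    next
      case 2
      have "Q q = th" using 2 by simp
      then show ?thesis using cutv_tie[OF u I] lt pt 2 by (simp add: e v[symmetric])
    next
      case 3
      note sk = cutv_skip[OF I 3]
      show ?thesis
      proof (cases "Q q \<le> th")
        case True
        then have "r \<le> 0" using 3 by auto
        then show ?thesis using sk lt pt True 3(1) by (simp add: e v[symmetric])
      next
        case False
        then show ?thesis using sk lt pt 3(1) by (simp add: e v[symmetric])
      qed
    qed
  next
    case (3 t s1)
    have e: "iv s1 ''v'' = i" "imem s1 ''vs'' (i + 1) = v1" "rmem s1 ''d'' = d"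
      using frameI[OF 3(3)] frameR[OF 3(3)] s by simp_all
    have q: "iv s1 ''q'' = v1" using 3(1,2) e by simp
    have C: "cutv Q v0 th u (c i) r0 v1 (rv s1 ''h'') (rv s1 ''rem'')" using 3(1) q by simp
    have t: "t \<le> 80 * (v1 - v0) + 20" using 3(4) by (simp add: s)
    show ?case
    proof (cases "rv s1 ''h'' \<le> d i")
      case True
      then have "d(i := rv s1 ''h'') = d(i := min (d i) (rv s1 ''h''))" by simp
      then show ?thesis using C t True by (auto simp: e)
    next
      case False
      then have "d = d(i := min (d i) (rv s1 ''h''))" by simp
      then show ?thesis using C t False by (auto simp: e)
    qed
  qed
qed

text \<open>The part of \<open>Y\<close> left for ties after all cells below the threshold are
  accounted for. Approximate sorting can make it negative; then no tie is granted.\<close>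

definition count_block :: com where
  "count_block = RS ''rem'' (RGet ''Y'' (IV ''blk'')) ;;
     IS ''q'' (IGet ''vs'' (IAdd (IGet ''sigma'' (ISub (IV ''blk'') (IConst 1))) (IConst 1))) ;;
     While (ILt (IV ''q'') (IGet ''vs'' (IAdd (IGet ''sigma'' (IV ''blk'')) (IConst 1))))
       (Cond (RLt (RGet ''Q'' (IV ''q'')) (RGet ''th'' (IV ''blk'')))
          (RS ''rem'' (RSub (RV ''rem'') (RV ''u''))) Skip ;; inc ''q'')"

lemma mods_count_block [simp]: "imods count_block = {''q''}" "rmods count_block = {''rem''}"
  by (auto simp: count_block_def)

lemma count_block:
  assumes s: "imem s ''sigma'' = sg" "rv s ''u'' = u" "rmem s ''Q'' = Q" "iv s ''blk'' = j" "rmem s ''th'' j = th" "rmem s ''Y'' j = Y"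
    "imem s ''vs'' (sg (j - 1) + 1) = v0" "imem s ''vs'' (sg j + 1) = v1" "v0 \<le> v1"
  shows "wp f count_block s (\<lambda>t s'. t \<le> 60 * (v1 - v0) + 40 \<and> rv s' ''rem'' = Y - u * cnt Q v0 v1 (\<lambda>x. x < th))"
  unfolding count_block_def wp_Seq wp_ISet wp_RSet
proof (rule wp_while[where V = "\<lambda>s'. 60 * (v1 - iv s' ''q'')" and
      I = "\<lambda>s'. v0 \<le> iv s' ''q'' \<and> iv s' ''q'' \<le> v1 \<and> rv s' ''rem'' = Y - u * cnt Q v0 (iv s' ''q'') (\<lambda>x. x < th)"], goal_cases)
  case 1
  show ?case using s by simp
next
  case (2 s1)
  define q where v: "q = iv s1 ''q''"
  have e: "imem s1 ''sigma'' = sg" "rv s1 ''u'' = u" "rmem s1 ''Q'' = Q" "iv s1 ''blk'' = j" "rmem s1 ''th'' j = th"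
    "imem s1 ''vs'' (sg j + 1) = v1"
    using frameI[OF 2(3)] frameR[OF 2(3)] s by simp_all
  have lt: "q < v1" using 2(2) e by (simp add: v)
  have q0: "v0 \<le> q" and I: "rv s1 ''rem'' = Y - u * cnt Q v0 q (\<lambda>x. x < th)" using 2(1) by (simp_all add: v)
  have pt: "40 + 60 * (v1 - (q + 1)) \<le> 60 * (v1 - q)" using lt by simp
  have cs: "cnt Q v0 (q + 1) (\<lambda>x. x < th) = cnt Q v0 q (\<lambda>x. x < th) + of_bool (Q q < th)" by (rule cnt_Suc[OF q0])
  have r1: "Y - u * cnt Q v0 q (\<lambda>x. x < th) - u = Y - u * cnt Q v0 (q + 1) (\<lambda>x. x < th)" if "Q q < th"
    unfolding cs using that by (simp add: algebra_simps)
  have r2: "cnt Q v0 (q + 1) (\<lambda>x. x < th) = cnt Q v0 q (\<lambda>x. x < th)" if "\<not> Q q < th"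
    unfolding cs using that by simp
  show ?case
    by (cases "Q q < th") (use lt pt q0 r1 r2 in \<open>simp_all add: e v[symmetric] I\<close>)
next
  case (3 t s1)
  have e: "imem s1 ''sigma'' = sg" "iv s1 ''blk'' = j" "imem s1 ''vs'' (sg j + 1) = v1"
    using frameI[OF 3(3)] s by simp_all
  have q: "iv s1 ''q'' = v1" using 3(1,2) e by simp
  show ?case using 3(1,4) by (simp add: q s)
qed

section \<open>All variables of a block\<close>

definition cut_vars :: com where
  "cut_vars = IS ''v'' (IGet ''sigma'' (ISub (IV ''blk'') (IConst 1))) ;;
     While (ILt (IV ''v'') (IGet ''sigma'' (IV ''blk''))) (inc ''v'' ;; cut_var)"

lemma mods_cut_vars [simp]: "imods cut_vars = {''q'', ''v''}" "rmods cut_vars = {''h'', ''rem'', ''d''}"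
  by (auto simp: cut_vars_def)

text \<open>One remainder is shared by all variables of the block. The overshoot of the ties is thus
  less than \<open>u\<close> per block and not per variable.\<close>

definition cut_set :: "(nat \<Rightarrow> real) \<Rightarrow> (nat \<Rightarrow> nat) \<Rightarrow> real \<Rightarrow> real \<Rightarrow> (nat \<Rightarrow> real) \<Rightarrow> (nat \<Rightarrow> real) \<Rightarrow> real \<Rightarrow> nat \<Rightarrow> nat \<Rightarrow>
    (nat \<Rightarrow> real) \<Rightarrow> real \<Rightarrow> (nat \<Rightarrow> nat) \<Rightarrow> bool" where
  "cut_set Q cc th u c d r0 lo v d' r t \<longleftrightarrow>
     (\<forall>i. lo < i \<and> i \<le> v \<longrightarrow> t i \<le> vcnt Q cc i (\<lambda>x. x = th) \<and>
        d' i = min (d i) (c i + real (2 + vcnt Q cc i (\<lambda>x. x < th) + t i) * u)) \<and>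
     (\<forall>i. \<not> (lo < i \<and> i \<le> v) \<longrightarrow> d' i = d i) \<and>
     r = r0 - u * (\<Sum>i\<in>{lo<..v}. real (t i)) \<and>
     ((\<forall>i. lo < i \<and> i \<le> v \<longrightarrow> t i = vcnt Q cc i (\<lambda>x. x = th)) \<or> r \<le> 0) \<and>
     ((\<forall>i. lo < i \<and> i \<le> v \<longrightarrow> t i = 0) \<or> - u < r)"

lemma cut_set_step:
  assumes u: "0 < u" and lv: "lo \<le> v" and S: "cut_set Q cc th u c d r0 lo v d' r t"
    and C: "cutv Q (vstart cc (v + 1)) th u (c (v + 1)) r (vstart cc (v + 1 + 1)) h r'"
  shows "\<exists>t. cut_set Q cc th u c d r0 lo (v + 1) (d'(v + 1 := min (d (v + 1)) h)) r' t"
proof -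
  obtain k where k: "k \<le> vcnt Q cc (v + 1) (\<lambda>x. x = th)"
     "h = c (v + 1) + real (2 + vcnt Q cc (v + 1) (\<lambda>x. x < th) + k) * u" "r' = r - real k * u"
     "k = vcnt Q cc (v + 1) (\<lambda>x. x = th) \<or> r' \<le> 0" "k = 0 \<or> - u < r'"
    using C unfolding cutv_def by blast
  have S': "\<And>i. lo < i \<Longrightarrow> i \<le> v \<Longrightarrow> t i \<le> vcnt Q cc i (\<lambda>x. x = th) \<and>
        d' i = min (d i) (c i + real (2 + vcnt Q cc i (\<lambda>x. x < th) + t i) * u)"
     "\<And>i. \<not> (lo < i \<and> i \<le> v) \<Longrightarrow> d' i = d i"
     "r = r0 - u * (\<Sum>i\<in>{lo<..v}. real (t i))"
     "(\<forall>i. lo < i \<and> i \<le> v \<longrightarrow> t i = vcnt Q cc i (\<lambda>x. x = th)) \<or> r \<le> 0"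
     "(\<forall>i. lo < i \<and> i \<le> v \<longrightarrow> t i = 0) \<or> - u < r"
    using S unfolding cut_set_def by blast+
  let ?t = "t(v + 1 := k)"
  have cases: "i = v + 1 \<or> i \<le> v \<and> i \<noteq> v + 1" if "i \<le> v + 1" for i using that by auto
  have ru: "0 \<le> real k * u" using u by simp
  have "{lo<..v + 1} = insert (v + 1) {lo<..v}" using lv by auto
  moreover have "(\<Sum>i\<in>{lo<..v}. real (?t i)) = (\<Sum>i\<in>{lo<..v}. real (t i))" by (intro sum.cong) auto
  ultimately have sm: "(\<Sum>i\<in>{lo<..v + 1}. real (?t i)) = real k + (\<Sum>i\<in>{lo<..v}. real (t i))" by simp
  have "cut_set Q cc th u c d r0 lo (v + 1) (d'(v + 1 := min (d (v + 1)) h)) r' ?t"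
    unfolding cut_set_def
  proof (intro conjI)
    show "\<forall>i. lo < i \<and> i \<le> v + 1 \<longrightarrow> ?t i \<le> vcnt Q cc i (\<lambda>x. x = th) \<and>
        (d'(v + 1 := min (d (v + 1)) h)) i = min (d i) (c i + real (2 + vcnt Q cc i (\<lambda>x. x < th) + ?t i) * u)"
    proof (intro allI impI)
      fix i assume i: "lo < i \<and> i \<le> v + 1"
      show "?t i \<le> vcnt Q cc i (\<lambda>x. x = th) \<and>
        (d'(v + 1 := min (d (v + 1)) h)) i = min (d i) (c i + real (2 + vcnt Q cc i (\<lambda>x. x < th) + ?t i) * u)"
      proof (cases "i = v + 1")
        case True
        then show ?thesis using k(1,2) by simp
      next
        case False
        then have "i \<le> v" using cases[of i] i by blast
        then show ?thesis using S'(1)[of i] i False by simp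
      qed
    qed
    show "\<forall>i. \<not> (lo < i \<and> i \<le> v + 1) \<longrightarrow> (d'(v + 1 := min (d (v + 1)) h)) i = d i"
    proof (intro allI impI)
      fix i assume i: "\<not> (lo < i \<and> i \<le> v + 1)"
      then have "i \<noteq> v + 1" "\<not> (lo < i \<and> i \<le> v)" using lv by auto
      then show "(d'(v + 1 := min (d (v + 1)) h)) i = d i" using S'(2)[of i] by simp
    qed
    show "r' = r0 - u * (\<Sum>i\<in>{lo<..v + 1}. real (?t i))" unfolding sm k(3) S'(3) by (simp add: algebra_simps)
    show "(\<forall>i. lo < i \<and> i \<le> v + 1 \<longrightarrow> ?t i = vcnt Q cc i (\<lambda>x. x = th)) \<or> r' \<le> 0"
    proof (rule disjCI)
      assume "\<not> r' \<le> 0"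
      then have "\<not> r \<le> 0" "k = vcnt Q cc (v + 1) (\<lambda>x. x = th)" using k(3,4) ru by linarith+
      then show "\<forall>i. lo < i \<and> i \<le> v + 1 \<longrightarrow> ?t i = vcnt Q cc i (\<lambda>x. x = th)"
        using S'(4) cases by (metis fun_upd_apply)
    qed
    show "(\<forall>i. lo < i \<and> i \<le> v + 1 \<longrightarrow> ?t i = 0) \<or> - u < r'"
    proof (rule disjCI)
      assume "\<not> - u < r'"
      then have "k = 0" using k(5) by blast
      then have "\<not> - u < r" using \<open>\<not> - u < r'\<close> k(3) by simp
      then show "\<forall>i. lo < i \<and> i \<le> v + 1 \<longrightarrow> ?t i = 0" using S'(5) cases \<open>k = 0\<close> by (metis fun_upd_apply)
    qed
  qed
  then show ?thesis by blast
qed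

lemma cut_vars:
  assumes u: "0 < u" and s: "imem s ''sigma'' = sg" "rmem s ''c'' = c" "rmem s ''d'' = d" "rv s ''u'' = u" "rmem s ''Q'' = Q"
    "iv s ''blk'' = j" "rmem s ''th'' j = th" "rv s ''rem'' = r0"
    and vs: "\<And>i. 1 \<le> i \<Longrightarrow> i \<le> sg j + 1 \<Longrightarrow> imem s ''vs'' i = vstart cc i" and sg: "sg (j - 1) \<le> sg j"
  shows "wp f cut_vars s (\<lambda>t s'. t \<le> 80 * (vstart cc (sg j + 1) - vstart cc (sg (j - 1) + 1)) + 100 * (sg j - sg (j - 1)) + 40 \<and>
    (\<exists>t. cut_set Q cc th u c d r0 (sg (j - 1)) (sg j) (rmem s' ''d'') (rv s' ''rem'') t))"
  unfolding cut_vars_def wp_Seq wp_ISet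
proof (rule wp_while[where V = "\<lambda>s'. 80 * (vstart cc (sg j + 1) - vstart cc (iv s' ''v'' + 1)) + 100 * (sg j - iv s' ''v'')" and
      I = "\<lambda>s'. sg (j - 1) \<le> iv s' ''v'' \<and> iv s' ''v'' \<le> sg j \<and>
        (\<exists>t. cut_set Q cc th u c d r0 (sg (j - 1)) (iv s' ''v'') (rmem s' ''d'') (rv s' ''rem'') t)"], goal_cases)
  case 1
  show ?case using sg by (simp add: s cut_set_def)
next
  case (2 s1)
  define v where "v = iv s1 ''v''"
  have e: "imem s1 ''sigma'' = sg" "rmem s1 ''c'' = c" "rv s1 ''u'' = u" "rmem s1 ''Q'' = Q"
    "iv s1 ''blk'' = j" "rmem s1 ''th'' j = th" "imem s1 ''vs'' = imem s ''vs''"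
    using frameI[OF 2(3)] frameR[OF 2(3)] s by simp_all
  have v: "v < sg j" "sg (j - 1) \<le> v" using 2(1,2) e by (simp_all add: v_def)
  obtain t0 where S: "cut_set Q cc th u c d r0 (sg (j - 1)) v (rmem s1 ''d'') (rv s1 ''rem'') t0"
    using 2(1) by (auto simp: v_def)
  have dv: "rmem s1 ''d'' (v + 1) = d (v + 1)" using S v unfolding cut_set_def by simp
  have vs1: "imem s1 ''vs'' (v + 1) = vstart cc (v + 1)" "imem s1 ''vs'' (v + 1 + 1) = vstart cc (v + 1 + 1)"
    using vs[of "v + 1"] vs[of "v + 1 + 1"] v e by simp_all
  have m1: "vstart cc (v + 1) \<le> vstart cc (v + 1 + 1)" "vstart cc (v + 1 + 1) \<le> vstart cc (sg j + 1)"
    using v by (intro vstart_mono; simp)+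
  have CV: "wp f cut_var (iset ''v'' 0 (v + 1) s1) (\<lambda>t s'. t \<le> 80 * (vstart cc (v + 1 + 1) - vstart cc (v + 1)) + 60 \<and>
    (\<exists>h. cutv Q (vstart cc (v + 1)) th u (c (v + 1)) (rv s1 ''rem'') (vstart cc (v + 1 + 1)) h (rv s' ''rem'') \<and>
    rmem s' ''d'' = (rmem s1 ''d'')(v + 1 := min (rmem s1 ''d'' (v + 1)) h)))"
    by (rule cut_var[OF u]) (use e vs1 m1 in simp_all)
  have CV': "wp f cut_var (iset ''v'' 0 (v + 1) s1) (\<lambda>t s'. t \<le> 80 * (vstart cc (v + 1 + 1) - vstart cc (v + 1)) + 60 \<and>
     iv s' ''v'' = v + 1 \<and> (\<exists>t. cut_set Q cc th u c d r0 (sg (j - 1)) (v + 1) (rmem s' ''d'') (rv s' ''rem'') t))"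
  proof (rule wp_use[OF CV], elim conjE exE)
    fix t s' h assume q: "t \<le> 80 * (vstart cc (v + 1 + 1) - vstart cc (v + 1)) + 60"
      "cutv Q (vstart cc (v + 1)) th u (c (v + 1)) (rv s1 ''rem'') (vstart cc (v + 1 + 1)) h (rv s' ''rem'')"
      "rmem s' ''d'' = (rmem s1 ''d'')(v + 1 := min (rmem s1 ''d'' (v + 1)) h)"
      and fr: "frame cut_var (iset ''v'' 0 (v + 1) s1) s'"
    have "iv s' ''v'' = v + 1" using frameI[OF fr] by simp
    then show "t \<le> 80 * (vstart cc (v + 1 + 1) - vstart cc (v + 1)) + 60 \<and>
     iv s' ''v'' = v + 1 \<and> (\<exists>t. cut_set Q cc th u c d r0 (sg (j - 1)) (v + 1) (rmem s' ''d'') (rv s' ''rem'') t)"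
      using cut_set_step[OF u v(2) S q(2)] q(1) unfolding q(3) dv by blast
  qed
  have V1: "80 * (vstart cc (sg j + 1) - vstart cc (v + 1)) =
      80 * (vstart cc (sg j + 1) - vstart cc (v + 1 + 1)) + 80 * (vstart cc (v + 1 + 1) - vstart cc (v + 1))"
    using m1 by simp
  have V2: "100 * (sg j - v) = 100 * (sg j - (v + 1)) + 100" using v by simp
  show ?case
    unfolding wp_Seq wp_ISet v_def[symmetric] V1 V2
    apply (simp only: ival.simps v_def[symmetric])
    apply (rule wp_use[OF CV'])
    using v by simp
next
  case (3 t s1)
  have e: "imem s1 ''sigma'' = sg" "iv s1 ''blk'' = j" using frameI[OF 3(3)] s by simp_all
  have v: "iv s1 ''v'' = sg j" using 3(1,2) e by simp
  show ?case using 3(1,4) by (simp add: v s)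
qed

section \<open>Correctness of a cut\<close>

lemma convex_slopes:
  fixes F :: "real \<Rightarrow> real"
  assumes F: "convex_on {c..d} F" and x: "c \<le> x" "x < y" "y < z" "z \<le> d"
  shows "(F y - F x) / (y - x) \<le> (F z - F y) / (z - y)"
proof -
  define t where "t = (y - x) / (z - x)"
  have t: "0 \<le> t" "t \<le> 1" using x by (simp_all add: t_def)
  have tz: "t * (z - x) = y - x" using x by (simp add: t_def)
  have "(1 - t) *\<^sub>R x + t *\<^sub>R z = x + t * (z - x)" by (simp add: algebra_simps)
  then have y: "(1 - t) *\<^sub>R x + t *\<^sub>R z = y" using tz by simp
  have "F y \<le> (1 - t) * F x + t * F z"
    using convex_onD[OF F t, of x z] x unfolding y by simp
  then have "F y * (z - x) \<le> ((1 - t) * F x + t * F z) * (z - x)" using x by (intro mult_right_mono) auto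
  also have "\<dots> = F x * (z - x) + (F z - F x) * (t * (z - x))" by (simp add: algebra_simps)
  finally have "F y * (z - x) \<le> F x * (z - x) + (F z - F x) * (y - x)" unfolding tz .
  then have "(F y - F x) * (z - y) \<le> (F z - F y) * (y - x)" by (simp add: algebra_simps)
  then show ?thesis using x by (simp add: divide_simps mult.commute)
qed

lemma convex_slopes_le:
  fixes F :: "real \<Rightarrow> real"
  assumes F: "convex_on {c..d} F" and x: "c \<le> x" "x < y" "y \<le> p" "p < q" "q \<le> d"
  shows "(F y - F x) / (y - x) \<le> (F q - F p) / (q - p)"
proof (cases "y = p")
  case True
  then show ?thesis using convex_slopes[OF F, of x y q] x by simp
next
  case False
  have "(F y - F x) / (y - x) \<le> (F p - F y) / (p - y)" using convex_slopes[OF F, of x y p] x False by simp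
  also have "\<dots> \<le> (F q - F p) / (q - p)" using convex_slopes[OF F, of y p q] x False by simp
  finally show ?thesis .
qed

context
  fixes F :: "nat \<Rightarrow> real \<Rightarrow> real" and c d :: "nat \<Rightarrow> real" and u :: real and i :: nat
  assumes F: "convex_on {c i..d i} (F i)" and u: "0 < u"
begin

lemma slope_mono:
  assumes "k \<le> l" "c i + real (l + 2) * u \<le> d i"
  shows "slope F c u i k \<le> slope F c u i l"
proof (cases "k = l")
  case False
  then have kl: "k + 2 \<le> l + 1" using assms by simp
  define x1 x2 y1 y2 where "x1 = c i + real (k + 1) * u" "x2 = c i + real (k + 2) * u"
    "y1 = c i + real (l + 1) * u" "y2 = c i + real (l + 2) * u"
  have "real (k + 2) * u \<le> real (l + 1) * u" using kl u by (intro mult_right_mono) auto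
  then have "x2 \<le> y1" by (simp add: x1_x2_y1_y2_def)
  moreover have "x2 - x1 = u" "y2 - y1 = u" by (simp_all add: x1_x2_y1_y2_def algebra_simps)
  moreover have "c i \<le> x1" using u by (simp add: x1_x2_y1_y2_def)
  ultimately have "(F i x2 - F i x1) / (x2 - x1) \<le> (F i y2 - F i y1) / (y2 - y1)"
    using u assms(2) by (intro convex_slopes_le[OF F]) (auto simp: x1_x2_y1_y2_def)
  then show ?thesis unfolding slope_def \<open>x2 - x1 = u\<close> \<open>y2 - y1 = u\<close> by (simp add: x1_x2_y1_y2_def)
qed simp

lemma slope_up:
  assumes k: "slope F c u i k \<le> l" "c i + real (k + 2) * u \<le> d i"
    and x: "c i \<le> x" "x < y" "y \<le> c i + real (k + 1) * u"
  shows "F i y - F i x \<le> l * (y - x)"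
proof -
  define p q where "p = c i + real (k + 1) * u" "q = c i + real (k + 2) * u"
  have pq: "q - p = u" by (simp add: p_q_def algebra_simps)
  have "(F i y - F i x) / (y - x) \<le> (F i q - F i p) / (q - p)"
    using x u pq k(2) by (intro convex_slopes_le[OF F]) (auto simp: p_q_def)
  also have "\<dots> = slope F c u i k" unfolding slope_def pq by (simp add: p_q_def)
  finally have "(F i y - F i x) / (y - x) \<le> l" using k(1) by linarith
  then show ?thesis using x by (simp add: divide_simps)
qed

lemma slope_dn:
  assumes k: "l \<le> slope F c u i k"
    and x: "c i + real (k + 2) * u \<le> x" "x < y" "y \<le> d i"
  shows "l * (y - x) \<le> F i y - F i x"
proof -
  define p q where "p = c i + real (k + 1) * u" "q = c i + real (k + 2) * u"
  have pq: "q - p = u" by (simp add: p_q_def algebra_simps)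
  have "c i \<le> p" using u by (simp add: p_q_def)
  then have "(F i q - F i p) / (q - p) \<le> (F i y - F i x) / (y - x)"
    using x u pq by (intro convex_slopes_le[OF F]) (auto simp: p_q_def)
  moreover have "(F i q - F i p) / (q - p) = slope F c u i k" unfolding slope_def pq by (simp add: p_q_def)
  ultimately have "l \<le> (F i y - F i x) / (y - x)" using k(1) by linarith
  then show ?thesis using x by (simp add: divide_simps)
qed

end

lemma steps_bounds:
  assumes "0 < u"
  shows "k < steps d u (c + 2 * u) \<Longrightarrow> c + real (k + 2) * u \<le> d"
    and "steps d u (c + 2 * u) \<le> k \<Longrightarrow> d < c + real (k + 2) * u"
proof -
  have e: "(d - (c + 2 * u)) / u + 1 = (d - c) / u - 1" using assms by (simp add: field_simps)
  {
    assume "k < steps d u (c + 2 * u)"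
    then have "int k < \<lfloor>(d - c) / u - 1\<rfloor>" unfolding steps_def e by linarith
    then have "real k + 1 \<le> (d - c) / u - 1" by linarith
    then show "c + real (k + 2) * u \<le> d" using assms by (simp add: field_simps)
  }
  {
    assume "steps d u (c + 2 * u) \<le> k"
    then have "\<lfloor>(d - c) / u - 1\<rfloor> \<le> int k" unfolding steps_def e by linarith
    then have "(d - c) / u - 1 < real k + 1" by linarith
    then show "d < c + real (k + 2) * u" using assms by (simp add: field_simps)
  }
qed

text \<open>In a sorted segment the members of a down-set form an initial part, whose length is
  their count; membership of a single cell is thus a comparison of its index with a count.\<close>

lemma cnt_down_sorted:
  assumes D: "down D" and s: "\<And>x y. x \<le> y \<Longrightarrow> y < N \<Longrightarrow> A (p + x) \<le> A (p + y)" and k: "k < N"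
  shows "D (A (p + k)) \<longleftrightarrow> k < cnt A p (p + N) D"
proof -
  have card: "cnt A p (p + N) D = card {x. x < N \<and> D (A (p + x))}"
    unfolding cnt_shift[symmetric] cnt_card ..
  show ?thesis
  proof
    assume Dk: "D (A (p + k))"
    have "{..k} \<subseteq> {x. x < N \<and> D (A (p + x))}"
    proof
      fix x assume "x \<in> {..k}"
      then have x: "x \<le> k" by simp
      have "D (A (p + x))" using D Dk s[OF x k] unfolding down_def by blast
      then show "x \<in> {x. x < N \<and> D (A (p + x))}" using x k by simp
    qed
    then have "card {..k} \<le> card {x. x < N \<and> D (A (p + x))}" by (intro card_mono) simp_all
    then show "k < cnt A p (p + N) D" by (simp add: card)
  next
    assume lt: "k < cnt A p (p + N) D"
    show "D (A (p + k))"
    proof (rule ccontr)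
      assume n: "\<not> D (A (p + k))"
      have "{x. x < N \<and> D (A (p + x))} \<subseteq> {..<k}"
      proof
        fix x assume x: "x \<in> {x. x < N \<and> D (A (p + x))}"
        show "x \<in> {..<k}"
        proof (rule ccontr)
          assume "x \<notin> {..<k}"
          then have "A (p + k) \<le> A (p + x)" using s[of k x] x by simp
          then show False using n x D unfolding down_def by blast
        qed
      qed
      then have "card {x. x < N \<and> D (A (p + x))} \<le> card {..<k}" by (intro card_mono) simp_all
      then show False using lt by (simp add: card)
    qed
  qed
qed

text \<open>The assumption \<open>\<not> D B\<close> keeps the sentinel out of the sum. What remains
  are survivors of weight \<open>w * u\<close>, for which the two-sided guarantee of
  \<open>compress\<close> only has to be scaled by \<open>u\<close>.\<close>

lemma packed_sum:
  assumes pk: "packed u B N A wid csum p p' P Wt cs cap" and u: "0 < u" and D: "down D" "\<not> D B"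
  shows "sum Wt {q \<in> {p..<p'}. D (P q)} \<le> u * cnt A 0 N D"
    and "u * cnt A 0 N D \<le> sum Wt {q \<in> {p..<p'}. D (P q)} + u * N / 32"
proof -
  obtain len and w :: real where h: "1 \<le> w" "p' = p + len + 1" "\<forall>k<len. Wt (p + k) = w * u"
     "P (p + len) = B"
     "\<forall>D. down D \<longrightarrow> w * cnt (\<lambda>k. P (p + k)) 0 len D \<le> cnt A 0 N D \<and>
        cnt A 0 N D \<le> w * cnt (\<lambda>k. P (p + k)) 0 len D + N / 32"
    using pk unfolding packed_def by blast
  have "sum Wt {q \<in> {p..<p'}. D (P q)} = sum Wt ((\<lambda>k. p + k) ` {k. k < len \<and> D (P (p + k))})"
  proof (rule sum.cong)
    show "{q \<in> {p..<p'}. D (P q)} = (\<lambda>k. p + k) ` {k. k < len \<and> D (P (p + k))}"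
    proof (rule set_eqI)
      fix q
      show "q \<in> {q \<in> {p..<p'}. D (P q)} \<longleftrightarrow> q \<in> (\<lambda>k. p + k) ` {k. k < len \<and> D (P (p + k))}"
      proof
        assume q: "q \<in> {q \<in> {p..<p'}. D (P q)}"
        then have "q \<noteq> p + len" using D(2) h(4) by auto
        then show "q \<in> (\<lambda>k. p + k) ` {k. k < len \<and> D (P (p + k))}"
          using q h(2) by (intro image_eqI[of _ _ "q - p"]) auto
      qed (use h(2) in auto)
    qed
  qed simp
  also have "\<dots> = (\<Sum>k\<in>{k. k < len \<and> D (P (p + k))}. w * u)"
    using h(3) by (subst sum.reindex) (auto simp: inj_on_def)
  also have "\<dots> = u * (w * cnt (\<lambda>k. P (p + k)) 0 len D)" by (simp add: cnt_card)
  finally have e: "sum Wt {q \<in> {p..<p'}. D (P q)} = u * (w * cnt (\<lambda>k. P (p + k)) 0 len D)" .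
  have b: "w * cnt (\<lambda>k. P (p + k)) 0 len D \<le> cnt A 0 N D"
    "cnt A 0 N D \<le> w * cnt (\<lambda>k. P (p + k)) 0 len D + N / 32"
    using h(5) D(1) by blast+
  show "sum Wt {q \<in> {p..<p'}. D (P q)} \<le> u * cnt A 0 N D"
    unfolding e using b(1) u by (intro mult_left_mono) auto
  have "u * cnt A 0 N D \<le> u * (w * cnt (\<lambda>k. P (p + k)) 0 len D + N / 32)"
    using b(2) u by (intro mult_left_mono) auto
  then show "u * cnt A 0 N D \<le> sum Wt {q \<in> {p..<p'}. D (P q)} + u * N / 32"
    unfolding e by (simp add: algebra_simps)
qed

section \<open>From thresholds to new bounds\<close>

lemma sum_blocks:
  fixes sg :: "nat \<Rightarrow> nat" and g :: "nat \<Rightarrow> real"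
  assumes "sg 0 = 0" "\<And>i j. i < j \<Longrightarrow> j \<le> m \<Longrightarrow> sg i < sg j" "k \<le> m"
  shows "(\<Sum>i=1..sg k. g i) = (\<Sum>j=1..k. \<Sum>i\<in>{sg (j - 1)<..sg j}. g i)"
  using assms(3)
proof (induction k)
  case 0 show ?case by (simp add: assms(1))
next
  case (Suc k)
  have le: "sg k \<le> sg (Suc k)" using assms(2)[of k "Suc k"] Suc.prems by simp
  have "pre g (sg (Suc k)) = pre g (sg k) + (\<Sum>i\<in>{sg k<..sg (Suc k)}. g i)" using pre_diff[OF le, of g] by simp
  then show ?case using Suc by (simp add: pre_def)
qed

lemma down_le: "down (\<lambda>x. x \<le> t)" and down_less: "down (\<lambda>x. x < t)"
  by (auto simp: down_def)

lemma cnt_le_split: "cnt Q a b (\<lambda>x. x \<le> t) = cnt Q a b (\<lambda>x. x < t) + cnt Q a b (\<lambda>x. x = t)"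
  unfolding cnt_def sum.distrib[symmetric] by (rule sum.cong) auto

lemma cnt_mono: "(\<And>x. D x \<Longrightarrow> D' x) \<Longrightarrow> cnt Q a b D \<le> cnt Q a b D'"
  unfolding cnt_def by (rule sum_mono) auto

lemma cnt_bound: "cnt Q a b D \<le> b - a"
proof -
  have "cnt Q a b D \<le> (\<Sum>k\<in>{a..<b}. 1)" unfolding cnt_def by (rule sum_mono) auto
  then show ?thesis by simp
qed

text \<open>The thresholds of the greedy algorithm refer to thinned items, the bounds
  \<open>h\<close> to actual cells; this lemma brings both into the form required by
  \<open>cut_exists\<close>. The error in the last conclusion consists of \<open>2 u\<close> per
  variable from the advance cells, less than \<open>u\<close> per block from ties and 1/32 of the
  width from thinning. As \<open>m \<le> n\<close>, the grid part is at most \<open>3 n u\<close>,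
  and 4 leaves some slack.\<close>

lemma cut_correct:
  fixes F :: "nat \<Rightarrow> real \<Rightarrow> real" and sg :: "nat \<Rightarrow> nat" and c d h a b Q P Wt C Y th la cap wid :: "nat \<Rightarrow> real"
    and cc bs ps :: "nat \<Rightarrow> nat" and u B :: real
  assumes u: "0 < u"
    and sg: "sg 0 = 0" "\<And>i j. i < j \<Longrightarrow> j \<le> m \<Longrightarrow> sg i < sg j" "sg m = n" and m: "1 \<le> m" "a m = b m"
    and F: "\<And>i. 1 \<le> i \<Longrightarrow> i \<le> n \<Longrightarrow> convex_on {c i..d i} (F i)"
      "\<And>i. 1 \<le> i \<Longrightarrow> i \<le> n \<Longrightarrow> continuous_on {c i..d i} (F i)"
    and x0: "feas n m sg a b c d x0"
    and cc: "\<And>i. cc i = steps (d i) u (c i + 2 * u)"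
    and Q: "\<And>i k. 1 \<le> i \<Longrightarrow> i \<le> n \<Longrightarrow> k < cc i \<Longrightarrow> Q (vstart cc i + k) = slope F c u i k \<and> \<bar>slope F c u i k\<bar> \<le> B - 1"
    and bs: "\<And>j. bs j = vstart cc (sg j + 1)"
    and pk: "\<And>j. 1 \<le> j \<Longrightarrow> j \<le> m \<Longrightarrow> packed u B (bs j - bs (j - 1)) (\<lambda>k. Q (bs (j - 1) + k)) (wid j)
      (\<Sum>i\<in>{sg (j - 1)<..sg j}. c i) (ps j) (ps (j + 1)) P Wt (C j) (cap j)"
    and G1: "\<And>j. 1 \<le> j \<Longrightarrow> j \<le> m \<Longrightarrow> a j \<le> pre (\<lambda>i. C i + Y i) j \<and> pre (\<lambda>i. C i + Y i) j \<le> b j"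
    and G2: "\<And>p q. 1 \<le> p \<Longrightarrow> p < q \<Longrightarrow> q \<le> m \<Longrightarrow> th p < la q \<Longrightarrow> \<exists>j. p \<le> j \<and> j < q \<and> pre (\<lambda>i. C i + Y i) j = b j"
    and G3: "\<And>p q. 1 \<le> q \<Longrightarrow> q < p \<Longrightarrow> p \<le> m \<Longrightarrow> th p < la q \<Longrightarrow> \<exists>j. q \<le> j \<and> j < p \<and> pre (\<lambda>i. C i + Y i) j = a j"
    and G4: "\<And>j. 1 \<le> j \<Longrightarrow> j \<le> m \<Longrightarrow> la j \<le> th j \<and> th j \<le> B"
    and G5: "\<And>j. 1 \<le> j \<Longrightarrow> j \<le> m \<Longrightarrow> sum Wt {p \<in> {ps j..<ps (j + 1)}. P p < th j} \<le> Y j \<and>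
       Y j \<le> sum Wt {p \<in> {ps j..<ps (j + 1)}. P p \<le> la j}"
    and cut: "\<And>j. 1 \<le> j \<Longrightarrow> j \<le> m \<Longrightarrow> \<exists>r t D. cut_set Q cc (th j) u c d (Y j - u * cnt Q (bs (j - 1)) (bs j) (\<lambda>x. x < th j))
       (sg (j - 1)) (sg j) D r t \<and> (\<forall>i. sg (j - 1) < i \<and> i \<le> sg j \<longrightarrow> h i = D i)"
  shows "\<And>i. 1 \<le> i \<Longrightarrow> i \<le> n \<Longrightarrow> c i \<le> h i \<and> h i \<le> d i"
    and "\<exists>x. feas n m sg a b c h x \<and> (\<forall>z. feas n m sg a b c d z \<longrightarrow> obj n F x \<le> obj n F z)"
    and "(\<Sum>i=1..n. h i - c i) \<le> b m - (\<Sum>i=1..n. c i) + (\<Sum>i=1..n. d i - c i) / 32 + 4 * real n * u"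
proof -
  let ?S = "pre (\<lambda>i. C i + Y i)"
  have sgn: "sg j \<le> n" if "j \<le> m" for j
    using sg(2)[of j m] sg(3) that by (cases "j = m") auto
  have sgle: "sg (j - 1) \<le> sg j" if "1 \<le> j" "j \<le> m" for j using sg(2)[of "j - 1" j] that by simp
  have C: "C j = (\<Sum>i\<in>{sg (j - 1)<..sg j}. c i)" if "1 \<le> j" "j \<le> m" for j
    using pk[OF that] unfolding packed_def by blast
  have bsle: "bs (j - 1) \<le> bs j" if "1 \<le> j" "j \<le> m" for j
    unfolding bs using sgle[OF that] by (intro vstart_mono) simp
  have cd: "c i \<le> d i" if "1 \<le> i" "i \<le> n" for i using x0 that unfolding feas_def by force
  have inblk: "1 \<le> i \<and> i \<le> n" if "1 \<le> j" "j \<le> m" "sg (j - 1) < i" "i \<le> sg j" for i j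
    using sgn[OF that(2)] that by simp
  have vc: "vstart cc (i + 1) = vstart cc i + cc i" if "1 \<le> i" for i by (rule vstart_Suc[OF that])
  have st: "c i + real (k + 2) * u \<le> d i" if "k < cc i" for i k
    using that unfolding cc by (rule steps_bounds(1)[OF u])
  have st2: "d i < c i + real (k + 2) * u" if "cc i \<le> k" for i k
    using that unfolding cc by (rule steps_bounds(2)[OF u])
  \<comment> \<open>Bundling the three existential witnesses of a block into one triple lets a
    single choice fix them consistently.\<close>
  define G where "G j p \<longleftrightarrow> cut_set Q cc (th j) u c d
       (Y j - u * cnt Q (bs (j - 1)) (bs j) (\<lambda>x. x < th j)) (sg (j - 1)) (sg j) (snd (snd p)) (fst p) (fst (snd p)) \<and>
       (\<forall>i. sg (j - 1) < i \<and> i \<le> sg j \<longrightarrow> h i = snd (snd p) i)" for j p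
  define r where "r j = fst (SOME p. G j p)" for j
  define t where "t j = fst (snd (SOME p. G j p))" for j
  define D where "D j = snd (snd (SOME p. G j p))" for j
  have cutj: "cut_set Q cc (th j) u c d
       (Y j - u * cnt Q (bs (j - 1)) (bs j) (\<lambda>x. x < th j)) (sg (j - 1)) (sg j) (D j) (r j) (t j) \<and>
       (\<forall>i. sg (j - 1) < i \<and> i \<le> sg j \<longrightarrow> h i = D j i)" if "1 \<le> j" "j \<le> m" for j
  proof -
    obtain r' t' D' where "cut_set Q cc (th j) u c d
       (Y j - u * cnt Q (bs (j - 1)) (bs j) (\<lambda>x. x < th j)) (sg (j - 1)) (sg j) D' r' t'"
       "\<forall>i. sg (j - 1) < i \<and> i \<le> sg j \<longrightarrow> h i = D' i"
      using cut[OF \<open>1 \<le> j\<close> \<open>j \<le> m\<close>] by (elim exE conjE)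
    then have "G j (r', t', D')" unfolding G_def by simp
    from someI[of "G j", OF this] show ?thesis unfolding G_def r_def t_def D_def .
  qed
  define lt where "lt j i = vcnt Q cc i (\<lambda>x. x < th j)" for j i
  define eq where "eq j i = vcnt Q cc i (\<lambda>x. x = th j)" for j i
  have tj: "t j i \<le> eq j i" "h i = min (d i) (c i + real (2 + lt j i + t j i) * u)"
    if "1 \<le> j" "j \<le> m" "sg (j - 1) < i" "i \<le> sg j" for i j
  proof -
    have "t j i \<le> vcnt Q cc i (\<lambda>x. x = th j) \<and>
        D j i = min (d i) (c i + real (2 + vcnt Q cc i (\<lambda>x. x < th j) + t j i) * u)"
      using conjunct1[OF cutj[OF that(1,2)], unfolded cut_set_def] that(3,4) by blast
    moreover have "h i = D j i" using conjunct2[OF cutj[OF that(1,2)]] that(3,4) by blast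
    ultimately show "t j i \<le> eq j i" "h i = min (d i) (c i + real (2 + lt j i + t j i) * u)"
      unfolding lt_def eq_def by simp_all
  qed
  have blkcnt: "cnt Q (bs (j - 1)) (bs j) E = (\<Sum>i\<in>{sg (j - 1)<..sg j}. vcnt Q cc i E)" if "1 \<le> j" "j \<le> m" for j E
    unfolding bs using cnt_vars[OF sgle[OF that]] .
  have rj: "r j = Y j - u * (\<Sum>i\<in>{sg (j - 1)<..sg j}. real (lt j i + t j i))"
    "(\<forall>i. sg (j - 1) < i \<and> i \<le> sg j \<longrightarrow> t j i = eq j i) \<or> r j \<le> 0"
    "(\<forall>i. sg (j - 1) < i \<and> i \<le> sg j \<longrightarrow> t j i = 0) \<or> - u < r j"
    if j: "1 \<le> j" "j \<le> m" for j
  proof -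
    have "r j = Y j - u * cnt Q (bs (j - 1)) (bs j) (\<lambda>x. x < th j) - u * (\<Sum>i\<in>{sg (j - 1)<..sg j}. real (t j i))"
      using conjunct1[OF cutj[OF j], unfolded cut_set_def] by blast
    then show "r j = Y j - u * (\<Sum>i\<in>{sg (j - 1)<..sg j}. real (lt j i + t j i))"
      unfolding blkcnt[OF j] lt_def by (simp add: sum.distrib algebra_simps)
    show "(\<forall>i. sg (j - 1) < i \<and> i \<le> sg j \<longrightarrow> t j i = eq j i) \<or> r j \<le> 0"
      "(\<forall>i. sg (j - 1) < i \<and> i \<le> sg j \<longrightarrow> t j i = 0) \<or> - u < r j"
      using conjunct1[OF cutj[OF j], unfolded cut_set_def] unfolding eq_def by blast+
  qed
  have bsN: "bs (j - 1) + (bs j - bs (j - 1)) = bs j" if "1 \<le> j" "j \<le> m" for j using bsle[OF that] by simp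
  have Ylo: "u * cnt Q (bs (j - 1)) (bs j) (\<lambda>x. x < th j) \<le> Y j + u * (bs j - bs (j - 1)) / 32" if j: "1 \<le> j" "j \<le> m" for j
  proof -
    have "\<not> B < th j" using G4[OF j] by simp
    from packed_sum(2)[OF pk[OF j] u down_less this] show ?thesis
      using G5[OF j] unfolding cnt_shift bsN[OF j] by simp
  qed
  have Yhi: "Y j \<le> u * cnt Q (bs (j - 1)) (bs j) (\<lambda>x. x \<le> la j)" if j: "1 \<le> j" "j \<le> m" "la j < B" for j
  proof -
    have "\<not> B \<le> la j" using j by simp
    from packed_sum(1)[OF pk[OF j(1,2)] u down_le this] show ?thesis
      using G5[OF j(1,2)] unfolding cnt_shift bsN[OF j(1,2)] by simp
  qed
  have item: "E (slope F c u i k) \<longleftrightarrow> k < vcnt Q cc i E" if i: "1 \<le> i" "i \<le> n" "k < cc i" "down E" for E i k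
  proof -
    have "Q (vstart cc i + x) \<le> Q (vstart cc i + y)" if xy: "x \<le> y" "y < cc i" for x y
    proof -
      have "c i + real (y + 2) * u \<le> d i" by (rule st[OF xy(2)])
      then have "slope F c u i x \<le> slope F c u i y" using slope_mono[where F = F and c = c and d = d and u = u and i = i, OF F(1)[OF i(1,2)] u xy(1)] by blast
      then show ?thesis using Q[OF i(1,2)] xy by simp
    qed
    from cnt_down_sorted[of E "cc i" Q "vstart cc i" k, OF i(4) this i(3)] show ?thesis
      using Q[OF i(1-3)] unfolding vc[OF i(1)] by simp
  qed
  have ccd: "c i + real (cc i) * u \<le> d i" "u * cc i \<le> d i - c i" if "1 \<le> i" "i \<le> n" for i
  proof -
    show "c i + real (cc i) * u \<le> d i"
    proof (cases "cc i")
      case 0 then show ?thesis using cd[OF that] by simp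
    next
      case (Suc k)
      have "c i + real (k + 2) * u \<le> d i" by (rule st) (simp add: Suc)
      moreover have "real (cc i) * u \<le> real (k + 2) * u" using u Suc by (intro mult_right_mono) auto
      ultimately show ?thesis by linarith
    qed
    then show "u * cc i \<le> d i - c i" by (simp add: algebra_simps)
  qed
  have hcut: "lt j i + t j i < cc i \<and> h i = c i + real (2 + lt j i + t j i) * u"
    if "1 \<le> j" "j \<le> m" "sg (j - 1) < i" "i \<le> sg j" "h i < d i" for i j
  proof -
    have h: "h i = c i + real (2 + lt j i + t j i) * u" using tj(2)[OF that(1-4)] that(5) by linarith
    have "lt j i + t j i < cc i"
    proof (rule ccontr)
      assume "\<not> ?thesis"
      then have "d i < c i + real (lt j i + t j i + 2) * u" by (intro st2) simp
      then show False using h that(5) by (simp add: algebra_simps)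
    qed
    then show ?thesis using h by blast
  qed
  \<comment> \<open>The number of cells of \<open>i\<close> that may be filled at slopes up to
    \<open>la\<close>. If \<open>la < th\<close>, all cells up to \<open>la\<close> qualify and lie
    below \<open>h\<close>. If the thresholds coincide, only the ties that were granted lie below
    \<open>h\<close>, so exactly the granted cells are counted.\<close>
  define e where "e j i = (if la j < th j then vcnt Q cc i (\<lambda>x. x \<le> la j) else lt j i + t j i)" for j i
  have lteq: "lt j i + eq j i = vcnt Q cc i (\<lambda>x. x \<le> th j)" for j i
    unfolding lt_def eq_def by (rule cnt_le_split[symmetric])
  have ele: "e j i \<le> vcnt Q cc i (\<lambda>x. x \<le> la j)" "e j i \<le> lt j i + t j i" "e j i \<le> cc i"
    if j: "1 \<le> j" "j \<le> m" "sg (j - 1) < i" "i \<le> sg j" for i j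
  proof -
    show 1: "e j i \<le> vcnt Q cc i (\<lambda>x. x \<le> la j)"
    proof (cases "la j < th j")
      case False
      then have "th j = la j" using G4[OF j(1,2)] by simp
      then show ?thesis using False lteq[of j i] tj(1)[OF j] by (simp add: e_def)
    qed (simp add: e_def)
    show "e j i \<le> lt j i + t j i"
    proof (cases "la j < th j")
      case True
      have "vcnt Q cc i (\<lambda>x. x \<le> la j) \<le> lt j i" unfolding lt_def using True by (intro cnt_mono) simp
      then show ?thesis using True by (simp add: e_def)
    qed (simp add: e_def)
    have "vcnt Q cc i (\<lambda>x. x \<le> la j) \<le> cc i"
      using cnt_bound[of Q "vstart cc i" "vstart cc (i + 1)"] vc[of i] inblk[OF j] by simp
    then show "e j i \<le> cc i" using 1 by simp
  qed
  define bk where "bk i = (SOME j. 1 \<le> j \<and> j \<le> m \<and> sg (j - 1) < i \<and> i \<le> sg j)" for i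
  have bk: "1 \<le> bk i \<and> bk i \<le> m \<and> sg (bk i - 1) < i \<and> i \<le> sg (bk i)" if i: "1 \<le> i" "i \<le> n" for i
  proof -
    have "i \<le> sg m" using i sg(3) by simp
    from someI_ex[OF block_exists[of sg, OF sg(1) i(1) this]] show ?thesis unfolding bk_def .
  qed
  have bkj: "bk i = j" if j: "1 \<le> j" "j \<le> m" "sg (j - 1) < i" "i \<le> sg j" for i j
  proof -
    have i: "1 \<le> i" "i \<le> n" using inblk[OF j] by blast+
    note b = bk[OF i]
    have *: False if "x < y" "y \<le> m" "i \<le> sg x" "sg (y - 1) < i" for x y
    proof -
      have "x = y - 1 \<or> x < y - 1 \<and> y - 1 \<le> m" using that by linarith
      then have "sg x \<le> sg (y - 1)" using sg(2)[of x "y - 1"] by auto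
      then show False using that by linarith
    qed
    show ?thesis using *[of "bk i" j] *[of j "bk i"] b j by (metis linorder_neqE_nat)
  qed
  define y where "y i = c i + real (e (bk i) i) * u" for i
  show ch: "c i \<le> h i \<and> h i \<le> d i" if i: "1 \<le> i" "i \<le> n" for i
  proof -
    note b = bk[OF i]
    have "0 \<le> real (2 + lt (bk i) i + t (bk i) i) * u" using u by simp
    then show ?thesis using tj(2)[of "bk i" i] b cd[OF i] by simp
  qed
  show "\<exists>x. feas n m sg a b c h x \<and> (\<forall>z. feas n m sg a b c d z \<longrightarrow> obj n F x \<le> obj n F z)"
  proof (rule cut_exists[where S = ?S and th = th and la = la and BIG = B and y = y])
    show "sg 0 = 0" "sg m = n" "1 \<le> m" "a m = b m" "feas n m sg a b c d x0" by fact+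
    show "sg i < sg j" if "i < j" "j \<le> m" for i j using sg(2) that .
    show "\<forall>i\<in>{1..n}. continuous_on {c i..d i} (F i)" using F(2) by simp
    show "?S 0 = 0" by simp
    show "a j \<le> ?S j \<and> ?S j \<le> b j" if "1 \<le> j" "j \<le> m" for j using G1[OF that] .
    show "\<exists>j. p \<le> j \<and> j < q \<and> ?S j = b j" if "1 \<le> p" "p < q" "q \<le> m" "th p < la q" for p q using G2[OF that] .
    show "\<exists>j. q \<le> j \<and> j < p \<and> ?S j = a j" if "1 \<le> q" "q < p" "p \<le> m" "th p < la q" for p q using G3[OF that] .
    show "la j \<le> th j" if "1 \<le> j" "j \<le> m" for j using G4[OF that] by blast
    show "?S j - ?S (j - 1) \<le> pre y (sg j) - pre y (sg (j - 1))" if j: "1 \<le> j" "j \<le> m" "la j < B" for j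
    proof -
      obtain k where k: "j = Suc k" using j by (cases j) auto
      have "?S j - ?S (j - 1) = C j + Y j" unfolding k by (simp add: pre_Suc)
      moreover have "pre y (sg j) - pre y (sg (j - 1)) = (\<Sum>i\<in>{sg (j - 1)<..sg j}. c i + real (e j i) * u)"
        unfolding pre_diff[OF sgle[OF j(1,2)]] using bkj[OF j(1,2)] by (intro sum.cong) (auto simp: y_def)
      moreover have "\<dots> = C j + u * (\<Sum>i\<in>{sg (j - 1)<..sg j}. real (e j i))"
        by (simp add: C[OF j(1,2)] sum.distrib sum_distrib_left mult.commute)
      moreover have "Y j \<le> u * (\<Sum>i\<in>{sg (j - 1)<..sg j}. real (e j i))"
      proof -
        have all: "Y j \<le> u * (\<Sum>i\<in>{sg (j - 1)<..sg j}. real (e j i))"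
          if "\<And>i. sg (j - 1) < i \<Longrightarrow> i \<le> sg j \<Longrightarrow> e j i = vcnt Q cc i (\<lambda>x. x \<le> la j)"
        proof -
          have "(\<Sum>i\<in>{sg (j - 1)<..sg j}. real (e j i)) = real (cnt Q (bs (j - 1)) (bs j) (\<lambda>x. x \<le> la j))"
            unfolding blkcnt[OF j(1,2)] of_nat_sum using that by (intro sum.cong) auto
          then show ?thesis using Yhi[OF j] by simp
        qed
        show ?thesis
        proof (cases "la j < th j")
          case True
          then show ?thesis by (intro all) (simp add: e_def)
        next
          case False
          then have tl: "th j = la j" using G4[OF j(1,2)] by simp
          \<comment> \<open>For equal thresholds: either every tie was granted, so all cells up to
            \<open>la\<close> are counted, or the remainder is used up, which says that the granted
            cells already weigh at least \<open>Y\<close>.\<close>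
          from rj(2)[OF j(1,2)] show ?thesis
          proof
            assume A: "\<forall>i. sg (j - 1) < i \<and> i \<le> sg j \<longrightarrow> t j i = eq j i"
            show ?thesis
            proof (rule all)
              fix i assume "sg (j - 1) < i" "i \<le> sg j"
              then have "t j i = eq j i" using A by blast
              then show "e j i = vcnt Q cc i (\<lambda>x. x \<le> la j)" using False lteq[of j i] tl by (simp add: e_def)
            qed
          next
            assume "r j \<le> 0"
            then show ?thesis using rj(1)[OF j(1,2)] False by (simp add: e_def)
          qed
        qed
      qed
      ultimately show ?thesis by linarith
    qed
    show "y i \<le> h i \<and> y i \<le> d i \<and> c i \<le> h i \<and> h i \<le> d i" if i: "1 \<le> i" "i \<le> n" for i
    proof -
      note b = bk[OF i]
      note el = ele[of "bk i" i]
      have "real (e (bk i) i) * u \<le> real (cc i) * u" "real (e (bk i) i) * u \<le> real (2 + lt (bk i) i + t (bk i) i) * u"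
        using el b u by (intro mult_right_mono; simp)+
      then have "y i \<le> d i" "y i \<le> c i + real (2 + lt (bk i) i + t (bk i) i) * u"
        using ccd(1)[OF i] by (simp_all add: y_def)
      then show ?thesis using tj(2)[of "bk i" i] b ch[OF i] by simp
    qed
    show "F i w - F i v \<le> la j * (w - v)"
      if j: "1 \<le> j" "j \<le> m" "la j < B" "sg (j - 1) < i" "i \<le> sg j" and v: "c i \<le> v" "v < w" "w \<le> y i" for i j v w
    proof -
      have i: "1 \<le> i" "i \<le> n" using inblk[OF j(1,2,4,5)] by blast+
      have yi: "y i = c i + real (e j i) * u" using bkj[OF j(1,2,4,5)] by (simp add: y_def)
      note el = ele[OF j(1,2,4,5)]
      have "e j i \<noteq> 0"
      proof
        assume "e j i = 0"
        then show False using v yi by simp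
      qed
      then obtain k where k: "e j i = k + 1" by (metis Suc_eq_plus1 not0_implies_Suc)
      have kc: "k < cc i" using el(3) k by simp
      have "slope F c u i k \<le> la j" using item[OF i kc down_le, of "la j"] el(1) k by simp
      moreover have "c i + real (k + 2) * u \<le> d i" by (rule st[OF kc])
      ultimately show ?thesis using slope_up[where F = F and c = c and d = d and u = u and i = i, OF F(1)[OF i] u, where k = k and l = "la j" and x = v and y = w] v yi k by simp
    qed
    show "th j * (w - v) \<le> F i w - F i v"
      if j: "1 \<le> j" "j \<le> m" "sg (j - 1) < i" "i \<le> sg j" and v: "h i \<le> v" "v < w" "w \<le> d i" for i j v w
    proof -
      have i: "1 \<le> i" "i \<le> n" using inblk[OF j] by blast+
      have hc: "lt j i + t j i < cc i" "h i = c i + real (2 + lt j i + t j i) * u" using hcut[OF j] v by auto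
      \<comment> \<open>The first cell not granted: its index is not below the number of cells
        cheaper than \<open>th\<close>, so its slope is at least \<open>th\<close> and bounds
        everything from \<open>h\<close> on.\<close>
      have "\<not> slope F c u i (lt j i + t j i) < th j"
        using item[OF i hc(1) down_less, of "th j"] by (simp add: lt_def)
      then show ?thesis
        using slope_dn[where F = F and c = c and d = d and u = u and i = i, OF F(1)[OF i] u, where k = "lt j i + t j i" and l = "th j" and x = v and y = w] v hc(2) by (simp add: algebra_simps)
    qed
    \<comment> \<open>If nothing was ever removed from the block below the price of the sentinel,
      all cells are cheaper than the threshold and \<open>h\<close> reaches
      \<open>d\<close>.\<close>
    show "th j < B" if j: "1 \<le> j" "j \<le> m" "sg (j - 1) < i" "i \<le> sg j" "h i < d i" for j i
    proof (rule ccontr)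
      assume "\<not> th j < B"
      have i: "1 \<le> i" "i \<le> n" using inblk[OF j(1-4)] by blast+
      have hc: "lt j i + t j i < cc i" using hcut[OF j] by blast
      have "slope F c u i (lt j i + t j i) < th j" using Q[OF i hc] \<open>\<not> th j < B\<close> by linarith
      then show False using item[OF i hc down_less, of "th j"] by (simp add: lt_def)
    qed
  qed
  \<comment> \<open>\<open>sg\<close> is strictly increasing, so each block contains a variable, and
    the error \<open>u\<close> per block is absorbed by an error per variable.\<close>
  have mn: "m \<le> n"
  proof -
    have "k \<le> sg k" if "k \<le> m" for k
      using that
    proof (induction k)
      case (Suc k)
      then show ?case using sg(2)[of k "Suc k"] by simp
    qed simp
    then show ?thesis using sg(3) by blast
  qed
  have blk: "(\<Sum>i\<in>{sg (j - 1)<..sg j}. real (lt j i + t j i)) * u \<le> Y j + u + (\<Sum>i\<in>{sg (j - 1)<..sg j}. d i - c i) / 32"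
    if j: "1 \<le> j" "j \<le> m" for j
  proof -
    have "real (bs j - bs (j - 1)) = (\<Sum>i\<in>{sg (j - 1)<..sg j}. real (cc i))"
    proof -
      have "vstart cc (sg j + 1) = vstart cc (sg (j - 1) + 1) + (\<Sum>i\<in>{sg (j - 1)<..sg j}. cc i)"
      proof -
        have "{1..<sg j + 1} = {1..<sg (j - 1) + 1} \<union> {sg (j - 1)<..sg j}" using sgle[OF j] by auto
        moreover have "{1..<sg (j - 1) + 1} \<inter> {sg (j - 1)<..sg j} = {}" by auto
        ultimately show ?thesis unfolding vstart_def by (simp add: sum.union_disjoint)
      qed
      then show ?thesis unfolding bs by simp
    qed
    then have "u * (bs j - bs (j - 1)) = (\<Sum>i\<in>{sg (j - 1)<..sg j}. u * cc i)" by (simp add: sum_distrib_left)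
    also have "\<dots> \<le> (\<Sum>i\<in>{sg (j - 1)<..sg j}. d i - c i)"
      using ccd(2) inblk[OF j] by (intro sum_mono) auto
    finally have N: "u * (bs j - bs (j - 1)) \<le> (\<Sum>i\<in>{sg (j - 1)<..sg j}. d i - c i)" .
    have W0: "0 \<le> (\<Sum>i\<in>{sg (j - 1)<..sg j}. d i - c i)" using cd inblk[OF j] by (intro sum_nonneg) auto
    \<comment> \<open>If no tie was granted, the only error is the thinning error in the count below
      \<open>th\<close>; otherwise the remainder is above \<open>- u\<close>, and the granted cells
      exceed \<open>Y\<close> by less than one cell.\<close>
    from rj(3)[OF j] show ?thesis
    proof
      assume "\<forall>i. sg (j - 1) < i \<and> i \<le> sg j \<longrightarrow> t j i = 0"
      then have "(\<Sum>i\<in>{sg (j - 1)<..sg j}. real (lt j i + t j i)) = (\<Sum>i\<in>{sg (j - 1)<..sg j}. real (lt j i))"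
        by (intro sum.cong) auto
      also have "\<dots> = cnt Q (bs (j - 1)) (bs j) (\<lambda>x. x < th j)" unfolding blkcnt[OF j] lt_def by simp
      finally show ?thesis using Ylo[OF j] N u by (simp add: mult.commute)
    next
      assume "- u < r j"
      then show ?thesis using rj(1)[OF j] W0 by (simp add: mult.commute)
    qed
  qed
  have "(\<Sum>i=1..n. h i - c i) \<le> (\<Sum>i=1..n. real (2 + lt (bk i) i + t (bk i) i) * u)"
  proof (rule sum_mono)
    fix i assume "i \<in> {1..n}"
    then have i: "1 \<le> i" "i \<le> n" by auto
    show "h i - c i \<le> real (2 + lt (bk i) i + t (bk i) i) * u" using tj(2)[of "bk i" i] bk[OF i] by simp
  qed
  also have "\<dots> = 2 * real n * u + (\<Sum>i=1..sg m. real (lt (bk i) i + t (bk i) i) * u)"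
    by (simp add: sg(3) sum.distrib algebra_simps)
  also have "(\<Sum>i=1..sg m. real (lt (bk i) i + t (bk i) i) * u) =
      (\<Sum>j=1..m. \<Sum>i\<in>{sg (j - 1)<..sg j}. real (lt (bk i) i + t (bk i) i) * u)"
    by (rule sum_blocks[where sg = sg and m = m, OF sg(1,2) order_refl])
  also have "\<dots> \<le> (\<Sum>j=1..m. Y j + u + (\<Sum>i\<in>{sg (j - 1)<..sg j}. d i - c i) / 32)"
  proof (rule sum_mono)
    fix j assume "j \<in> {1..m}"
    then have j: "1 \<le> j" "j \<le> m" by auto
    have "(\<Sum>i\<in>{sg (j - 1)<..sg j}. real (lt (bk i) i + t (bk i) i) * u) = (\<Sum>i\<in>{sg (j - 1)<..sg j}. real (lt j i + t j i)) * u"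
      unfolding sum_distrib_right using bkj[OF j] by (intro sum.cong) auto
    then show "(\<Sum>i\<in>{sg (j - 1)<..sg j}. real (lt (bk i) i + t (bk i) i) * u) \<le> Y j + u + (\<Sum>i\<in>{sg (j - 1)<..sg j}. d i - c i) / 32"
      using blk[OF j] by simp
  qed
  also have "\<dots> = (\<Sum>j=1..m. Y j) + real m * u + (\<Sum>i=1..n. d i - c i) / 32"
    using sum_blocks[where sg = sg and m = m, OF sg(1,2) order_refl, where g = "\<lambda>i. d i - c i"] sg(3)
    by (simp add: sum.distrib sum_divide_distrib)
  also have "(\<Sum>j=1..m. Y j) = ?S m - (\<Sum>i=1..n. c i)"
  proof -
    have "(\<Sum>i=1..n. c i) = (\<Sum>j=1..m. C j)"
      using sum_blocks[where sg = sg and m = m, OF sg(1,2) order_refl, where g = c] C sg(3) by simp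
    then show ?thesis by (simp add: pre_def sum.distrib)
  qed
  finally have "(\<Sum>i=1..n. h i - c i) \<le> 2 * real n * u + (?S m - (\<Sum>i=1..n. c i) + real m * u + (\<Sum>i=1..n. d i - c i) / 32)"
    by simp
  moreover have "real m * u \<le> real n * u" using mn u by simp
  moreover have "?S m \<le> b m" using G1[of m] m by simp
  moreover have "0 \<le> real n * u" using u by simp
  ultimately show "(\<Sum>i=1..n. h i - c i) \<le> b m - (\<Sum>i=1..n. c i) + (\<Sum>i=1..n. d i - c i) / 32 + 4 * real n * u"
    by linarith
qed

section \<open>One cut\<close>

lemma packed_facts:
  assumes pk: "packed u B N A wid csum p p' P Wt cs cap" and u: "0 < u" "0 < wid"
  shows "p < p'" "p' \<le> p + N + 1" "\<And>x y. p \<le> x \<Longrightarrow> x \<le> y \<Longrightarrow> y < p' \<Longrightarrow> P x \<le> P y"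
    "\<And>x. p \<le> x \<Longrightarrow> x < p' \<Longrightarrow> 0 < Wt x" "0 \<le> B \<Longrightarrow> (\<And>x. p \<le> x \<Longrightarrow> x < p' \<Longrightarrow> - B \<le> P x \<and> P x \<le> B)"
    "sum Wt {p..<p'} = cap" "wid \<le> cap" "cs = csum"
proof -
  obtain len and w :: real where h: "1 \<le> w" "p' = p + len + 1" "len \<le> N"
     "\<forall>k<len. Wt (p + k) = w * u" "\<forall>x y. x \<le> y \<and> y < len \<longrightarrow> P (p + x) \<le> P (p + y)"
     "P (p + len) = B" "Wt (p + len) = wid" "cs = csum" "cap = wid + w * u * len"
     "\<forall>k<len. \<bar>P (p + k)\<bar> \<le> B - 1"
    using pk unfolding packed_def by blast
  show "p < p'" "p' \<le> p + N + 1" "cs = csum" using h by simp_all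
  have wu: "0 < w * u" using h(1) u by simp
  have P1: "P (p + k) \<le> B" "0 \<le> B \<Longrightarrow> - B \<le> P (p + k)" if "k \<le> len" for k
  proof -
    have "k = len \<or> k < len" using that by auto
    then show "P (p + k) \<le> B" "0 \<le> B \<Longrightarrow> - B \<le> P (p + k)" using h(6) h(10)[rule_format, of k] by auto
  qed
  show "P x \<le> P y" if xy: "p \<le> x" "x \<le> y" "y < p'" for x y
  proof -
    define k l where "k = x - p" "l = y - p"
    have e: "x = p + k" "y = p + l" "k \<le> l" "l \<le> len" using xy h(2) by (simp_all add: k_l_def)
    show ?thesis
    proof (cases "l = len")
      case True then show ?thesis using P1(1)[of k] e h(6) by simp
    next
      case False
      then have "l < len" using e by simp
      then show ?thesis using h(5) e by simp
    qed
  qed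
  show "0 < Wt x" if x: "p \<le> x" "x < p'" for x
  proof -
    define k where "k = x - p"
    have e: "x = p + k" "k \<le> len" using x h(2) by (simp_all add: k_def)
    then have "k = len \<or> k < len" by auto
    then show ?thesis using h(4,7) e(1) wu u(2) by auto
  qed
  show "- B \<le> P x \<and> P x \<le> B" if "0 \<le> B" "p \<le> x" "x < p'" for x
    using P1[of "x - p"] that h(2) by simp
  have "sum Wt {p..<p + len} = (\<Sum>k<len. Wt (p + k))"
    using sum.shift_bounds_nat_ivl[of Wt 0 p len] by (simp add: atLeast0LessThan add.commute)
  also have "\<dots> = (\<Sum>k<len. w * u)" using h(4) by (intro sum.cong) auto
  finally have "sum Wt {p..<p + len} = len * (w * u)" by simp
  moreover have "{p..<p'} = insert (p + len) {p..<p + len}" using h(2) by auto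
  ultimately show "sum Wt {p..<p'} = cap" using h(7,9) by simp
  have "0 \<le> w * u * len" using wu by simp
  then show "wid \<le> cap" using h(9) by linarith
qed

definition cut_loop :: com where
  "cut_loop = IS ''blk'' (IConst 0) ;;
     While (ILt (IV ''blk'') (IV ''m'')) (inc ''blk'' ;; count_block ;; cut_vars)"

lemma mods_cut_loop [simp]: "imods cut_loop = {''blk'', ''q'', ''v''}" "rmods cut_loop = {''rem'', ''h'', ''d''}"
  by (auto simp: cut_loop_def)

lemma cut_loop:
  fixes sg :: "nat \<Rightarrow> nat" and c d Q th Y :: "nat \<Rightarrow> real" and u :: real
  assumes u: "0 < u" and s: "imem s ''sigma'' = sg" "iv s ''m'' = m" "rmem s ''c'' = c" "rmem s ''d'' = d" "rv s ''u'' = u"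
      "rmem s ''Q'' = Q" "rmem s ''th'' = th" "rmem s ''Y'' = Y"
    and sg: "sg 0 = 0" "\<And>i j. i < j \<Longrightarrow> j \<le> m \<Longrightarrow> sg i < sg j" "sg m = n"
    and vs: "\<And>i. 1 \<le> i \<Longrightarrow> i \<le> n + 1 \<Longrightarrow> imem s ''vs'' i = vstart cc i"
  defines "bs \<equiv> \<lambda>j. vstart cc (sg j + 1)"
  shows "wp f cut_loop s (\<lambda>t s'. t \<le> 140 * vstart cc (n + 1) + 100 * n + 150 * m + 20 \<and>
    (\<forall>j. 1 \<le> j \<and> j \<le> m \<longrightarrow> (\<exists>r t D. cut_set Q cc (th j) u c d (Y j - u * cnt Q (bs (j - 1)) (bs j) (\<lambda>x. x < th j))
       (sg (j - 1)) (sg j) D r t \<and> (\<forall>i. sg (j - 1) < i \<and> i \<le> sg j \<longrightarrow> rmem s' ''d'' i = D i))))"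
proof -
  define cs where "cs j h \<longleftrightarrow> (\<exists>r t D. cut_set Q cc (th j) u c d (Y j - u * cnt Q (bs (j - 1)) (bs j) (\<lambda>x. x < th j))
       (sg (j - 1)) (sg j) D r t \<and> (\<forall>i. sg (j - 1) < i \<and> i \<le> sg j \<longrightarrow> h i = D i))" for j h
  have sgmono: "sg i \<le> sg j" if "i \<le> j" "j \<le> m" for i j using sg(2)[of i j] that by (cases "i = j") auto
  have bsmono: "bs i \<le> bs j" if "i \<le> j" "j \<le> m" for i j unfolding bs_def using sgmono[OF that] by (intro vstart_mono) simp
  have bs0: "bs 0 = 0" using vstart_1[of cc] by (simp add: bs_def sg(1))
  have bsm: "bs m = vstart cc (n + 1)" by (simp add: bs_def sg(3))
  let ?I = "\<lambda>s'. iv s' ''blk'' \<le> m \<and> (\<forall>j. 1 \<le> j \<and> j \<le> iv s' ''blk'' \<longrightarrow> cs j (rmem s' ''d'')) \<and>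
    (\<forall>i. sg (iv s' ''blk'') < i \<longrightarrow> rmem s' ''d'' i = d i)"
  let ?V = "\<lambda>s'. 140 * (bs m - bs (iv s' ''blk'')) + 100 * (n - sg (iv s' ''blk'')) + 150 * (m - iv s' ''blk'')"
  show ?thesis
    unfolding cut_loop_def wp_Seq wp_ISet
  proof (rule wp_while[where I = ?I and V = ?V], goal_cases)
    case 1
    show ?case by (simp add: s)
  next
    case (2 s1)
    define j where "j = iv s1 ''blk'' + 1"
    have e: "imem s1 ''sigma'' = sg" "iv s1 ''m'' = m" "rmem s1 ''c'' = c" "rv s1 ''u'' = u"
      "rmem s1 ''Q'' = Q" "rmem s1 ''th'' = th" "rmem s1 ''Y'' = Y" "imem s1 ''vs'' = imem s ''vs''"
      using frameI[OF 2(3)] frameR[OF 2(3)] s by simp_all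
    have b: "iv s1 ''blk'' = j - 1" "j - 1 + 1 = j" by (simp_all add: j_def)
    have j: "1 \<le> j" "j \<le> m" "j - 1 \<le> m" "j - 1 < j" "j - 1 \<le> j" using 2(2) e by (simp_all add: j_def)
    have lt: "sg (j - 1) < sg j" using sg(2)[OF j(4,2)] .
    have sgn: "sg j \<le> n" "sg (j - 1) \<le> n" using sgmono[OF j(2) order_refl] sgmono[OF j(3) order_refl] sg(3) by simp_all
    define d1 where "d1 = rmem s1 ''d''"
    have I: "\<And>i. 1 \<le> i \<Longrightarrow> i \<le> j - 1 \<Longrightarrow> cs i d1" "\<And>i. sg (j - 1) < i \<Longrightarrow> d1 i = d i"
      using 2(1) unfolding b(1) d1_def by blast+
    define s2 where "s2 = iset ''blk'' 0 j s1"
    have e2: "imem s2 ''sigma'' = sg" "rmem s2 ''c'' = c" "rv s2 ''u'' = u"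
      "rmem s2 ''Q'' = Q" "rmem s2 ''th'' = th" "rmem s2 ''Y'' = Y" "imem s2 ''vs'' = imem s ''vs''" "iv s2 ''blk'' = j"
      "rmem s2 ''d'' = d1"
      by (simp_all add: s2_def e d1_def)
    have vsj: "imem s2 ''vs'' (sg (j - 1) + 1) = bs (j - 1)" "imem s2 ''vs'' (sg j + 1) = bs j"
      using vs[of "sg (j - 1) + 1"] vs[of "sg j + 1"] sgn by (simp_all add: bs_def e2(7))
    define r0 where "r0 = Y j - u * cnt Q (bs (j - 1)) (bs j) (\<lambda>x. x < th j)"
    have CB: "wp f count_block s2 (\<lambda>t s'. t \<le> 60 * (bs j - bs (j - 1)) + 40 \<and> rv s' ''rem'' = r0)"
      unfolding r0_def by (rule count_block[OF e2(1,3,4,8) _ _ vsj bsmono[OF j(5,2)]]) (simp_all add: e2)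
    have step: "?I s3 \<and> iv s3 ''blk'' = j"
      if cut: "cut_set Q cc (th j) u c d1 r0 (sg (j - 1)) (sg j) (rmem s3 ''d'') r t"
        and bk: "iv s3 ''blk'' = j" for s3 r t
    proof -
      have c1: "\<And>i. sg (j - 1) < i \<Longrightarrow> i \<le> sg j \<Longrightarrow> t i \<le> vcnt Q cc i (\<lambda>x. x = th j) \<and>
        rmem s3 ''d'' i = min (d1 i) (c i + real (2 + vcnt Q cc i (\<lambda>x. x < th j) + t i) * u)"
        and c2: "\<And>i. \<not> (sg (j - 1) < i \<and> i \<le> sg j) \<Longrightarrow> rmem s3 ''d'' i = d1 i"
        and c3: "r = r0 - u * (\<Sum>i\<in>{sg (j - 1)<..sg j}. real (t i)) \<and>
         ((\<forall>i. sg (j - 1) < i \<and> i \<le> sg j \<longrightarrow> t i = vcnt Q cc i (\<lambda>x. x = th j)) \<or> r \<le> 0) \<and>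
         ((\<forall>i. sg (j - 1) < i \<and> i \<le> sg j \<longrightarrow> t i = 0) \<or> - u < r)"
        using cut unfolding cut_set_def by blast+
      \<comment> \<open>Earlier iterations have already lowered the bounds of earlier blocks.
        Outside the current block \<open>D\<close> falls back to the original \<open>d\<close>, to
        which the claim refers; inside, the two agree before the cut.\<close>
      define D where "D i = (if sg (j - 1) < i \<and> i \<le> sg j then rmem s3 ''d'' i else d i)" for i
      have cD: "t i \<le> vcnt Q cc i (\<lambda>x. x = th j) \<and>
        D i = min (d i) (c i + real (2 + vcnt Q cc i (\<lambda>x. x < th j) + t i) * u)" if "sg (j - 1) < i" "i \<le> sg j" for i
        using c1[OF that] I(2)[OF that(1)] that by (simp add: D_def)
      have "cut_set Q cc (th j) u c d r0 (sg (j - 1)) (sg j) D r t"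
        unfolding cut_set_def
      proof (intro conjI)
        show "\<forall>i. sg (j - 1) < i \<and> i \<le> sg j \<longrightarrow> t i \<le> vcnt Q cc i (\<lambda>x. x = th j) \<and>
          D i = min (d i) (c i + real (2 + vcnt Q cc i (\<lambda>x. x < th j) + t i) * u)" using cD by blast
        show "\<forall>i. \<not> (sg (j - 1) < i \<and> i \<le> sg j) \<longrightarrow> D i = d i" unfolding D_def by presburger
      qed (use c3 in blast)+
      moreover have "\<forall>i. sg (j - 1) < i \<and> i \<le> sg j \<longrightarrow> rmem s3 ''d'' i = D i" by (simp add: D_def)
      ultimately have csj: "cs j (rmem s3 ''d'')" unfolding cs_def r0_def by blast
      have csi: "cs i (rmem s3 ''d'')" if i: "1 \<le> i" "i \<le> j" for i
      proof (cases "i = j")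
        case True then show ?thesis using csj by simp
      next
        case False
        then have ij: "i \<le> j - 1" using i by simp
        have "rmem s3 ''d'' k = d1 k" if "k \<le> sg i" for k
          using that sgmono[OF ij j(3)] by (intro c2) simp
        then show ?thesis using I(1)[OF i(1) ij] unfolding cs_def by (metis)
      qed
      have "rmem s3 ''d'' i = d i" if "sg j < i" for i
        using c2[of i] I(2)[of i] that lt by simp
      then show ?thesis using csi j(2) unfolding bk by blast
    qed
    have V1: "140 * (bs m - bs (j - 1)) = 140 * (bs m - bs j) + 140 * (bs j - bs (j - 1))"
      using bsmono[OF j(5,2)] bsmono[OF j(2) order_refl] by simp
    have V2: "100 * (n - sg (j - 1)) = 100 * (n - sg j) + 100 * (sg j - sg (j - 1))" using lt sgn by simp
    have V3: "150 * (m - (j - 1)) = 150 * (m - j) + 150" using j by simp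
    have all: "wp f (count_block ;; cut_vars) s2 (\<lambda>t s'. (?I s' \<and> iv s' ''blk'' = j) \<and>
        t \<le> 140 * (bs j - bs (j - 1)) + 100 * (sg j - sg (j - 1)) + 80)"
      unfolding wp_Seq
    proof (rule wp_use[OF CB], elim conjE)
      fix t3 s3 assume q: "t3 \<le> 60 * (bs j - bs (j - 1)) + 40" "rv s3 ''rem'' = r0" and fr: "frame count_block s2 s3"
      have e3: "imem s3 ''sigma'' = sg" "rmem s3 ''c'' = c" "rmem s3 ''d'' = d1" "rv s3 ''u'' = u" "rmem s3 ''Q'' = Q"
        "iv s3 ''blk'' = j" "rmem s3 ''th'' j = th j" "imem s3 ''vs'' = imem s ''vs''"
        by (simp_all add: frameI[OF fr] frameR[OF fr] e2)
      have vs3: "imem s3 ''vs'' i = vstart cc i" if "1 \<le> i" "i \<le> sg j + 1" for i using vs[of i] that sgn e3(8) by simp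
      have CV: "wp f cut_vars s3 (\<lambda>t s'. t \<le> 80 * (bs j - bs (j - 1)) + 100 * (sg j - sg (j - 1)) + 40 \<and>
        (\<exists>t. cut_set Q cc (th j) u c d1 r0 (sg (j - 1)) (sg j) (rmem s' ''d'') (rv s' ''rem'') t))"
        unfolding bs_def by (rule cut_vars[OF u e3(1-7) q(2) vs3]) (use lt in simp_all)
      show "wp f cut_vars s3 (\<lambda>t' s'. (?I s' \<and> iv s' ''blk'' = j) \<and>
        t3 + t' \<le> 140 * (bs j - bs (j - 1)) + 100 * (sg j - sg (j - 1)) + 80)"
      proof (rule wp_use[OF CV], elim conjE exE)
        fix t4 s4 t assume p: "t4 \<le> 80 * (bs j - bs (j - 1)) + 100 * (sg j - sg (j - 1)) + 40"
          "cut_set Q cc (th j) u c d1 r0 (sg (j - 1)) (sg j) (rmem s4 ''d'') (rv s4 ''rem'') t" and fr4: "frame cut_vars s3 s4"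
        have "iv s4 ''blk'' = j" using frameI[OF fr4] e3 by simp
        from step[OF p(2) this] show "(?I s4 \<and> iv s4 ''blk'' = j) \<and>
          t3 + t4 \<le> 140 * (bs j - bs (j - 1)) + 100 * (sg j - sg (j - 1)) + 80"
          using p(1) q(1) by simp
      qed
    qed
    show ?case
      unfolding wp_Seq[of f "inc ''blk''"] wp_ISet
      apply (simp only: ival.simps b(1) b(2))
      apply (rule wp_use[OF all[unfolded s2_def]])
      apply (unfold V1 V2 V3)
      subgoal premises p for t s'
      proof -
        have "t \<le> 140 * (bs j - bs (j - 1)) + 100 * (sg j - sg (j - 1)) + 80" "iv s' ''blk'' = j" using p(1) by blast+
        then show ?thesis
          apply (intro conjI[OF conjunct1[OF conjunct1[OF p(1)]]])
          by simp
      qed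
      done
  next
    case (3 t s1)
    have e: "iv s1 ''m'' = m" using frameI[OF 3(3)] s by simp
    have b: "iv s1 ''blk'' = m" using 3(1,2) e by simp
    have "t \<le> 140 * vstart cc (n + 1) + 100 * n + 150 * m + 10" using 3(4) by (simp add: b bs0 bsm sg(1))
    moreover have "\<forall>j. 1 \<le> j \<and> j \<le> m \<longrightarrow> cs j (rmem s1 ''d'')" using 3(1) unfolding b by blast
    ultimately show ?case unfolding cs_def by simp
  qed
qed

definition cut :: com where
  "cut = build ;; pack ;; greedy ;; cut_loop"

lemma mods_cut [simp]:
  "imods cut = {''q'', ''v'', ''vs'', ''blk'', ''ps'', ''Len'', ''k'', ''i'', ''j'', ''lo'', ''e1'', ''e2'', ''L'', ''lim'', ''pp'',
     ''M'', ''K'', ''hd'', ''tl'', ''pos'', ''p''}"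
  "rmods cut = {''x1'', ''x2'', ''f1'', ''f2'', ''sl'', ''Q'', ''BIG'', ''S'', ''T'', ''w'', ''P'', ''Wt'', ''wu'', ''wid'', ''cs'', ''cap'',
     ''base'', ''tot'', ''th'', ''la'', ''Y'', ''val'', ''tmax'', ''tmin'', ''need'', ''rem'', ''h'', ''d''}"
  by (auto simp: cut_def)

text \<open>Index 0 is included with \<open>sg 0 = 0\<close>, so that block \<open>j\<close> always
  consists of the variables after \<open>sg (j - 1)\<close> up to \<open>sg j\<close>. Memory
  outside the input is zero, hence the stored array has this value.\<close>

definition block_map :: "nat \<Rightarrow> nat \<Rightarrow> (nat \<Rightarrow> nat) \<Rightarrow> bool" where
  "block_map n m sg \<longleftrightarrow> sg 0 = 0 \<and> (\<forall>i j. i < j \<and> j \<le> m \<longrightarrow> sg i < sg j) \<and> sg m = n \<and> 1 \<le> m"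

lemma block_map_le: "block_map n m sg \<Longrightarrow> k \<le> m \<Longrightarrow> k \<le> sg k"
proof (induction k)
  case (Suc k)
  then have "sg k < sg (Suc k)" unfolding block_map_def by simp
  then show ?case using Suc by simp
qed simp

text \<open>\<open>N\<close> bounds the width in units of \<open>u\<close> and thereby the number of
  cells. Listing, sorting and cutting are linear in \<open>N + n\<close>; only the greedy part pays
  the factor \<open>depth (2 * (m + 1))\<close>, once for each of its \<open>O(N + n)\<close>
  steps.\<close>

lemma cut:
  fixes F :: "nat \<Rightarrow> real \<Rightarrow> real" and sg :: "nat \<Rightarrow> nat" and a b c d :: "nat \<Rightarrow> real" and u g :: real and f :: oracle_fun
  assumes u: "0 < u" and s: "iv s ''n'' = n" "iv s ''m'' = m" "imem s ''sigma'' = sg" "rmem s ''a'' = a" "rmem s ''b'' = b"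
      "rmem s ''c'' = c" "rmem s ''d'' = d" "rv s ''u'' = u" "rv s ''g'' = g"
    and bm: "block_map n m sg" and abm: "a m = b m"
    and f: "\<And>i x. F i x = f i (g * x)"
    and F: "\<And>i. 1 \<le> i \<Longrightarrow> i \<le> n \<Longrightarrow> convex_on {c i..d i} (F i)"
      "\<And>i. 1 \<le> i \<Longrightarrow> i \<le> n \<Longrightarrow> continuous_on {c i..d i} (F i)"
    and x0: "feas n m sg a b c d x0"
    and W: "(\<Sum>i=1..n. d i - c i) \<le> real N * u"
  shows "wp f cut s (\<lambda>t s'. t \<le> 50000 * depth (2 * (m + 1)) * (N + n) \<and>
    (\<forall>i. 1 \<le> i \<and> i \<le> n \<longrightarrow> c i \<le> rmem s' ''d'' i \<and> rmem s' ''d'' i \<le> d i) \<and>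
    (\<exists>x. feas n m sg a b c (rmem s' ''d'') x \<and> (\<forall>z. feas n m sg a b c d z \<longrightarrow> obj n F x \<le> obj n F z)) \<and>
    (\<Sum>i=1..n. rmem s' ''d'' i - c i) \<le> b m - (\<Sum>i=1..n. c i) + (\<Sum>i=1..n. d i - c i) / 32 + 4 * real n * u)"
proof -
  have sg: "sg 0 = 0" "\<And>i j. i < j \<Longrightarrow> j \<le> m \<Longrightarrow> sg i < sg j" "sg m = n" and m: "1 \<le> m"
    using bm unfolding block_map_def by blast+
  have mn: "m \<le> n" using block_map_le[OF bm order_refl] sg(3) by simp
  define cc where "cc = (\<lambda>i. steps (d i) u (c i + 2 * u))"
  define VN where "VN = vstart cc (n + 1)"
  have cd: "c i \<le> d i" if "1 \<le> i" "i \<le> n" for i using x0 that unfolding feas_def by force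
  \<comment> \<open>The cells of a variable are disjoint and fit into its interval, so their number
    times \<open>u\<close> is at most its width.\<close>
  have VN: "VN \<le> N"
  proof -
    have "real (cc i) * u \<le> d i - c i" if i: "1 \<le> i" "i \<le> n" for i
    proof (cases "cc i")
      case 0 then show ?thesis using cd[OF i] by simp
    next
      case (Suc k)
      have "c i + real (k + 2) * u \<le> d i" by (rule steps_bounds(1)[OF u]) (use Suc in \<open>simp add: cc_def\<close>)
      moreover have "real (cc i) * u \<le> real (k + 2) * u" using u Suc by (intro mult_right_mono) auto
      ultimately show ?thesis by linarith
    qed
    then have "(\<Sum>i=1..n. real (cc i) * u) \<le> (\<Sum>i=1..n. d i - c i)" by (intro sum_mono) simp
    moreover have "{1..<n + 1} = {1..n}" by auto
    ultimately have "real VN * u \<le> real N * u" using W unfolding VN_def vstart_def by (simp add: sum_distrib_right)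
    then show ?thesis using u by simp
  qed
  define bs where "bs = (\<lambda>j. vstart cc (sg j + 1))"
  define wid where "wid j = u + (\<Sum>i\<in>{sg (j - 1)<..sg j}. d i - c i)" for j
  define csum where "csum j = (\<Sum>i\<in>{sg (j - 1)<..sg j}. c i)" for j
  define Dm where "Dm = depth (2 * (m + 1))"
  have sgle: "sg (j - 1) \<le> sg j" "sg j \<le> n" if "1 \<le> j" "j \<le> m" for j
  proof -
    show "sg (j - 1) \<le> sg j" using sg(2)[of "j - 1" j] that by simp
    show "sg j \<le> n" using sg(2)[of j m] sg(3) that by (cases "j = m") auto
  qed
  have wid0: "0 < wid j" "(\<Sum>i\<in>{sg (j - 1)<..sg j}. d i - c i) \<le> wid j" if j: "1 \<le> j" "j \<le> m" for j
  proof -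
    have "0 \<le> (\<Sum>i\<in>{sg (j - 1)<..sg j}. d i - c i)"
      using sgle[OF j] cd by (intro sum_nonneg) simp
    then show "0 < wid j" "(\<Sum>i\<in>{sg (j - 1)<..sg j}. d i - c i) \<le> wid j" using u by (simp_all add: wid_def)
  qed
  show ?thesis
    unfolding cut_def wp_Seq
  proof (rule wp_use[OF build[where F=F and f=f, OF u s(1,6,7,8,9) f, folded cc_def VN_def]], elim conjE)
    fix t1 s1 assume q1: "t1 \<le> 80 * VN + 100 * n + 50" "2 \<le> rv s1 ''BIG''"
      "cells F c u cc n (imem s1 ''vs'') (rmem s1 ''Q'') (rv s1 ''BIG'' - 1)" and fr1: "frame build s s1"
    define Q B where "Q = rmem s1 ''Q''" "B = rv s1 ''BIG''"
    have e1: "imem s1 ''sigma'' = sg" "iv s1 ''m'' = m" "rmem s1 ''c'' = c" "rmem s1 ''d'' = d" "rv s1 ''u'' = u"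
      "rmem s1 ''Q'' = Q" "rv s1 ''BIG'' = B" "rmem s1 ''a'' = a" "rmem s1 ''b'' = b"
      by (simp_all add: frameI[OF fr1] frameR[OF fr1] s Q_B_def)
    have vs1: "\<And>i. 1 \<le> i \<Longrightarrow> i \<le> n + 1 \<Longrightarrow> imem s1 ''vs'' i = vstart cc i"
      and Qs: "\<And>i k. 1 \<le> i \<Longrightarrow> i \<le> n \<Longrightarrow> k < cc i \<Longrightarrow> Q (vstart cc i + k) = slope F c u i k \<and> \<bar>slope F c u i k\<bar> \<le> B - 1"
      using q1(3) unfolding cells_def Q_B_def by blast+
    have QB: "\<bar>Q k\<bar> \<le> B - 1" if k: "k < vstart cc (n + 1)" for k
    proof -
      define i where "i = (LEAST i. k < vstart cc (i + 1))"
      have i1: "k < vstart cc (i + 1)" unfolding i_def using k by (rule LeastI)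
      have i0: "i \<noteq> 0"
      proof
        assume "i = 0"
        then have "k < vstart cc 1" using i1 by simp
        then show False by simp
      qed
      then have "\<not> k < vstart cc (i - 1 + 1)"
        using not_less_Least[of "i - 1" "\<lambda>i. k < vstart cc (i + 1)"] by (simp add: i_def)
      then have i2: "vstart cc i \<le> k" using i0 by simp
      have i3: "i \<le> n" unfolding i_def using k by (rule Least_le)
      have i4: "1 \<le> i" using i0 by simp
      have "k - vstart cc i < cc i" using i1 i2 vstart_Suc[OF i4, of cc] by simp
      from Qs[OF i4 i3 this] show ?thesis using i2 by simp
    qed
    show "wp f pack s1 (\<lambda>t s'. wp f greedy s' (\<lambda>t' s''. wp f cut_loop s'' (\<lambda>t'a s''. t1 + (t + (t' + t'a)) \<le> 50000 * depth (2 * (m + 1)) * (N + n) \<and>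
       (\<forall>i. 1 \<le> i \<and> i \<le> n \<longrightarrow> c i \<le> rmem s'' ''d'' i \<and> rmem s'' ''d'' i \<le> d i) \<and>
       (\<exists>x. feas n m sg a b c (rmem s'' ''d'') x \<and> (\<forall>z. feas n m sg a b c d z \<longrightarrow> obj n F x \<le> obj n F z)) \<and>
       (\<Sum>i=1..n. rmem s'' ''d'' i - c i) \<le> b m - (\<Sum>i=1..n. c i) + (\<Sum>i=1..n. d i - c i) / 32 + 4 * real n * u)))"
    proof (rule wp_use[OF pack[OF e1(1-7) sg vs1 QB, folded VN_def]], assumption, assumption, assumption, assumption, assumption, elim conjE)
      fix t2 s2 assume q2: "t2 \<le> 41000 * VN + 100 * n + 600 * m + 100" "imem s2 ''ps'' 1 = 0"
          "imem s2 ''ps'' (m + 1) \<le> VN + m"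
        and pk0: "\<forall>j. 1 \<le> j \<and> j \<le> m \<longrightarrow> packed u B (vstart cc (sg j + 1) - vstart cc (sg (j - 1) + 1)) (\<lambda>k. Q (vstart cc (sg (j - 1) + 1) + k))
          (u + (\<Sum>i\<in>{sg (j - 1)<..sg j}. d i - c i)) (\<Sum>i\<in>{sg (j - 1)<..sg j}. c i)
          (imem s2 ''ps'' j) (imem s2 ''ps'' (j + 1)) (rmem s2 ''P'') (rmem s2 ''Wt'') (rmem s2 ''cs'' j) (rmem s2 ''cap'' j)"
        and fr2: "frame pack s1 s2"
      define P Wt C cap ps where "P = rmem s2 ''P''" "Wt = rmem s2 ''Wt''" "C = rmem s2 ''cs''" "cap = rmem s2 ''cap''" "ps = imem s2 ''ps''"
      note PWd = this
      have pk: "packed u B (bs j - bs (j - 1)) (\<lambda>k. Q (bs (j - 1) + k)) (wid j) (csum j) (ps j) (ps (j + 1)) P Wt (C j) (cap j)"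
        if "1 \<le> j" "j \<le> m" for j
        using pk0 that unfolding bs_def wid_def csum_def PWd by blast
      have e2: "imem s2 ''sigma'' = sg" "iv s2 ''m'' = m" "rmem s2 ''c'' = c" "rmem s2 ''d'' = d" "rv s2 ''u'' = u"
        "rmem s2 ''Q'' = Q" "rv s2 ''BIG'' = B" "rmem s2 ''a'' = a" "rmem s2 ''b'' = b" "imem s2 ''vs'' = imem s1 ''vs''"
        by (simp_all add: frameI[OF fr2] frameR[OF fr2] e1)
      have B2: "2 \<le> B" "0 \<le> B" using q1(2) by (simp_all add: Q_B_def)
      note pf = packed_facts[OF pk u wid0(1)]
      have psmono: "ps i \<le> ps j" if "1 \<le> i" "i \<le> j" "j \<le> m + 1" for i j
        using that(2,3)
      proof (induction j rule: dec_induct)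
        case (step j)
        then show ?case using pf(1)[of j] that(1) by (simp flip: Suc_eq_plus1)
      qed simp
      \<comment> \<open>The block sums of the given feasible point are the witness that the relaxed
        problem is solvable.\<close>
      define X where "X j = pre x0 (sg j)" for j
      interpret G: greedy_data m a b C X P Wt ps "\<lambda>j. ps (j + 1)" B
      proof
        show "1 \<le> m" "a m = b m" by fact+
        show "0 < B" using B2 by simp
        show "ps j \<le> ps (j + 1)" if "1 \<le> j" "j \<le> m" for j using pf(1)[OF that that] by simp
        show "ps (i + 1) \<le> ps j" if "1 \<le> i" "i < j" "j \<le> m" for i j by (rule psmono) (use that in simp_all)
        show "P p \<le> P q" if "1 \<le> j" "j \<le> m" "ps j \<le> p" "p \<le> q" "q < ps (j + 1)" for j p q
          using pf(3)[OF that(1,2,1,2) that(3,4,5)] .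
        show "0 < Wt p" if "1 \<le> j" "j \<le> m" "ps j \<le> p" "p < ps (j + 1)" for j p
          using pf(4)[OF that(1,2,1,2) that(3,4)] .
        show "- B \<le> P p \<and> P p \<le> B" if "1 \<le> j" "j \<le> m" "ps j \<le> p" "p < ps (j + 1)" for j p
          using pf(5)[OF that(1,2,1,2) B2(2) that(3,4)] .
        show "X 0 = 0" by (simp add: X_def sg(1))
        show "a j \<le> X j \<and> X j \<le> b j" if "1 \<le> j" "j \<le> m" for j using x0 that unfolding feas_def X_def by simp
        \<comment> \<open>The sentinel alone has room for everything that \<open>x0\<close> puts
          above the lower bounds of the block.\<close>
        show "C j \<le> X j - X (j - 1) \<and> X j - X (j - 1) \<le> C j + sum Wt {ps j..<ps (j + 1)}" if j: "1 \<le> j" "j \<le> m" for j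
        proof -
          have Cj: "C j = csum j" and cp: "sum Wt {ps j..<ps (j + 1)} = cap j" "wid j \<le> cap j"
            using pf(6,7,8)[OF j j] by blast+
          have xi: "c i \<le> x0 i" "x0 i - c i \<le> d i - c i" if "i \<in> {sg (j - 1)<..sg j}" for i
            using x0 that sgle[OF j] unfolding feas_def by auto
          have Xd: "X j - X (j - 1) = (\<Sum>i\<in>{sg (j - 1)<..sg j}. x0 i)" unfolding X_def by (rule pre_diff[OF sgle(1)[OF j]])
          have "csum j \<le> (\<Sum>i\<in>{sg (j - 1)<..sg j}. x0 i)" unfolding csum_def using xi(1) by (rule sum_mono)
          moreover have "(\<Sum>i\<in>{sg (j - 1)<..sg j}. x0 i - c i) \<le> (\<Sum>i\<in>{sg (j - 1)<..sg j}. d i - c i)" using xi(2) by (rule sum_mono)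
          ultimately show ?thesis unfolding Xd Cj cp(1) using wid0(2)[OF j] cp(2) by (simp add: sum_subtractf csum_def)
        qed
      qed
      have ge: "G.genv (iset ''M'' 0 (m + 1) s2)"
        unfolding G.genv_def using pf(6) by (simp add: e2 PWd)
      have GW: "rmem s2 ''Wt'' p = Wt p" for p by (simp add: PWd)
      have Dmd: "G.Dm = Dm" unfolding G.Dm_def Dm_def ..
      have items: "(\<Sum>j=1..m. ps (j + 1) - ps j) \<le> VN + m"
      proof -
        have "(\<Sum>j=1..k. ps (j + 1) - ps j) = ps (k + 1)" if "k \<le> m" for k
          using that
        proof (induction k)
          case 0 then show ?case using q2(2) by (simp add: PWd)
        next
          case (Suc k)
          then show ?case using pf(1)[of "Suc k"] by (simp flip: Suc_eq_plus1)
        qed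
        then show ?thesis using q2(3) by (simp add: PWd)
      qed
      show "wp f greedy s2 (\<lambda>t' s''. wp f cut_loop s'' (\<lambda>t'a s''. t1 + (t2 + (t' + t'a)) \<le> 50000 * depth (2 * (m + 1)) * (N + n) \<and>
         (\<forall>i. 1 \<le> i \<and> i \<le> n \<longrightarrow> c i \<le> rmem s'' ''d'' i \<and> rmem s'' ''d'' i \<le> d i) \<and>
         (\<exists>x. feas n m sg a b c (rmem s'' ''d'') x \<and> (\<forall>z. feas n m sg a b c d z \<longrightarrow> obj n F x \<le> obj n F z)) \<and>
         (\<Sum>i=1..n. rmem s'' ''d'' i - c i) \<le> b m - (\<Sum>i=1..n. c i) + (\<Sum>i=1..n. d i - c i) / 32 + 4 * real n * u))"
      proof (rule wp_use[OF G.greedy[OF ge GW]], elim conjE exE)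
        fix t3 s3 hp tp w base tot
        assume G: "G.ginv m hp tp w (rmem s3 ''th'') (rmem s3 ''la'') (rmem s3 ''Y'') base tot" "a m \<le> base" "tot \<le> b m"
          and t3: "t3 \<le> (120 * G.Dm + 300) * ((\<Sum>j=1..m. ps (j + 1) - ps j) + 4 * m) + 200 * (m + 1)"
          and fr3: "frame greedy s2 s3"
        define th la Y where "th = rmem s3 ''th''" "la = rmem s3 ''la''" "Y = rmem s3 ''Y''"
        note gf = G.ginv_final[OF G, folded th_la_Y_def]
        have e3: "imem s3 ''sigma'' = sg" "iv s3 ''m'' = m" "rmem s3 ''c'' = c" "rmem s3 ''d'' = d" "rv s3 ''u'' = u"
          "rmem s3 ''Q'' = Q" "rmem s3 ''th'' = th" "rmem s3 ''Y'' = Y" "imem s3 ''vs'' = imem s1 ''vs''"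
          by (simp_all add: frameI[OF fr3] frameR[OF fr3] e2 th_la_Y_def)
        have vs3: "imem s3 ''vs'' i = vstart cc i" if "1 \<le> i" "i \<le> n + 1" for i using vs1[OF that] e3(9) by simp
        show "wp f cut_loop s3 (\<lambda>t'a s''. t1 + (t2 + (t3 + t'a)) \<le> 50000 * depth (2 * (m + 1)) * (N + n) \<and>
           (\<forall>i. 1 \<le> i \<and> i \<le> n \<longrightarrow> c i \<le> rmem s'' ''d'' i \<and> rmem s'' ''d'' i \<le> d i) \<and>
           (\<exists>x. feas n m sg a b c (rmem s'' ''d'') x \<and> (\<forall>z. feas n m sg a b c d z \<longrightarrow> obj n F x \<le> obj n F z)) \<and>
           (\<Sum>i=1..n. rmem s'' ''d'' i - c i) \<le> b m - (\<Sum>i=1..n. c i) + (\<Sum>i=1..n. d i - c i) / 32 + 4 * real n * u)"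
        proof (rule wp_use[OF cut_loop[OF u e3(1-8) sg vs3, folded VN_def]], assumption, assumption, assumption, assumption, elim conjE)
          fix t4 s4 assume t4: "t4 \<le> 140 * VN + 100 * n + 150 * m + 20"
            and cut: "\<forall>j. 1 \<le> j \<and> j \<le> m \<longrightarrow> (\<exists>r t D. cut_set Q cc (th j) u c d
              (Y j - u * cnt Q (vstart cc (sg (j - 1) + 1)) (vstart cc (sg j + 1)) (\<lambda>x. x < th j))
              (sg (j - 1)) (sg j) D r t \<and> (\<forall>i. sg (j - 1) < i \<and> i \<le> sg j \<longrightarrow> rmem s4 ''d'' i = D i))"
          have cut': "\<exists>r t D. cut_set Q cc (th j) u c d (Y j - u * cnt Q (bs (j - 1)) (bs j) (\<lambda>x. x < th j))
              (sg (j - 1)) (sg j) D r t \<and> (\<forall>i. sg (j - 1) < i \<and> i \<le> sg j \<longrightarrow> rmem s4 ''d'' i = D i)" if "1 \<le> j" "j \<le> m" for j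
            using cut that unfolding bs_def by blast
          have G4: "la j \<le> th j \<and> th j \<le> B" if "1 \<le> j" "j \<le> m" for j using gf(4)[OF that] by blast
          have ccd: "cc i = steps (d i) u (c i + 2 * u)" for i by (simp add: cc_def)
          have bsd: "bs j = vstart cc (sg j + 1)" for j by (simp add: bs_def)
          note cor = cut_correct[where F=F, OF u sg m abm F x0 ccd Qs bsd pk[unfolded csum_def] gf(1,2,3) G4 gf(5) cut']
          have "t1 + (t2 + (t3 + t4)) \<le> 50000 * Dm * (N + n)"
          proof -
            have Dm1: "1 \<le> Dm" unfolding Dm_def by (subst depth.simps) simp
            have n1: "1 \<le> n" using m mn by simp
            define K where "K = N + n"
            have K: "VN \<le> K" "n \<le> K" "m \<le> K" "1 \<le> K" using VN mn n1 by (simp_all add: K_def)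
            have "t3 \<le> (120 * Dm + 300) * (6 * K) + 400 * K"
            proof -
              have "(\<Sum>j=1..m. ps (j + 1) - ps j) + 4 * m \<le> 6 * K" using items K by simp
              then have p: "(120 * Dm + 300) * ((\<Sum>j=1..m. ps (j + 1) - ps j) + 4 * m) \<le> (120 * Dm + 300) * (6 * K)"
                by (rule mult_le_mono2)
              have "200 * (m + 1) \<le> 400 * K" using K by simp
              from order_trans[OF t3[unfolded Dmd] add_mono[OF p this]] show ?thesis .
            qed
            also have "\<dots> \<le> 3000 * (Dm * K)"
            proof -
              have "K \<le> Dm * K" using Dm1 by simp
              moreover have "(120 * Dm + 300) * (6 * K) + 400 * K = 720 * (Dm * K) + 2200 * K" by (simp add: algebra_simps)
              ultimately show ?thesis by linarith
            qed
            finally have t3': "t3 \<le> 3000 * (Dm * K)" .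
            have "t1 + t2 + t4 \<le> 43000 * K" using q1(1) q2(1) t4 K by linarith
            also have "\<dots> \<le> 43000 * (Dm * K)" using Dm1 by simp
            finally have "t1 + (t2 + (t3 + t4)) \<le> 50000 * (Dm * K)" using t3' by linarith
            then show ?thesis by (simp add: K_def mult.assoc)
          qed
          then show "t1 + (t2 + (t3 + t4)) \<le> 50000 * depth (2 * (m + 1)) * (N + n) \<and>
           (\<forall>i. 1 \<le> i \<and> i \<le> n \<longrightarrow> c i \<le> rmem s4 ''d'' i \<and> rmem s4 ''d'' i \<le> d i) \<and>
           (\<exists>x. feas n m sg a b c (rmem s4 ''d'') x \<and> (\<forall>z. feas n m sg a b c d z \<longrightarrow> obj n F x \<le> obj n F z)) \<and>
           (\<Sum>i=1..n. rmem s4 ''d'' i - c i) \<le> b m - (\<Sum>i=1..n. c i) + (\<Sum>i=1..n. d i - c i) / 32 + 4 * real n * u"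
            using cor unfolding Dm_def by blast
        qed
      qed
    qed
  qed
qed

section \<open>Rounds\<close>

text \<open>Only the meaningful indices change sign; elsewhere the old contents \<open>q\<close>
  stay, as the loop does not touch them. Two flips therefore restore whole arrays, as
  \<open>neg_neg\<close> says.\<close>

definition neg :: "nat \<Rightarrow> (nat \<Rightarrow> real) \<Rightarrow> (nat \<Rightarrow> real) \<Rightarrow> nat \<Rightarrow> real" where
  "neg k p q = (\<lambda>i. if 1 \<le> i \<and> i \<le> k then - p i else q i)"

lemma neg_0 [simp]: "neg 0 p q = q"
  by (rule ext) (simp add: neg_def)

lemma neg_Suc: "(neg k p q)(k + 1 := - p (k + 1)) = neg (k + 1) p q"
  by (rule ext) (simp add: neg_def le_Suc_eq flip: Suc_eq_plus1)

lemma neg_Suc_same: "neg k p q (k + 1) = q (k + 1)"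
  by (simp add: neg_def)

lemma neg_in: "1 \<le> i \<Longrightarrow> i \<le> k \<Longrightarrow> neg k p q i = - p i"
  by (simp add: neg_def)

lemma neg_neg: "neg k (neg k p q) (neg k r p) = p"
  by (rule ext) (simp add: neg_def)

definition flip_loop :: "name \<Rightarrow> name \<Rightarrow> name \<Rightarrow> com" where
  "flip_loop x y l = IS ''v'' (IConst 0) ;;
     While (ILt (IV ''v'') (IV l))
      (inc ''v'' ;;
       RS ''h'' (RGet x (IV ''v'')) ;;
       RSet x (IV ''v'') (RSub (RConst 0) (RGet y (IV ''v''))) ;;
       RSet y (IV ''v'') (RSub (RConst 0) (RV ''h'')))"

lemma mods_flip_loop [simp]: "imods (flip_loop x y l) = {''v''}" "rmods (flip_loop x y l) = {''h'', x, y}"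
  by (auto simp: flip_loop_def)

lemma flip_loop:
  assumes xy: "x \<noteq> y" "x \<noteq> ''h''" "y \<noteq> ''h''" "l \<noteq> ''v''" and s: "iv s l = k" "rmem s x = p" "rmem s y = q"
  shows "wp f (flip_loop x y l) s (\<lambda>t s'. t \<le> 40 * k + 20 \<and> rmem s' x = neg k q p \<and> rmem s' y = neg k p q)"
  unfolding flip_loop_def wp_Seq wp_ISet
proof (rule wp_while[where V = "\<lambda>s'. 40 * (k - iv s' ''v'')" and
      I = "\<lambda>s'. iv s' ''v'' \<le> k \<and> rmem s' x = neg (iv s' ''v'') q p \<and> rmem s' y = neg (iv s' ''v'') p q"], goal_cases)
  case 1
  show ?case using s by simp
next
  case (2 s1)
  define v where v: "v = iv s1 ''v''"
  have e: "iv s1 l = k" using frameI[OF 2(3)] s xy by simp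
  have lt: "v < k" using 2(2) e by (simp add: v)
  have I: "rmem s1 x = neg v q p" "rmem s1 y = neg v p q" using 2(1) by (simp_all add: v)
  have pt: "40 + 40 * (k - (v + 1)) \<le> 40 * (k - v)" using lt by simp
  have xy': "y \<noteq> x" "''h'' \<noteq> x" "''h'' \<noteq> y" using xy by blast+
  show ?case using lt pt xy xy' by (simp add: e v[symmetric] I neg_Suc neg_Suc_same)
next
  case (3 t s1)
  have e: "iv s1 l = k" using frameI[OF 3(3)] s xy by simp
  have v: "iv s1 ''v'' = k" using 3(1,2) e by simp
  show ?case using 3(1,4) by (simp add: v)
qed

text \<open>After negating all variables, a cut of the upper bounds raises the lower bounds of the original problem.\<close>

definition flip :: com where
  "flip = flip_loop ''c'' ''d'' ''n'' ;; flip_loop ''a'' ''b'' ''m'' ;; RS ''g'' (RSub (RConst 0) (RV ''g''))"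

lemma mods_flip [simp]: "imods flip = {''v''}" "rmods flip = {''h'', ''c'', ''d'', ''a'', ''b'', ''g''}"
  by (auto simp: flip_def)

lemma flip:
  assumes s: "iv s ''n'' = n" "iv s ''m'' = m" "rmem s ''a'' = a" "rmem s ''b'' = b" "rmem s ''c'' = c" "rmem s ''d'' = d" "rv s ''g'' = g"
  shows "wp f flip s (\<lambda>t s'. t \<le> 40 * n + 40 * m + 50 \<and> rmem s' ''a'' = neg m b a \<and> rmem s' ''b'' = neg m a b \<and>
    rmem s' ''c'' = neg n d c \<and> rmem s' ''d'' = neg n c d \<and> rv s' ''g'' = - g)"
  unfolding flip_def wp_Seq
proof (rule wp_use[OF flip_loop[OF _ _ _ _ s(1,5,6)]], simp, simp, simp, simp, elim conjE)
  fix t1 s1 assume q1: "t1 \<le> 40 * n + 20" "rmem s1 ''c'' = neg n d c" "rmem s1 ''d'' = neg n c d"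
    and fr1: "frame (flip_loop ''c'' ''d'' ''n'') s s1"
  have e: "iv s1 ''m'' = m" "rmem s1 ''a'' = a" "rmem s1 ''b'' = b" "rv s1 ''g'' = g"
    by (simp_all add: frameI[OF fr1] frameR[OF fr1] s)
  show "wp f (flip_loop ''a'' ''b'' ''m'') s1 (\<lambda>t' s''. wp f (RS ''g'' (RSub (RConst 0) (RV ''g''))) s'' (\<lambda>t'a s''.
     t1 + (t' + t'a) \<le> 40 * n + 40 * m + 50 \<and> rmem s'' ''a'' = neg m b a \<and> rmem s'' ''b'' = neg m a b \<and>
    rmem s'' ''c'' = neg n d c \<and> rmem s'' ''d'' = neg n c d \<and> rv s'' ''g'' = - g))"
  proof (rule wp_use[OF flip_loop[OF _ _ _ _ e(1,2,3)]], simp, simp, simp, simp, elim conjE)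
    fix t2 s2 assume q2: "t2 \<le> 40 * m + 20" "rmem s2 ''a'' = neg m b a" "rmem s2 ''b'' = neg m a b"
      and fr2: "frame (flip_loop ''a'' ''b'' ''m'') s1 s2"
    have e2: "rmem s2 ''c'' = neg n d c" "rmem s2 ''d'' = neg n c d" "rv s2 ''g'' = g"
      by (simp_all add: frameR[OF fr2] q1 e)
    show "wp f (RS ''g'' (RSub (RConst 0) (RV ''g''))) s2 (\<lambda>t'a s''.
     t1 + (t2 + t'a) \<le> 40 * n + 40 * m + 50 \<and> rmem s'' ''a'' = neg m b a \<and> rmem s'' ''b'' = neg m a b \<and>
    rmem s'' ''c'' = neg n d c \<and> rmem s'' ''d'' = neg n c d \<and> rv s'' ''g'' = - g)"
      using q1(1) q2(1) by (simp add: q2(2,3) e2)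
  qed
qed

section \<open>The mirrored problem\<close>

lemma pre_uminus: "pre (\<lambda>i. - x i) k = - pre x k"
  by (simp add: pre_def sum_negf)

lemma feas_neg:
  "feas n m sg (neg m b a) (neg m a b) (neg n d c) (neg n c d) (\<lambda>i. - x i) \<longleftrightarrow> feas n m sg a b c d x"
  unfolding feas_def pre_uminus by (rule arg_cong2[where f = "(\<and>)"]; rule ball_cong[OF refl]; auto simp: neg_in)

lemma feas_box_mono:
  assumes "feas n m sg a b c' d' x" "\<And>i. 1 \<le> i \<Longrightarrow> i \<le> n \<Longrightarrow> c i \<le> c' i \<and> d' i \<le> d i"
  shows "feas n m sg a b c d x"
  unfolding feas_def
proof (intro conjI ballI)
  fix i assume i: "i \<in> {1..n}"
  then have "c i \<le> c' i" "d' i \<le> d i" "c' i \<le> x i" "x i \<le> d' i" using assms unfolding feas_def by auto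
  then show "c i \<le> x i" "x i \<le> d i" by linarith+
qed (use assms(1) in \<open>simp_all add: feas_def\<close>)

lemma continuous_on_reflect:
  fixes h :: "real \<Rightarrow> real"
  assumes "continuous_on {l..r} h"
  shows "continuous_on {- r..- l} (\<lambda>x. h (- x))"
  by (rule continuous_on_compose2[OF assms]) (auto intro: continuous_intros)

lemma convex_on_reflect:
  fixes h :: "real \<Rightarrow> real"
  assumes "convex_on {l..r} h"
  shows "convex_on {- r..- l} (\<lambda>x. h (- x))"
proof (rule convex_onI)
  fix t x y :: real assume a: "0 < t" "t < 1" "x \<in> {- r..- l}" "y \<in> {- r..- l}"
  have "h ((1 - t) *\<^sub>R (- x) + t *\<^sub>R (- y)) \<le> (1 - t) * h (- x) + t * h (- y)"
    by (rule convex_onD[OF assms]) (use a in auto)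
  then show "h (- ((1 - t) *\<^sub>R x + t *\<^sub>R y)) \<le> (1 - t) * h (- x) + t * h (- y)" by (simp add: algebra_simps)
qed simp

definition round :: com where
  "round = (cut ;; flip) ;; (cut ;; flip)"

lemma mods_round [simp]:
  "imods round = imods cut"
  "rmods round = rmods cut \<union> {''c'', ''a'', ''b'', ''g''}"
  by (auto simp: round_def)

text \<open>With \<open>W\<close> the old width, the first cut makes the surplus of the upper bounds
  over the resource at most \<open>W / 32 + 4 n u\<close>. In mirrored form the second cut bounds
  the remaining width by exactly this surplus plus another \<open>W / 32 + 4 n u\<close>. The terms
  with the resource and the lower bounds cancel in the sum.\<close>

lemma round:
  fixes f :: "nat \<Rightarrow> real \<Rightarrow> real" and sg :: "nat \<Rightarrow> nat" and a b c d :: "nat \<Rightarrow> real" and u :: real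
  assumes u: "0 < u" and s: "iv s ''n'' = n" "iv s ''m'' = m" "imem s ''sigma'' = sg" "rmem s ''a'' = a" "rmem s ''b'' = b"
      "rmem s ''c'' = c" "rmem s ''d'' = d" "rv s ''u'' = u" "rv s ''g'' = 1"
    and bm: "block_map n m sg" and abm: "a m = b m"
    and F: "\<And>i. 1 \<le> i \<Longrightarrow> i \<le> n \<Longrightarrow> convex_on {c i..d i} (f i)"
      "\<And>i. 1 \<le> i \<Longrightarrow> i \<le> n \<Longrightarrow> continuous_on {c i..d i} (f i)"
    and x0: "feas n m sg a b c d x0"
    and W: "(\<Sum>i=1..n. d i - c i) \<le> real N * u"
  shows "wp f round s (\<lambda>t s'. t \<le> 100000 * depth (2 * (m + 1)) * (N + n) + 80 * n + 80 * m + 100 \<and>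
    rmem s' ''a'' = a \<and> rmem s' ''b'' = b \<and> rv s' ''g'' = 1 \<and>
    (\<forall>i. 1 \<le> i \<and> i \<le> n \<longrightarrow> c i \<le> rmem s' ''c'' i \<and> rmem s' ''d'' i \<le> d i) \<and>
    (\<exists>x. feas n m sg a b (rmem s' ''c'') (rmem s' ''d'') x \<and> (\<forall>z. feas n m sg a b c d z \<longrightarrow> obj n f x \<le> obj n f z)) \<and>
    (\<Sum>i=1..n. rmem s' ''d'' i - rmem s' ''c'' i) \<le> (\<Sum>i=1..n. d i - c i) / 16 + 8 * real n * u)"
proof -
  define Dm where "Dm = depth (2 * (m + 1))"
  define Q where "Q = (\<lambda>t s'. t \<le> 100000 * Dm * (N + n) + 80 * n + 80 * m + 100 \<and>
    rmem s' ''a'' = a \<and> rmem s' ''b'' = b \<and> rv s' ''g'' = 1 \<and>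
    (\<forall>i. 1 \<le> i \<and> i \<le> n \<longrightarrow> c i \<le> rmem s' ''c'' i \<and> rmem s' ''d'' i \<le> d i) \<and>
    (\<exists>x. feas n m sg a b (rmem s' ''c'') (rmem s' ''d'') x \<and> (\<forall>z. feas n m sg a b c d z \<longrightarrow> obj n f x \<le> obj n f z)) \<and>
    (\<Sum>i=1..n. rmem s' ''d'' i - rmem s' ''c'' i) \<le> (\<Sum>i=1..n. d i - c i) / 16 + 8 * real n * u)"
  have m: "1 \<le> m" using bm unfolding block_map_def by blast
  have f1: "f i x = f i (1 * x)" for i x by simp
  have "wp f round s Q"
    unfolding round_def wp_Seq
  proof (rule wp_use[OF cut[where F=f and f=f, OF u s bm abm f1 F x0 W, folded Dm_def]], assumption, assumption, assumption, assumption, elim conjE exE)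
    fix t1 s1 x1
    assume t1: "t1 \<le> 50000 * Dm * (N + n)"
      and box1: "\<forall>i. 1 \<le> i \<and> i \<le> n \<longrightarrow> c i \<le> rmem s1 ''d'' i \<and> rmem s1 ''d'' i \<le> d i"
      and x1: "feas n m sg a b c (rmem s1 ''d'') x1" "\<forall>z. feas n m sg a b c d z \<longrightarrow> obj n f x1 \<le> obj n f z"
      and W1: "(\<Sum>i=1..n. rmem s1 ''d'' i - c i) \<le> b m - (\<Sum>i=1..n. c i) + (\<Sum>i=1..n. d i - c i) / 32 + 4 * real n * u"
      and fr1: "frame cut s s1"
    define d1 where "d1 = rmem s1 ''d''"
    note box1 = box1[folded d1_def] and x1 = x1[folded d1_def] and W1 = W1[folded d1_def]
    have e1: "iv s1 ''n'' = n" "iv s1 ''m'' = m" "imem s1 ''sigma'' = sg" "rmem s1 ''a'' = a" "rmem s1 ''b'' = b"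
      "rmem s1 ''c'' = c" "rmem s1 ''d'' = d1" "rv s1 ''u'' = u" "rv s1 ''g'' = 1"
      by (simp_all add: frameI[OF fr1] frameR[OF fr1] s d1_def)
    show "wp f flip s1 (\<lambda>t' s'. wp f cut s' (\<lambda>t s'a. wp f flip s'a (\<lambda>t'a. Q (t1 + t' + (t + t'a)))))"
    proof (rule wp_use[OF flip[OF e1(1,2,4,5,6,7,9)]], elim conjE)
      fix t2 s2
      assume q2: "t2 \<le> 40 * n + 40 * m + 50" "rmem s2 ''a'' = neg m b a" "rmem s2 ''b'' = neg m a b" "rmem s2 ''c'' = neg n d1 c"
          "rmem s2 ''d'' = neg n c d1" "rv s2 ''g'' = - 1" and fr2: "frame flip s1 s2"
      have e2: "iv s2 ''n'' = n" "iv s2 ''m'' = m" "imem s2 ''sigma'' = sg" "rv s2 ''u'' = u"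
        by (simp_all add: frameI[OF fr2] frameR[OF fr2] e1)
      have abm2: "neg m b a m = neg m a b m" using m abm by (simp add: neg_def)
      have f2: "f i (- x) = f i (- 1 * x)" for i x by simp
      have sub: "{c i..d1 i} \<subseteq> {c i..d i}" if "1 \<le> i" "i \<le> n" for i using box1 that by simp
      have F2: "convex_on {neg n d1 c i..neg n c d1 i} (\<lambda>x. f i (- x))"
        "continuous_on {neg n d1 c i..neg n c d1 i} (\<lambda>x. f i (- x))" if i: "1 \<le> i" "i \<le> n" for i
        unfolding neg_in[OF i]
        by (rule convex_on_reflect[OF convex_on_subset[OF F(1)[OF i] sub[OF i]]] continuous_on_reflect[OF continuous_on_subset[OF F(2)[OF i] sub[OF i]]]; simp)+
      have W2e: "(\<Sum>i=1..n. neg n c d1 i - neg n d1 c i) = (\<Sum>i=1..n. d1 i - c i)"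
        by (rule sum.cong) (simp_all add: neg_in)
      have W1': "(\<Sum>i=1..n. d1 i - c i) \<le> (\<Sum>i=1..n. d i - c i)" using box1 by (intro sum_mono) simp
      have W2: "(\<Sum>i=1..n. neg n c d1 i - neg n d1 c i) \<le> real N * u" unfolding W2e using W1' W by linarith
      note x2 = iffD2[OF feas_neg x1(1)]
      show "wp f cut s2 (\<lambda>t s'a. wp f flip s'a (\<lambda>t'a. Q (t1 + t2 + (t + t'a))))"
      proof (rule wp_use[OF cut[where F = "\<lambda>i x. f i (- x)" and f=f, OF u e2(1,2,3) q2(2-5) e2(4) q2(6) bm abm2 f2 F2 x2 W2, folded Dm_def, unfolded W2e]],
          assumption, assumption, assumption, assumption, elim conjE exE)
        fix t3 s3 x3
        assume t3: "t3 \<le> 50000 * Dm * (N + n)"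
          and box3: "\<forall>i. 1 \<le> i \<and> i \<le> n \<longrightarrow> neg n d1 c i \<le> rmem s3 ''d'' i \<and> rmem s3 ''d'' i \<le> neg n c d1 i"
          and x3: "feas n m sg (neg m b a) (neg m a b) (neg n d1 c) (rmem s3 ''d'') x3"
            "\<forall>z. feas n m sg (neg m b a) (neg m a b) (neg n d1 c) (neg n c d1) z \<longrightarrow> (\<Sum>i=1..n. f i (- x3 i)) \<le> (\<Sum>i=1..n. f i (- z i))"
          and W3: "(\<Sum>i=1..n. rmem s3 ''d'' i - neg n d1 c i) \<le> neg m a b m - (\<Sum>i=1..n. neg n d1 c i) + (\<Sum>i=1..n. d1 i - c i) / 32 + 4 * real n * u"
          and fr3: "frame cut s2 s3"
        define d3 where "d3 = rmem s3 ''d''"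
        note box3 = box3[folded d3_def] and x3 = x3[folded d3_def] and W3 = W3[folded d3_def]
        have e3: "iv s3 ''n'' = n" "iv s3 ''m'' = m" "rmem s3 ''a'' = neg m b a" "rmem s3 ''b'' = neg m a b"
          "rmem s3 ''c'' = neg n d1 c" "rmem s3 ''d'' = d3" "rv s3 ''g'' = - 1"
          by (simp_all add: frameI[OF fr3] frameR[OF fr3] e2 q2 d3_def)
        show "wp f flip s3 (\<lambda>t'a. Q (t1 + t2 + (t3 + t'a)))"
        proof (rule wp_use[OF flip[OF e3]], elim conjE)
          fix t4 s4
          assume q4: "t4 \<le> 40 * n + 40 * m + 50" "rmem s4 ''a'' = neg m (neg m a b) (neg m b a)" "rmem s4 ''b'' = neg m (neg m b a) (neg m a b)"
            "rmem s4 ''c'' = neg n d3 (neg n d1 c)" "rmem s4 ''d'' = neg n (neg n d1 c) d3" "rv s4 ''g'' = - (- 1)"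
          define c4 d4 where "c4 = neg n d3 (neg n d1 c)" "d4 = neg n (neg n d1 c) d3"
          have cd4: "c4 i = - d3 i" "d4 i = d1 i" if "1 \<le> i" "i \<le> n" for i using that by (simp_all add: c4_d4_def neg_in)
          have box4: "c i \<le> c4 i \<and> d4 i \<le> d i" if i: "1 \<le> i" "i \<le> n" for i
          proof -
            have "d3 i \<le> neg n c d1 i" "d1 i \<le> d i" using box3 box1 i by blast+
            then show ?thesis using cd4[OF i] i by (simp add: neg_in)
          qed
          have feas4: "feas n m sg a b c4 d4 (\<lambda>i. - x3 i)"
          proof -
            have "feas n m sg (neg m (neg m a b) (neg m b a)) (neg m (neg m b a) (neg m a b)) c4 d4 (\<lambda>i. - x3 i)"
              unfolding c4_d4_def feas_neg by (rule x3(1))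
            then show ?thesis unfolding neg_neg .
          qed
          \<comment> \<open>The minimizer found in the box cut twice is at least as good as
            \<open>x1\<close>, which lies in the box cut once and is optimal for the full
            box.\<close>
          have opt4: "obj n f (\<lambda>i. - x3 i) \<le> obj n f z" if z: "feas n m sg a b c d z" for z
          proof -
            have "(\<Sum>i=1..n. f i (- x3 i)) \<le> (\<Sum>i=1..n. f i (- (- x1 i)))" using x3(2) x2 by blast
            moreover have "obj n f x1 \<le> obj n f z" using x1(2) z by blast
            ultimately show ?thesis by simp
          qed
          have W4: "(\<Sum>i=1..n. d4 i - c4 i) \<le> (\<Sum>i=1..n. d i - c i) / 16 + 8 * real n * u"
          proof -
            have n1: "neg m a b m = - b m" using m abm by (simp add: neg_in)
            have n2: "(\<Sum>i=1..n. neg n d1 c i) = - (\<Sum>i=1..n. d1 i)"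
              unfolding sum_negf[symmetric] by (rule sum.cong) (simp_all add: neg_in)
            have n3: "(\<Sum>i=1..n. d3 i - neg n d1 c i) = (\<Sum>i=1..n. d4 i - c4 i)"
              by (rule sum.cong) (simp_all add: neg_in cd4)
            have n4: "(\<Sum>i=1..n. d1 i) = (\<Sum>i=1..n. d1 i - c i) + (\<Sum>i=1..n. c i)" by (simp add: sum_subtractf)
            from W3 have "(\<Sum>i=1..n. d4 i - c4 i) \<le> - b m + (\<Sum>i=1..n. d1 i) + (\<Sum>i=1..n. d1 i - c i) / 32 + 4 * real n * u"
              unfolding n1 n2 n3 by linarith
            then show ?thesis using W1 W1' n4 by linarith
          qed
          have t: "t1 + t2 + (t3 + t4) \<le> 100000 * Dm * (N + n) + 80 * n + 80 * m + 100"
            using t1 t3 q2(1) q4(1) unfolding mult.assoc by linarith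
          have e4: "rmem s4 ''a'' = a" "rmem s4 ''b'' = b" "rv s4 ''g'' = 1" "rmem s4 ''c'' = c4" "rmem s4 ''d'' = d4"
            unfolding q4 neg_neg c4_d4_def by simp_all
          show "Q (t1 + t2 + (t3 + t4)) s4"
            unfolding Q_def e4 using t box4 feas4 opt4 W4 by blast
        qed
      qed
    qed
  qed
  then show ?thesis unfolding Q_def Dm_def .
qed

section \<open>A feasible point of a box\<close>

lemma block_map_bound:
  assumes "block_map n m sg" "j \<le> m"
  shows "sg j \<le> n"
proof (cases "j = m")
  case False
  then have "j < m" using assms(2) by simp
  then have "sg j < sg m" "sg m = n" using assms(1) unfolding block_map_def by blast+
  then show ?thesis by simp
qed (use assms(1) in \<open>simp add: block_map_def\<close>)

text \<open>\<open>L\<close> collects prefix sums forced by the lower bounds \<open>c\<close> and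
  \<open>a\<close>, so it stays below the prefix sums of any feasible \<open>x\<close>. The index
  \<open>j\<close> belongs to the first nested constraint that ends after \<open>v\<close>, or is
  \<open>m + 1\<close> if there is none.\<close>

definition earliest :: "nat \<Rightarrow> (nat \<Rightarrow> nat) \<Rightarrow> (nat \<Rightarrow> real) \<Rightarrow> (nat \<Rightarrow> real) \<Rightarrow> (nat \<Rightarrow> real) \<Rightarrow> nat \<Rightarrow> nat \<Rightarrow> (nat \<Rightarrow> real) \<Rightarrow> bool" where
  "earliest m sg a c x v j L \<longleftrightarrow> L 0 = 0 \<and> (\<forall>i. 1 \<le> i \<and> i \<le> v \<longrightarrow> L (i - 1) + c i \<le> L i) \<and>
     (\<forall>i\<le>v. L i \<le> pre x i) \<and> (\<forall>k. 1 \<le> k \<and> k < j \<longrightarrow> a k \<le> L (sg k)) \<and>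
     1 \<le> j \<and> j \<le> m + 1 \<and> sg (j - 1) \<le> v \<and> (j \<le> m \<longrightarrow> v < sg j) \<and> (\<forall>k. 1 \<le> k \<and> k < j \<longrightarrow> sg k \<le> v)"

lemma earliest_0:
  assumes "block_map n m sg" "L 0 = 0"
  shows "earliest m sg a c x 0 1 L"
proof -
  have "sg 0 = 0" "(0::nat) < 1" "1 \<le> m" "\<forall>i j. i < j \<and> j \<le> m \<longrightarrow> sg i < sg j" using assms(1) unfolding block_map_def by simp_all
  then have "sg 0 = 0" "sg 0 < sg 1" by blast+
  then show ?thesis using assms(2) unfolding earliest_def by simp
qed

lemma earliest_step:
  assumes bm: "block_map n m sg" and x: "feas n m sg a b c d x" and E: "earliest m sg a c x v j L" and v: "v < n"
  shows "v + 1 < sg j \<Longrightarrow> earliest m sg a c x (v + 1) j (L(v + 1 := L v + c (v + 1)))"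
    and "\<not> v + 1 < sg j \<Longrightarrow> earliest m sg a c x (v + 1) (j + 1) (L(v + 1 := max (L v + c (v + 1)) (a j)))"
proof -
  have sm: "\<And>i j. i < j \<Longrightarrow> j \<le> m \<Longrightarrow> sg i < sg j" "sg m = n" "1 \<le> m" "sg 0 = 0" using bm unfolding block_map_def by blast+
  have E1: "L 0 = 0" "\<And>i. 1 \<le> i \<Longrightarrow> i \<le> v \<Longrightarrow> L (i - 1) + c i \<le> L i" "\<And>i. i \<le> v \<Longrightarrow> L i \<le> pre x i"
    "\<And>k. 1 \<le> k \<Longrightarrow> k < j \<Longrightarrow> a k \<le> L (sg k)" "1 \<le> j" "j \<le> m + 1" "sg (j - 1) \<le> v" "j \<le> m \<Longrightarrow> v < sg j"
    "\<And>k. 1 \<le> k \<Longrightarrow> k < j \<Longrightarrow> sg k \<le> v"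
    using E unfolding earliest_def by blast+
  have jm: "j \<le> m"
  proof (rule ccontr)
    assume "\<not> j \<le> m"
    then have "j - 1 = m" using E1(6) by simp
    then show False using E1(7) sm(2) v by simp
  qed
  have xi: "c (v + 1) \<le> x (v + 1)" and xa: "a j \<le> pre x (sg j)" using x v jm E1(5) unfolding feas_def by simp_all
  have p1: "pre x (v + 1) = pre x v + x (v + 1)" using pre_Suc[of x v] unfolding Suc_eq_plus1 .
  have Lp: "L v + c (v + 1) \<le> pre x (v + 1)" using E1(3)[of v] xi p1 by simp
  have old: "w i = L i" if "i \<le> v" "w = L(v + 1 := r)" for i r w using that by simp
  have gen: "w 0 = 0 \<and> (\<forall>i. 1 \<le> i \<and> i \<le> v + 1 \<longrightarrow> w (i - 1) + c i \<le> w i) \<and> (\<forall>i\<le>v + 1. w i \<le> pre x i) \<and>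
     (\<forall>k. 1 \<le> k \<and> k < j \<longrightarrow> a k \<le> w (sg k)) \<and> (\<forall>k. 1 \<le> k \<and> k < j \<longrightarrow> sg k \<le> v + 1)"
    if w: "w = L(v + 1 := r)" and r: "L v + c (v + 1) \<le> r" "r \<le> pre x (v + 1)" for w r
  proof (intro conjI allI impI)
    show "w 0 = 0" using E1(1) w by simp
    show "w (i - 1) + c i \<le> w i" if i: "1 \<le> i \<and> i \<le> v + 1" for i
    proof (cases "i = v + 1")
      case True then show ?thesis using r w by simp
    next
      case False
      then have iv: "i \<le> v" "i - 1 \<le> v" using i by linarith+
      show ?thesis using E1(2)[of i] i iv old[OF iv(1) w] old[OF iv(2) w] by simp
    qed
    show "w i \<le> pre x i" if i: "i \<le> v + 1" for i
    proof (cases "i = v + 1")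
      case True then show ?thesis using r w by simp
    next
      case False
      then show ?thesis using E1(3)[of i] i w by simp
    qed
    show "a k \<le> w (sg k)" if k: "1 \<le> k \<and> k < j" for k
      using E1(4)[of k] E1(9)[of k] k w by simp
    show "sg k \<le> v + 1" if k: "1 \<le> k \<and> k < j" for k using E1(9)[of k] k by simp
  qed
  {
    assume lt: "v + 1 < sg j"
    show "earliest m sg a c x (v + 1) j (L(v + 1 := L v + c (v + 1)))"
      unfolding earliest_def using gen[OF refl order_refl Lp] E1(5,6,7) lt by simp
  next
    assume nlt: "\<not> v + 1 < sg j"
    then have sj: "sg j = v + 1" using E1(8)[OF jm] by simp
    have r: "L v + c (v + 1) \<le> max (L v + c (v + 1)) (a j)" "max (L v + c (v + 1)) (a j) \<le> pre x (v + 1)"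
      using Lp xa sj by simp_all
    have j1: "v + 1 < sg (j + 1)" if "j + 1 \<le> m" using sm(1)[of j "j + 1"] that sj by simp
    note g = gen[OF refl r]
    have k1: "k = j" if "k < j + 1" "\<not> k < j" for k using that by simp
    have "a k \<le> (L(v + 1 := max (L v + c (v + 1)) (a j))) (sg k) \<and> sg k \<le> v + 1" if k: "1 \<le> k \<and> k < j + 1" for k
    proof (cases "k < j")
      case True then show ?thesis using g k by blast
    next
      case False
      then have "k = j" using k1 k by blast
      then show ?thesis using sj by simp
    qed
    then show "earliest m sg a c x (v + 1) (j + 1) (L(v + 1 := max (L v + c (v + 1)) (a j)))"
      unfolding earliest_def using g jm j1 sj by simp
  }
qed

section \<open>Forced prefix sums from the left\<close>

definition forward :: com where
  "forward = IS ''v'' (IConst 0) ;; IS ''j'' (IConst 1) ;; RSet ''Y'' (IConst 0) (RConst 0) ;;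
     While (ILt (IV ''v'') (IV ''n''))
      (RS ''h'' (RAdd (RGet ''Y'' (IV ''v'')) (RGet ''c'' (IAdd (IV ''v'') (IConst 1)))) ;;
       inc ''v'' ;;
       Cond (ILt (IV ''v'') (IGet ''sigma'' (IV ''j''))) Skip
        (Cond (RLt (RV ''h'') (RGet ''a'' (IV ''j''))) (RS ''h'' (RGet ''a'' (IV ''j''))) Skip ;; inc ''j'') ;;
       RSet ''Y'' (IV ''v'') (RV ''h''))"

lemma mods_forward [simp]: "imods forward = {''v'', ''j''}" "rmods forward = {''Y'', ''h''}"
  by (auto simp: forward_def)

lemma forward:
  assumes s: "iv s ''n'' = n" "imem s ''sigma'' = sg" "rmem s ''a'' = a" "rmem s ''c'' = c"
    and bm: "block_map n m sg" and x: "feas n m sg a b c d x"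
  shows "wp f forward s (\<lambda>t s'. t \<le> 70 * n + 30 \<and> earliest m sg a c x n (m + 1) (rmem s' ''Y''))"
  unfolding forward_def wp_Seq wp_ISet wp_RSet
proof (rule wp_while[where V = "\<lambda>s'. 70 * (n - iv s' ''v'')" and
      I = "\<lambda>s'. iv s' ''v'' \<le> n \<and> earliest m sg a c x (iv s' ''v'') (iv s' ''j'') (rmem s' ''Y'')"], goal_cases)
  case 1
  show ?case by (simp add: earliest_0[OF bm])
next
  case (2 s1)
  define v j L where v: "v = iv s1 ''v''" "j = iv s1 ''j''" "L = rmem s1 ''Y''"
  have e: "iv s1 ''n'' = n" "imem s1 ''sigma'' = sg" "rmem s1 ''a'' = a" "rmem s1 ''c'' = c"
    using frameI[OF 2(3)] frameR[OF 2(3)] s by simp_all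
  have lt: "v < n" using 2(2) e by (simp add: v)
  have E: "earliest m sg a c x v j L" using 2(1) by (simp add: v)
  have pt: "70 + 70 * (n - (v + 1)) \<le> 70 * (n - v)" using lt by simp
  note st = earliest_step[OF bm x E lt]
  have mx: "max p q = (if p < q then q else p)" for p q :: real by simp
  show ?case
  proof (cases "v + 1 < sg j")
    case True
    show ?thesis using st(1)[OF True] True lt pt by (simp add: e v[symmetric])
  next
    case False
    show ?thesis using st(2)[OF False] False lt pt by (cases "L v + c (v + 1) < a j") (simp_all add: e v[symmetric])
  qed
next
  case (3 t s1)
  have e: "iv s1 ''n'' = n" using frameI[OF 3(3)] s by simp
  have v: "iv s1 ''v'' = n" using 3(1,2) e by simp
  define j where "j = iv s1 ''j''"
  have E: "earliest m sg a c x n j (rmem s1 ''Y'')" using 3(1) unfolding v j_def by blast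
  have "j = m + 1"
  proof (rule ccontr)
    assume "j \<noteq> m + 1"
    then have "j \<le> m" "n < sg j" using E unfolding earliest_def by auto
    moreover have "sg j \<le> n" by (rule block_map_bound[OF bm \<open>j \<le> m\<close>])
    ultimately show False by simp
  qed
  then show ?case using 3(4) E by (simp add: v)
qed

text \<open>The prefix sums \<open>S\<close> are squeezed between \<open>L\<close> and those of a
  feasible \<open>x\<close>: nested lower bounds are inherited from \<open>L\<close>, nested upper
  bounds from \<open>x\<close>, and the program never has to look at \<open>b\<close>.\<close>

definition latest :: "nat \<Rightarrow> real \<Rightarrow> (nat \<Rightarrow> real) \<Rightarrow> (nat \<Rightarrow> real) \<Rightarrow> (nat \<Rightarrow> real) \<Rightarrow> (nat \<Rightarrow> real) \<Rightarrow> nat \<Rightarrow> (nat \<Rightarrow> real) \<Rightarrow> (nat \<Rightarrow> real) \<Rightarrow> bool" where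
  "latest n B c d x L v S X \<longleftrightarrow> S n = B \<and> (\<forall>i. v \<le> i \<and> i \<le> n \<longrightarrow> L i \<le> S i \<and> S i \<le> pre x i) \<and>
     (\<forall>i. v < i \<and> i \<le> n \<longrightarrow> X i = S i - S (i - 1) \<and> c i \<le> X i \<and> X i \<le> d i)"

text \<open>\<open>r\<close> is the least prefix sum that respects both \<open>L\<close> and the
  upper bound of variable \<open>v + 1\<close>. Both arguments of the maximum are at most
  \<open>pre x v\<close>. The lower bound of the variable holds because \<open>L\<close> already
  leaves room for it, or because its upper bound is attained.\<close>

lemma latest_step:
  assumes E: "earliest m sg a c x n (m + 1) L" and x: "feas n m sg a b c d x"
    and T: "latest n B c d x L (v + 1) S X" and v: "v + 1 \<le> n" and r: "r = max (S (v + 1) - d (v + 1)) (L v)"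
  shows "latest n B c d x L v (S(v := r)) (X(v + 1 := S (v + 1) - r))"
proof -
  have T1: "S n = B" "\<And>i. v + 1 \<le> i \<Longrightarrow> i \<le> n \<Longrightarrow> L i \<le> S i \<and> S i \<le> pre x i"
    "\<And>i. v + 1 < i \<Longrightarrow> i \<le> n \<Longrightarrow> X i = S i - S (i - 1) \<and> c i \<le> X i \<and> X i \<le> d i"
    using T unfolding latest_def by blast+
  have xd: "c (v + 1) \<le> x (v + 1)" "x (v + 1) \<le> d (v + 1)" using x v unfolding feas_def by simp_all
  have p: "pre x (v + 1) = pre x v + x (v + 1)" using pre_Suc[of x v] unfolding Suc_eq_plus1 .
  have "1 \<le> v + 1 \<and> v + 1 \<le> n" "v \<le> n" using v by simp_all
  then have "L v \<le> pre x v" "L (v + 1 - 1) + c (v + 1) \<le> L (v + 1)" using E unfolding earliest_def by blast+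
  then have L: "L v \<le> pre x v" "L v + c (v + 1) \<le> L (v + 1)" by simp_all
  have S: "L (v + 1) \<le> S (v + 1)" "S (v + 1) \<le> pre x (v + 1)" using T1(2)[of "v + 1"] v by simp_all
  have r1: "L v \<le> r" "r \<le> pre x v" "c (v + 1) \<le> S (v + 1) - r" "S (v + 1) - r \<le> d (v + 1)"
    using L S xd p unfolding r by simp_all
  have "L i \<le> (S(v := r)) i \<and> (S(v := r)) i \<le> pre x i" if "v \<le> i \<and> i \<le> n" for i
    using T1(2)[of i] r1(1,2) that by (cases "i = v") simp_all
  moreover have "(X(v + 1 := S (v + 1) - r)) i = (S(v := r)) i - (S(v := r)) (i - 1) \<and> c i \<le> (X(v + 1 := S (v + 1) - r)) i \<and>
     (X(v + 1 := S (v + 1) - r)) i \<le> d i" if i: "v < i \<and> i \<le> n" for i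
  proof (cases "i = v + 1")
    case True then show ?thesis using r1(3,4) by simp
  next
    case False
    then have "v + 1 < i" "i \<noteq> v" "i - 1 \<noteq> v" using i by linarith+
    then show ?thesis using T1(3)[of i] i False by simp
  qed
  moreover have "(S(v := r)) n = B" using T1(1) v by simp
  ultimately show ?thesis unfolding latest_def by blast
qed

lemma latest_feas:
  assumes bm: "block_map n m sg" and E: "earliest m sg a c x n (m + 1) L" and x: "feas n m sg a b c d x" and T: "latest n B c d x L 0 S X"
  shows "feas n m sg a b c d X"
proof -
  have "S 0 = 0" using T E unfolding latest_def earliest_def by (metis le0 order_antisym pre_0)
  have pS: "pre X k = S k" if "k \<le> n" for k
    using that
  proof (induction k)
    case 0 then show ?case using \<open>S 0 = 0\<close> by simp
  next
    case (Suc k)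
    have "X (Suc k) = S (Suc k) - S (Suc k - 1)" using T Suc.prems unfolding latest_def by blast
    then show ?case using Suc by (simp add: pre_Suc)
  qed
  show ?thesis
    unfolding feas_def
  proof (intro conjI ballI)
    fix j assume j: "j \<in> {1..m}"
    have sj: "sg j \<le> n" by (rule block_map_bound[OF bm]) (use j in simp)
    have "a j \<le> L (sg j)" using E j unfolding earliest_def by auto
    moreover have "L (sg j) \<le> S (sg j)" "S (sg j) \<le> pre x (sg j)" using T sj unfolding latest_def by auto
    moreover have "pre x (sg j) \<le> b j" using x j unfolding feas_def by blast
    ultimately show "a j \<le> pre X (sg j)" "pre X (sg j) \<le> b j" using pS[OF sj] by linarith+
  next
    fix i assume "i \<in> {1..n}"
    then have "0 < i" "i \<le> n" by simp_all
    then show "c i \<le> X i" "X i \<le> d i" using T unfolding latest_def by blast+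
  qed
qed

section \<open>The point itself, from the right\<close>

definition backward :: com where
  "backward = IS ''v'' (IV ''n'') ;; RSet ''S'' (IV ''n'') (RV ''B'') ;;
     While (ILt (IConst 0) (IV ''v''))
      (RS ''h'' (RSub (RGet ''S'' (IV ''v'')) (RGet ''d'' (IV ''v''))) ;;
       IS ''v'' (ISub (IV ''v'') (IConst 1)) ;;
       Cond (RLt (RV ''h'') (RGet ''Y'' (IV ''v''))) (RS ''h'' (RGet ''Y'' (IV ''v''))) Skip ;;
       RSet ''x'' (IAdd (IV ''v'') (IConst 1)) (RSub (RGet ''S'' (IAdd (IV ''v'') (IConst 1))) (RV ''h'')) ;;
       RSet ''S'' (IV ''v'') (RV ''h''))"

lemma mods_backward [simp]: "imods backward = {''v''}" "rmods backward = {''S'', ''h'', ''x''}"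
  by (auto simp: backward_def)

lemma backward:
  assumes s: "iv s ''n'' = n" "rmem s ''d'' = d" "rmem s ''Y'' = L" "rv s ''B'' = B"
    and bm: "block_map n m sg" and E: "earliest m sg a c x n (m + 1) L" and x: "feas n m sg a b c d x" and B: "a m = B" "b m = B"
  shows "wp f backward s (\<lambda>t s'. t \<le> 70 * n + 30 \<and> feas n m sg a b c d (rmem s' ''x''))"
  unfolding backward_def wp_Seq wp_ISet wp_RSet
proof (rule wp_while[where V = "\<lambda>s'. 70 * iv s' ''v''" and
      I = "\<lambda>s'. iv s' ''v'' \<le> n \<and> latest n B c d x L (iv s' ''v'') (rmem s' ''S'') (rmem s' ''x'')"], goal_cases)
  case 1
  have "1 \<le> m" "sg m = n" using bm unfolding block_map_def by blast+
  then have "a m \<le> L n" "L n \<le> pre x n" "pre x n \<le> b m" using E x unfolding earliest_def feas_def by auto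
  then have "latest n B c d x L n ((rmem s ''S'')(n := B)) (rmem s ''x'')" unfolding latest_def using B by (auto dest: le_antisym)
  then show ?case by (simp add: s)
next
  case (2 s1)
  define v S X where v: "v = iv s1 ''v'' - 1" "S = rmem s1 ''S''" "X = rmem s1 ''x''"
  have e: "rmem s1 ''d'' = d" "rmem s1 ''Y'' = L" using frameI[OF 2(3)] frameR[OF 2(3)] s by simp_all
  have v1: "iv s1 ''v'' = v + 1" using 2(2) v(1) by simp
  have lt: "v + 1 \<le> n" and T: "latest n B c d x L (v + 1) S X" using 2(1) unfolding v1 v(2,3)[symmetric] by blast+
  note st = latest_step[OF E x T lt]
  show ?case
  proof (cases "S (v + 1) - d (v + 1) < L v")
    case True
    then show ?thesis using st[of "L v"] lt by (simp add: e v1 v(2,3)[symmetric])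
  next
    case False
    then show ?thesis using st[of "S (v + 1) - d (v + 1)"] lt by (simp add: e v1 v(2,3)[symmetric])
  qed
next
  case (3 t s1)
  have v: "iv s1 ''v'' = 0" using 3(2) by simp
  then have "latest n B c d x L 0 (rmem s1 ''S'') (rmem s1 ''x'')" using 3(1) by simp
  from latest_feas[OF bm E x this] show ?case using 3(4) v s(1) by simp
qed

definition pick :: com where
  "pick = forward ;; backward"

lemma mods_pick [simp]: "imods pick = {''v'', ''j''}" "rmods pick = {''Y'', ''h'', ''S'', ''x''}"
  by (auto simp: pick_def)

lemma pick:
  assumes s: "iv s ''n'' = n" "imem s ''sigma'' = sg" "rmem s ''a'' = a" "rmem s ''c'' = c" "rmem s ''d'' = d" "rv s ''B'' = B"
    and bm: "block_map n m sg" and x: "feas n m sg a b c d x" and B: "a m = B" "b m = B"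
  shows "wp f pick s (\<lambda>t s'. t \<le> 140 * n + 60 \<and> feas n m sg a b c d (rmem s' ''x''))"
  unfolding pick_def wp_Seq
proof (rule wp_use[OF forward[OF s(1-4) bm x]], elim conjE)
  fix t1 s1 assume t1: "t1 \<le> 70 * n + 30" and E: "earliest m sg a c x n (m + 1) (rmem s1 ''Y'')" and fr: "frame forward s s1"
  have e: "iv s1 ''n'' = n" "rmem s1 ''d'' = d" "rv s1 ''B'' = B" by (simp_all add: frameI[OF fr] frameR[OF fr] s)
  show "wp f backward s1 (\<lambda>t' s'. t1 + t' \<le> 140 * n + 60 \<and> feas n m sg a b c d (rmem s' ''x''))"
  proof (rule wp_use[OF backward[OF e(1,2) refl e(3) bm E x B]], elim conjE)
    fix t2 s2 assume "t2 \<le> 70 * n + 30" "feas n m sg a b c d (rmem s2 ''x'')"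
    then show "t1 + t2 \<le> 140 * n + 60 \<and> feas n m sg a b c d (rmem s2 ''x'')" using t1 by simp
  qed
qed

section \<open>The main loop\<close>

text \<open>Storing \<open>B\<close> in both bounds of index \<open>m\<close> makes the resource
  equation a nested constraint. The initial \<open>u\<close> is \<open>B\<close> minus all lower
  bounds, the largest amount by which a single variable can exceed its lower bound.\<close>

definition setup_loop :: com where
  "setup_loop = RSet ''a'' (IV ''m'') (RV ''B'') ;; RSet ''b'' (IV ''m'') (RV ''B'') ;; RS ''g'' (RConst 1) ;; RS ''u'' (RV ''B'') ;;
     IS ''v'' (IConst 0) ;;
     While (ILt (IV ''v'') (IV ''n'')) (inc ''v'' ;; RS ''u'' (RSub (RV ''u'') (RGet ''c'' (IV ''v''))))"

text \<open>Clipping removes no feasible point, but it makes the initial width at most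
  \<open>n u\<close>, however large the given upper bounds are; so they do not enter the running
  time.\<close>

definition clip_loop :: com where
  "clip_loop = IS ''v'' (IConst 0) ;;
     While (ILt (IV ''v'') (IV ''n''))
      (inc ''v'' ;;
       RS ''h'' (RAdd (RGet ''c'' (IV ''v'')) (RV ''u'')) ;;
       Cond (RLt (RV ''h'') (RGet ''d'' (IV ''v''))) (RSet ''d'' (IV ''v'') (RV ''h'')) Skip)"

lemma mods_setup_loop [simp]: "imods setup_loop = {''v''}" "rmods setup_loop = {''a'', ''b'', ''g'', ''u''}"
  by (auto simp: setup_loop_def)

lemma mods_clip_loop [simp]: "imods clip_loop = {''v''}" "rmods clip_loop = {''h'', ''d''}"
  by (auto simp: clip_loop_def)

lemma setup_loop:
  assumes s: "iv s ''n'' = n" "iv s ''m'' = m" "rmem s ''a'' = a" "rmem s ''b'' = b" "rmem s ''c'' = c" "rv s ''B'' = B"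
  shows "wp f setup_loop s (\<lambda>t s'. t \<le> 30 * n + 50 \<and> rmem s' ''a'' = a(m := B) \<and> rmem s' ''b'' = b(m := B) \<and> rv s' ''g'' = 1 \<and>
     rv s' ''u'' = B - pre c n)"
  unfolding setup_loop_def wp_Seq wp_ISet wp_RSet
proof (rule wp_while[where V = "\<lambda>s'. 30 * (n - iv s' ''v'')" and
      I = "\<lambda>s'. iv s' ''v'' \<le> n \<and> rmem s' ''a'' = a(m := B) \<and> rmem s' ''b'' = b(m := B) \<and> rv s' ''g'' = 1 \<and>
        rv s' ''u'' = B - pre c (iv s' ''v'')"], goal_cases)
  case 1
  show ?case by (simp add: s)
next
  case (2 s1)
  define v where v: "v = iv s1 ''v''"
  have e: "iv s1 ''n'' = n" "rmem s1 ''c'' = c" using frameI[OF 2(3)] frameR[OF 2(3)] s by simp_all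
  have lt: "v < n" using 2(2) e by (simp add: v)
  have I: "rmem s1 ''a'' = a(m := B)" "rmem s1 ''b'' = b(m := B)" "rv s1 ''g'' = 1" "rv s1 ''u'' = B - pre c v" using 2(1) by (simp_all add: v)
  have pt: "30 + 30 * (n - (v + 1)) \<le> 30 * (n - v)" using lt by simp
  have p: "pre c (v + 1) = pre c v + c (v + 1)" using pre_Suc[of c v] unfolding Suc_eq_plus1 .
  show ?case using lt pt p by (simp add: e v[symmetric] I)
next
  case (3 t s1)
  have e: "iv s1 ''n'' = n" using frameI[OF 3(3)] s by simp
  have v: "iv s1 ''v'' = n" using 3(1,2) e by simp
  show ?case using 3(1,4) by (simp add: v)
qed

lemma clip_loop:
  assumes s: "iv s ''n'' = n" "rmem s ''c'' = c" "rmem s ''d'' = d" "rv s ''u'' = u"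
  shows "wp f clip_loop s (\<lambda>t s'. t \<le> 40 * n + 20 \<and> (\<forall>i. 1 \<le> i \<and> i \<le> n \<longrightarrow> rmem s' ''d'' i = min (d i) (c i + u)))"
  unfolding clip_loop_def wp_Seq wp_ISet wp_RSet
proof (rule wp_while[where V = "\<lambda>s'. 40 * (n - iv s' ''v'')" and
      I = "\<lambda>s'. iv s' ''v'' \<le> n \<and> rmem s' ''d'' = (\<lambda>i. if 1 \<le> i \<and> i \<le> iv s' ''v'' then min (d i) (c i + u) else d i)"], goal_cases)
  case 1
  show ?case by (auto simp: s fun_eq_iff)
next
  case (2 s1)
  define v where v: "v = iv s1 ''v''"
  have e: "iv s1 ''n'' = n" "rmem s1 ''c'' = c" "rv s1 ''u'' = u" using frameI[OF 2(3)] frameR[OF 2(3)] s by simp_all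
  have lt: "v < n" using 2(2) e by (simp add: v)
  define D where "D = (\<lambda>k i. if 1 \<le> i \<and> i \<le> k then min (d i) (c i + u) else d i)"
  have I: "rmem s1 ''d'' = D v" using 2(1) by (simp add: v D_def)
  have pt: "40 + 40 * (n - (v + 1)) \<le> 40 * (n - v)" using lt by simp
  have D: "D v (v + 1) = d (v + 1)" by (simp add: D_def)
  have D1: "(D v)(v + 1 := min (d (v + 1)) (c (v + 1) + u)) = D (v + 1)" unfolding D_def by (rule ext) auto
  have D2: "(D v)(v + 1 := c (v + 1) + u) = D (v + 1)" if "c (v + 1) + u < d (v + 1)" using D1 that by simp
  have D3: "D (v + 1) = D v" if "\<not> c (v + 1) + u < d (v + 1)"
    using D1 that D fun_upd_triv[of "D v" "v + 1"] by simp
  have D4: "(\<lambda>i. if 1 \<le> i \<and> i \<le> v + 1 then min (d i) (c i + u) else d i) = D (v + 1)" by (simp add: D_def)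
  show ?case
  proof (cases "c (v + 1) + u < d (v + 1)")
    case True
    then show ?thesis using lt pt by (simp add: e v[symmetric] I D D4 D2)
  next
    case False
    then show ?thesis using lt pt by (simp add: e v[symmetric] I D D4 D3)
  qed
next
  case (3 t s1)
  have e: "iv s1 ''n'' = n" using frameI[OF 3(3)] s by simp
  have v: "iv s1 ''v'' = n" using 3(1,2) e by simp
  show ?case using 3(1,4) by (simp add: v)
qed

definition main_loop :: com where
  "main_loop = While (RLt (RV ''eps'') (RMul (RMul (RConst 16) (ROfIndex (IV ''n''))) (RV ''u'')))
     (RS ''u'' (RDiv (RV ''u'') (RConst 2)) ;; round)"

lemma mods_main_loop [simp]: "imods main_loop = imods round" "rmods main_loop = insert ''u'' (rmods round)"
  by (auto simp: main_loop_def)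

text \<open>Some minimizer over the original box \<open>c0\<close>, \<open>d0\<close> lies in the
  current box. It may be a different one after every round, since a cut preserves the optimal value
  and not a particular solution.\<close>

definition good_box :: "nat \<Rightarrow> nat \<Rightarrow> (nat \<Rightarrow> nat) \<Rightarrow> (nat \<Rightarrow> real) \<Rightarrow> (nat \<Rightarrow> real) \<Rightarrow> (nat \<Rightarrow> real) \<Rightarrow> (nat \<Rightarrow> real) \<Rightarrow> (nat \<Rightarrow> real \<Rightarrow> real) \<Rightarrow>
    (nat \<Rightarrow> real) \<Rightarrow> (nat \<Rightarrow> real) \<Rightarrow> real \<Rightarrow> bool" where
  "good_box n m sg a b c0 d0 f c d u \<longleftrightarrow> 0 \<le> u \<and> (\<forall>i. 1 \<le> i \<and> i \<le> n \<longrightarrow> c0 i \<le> c i \<and> d i \<le> d0 i) \<and>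
     (\<exists>x. feas n m sg a b c d x \<and> (\<forall>z. feas n m sg a b c0 d0 z \<longrightarrow> obj n f x \<le> obj n f z)) \<and>
     (\<Sum>i=1..n. d i - c i) \<le> 16 * real n * u"

text \<open>For \<open>1 < y\<close> the logarithm is positive, so its ceiling is at least 1 and
  \<open>nat\<close> truncates nothing when it drops by one. The loop test provides exactly this
  inequality.\<close>

lemma halving_count:
  fixes y :: real
  assumes "1 < y"
  shows "nat \<lceil>log 2 (y / 2)\<rceil> + 1 = nat \<lceil>log 2 y\<rceil>"
proof -
  have "log 2 (y / 2) = log 2 y - 1" using assms by (simp add: log_divide)
  moreover have "0 < log 2 y" using assms by simp
  moreover have "\<lceil>log 2 y - 1\<rceil> = \<lceil>log 2 y\<rceil> - 1" using ceiling_diff_of_int[of "log 2 y" 1] by simp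
  moreover have "nat (k - 1) + 1 = nat k" if "0 < k" for k :: int using that by arith
  ultimately show ?thesis by simp
qed

lemma main_loop:
  fixes f :: "nat \<Rightarrow> real \<Rightarrow> real" and sg :: "nat \<Rightarrow> nat" and a b c d :: "nat \<Rightarrow> real" and u e :: real
  assumes e: "0 < e" and s: "iv s ''n'' = n" "iv s ''m'' = m" "imem s ''sigma'' = sg" "rmem s ''a'' = a" "rmem s ''b'' = b"
      "rmem s ''c'' = c" "rmem s ''d'' = d" "rv s ''u'' = u" "rv s ''g'' = 1" "rv s ''eps'' = e"
    and bm: "block_map n m sg" and abm: "a m = b m"
    and F: "\<And>i. 1 \<le> i \<Longrightarrow> i \<le> n \<Longrightarrow> convex_on {c i..d i} (f i)"
      "\<And>i. 1 \<le> i \<Longrightarrow> i \<le> n \<Longrightarrow> continuous_on {c i..d i} (f i)"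
    and G: "good_box n m sg a b c d f c d u"
  shows "wp f main_loop s (\<lambda>t s'. t \<le> 4000000 * (depth (2 * (m + 1)) * n) * nat \<lceil>log 2 (16 * real n * u / e)\<rceil> + 20 \<and>
    rmem s' ''a'' = a \<and> rmem s' ''b'' = b \<and> good_box n m sg a b c d f (rmem s' ''c'') (rmem s' ''d'') (rv s' ''u'') \<and>
    16 * real n * rv s' ''u'' \<le> e)"
proof -
  define Dm where "Dm = depth (2 * (m + 1))"
  define T where "T = 4000000 * (Dm * n)"
  have m: "1 \<le> m" "m \<le> n" using block_map_le[OF bm order_refl] bm unfolding block_map_def by simp_all
  have Dm1: "1 \<le> Dm" unfolding Dm_def by (subst depth.simps) simp
  have T1: "100000 * Dm * (32 * n + n) + 80 * n + 80 * m + 130 \<le> T"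
  proof -
    have "n \<le> Dm * n" using Dm1 by simp
    moreover have "100000 * Dm * (32 * n + n) = 3300000 * (Dm * n)" by simp
    ultimately show ?thesis using m unfolding T_def by linarith
  qed
  have "wp f main_loop s (\<lambda>t s'. t \<le> T * nat \<lceil>log 2 (16 * real n * u / e)\<rceil> + 20 \<and>
    rmem s' ''a'' = a \<and> rmem s' ''b'' = b \<and> good_box n m sg a b c d f (rmem s' ''c'') (rmem s' ''d'') (rv s' ''u'') \<and>
    16 * real n * rv s' ''u'' \<le> e)"
    unfolding main_loop_def
  proof (rule wp_while[where V = "\<lambda>s'. T * nat \<lceil>log 2 (16 * real n * rv s' ''u'' / e)\<rceil>" and
        I = "\<lambda>s'. rmem s' ''a'' = a \<and> rmem s' ''b'' = b \<and> rv s' ''g'' = 1 \<and>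
          good_box n m sg a b c d f (rmem s' ''c'') (rmem s' ''d'') (rv s' ''u'')"], goal_cases)
    case 1
    show ?case using G by (simp add: s)
  next
    case (2 s1)
    define c1 d1 u1 where "c1 = rmem s1 ''c''" "d1 = rmem s1 ''d''" "u1 = rv s1 ''u''"
    note cd1 = this
    have e1: "iv s1 ''n'' = n" "iv s1 ''m'' = m" "imem s1 ''sigma'' = sg" "rv s1 ''eps'' = e"
      using frameI[OF 2(3)] frameR[OF 2(3)] s by simp_all
    have I: "rmem s1 ''a'' = a" "rmem s1 ''b'' = b" "rv s1 ''g'' = 1" using 2(1) by blast+
    have gb: "good_box n m sg a b c d f c1 d1 u1" using 2(1) unfolding cd1 by blast
    have lt: "e < 16 * real n * u1" using 2(2) by (simp add: e1 cd1)
    have u1: "0 < u1 / 2"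
    proof (rule ccontr)
      assume "\<not> 0 < u1 / 2"
      then have "16 * real n * u1 \<le> 0" by (simp add: mult_nonneg_nonpos)
      then show False using lt e by linarith
    qed
    obtain x where box: "\<And>i. 1 \<le> i \<Longrightarrow> i \<le> n \<Longrightarrow> c i \<le> c1 i \<and> d1 i \<le> d i" and x: "feas n m sg a b c1 d1 x"
      and xo: "\<And>z. feas n m sg a b c d z \<Longrightarrow> obj n f x \<le> obj n f z" and W: "(\<Sum>i=1..n. d1 i - c1 i) \<le> 16 * real n * u1"
      using gb unfolding good_box_def by blast
    have sub: "{c1 i..d1 i} \<subseteq> {c i..d i}" if "1 \<le> i" "i \<le> n" for i using box[OF that] by simp
    have F1: "convex_on {c1 i..d1 i} (f i)" "continuous_on {c1 i..d1 i} (f i)" if i: "1 \<le> i" "i \<le> n" for i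
      using convex_on_subset[OF F(1)[OF i] sub[OF i]] continuous_on_subset[OF F(2)[OF i] sub[OF i]] by simp_all
    \<comment> \<open>Halving \<open>u\<close> doubles the width measured in units of
      \<open>u\<close>, from \<open>16 * n\<close> to \<open>32 * n\<close>; this is the
      \<open>N\<close> of the round.\<close>
    have W': "(\<Sum>i=1..n. d1 i - c1 i) \<le> real (32 * n) * (u1 / 2)" using W by (simp add: mult_ac)
    define s2 where "s2 = rset ''u'' 0 (u1 / 2) s1"
    have e2: "iv s2 ''n'' = n" "iv s2 ''m'' = m" "imem s2 ''sigma'' = sg" "rmem s2 ''a'' = a" "rmem s2 ''b'' = b" "rmem s2 ''c'' = c1"
       "rmem s2 ''d'' = d1" "rv s2 ''u'' = u1 / 2" "rv s2 ''g'' = 1"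
      unfolding s2_def by (simp_all add: e1 I cd1)
    have V: "T * nat \<lceil>log 2 (16 * real n * (u1 / 2) / e)\<rceil> + T = T * nat \<lceil>log 2 (16 * real n * u1 / e)\<rceil>"
    proof -
      have "1 < 16 * real n * u1 / e" using lt e by simp
      from halving_count[OF this] have h: "nat \<lceil>log 2 (16 * real n * (u1 / 2) / e)\<rceil> + 1 = nat \<lceil>log 2 (16 * real n * u1 / e)\<rceil>" by simp
      show ?thesis unfolding h[symmetric] by (simp only: distrib_left mult_1_right)
    qed
    have main: "wp f round s2 (\<lambda>t s'. (rmem s' ''a'' = a \<and> rmem s' ''b'' = b \<and> rv s' ''g'' = 1 \<and>
          good_box n m sg a b c d f (rmem s' ''c'') (rmem s' ''d'') (rv s' ''u'')) \<and>
          30 + t + T * nat \<lceil>log 2 (16 * real n * rv s' ''u'' / e)\<rceil> \<le> T * nat \<lceil>log 2 (16 * real n * u1 / e)\<rceil>)"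
    proof (rule wp_use[OF round[where f=f, OF u1 e2 bm abm F1 x W', folded Dm_def]], assumption, assumption, assumption, assumption, elim conjE exE)
      fix t s3 x3
      assume t: "t \<le> 100000 * Dm * (32 * n + n) + 80 * n + 80 * m + 100"
        and ab: "rmem s3 ''a'' = a" "rmem s3 ''b'' = b" "rv s3 ''g'' = 1"
        and box3: "\<forall>i. 1 \<le> i \<and> i \<le> n \<longrightarrow> c1 i \<le> rmem s3 ''c'' i \<and> rmem s3 ''d'' i \<le> d1 i"
        and x3: "feas n m sg a b (rmem s3 ''c'') (rmem s3 ''d'') x3" "\<forall>z. feas n m sg a b c1 d1 z \<longrightarrow> obj n f x3 \<le> obj n f z"
        and W3: "(\<Sum>i=1..n. rmem s3 ''d'' i - rmem s3 ''c'' i) \<le> (\<Sum>i=1..n. d1 i - c1 i) / 16 + 8 * real n * (u1 / 2)"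
        and fr: "frame round s2 s3"
      define c3 d3 where "c3 = rmem s3 ''c''" "d3 = rmem s3 ''d''"
      note box3 = box3[folded c3_d3_def] and x3 = x3[folded c3_d3_def] and W3 = W3[folded c3_d3_def]
      have u3: "rv s3 ''u'' = u1 / 2" by (simp add: frameR[OF fr] e2)
      have b3: "c i \<le> c3 i \<and> d3 i \<le> d i" if i: "1 \<le> i" "i \<le> n" for i
      proof -
        have "c1 i \<le> c3 i" "d3 i \<le> d1 i" using box3 i by blast+
        then show ?thesis using box[OF i] by simp
      qed
      have o3: "obj n f x3 \<le> obj n f z" if "feas n m sg a b c d z" for z
        using x3(2) x xo[OF that] order_trans by blast
      \<comment> \<open>In terms of the new \<open>u\<close>, the round leaves at most
        \<open>2 n u + 8 n u\<close>, which is below the required \<open>16 n u\<close>.\<close>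
      have w3: "(\<Sum>i=1..n. d3 i - c3 i) \<le> 16 * real n * (u1 / 2)"
      proof -
        have "0 \<le> real n * u1" using u1 by simp
        moreover have "8 * real n * (u1 / 2) = 4 * (real n * u1)" "16 * real n * u1 = 16 * (real n * u1)" "16 * real n * (u1 / 2) = 8 * (real n * u1)"
          by (simp_all add: mult_ac)
        ultimately show ?thesis using W3 W by linarith
      qed
      have "good_box n m sg a b c d f c3 d3 (u1 / 2)"
        unfolding good_box_def using b3 x3(1) o3 w3 u1 less_imp_le by blast
      moreover have "30 + t + T * nat \<lceil>log 2 (16 * real n * (u1 / 2) / e)\<rceil> \<le> T * nat \<lceil>log 2 (16 * real n * u1 / e)\<rceil>"
        unfolding V[symmetric] using t T1 by linarith
      ultimately show "(rmem s3 ''a'' = a \<and> rmem s3 ''b'' = b \<and> rv s3 ''g'' = 1 \<and>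
          good_box n m sg a b c d f (rmem s3 ''c'') (rmem s3 ''d'') (rv s3 ''u'')) \<and>
          30 + t + T * nat \<lceil>log 2 (16 * real n * rv s3 ''u'' / e)\<rceil> \<le> T * nat \<lceil>log 2 (16 * real n * u1 / e)\<rceil>"
        using ab unfolding u3 c3_d3_def by blast
    qed
    have st: "rset ''u'' (ival s1 (IConst 0)) (rval f s1 (RDiv (RV ''u'') (RConst 2))) s1 = s2" by (simp add: s2_def cd1)
    show ?case
      unfolding wp_Seq wp_RSet st cd1(3)[symmetric]
      by (rule wp_use[OF main], elim conjE, intro conjI) (assumption | simp)+
  next
    case (3 t s1)
    have e1: "iv s1 ''n'' = n" "rv s1 ''eps'' = e"
      using frameI[OF 3(3)] frameR[OF 3(3)] s by simp_all
    have "16 * real n * rv s1 ''u'' \<le> e" using 3(2) by (simp add: e1)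
    moreover have "t \<le> T * nat \<lceil>log 2 (16 * real n * u / e)\<rceil> + 20" using 3(4) by (simp add: s)
    ultimately show ?case using 3(1) by blast
  qed
  then show ?thesis unfolding T_def Dm_def .
qed

definition solve :: com where
  "solve = setup_loop ;; clip_loop ;; main_loop ;; pick"

lemma solve:
  fixes f :: "nat \<Rightarrow> real \<Rightarrow> real" and sg :: "nat \<Rightarrow> nat" and a b c d :: "nat \<Rightarrow> real" and B e :: real and n m :: nat
  defines "A \<equiv> a(m := B)" and "A' \<equiv> b(m := B)"
  assumes e: "0 < e" and s: "iv s ''n'' = n" "iv s ''m'' = m" "imem s ''sigma'' = sg" "rmem s ''a'' = a" "rmem s ''b'' = b"
      "rmem s ''c'' = c" "rmem s ''d'' = d" "rv s ''B'' = B" "rv s ''eps'' = e"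
    and bm: "block_map n m sg"
    and F: "\<And>i. 1 \<le> i \<Longrightarrow> i \<le> n \<Longrightarrow> convex_on {c i..d i} (f i)"
      "\<And>i. 1 \<le> i \<Longrightarrow> i \<le> n \<Longrightarrow> continuous_on {c i..d i} (f i)"
    and x0: "feas n m sg A A' c d x0"
  shows "wp f solve s (\<lambda>t s'. t \<le> 4000000 * (depth (2 * (m + 1)) * n) * (nat \<lceil>log 2 (16 * real n * (B - pre c n) / e)\<rceil> + 1) \<and>
    feas n m sg A A' c d (rmem s' ''x'') \<and>
    (\<exists>y. feas n m sg A A' c d y \<and> (\<forall>z. feas n m sg A A' c d z \<longrightarrow> obj n f y \<le> obj n f z) \<and>
       (\<forall>i. 1 \<le> i \<and> i \<le> n \<longrightarrow> \<bar>rmem s' ''x'' i - y i\<bar> \<le> e)))"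
proof -
  define R where "R = B - pre c n"
  define Dm where "Dm = depth (2 * (m + 1))"
  define K where "K = nat \<lceil>log 2 (16 * real n * R / e)\<rceil>"
  define Q where "Q = (\<lambda>t (s'::state). t \<le> 4000000 * (Dm * n) * (K + 1) \<and>
    feas n m sg A A' c d (rmem s' ''x'') \<and>
    (\<exists>y. feas n m sg A A' c d y \<and> (\<forall>z. feas n m sg A A' c d z \<longrightarrow> obj n f y \<le> obj n f z) \<and>
       (\<forall>i. 1 \<le> i \<and> i \<le> n \<longrightarrow> \<bar>rmem s' ''x'' i - y i\<bar> \<le> e)))"
  have m: "1 \<le> m" "sg m = n" "m \<le> n" using block_map_le[OF bm order_refl] bm unfolding block_map_def by simp_all
  have Dm1: "1 \<le> Dm" unfolding Dm_def by (subst depth.simps) simp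
  have AA: "A m = B" "A' m = B" by (simp_all add: A_def A'_def)
  \<comment> \<open>The amounts above the lower bounds are nonnegative and add up to
    \<open>R\<close>, so each of them is at most \<open>R\<close>.\<close>
  have cR: "x i - c i \<le> R" if x: "feas n m sg A A' c d x" and i: "1 \<le> i" "i \<le> n" for x i
  proof -
    have "m \<in> {1..m}" using m by simp
    then have "A m \<le> pre x (sg m)" "pre x (sg m) \<le> A' m" using x unfolding feas_def by blast+
    then have "pre x n = B" using m AA by simp
    then have "R = (\<Sum>i=1..n. x i - c i)" by (simp add: R_def pre_def sum_subtractf)
    moreover have "x i - c i \<le> (\<Sum>i=1..n. x i - c i)"
      by (rule member_le_sum[where f = "\<lambda>i. x i - c i"]) (use x i in \<open>auto simp: feas_def\<close>)
    ultimately show ?thesis by simp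
  qed
  have "wp f solve s Q"
    unfolding solve_def wp_Seq
  proof (rule wp_use[OF setup_loop[OF s(1,2,4,5,6,8), folded A_def A'_def R_def]], elim conjE)
    fix t1 s1 assume q1: "t1 \<le> 30 * n + 50" "rmem s1 ''a'' = A" "rmem s1 ''b'' = A'" "rv s1 ''g'' = 1" "rv s1 ''u'' = R"
      and fr1: "frame setup_loop s s1"
    have e1: "iv s1 ''n'' = n" "rmem s1 ''c'' = c" "rmem s1 ''d'' = d" "iv s1 ''m'' = m" "imem s1 ''sigma'' = sg" "rv s1 ''B'' = B" "rv s1 ''eps'' = e"
      by (simp_all add: frameI[OF fr1] frameR[OF fr1] s)
    show "wp f clip_loop s1 (\<lambda>t s'. wp f main_loop s' (\<lambda>t' s''. wp f pick s'' (\<lambda>t'a. Q (t1 + (t + (t' + t'a))))))"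
    proof (rule wp_use[OF clip_loop[OF e1(1-3) q1(5)]], elim conjE)
      fix t2 s2 assume q2: "t2 \<le> 40 * n + 20" and d2: "\<forall>i. 1 \<le> i \<and> i \<le> n \<longrightarrow> rmem s2 ''d'' i = min (d i) (c i + R)"
        and fr2: "frame clip_loop s1 s2"
      define d' where "d' = rmem s2 ''d''"
      have d': "d' i = min (d i) (c i + R)" if "1 \<le> i" "i \<le> n" for i using d2 that by (simp add: d'_def)
      have e2: "iv s2 ''n'' = n" "iv s2 ''m'' = m" "imem s2 ''sigma'' = sg" "rmem s2 ''a'' = A" "rmem s2 ''b'' = A'"
        "rmem s2 ''c'' = c" "rmem s2 ''d'' = d'" "rv s2 ''u'' = R" "rv s2 ''g'' = 1" "rv s2 ''eps'' = e" "rv s2 ''B'' = B"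
        by (simp_all add: frameI[OF fr2] frameR[OF fr2] e1 q1 d'_def)
      have feq: "feas n m sg A A' c d' x \<longleftrightarrow> feas n m sg A A' c d x" for x
      proof
        assume "feas n m sg A A' c d' x"
        then show "feas n m sg A A' c d x" by (rule feas_box_mono) (simp add: d')
      next
        assume x: "feas n m sg A A' c d x"
        have "c i \<le> x i \<and> x i \<le> d' i" if i: "i \<in> {1..n}" for i
        proof -
          have "x i - c i \<le> R" "c i \<le> x i" "x i \<le> d i" using cR[OF x] x i unfolding feas_def by auto
          then show ?thesis using i by (simp add: d')
        qed
        then show "feas n m sg A A' c d' x" using x unfolding feas_def by blast
      qed
      have sub: "{c i..d' i} \<subseteq> {c i..d i}" if "1 \<le> i" "i \<le> n" for i using d'[OF that] by simp
      have F': "convex_on {c i..d' i} (f i)" "continuous_on {c i..d' i} (f i)" if i: "1 \<le> i" "i \<le> n" for i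
        using convex_on_subset[OF F(1)[OF i] sub[OF i]] continuous_on_subset[OF F(2)[OF i] sub[OF i]] by simp_all
      have sgn: "\<forall>j\<in>{1..m}. sg j \<le> n" using block_map_bound[OF bm] by simp
      have F'': "\<forall>i\<in>{1..n}. continuous_on {c i..d' i} (f i)" using F'(2) by simp
      have "feas n m sg A A' c d' x0" using x0 feq by blast
      from minimizer_least_excess[OF sgn F'' this, of "\<lambda>_. 0"]
      obtain xo where xo: "feas n m sg A A' c d' xo" "\<forall>z. feas n m sg A A' c d' z \<longrightarrow> obj n f xo \<le> obj n f z" by blast
      have R0: "0 \<le> R"
      proof -
        have "x0 1 - c 1 \<le> R" "c 1 \<le> x0 1" using cR[OF x0, of 1] x0 m unfolding feas_def by auto
        then show ?thesis by simp
      qed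
      have gb: "good_box n m sg A A' c d' f c d' R"
      proof -
        have "(\<Sum>i=1..n. d' i - c i) \<le> (\<Sum>i=1..n. R)" by (rule sum_mono) (simp add: d')
        also have "\<dots> \<le> 16 * real n * R" using R0 by (simp add: mult_right_mono)
        finally show ?thesis unfolding good_box_def using xo R0 by blast
      qed
      have AA': "A m = A' m" using AA by simp
      show "wp f main_loop s2 (\<lambda>t' s''. wp f pick s'' (\<lambda>t'a. Q (t1 + (t2 + (t' + t'a)))))"
      proof (rule wp_use[OF main_loop[where f=f, OF e e2(1-10) bm AA' F' gb, folded Dm_def K_def]], assumption, assumption, assumption, assumption, elim conjE)
        fix t3 s3
        assume q3: "t3 \<le> 4000000 * (Dm * n) * K + 20" "rmem s3 ''a'' = A" "rmem s3 ''b'' = A'"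
          and g3: "good_box n m sg A A' c d' f (rmem s3 ''c'') (rmem s3 ''d'') (rv s3 ''u'')" and u3: "16 * real n * rv s3 ''u'' \<le> e"
          and fr3: "frame main_loop s2 s3"
        define c3 d3 where "c3 = rmem s3 ''c''" "d3 = rmem s3 ''d''"
        note g3 = g3[folded c3_d3_def]
        have e3: "iv s3 ''n'' = n" "imem s3 ''sigma'' = sg" "rmem s3 ''a'' = A" "rmem s3 ''c'' = c3" "rmem s3 ''d'' = d3" "rv s3 ''B'' = B"
          using q3 by (simp_all add: frameI[OF fr3] frameR[OF fr3] e2 c3_d3_def)
        obtain y where box: "\<And>i. 1 \<le> i \<Longrightarrow> i \<le> n \<Longrightarrow> c i \<le> c3 i \<and> d3 i \<le> d' i" and y: "feas n m sg A A' c3 d3 y"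
          and yo: "\<And>z. feas n m sg A A' c d' z \<Longrightarrow> obj n f y \<le> obj n f z" and W: "(\<Sum>i=1..n. d3 i - c3 i) \<le> 16 * real n * rv s3 ''u''"
          using g3 unfolding good_box_def by blast
        have up: "feas n m sg A A' c d x" if "feas n m sg A A' c3 d3 x" for x
          using feas_box_mono[OF that box] feq by blast
        show "wp f pick s3 (\<lambda>t'a. Q (t1 + (t2 + (t3 + t'a))))"
        proof (rule wp_use[OF pick[OF e3 bm y AA]], elim conjE)
          fix t4 and s4 :: state assume t4: "t4 \<le> 140 * n + 60" and X: "feas n m sg A A' c3 d3 (rmem s4 ''x'')"
          define X where "X = rmem s4 ''x''"
          have X: "feas n m sg A A' c3 d3 X" using X unfolding X_def .
          \<comment> \<open>Both points lie in the last box. Each of its sides is at most the total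
            width, and the exit condition bounds \<open>16 n u\<close>, hence that width, by
            \<open>e\<close>.\<close>
          have near: "\<bar>X i - y i\<bar> \<le> e" if i: "1 \<le> i \<and> i \<le> n" for i
          proof -
            have ii: "i \<in> {1..n}" using i by simp
            have "d3 i - c3 i \<le> (\<Sum>i=1..n. d3 i - c3 i)"
              by (rule member_le_sum[where f = "\<lambda>i. d3 i - c3 i"]) (use ii y in \<open>auto simp: feas_def intro: order_trans\<close>)
            moreover have "c3 i \<le> X i" "X i \<le> d3 i" "c3 i \<le> y i" "y i \<le> d3 i" using X y ii unfolding feas_def by blast+
            ultimately show ?thesis using W u3 by linarith
          qed
          have t: "t1 + (t2 + (t3 + t4)) \<le> 4000000 * (Dm * n) * (K + 1)"
          proof -
            have "n \<le> Dm * n" using Dm1 by simp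
            moreover have "4000000 * (Dm * n) * (K + 1) = 4000000 * (Dm * n) * K + 4000000 * (Dm * n)"
              by (simp only: distrib_left mult_1_right)
            ultimately show ?thesis using q1(1) q2 q3(1) t4 m by linarith
          qed
          have yo': "obj n f y \<le> obj n f z" if "feas n m sg A A' c d z" for z using yo feq that by blast
          show "Q (t1 + (t2 + (t3 + t4))) s4"
            unfolding Q_def X_def[symmetric] using t up[OF X] up[OF y] yo' near by blast
        qed
      qed
    qed
  qed
  then show ?thesis unfolding Q_def K_def Dm_def R_def .
qed

text \<open>From \<open>2 * (m + 1) \<le> 4 * m\<close> the depth is at most
  \<open>3 + log 2 m\<close>, hence at most \<open>4 * lg m\<close>. The number of rounds plus one
  is at most the logarithm plus 6: the factor 16 contributes 4, the ceiling and the final summand 1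
  each. So \<open>7 * lg\<close> suffices, and 112 is 4 times 4 times 7.\<close>

lemma time_bound:
  fixes R R' e :: real and n m :: nat
  assumes "1 \<le> m" "1 \<le> n" "0 < e" "0 \<le> R" "R \<le> R'"
  shows "real (4000000 * (depth (2 * (m + 1)) * n) * (nat \<lceil>log 2 (16 * real n * R / e)\<rceil> + 1)) \<le>
    112000000 * real n * lg (real m) * lg (real n * R' / e)"
proof -
  have "real (depth (2 * (m + 1))) \<le> 1 + log 2 (real (2 * (m + 1)))" by (rule depth_log) simp
  also have "\<dots> \<le> 1 + log 2 (2 ^ 2 * real m)" using assms(1) by (intro add_left_mono log_mono) auto
  also have "\<dots> = 3 + log 2 (real m)" using assms(1) log_pow_cancel[of "2::real" 2] by (subst log_mult) simp_all
  also have "\<dots> \<le> 4 * lg (real m)" by (simp add: lg_def)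
  finally have D: "real (depth (2 * (m + 1))) \<le> 4 * lg (real m)" .
  have K: "real (nat \<lceil>log 2 (16 * real n * R / e)\<rceil> + 1) \<le> 7 * lg (real n * R' / e)"
  proof (cases "R = 0")
    case True
    \<comment> \<open>The logarithm of 0 is 0 by convention, so the formula counts no round, in
      accordance with a loop that is not entered for \<open>u = 0\<close>.\<close>
    then show ?thesis by (simp add: lg_def log_def)
  next
    case False
    then have R: "0 < R" using assms(4) by simp
    have "log 2 (16 * real n * R / e) = log 2 (2 ^ 4 * (real n * R / e))" by (simp add: mult.assoc)
    also have "\<dots> = 4 + log 2 (real n * R / e)" using R assms log_pow_cancel[of "2::real" 4] by (subst log_mult) simp_all
    also have "log 2 (real n * R / e) \<le> log 2 (real n * R' / e)"
      using R assms by (intro log_mono divide_right_mono mult_left_mono) simp_all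
    finally have "log 2 (16 * real n * R / e) \<le> 4 + log 2 (real n * R' / e)" by simp
    moreover have "log 2 (real n * R' / e) \<le> lg (real n * R' / e)" "1 \<le> lg (real n * R' / e)" by (simp_all add: lg_def)
    moreover have "real (nat k) \<le> max 0 (real_of_int k)" for k :: int by simp
    moreover have "real_of_int \<lceil>y\<rceil> \<le> y + 1" for y :: real by linarith
    ultimately show ?thesis by (smt (verit) of_nat_1 of_nat_add)
  qed
  have "real (4000000 * (depth (2 * (m + 1)) * n) * (nat \<lceil>log 2 (16 * real n * R / e)\<rceil> + 1)) =
    4000000 * real n * (real (depth (2 * (m + 1))) * real (nat \<lceil>log 2 (16 * real n * R / e)\<rceil> + 1))" by simp
  also have "\<dots> \<le> 4000000 * real n * ((4 * lg (real m)) * (7 * lg (real n * R' / e)))"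
    by (intro mult_left_mono mult_mono D K) (simp_all add: lg_def)
  also have "\<dots> = 112000000 * real n * lg (real m) * lg (real n * R' / e)" by simp
  finally show ?thesis .
qed

section \<open>From the stored input to the abstract problem\<close>

lemma block_map_input:
  assumes "is_rapnc P"
  shows "block_map (nvars P) (ncons P) (segment {1..ncons P} (sigma P))"
proof -
  have P: "1 \<le> ncons P" "sigma P ` {1..ncons P} \<subseteq> {1..nvars P}" "strict_mono_on {1..ncons P} (sigma P)" "sigma P (ncons P) = nvars P"
    using assms unfolding is_rapnc_def by blast+
  have "segment {1..ncons P} (sigma P) i < segment {1..ncons P} (sigma P) j" if ij: "i < j \<and> j \<le> ncons P" for i j
  proof (cases "i = 0")
    case True
    have "j \<in> {1..ncons P}" using ij by simp
    then have "1 \<le> sigma P j" using P(2) by force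
    then show ?thesis using True \<open>j \<in> {1..ncons P}\<close> by (simp add: segment_def)
  next
    case False
    then have "i \<in> {1..ncons P}" "j \<in> {1..ncons P}" using ij by simp_all
    then show ?thesis using strict_mono_onD[OF P(3)] ij by (simp add: segment_def)
  qed
  then show ?thesis using P(1,4) unfolding block_map_def by (simp add: segment_def)
qed

lemma feas_input:
  assumes "is_rapnc P"
  shows "feas (nvars P) (ncons P) (segment {1..ncons P} (sigma P))
      ((segment {1..<ncons P} (\<lambda>i. real_of_int (nest_lo P i)))(ncons P := real_of_int (resource P)))
      ((segment {1..<ncons P} (\<lambda>i. real_of_int (nest_hi P i)))(ncons P := real_of_int (resource P)))
      (segment {1..nvars P} (\<lambda>i. real_of_int (var_lo P i))) (segment {1..nvars P} (\<lambda>i. real_of_int (var_hi P i))) x \<longleftrightarrow> feasible P x"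
proof -
  have P: "1 \<le> ncons P" "sigma P (ncons P) = nvars P"
    using assms unfolding is_rapnc_def by blast+
  have m: "{1..ncons P} = insert (ncons P) {1..<ncons P}" using P(1) by auto
  show ?thesis
    unfolding feas_def feasible_def m pre_def by (auto simp: segment_def P)
qed

text \<open>The run is governed by \<open>B\<close> minus the sum of the lower bounds, which is at
  most the total resource because replacing each negated lower bound by its positive part only
  increases the sum. With nonnegative lower bounds the total resource is \<open>B\<close> itself, so
  one estimate yields both time bounds. The program and the constant are fixed before the instance,
  and the costs enter only as the oracle.\<close>

theorem mainTheorem2:
  "\<exists>(prog :: com) (C :: real). \<forall>(P :: rapnc) (\<epsilon> :: real).
     is_rapnc P \<and> (\<exists>x. feasible P x) \<and> 0 < \<epsilon> \<longrightarrow>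
     (\<exists>t s. exec (cost P) prog (input P \<epsilon>) t s \<and>
        approx_solution P \<epsilon> (result_vector s) \<and>
        ((\<forall>i\<in>{1..nvars P}. 0 \<le> var_lo P i) \<longrightarrow>
           real t \<le> C * real (nvars P) * lg (real (ncons P)) *
                    lg (real (nvars P) * real_of_int (resource P) / \<epsilon>)) \<and>
        real t \<le> C * real (nvars P) * lg (real (ncons P)) *
                 lg (real (nvars P) * real_of_int (total_resource P) / \<epsilon>))"
proof (intro exI[of _ solve] exI[of _ "112000000 :: real"] allI impI)
  fix P :: rapnc and \<epsilon> :: real
  assume H: "is_rapnc P \<and> (\<exists>x. feasible P x) \<and> 0 < \<epsilon>"
  then obtain x0 where P: "is_rapnc P" and x0: "feasible P x0" and e: "0 < \<epsilon>" by blast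
  define n m B where "n = nvars P" "m = ncons P" "B = real_of_int (resource P)"
  define sg where "sg = segment {1..ncons P} (sigma P)"
  define a b where "a = segment {1..<ncons P} (\<lambda>i. real_of_int (nest_lo P i))"
    "b = segment {1..<ncons P} (\<lambda>i. real_of_int (nest_hi P i))"
  define c d where "c = segment {1..nvars P} (\<lambda>i. real_of_int (var_lo P i))"
    "d = segment {1..nvars P} (\<lambda>i. real_of_int (var_hi P i))"
  have s: "iv (input P \<epsilon>) ''n'' = n" "iv (input P \<epsilon>) ''m'' = m" "imem (input P \<epsilon>) ''sigma'' = sg"
    "rmem (input P \<epsilon>) ''a'' = a" "rmem (input P \<epsilon>) ''b'' = b" "rmem (input P \<epsilon>) ''c'' = c" "rmem (input P \<epsilon>) ''d'' = d"
    "rv (input P \<epsilon>) ''B'' = B" "rv (input P \<epsilon>) ''eps'' = \<epsilon>"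
    by (simp_all add: input_def n_m_B_def sg_def a_b_def c_d_def) (simp_all add: segment_def)
  have bm: "block_map n m sg" unfolding n_m_B_def sg_def by (rule block_map_input[OF P])
  have fe: "feas n m sg (a(m := B)) (b(m := B)) c d x \<longleftrightarrow> feasible P x" for x
    unfolding n_m_B_def sg_def a_b_def c_d_def by (rule feas_input[OF P])
  have cd: "c i = real_of_int (var_lo P i)" "d i = real_of_int (var_hi P i)" if "1 \<le> i" "i \<le> n" for i
    using that by (simp_all add: c_d_def n_m_B_def segment_def)
  have F: "convex_on {c i..d i} (cost P i)" "continuous_on {c i..d i} (cost P i)" if i: "1 \<le> i" "i \<le> n" for i
  proof -
    have "i \<in> {1..nvars P}" using i by (simp add: n_m_B_def)
    then obtain L where L: "convex_on {real_of_int (var_lo P i)..real_of_int (var_hi P i)} (cost P i)"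
      "L-lipschitz_on {real_of_int (var_lo P i)..real_of_int (var_hi P i)} (cost P i)"
      using P unfolding is_rapnc_def by blast
    then show "convex_on {c i..d i} (cost P i)" "continuous_on {c i..d i} (cost P i)"
      using lipschitz_on_continuous_on[OF L(2)] by (simp_all add: cd[OF i])
  qed
  have ob: "obj n (cost P) x = objective P x" for x by (simp add: objective_def n_m_B_def)
  from solve[where f = "cost P", OF e s bm F iffD2[OF fe x0], unfolded fe ob]
  obtain t s' y where t: "t \<le> 4000000 * (depth (2 * (m + 1)) * n) * (nat \<lceil>log 2 (16 * real n * (B - pre c n) / \<epsilon>)\<rceil> + 1)"
    and ex: "exec (cost P) solve (input P \<epsilon>) t s'" and X: "feasible P (rmem s' ''x'')"
    and y: "feasible P y" "\<forall>z. feasible P z \<longrightarrow> objective P y \<le> objective P z"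
    and near: "\<forall>i. 1 \<le> i \<and> i \<le> n \<longrightarrow> \<bar>rmem s' ''x'' i - y i\<bar> \<le> \<epsilon>"
    unfolding wp_def by blast
  have sol: "approx_solution P \<epsilon> (result_vector s')"
    unfolding approx_solution_def optimal_def result_vector_def using X y near unfolding n_m_B_def by auto
  have mn: "1 \<le> m" "1 \<le> n" using block_map_le[OF bm order_refl] bm unfolding block_map_def by simp_all
  have pc: "pre c n = (\<Sum>i=1..n. real_of_int (var_lo P i))" unfolding pre_def by (rule sum.cong) (simp_all add: cd)
  have R: "0 \<le> B - pre c n"
  proof -
    have "(\<Sum>i=1..n. real_of_int (var_lo P i)) \<le> (\<Sum>i=1..n. x0 i)"
      by (rule sum_mono) (use x0 in \<open>auto simp: feasible_def n_m_B_def\<close>)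
    then show ?thesis using x0 pc unfolding feasible_def n_m_B_def by simp
  qed
  have TR: "B - pre c n \<le> real_of_int (total_resource P)"
  proof -
    have "- (\<Sum>i=1..n. real_of_int (var_lo P i)) \<le> (\<Sum>i=1..n. real_of_int (max 0 (- var_lo P i)))"
      unfolding sum_negf[symmetric] by (rule sum_mono) simp
    then show ?thesis using pc unfolding total_resource_def n_m_B_def by simp
  qed
  have time: "real t \<le> 112000000 * real (nvars P) * lg (real (ncons P)) * lg (real (nvars P) * real_of_int (total_resource P) / \<epsilon>)"
    using order_trans[OF of_nat_mono[OF t] time_bound[OF mn e R TR]] unfolding n_m_B_def .
  have "total_resource P = resource P" if "\<forall>i\<in>{1..nvars P}. 0 \<le> var_lo P i"
    using that by (simp add: total_resource_def)
  then show "\<exists>t s. exec (cost P) solve (input P \<epsilon>) t s \<and>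
        approx_solution P \<epsilon> (result_vector s) \<and>
        ((\<forall>i\<in>{1..nvars P}. 0 \<le> var_lo P i) \<longrightarrow>
           real t \<le> 112000000 * real (nvars P) * lg (real (ncons P)) *
                    lg (real (nvars P) * real_of_int (resource P) / \<epsilon>)) \<and>
        real t \<le> 112000000 * real (nvars P) * lg (real (ncons P)) *
                 lg (real (nvars P) * real_of_int (total_resource P) / \<epsilon>)"
    using ex sol time by metis
qed

end
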